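(* Let $k$ be a field of characteristic not equal to $2$, and let $f(z)=z^2+c\in k[z]$ be such that $0$ is strictly preperiodic under $f$. Let $r>s\geq 1$ be minimal such that $f^r(0)=-f^s(0)$, and assume $r\geq 3$. Let $x_0\in k$, and define $K_{x_0,n}=k(f^{-n}(x_0))$ for $n\ge 1$, $K_{x_0,\infty}=\bigcup_{n\ge1}K_{x_0,n}$, $G_{x_0,n}=\mathrm{Gal}(K_{x_0,n}/k)$ and $G_{x_0,\infty}=\mathrm{Gal}(K_{x_0,\infty}/k)$. Define $D_1,\dots,D_r\in k$ by $D_1=x_0-c$ and $D_i=f^i(0)-x_0$ for $i\ge 2$. Let $$\gamma=\begin{cases}\sqrt2 & \text{if } r\ge 3,\ s=1,\\ \zeta_8 & \text{if } r=3,\ s=2,\\ \zeta_4 & \text{if } r\ge 4,\ s\ge 2,\end{cases}\qquad e=\begin{cases}2 & \text{if } (r,s)=(3,2),\\ 1&\text{otherwise},\end{cases}$$ where $\zeta_m$ denotes a primitive $m$-th root of unity in $\overline{k}$. Then the following are equivalent: (1) $[k(\gamma,\sqrt{D_1},\dots,\sqrt{D_r}):k]=2^{r+e}$; (2) $[K_{x_0,r+e}:k]=|\tilde M_{r,s,r+e}|$; (3) $G_{x_0,r+e}=\tilde M_{r,s,r+e}$; (4) $G_{x_0,n}=\tilde M_{r,s,n}$ for all $n\ge 1$; (5) $G_{x_0,\infty}\cong \tilde M_{r,s,\infty}$.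
   Context: Tree notation: $T_\infty$ is the infinite binary rooted tree whose nodes are the finite words in the alphabet $\{a,b\}$ (root = empty word; words of length $m$ form level $m$; $w$ is joined to $wa$ and $wb$); $T_n$ consists of the words of length $\le n$. $\mathrm{Aut}(T_\infty)$ is the group of length- and prefix-preserving permutations of words, and $\mathrm{res}_{\infty,n}$ denotes restriction to $T_n$. For $\sigma\in\mathrm{Aut}(T_\infty)$ and a word $x$, the parity $\mathrm{Par}(\sigma,x)\in\mathbb{Z}/2\mathbb{Z}$ is $0$ if $\sigma(xa)=\sigma(x)a$ (and $\sigma(xb)=\sigma(x)b$), and $1$ if $\sigma(xa)=\sigma(x)b$ (and $\sigma(xb)=\sigma(x)a$). For $r>s\ge1$ define, in $\mathbb{Z}/2\mathbb{Z}$, $P^a_{r,s}(\sigma,x)=\sum_{w\in\{a,b\}^{r-1}}\mathrm{Par}(\sigma,xaw)+\sum_{w'\in\{a,b\}^{s-1}}\mathrm{Par}(\sigma,xbw')$ and $P^b_{r,s}(\sigma,x)=\sum_{w\in\{a,b\}^{r-1}}\mathrm{Par}(\sigma,xbw)+\sum_{w'\in\{a,b\}^{s-1}}\mathrm{Par}(\sigma,xaw')$. $M_{r,s,\infty}$ is the set of $\sigma$ such that all values $P^a_{r,s}(\sigma,x),P^b_{r,s}(\sigma,x)$ ($x$ ranging over all nodes) are equal; $P_{r,s}(\sigma)$ is this common value and $B_{r,s,\infty}=\{\sigma\in M_{r,s,\infty}:P_{r,s}(\sigma)=0\}$. Define $R_{3,2}(\sigma,x)=\sum_{w\in\{a,b\}^2}\big[\mathrm{Par}(\sigma,xw)+\mathrm{Par}(\sigma,xwb)+\sum_{t\in\{a,b\}}\mathrm{Par}(\sigma,xwat)\big]+[\mathrm{Par}(\sigma,xaa)+\mathrm{Par}(\sigma,xab)][\mathrm{Par}(\sigma,xba)+\mathrm{Par}(\sigma,xbb)]$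 and, for $r\ge3$, $R_{r,1}(\sigma,x)=\mathrm{Par}(\sigma,xa)\mathrm{Par}(\sigma,xb)+\sum_{w\in\{a,b\}^{r-2}}(\mathrm{Par}(\sigma,xabw)+\mathrm{Par}(\sigma,xbbw))$, both in $\mathbb{Z}/2\mathbb{Z}$. Set $\tilde M_{r,s,\infty}=M_{r,s,\infty}$ if $r\ge4,s\ge2$; $\tilde M_{3,2,\infty}=\{\sigma\in M_{3,2,\infty}: R_{3,2}(\sigma,x)\text{ is independent of } x\}$; and for $r\ge3$, $\tilde M_{r,1,\infty}=\{\sigma\in B_{r,1,\infty}:R_{r,1}(\sigma,x)\text{ is independent of }x\}$. Put $\tilde M_{r,s,n}=\mathrm{res}_{\infty,n}(\tilde M_{r,s,\infty})$. Galois action: a labeling of the preimage tree of $x_0$ assigns to each word $w$ of length $n$ a point $[w]\in f^{-n}(x_0)\subset\overline{k}$, with $[\,]=x_0$, bijectively on each level, such that $[wa],[wb]$ are the two roots of $f(z)=[w]$. Galois elements then act on words via $[\sigma(w)]=\sigma([w])$, giving a homomorphism into $\mathrm{Aut}(T_n)$ or $\mathrm{Aut}(T_\infty)$. Statements like $G_{x_0,n}=\tilde M_{r,s,n}$ and $G_{x_0,\infty}\cong\tilde M_{r,s,\infty}$ mean equality/isomorphism as groups acting on the tree, i.e. for a suitable labeling the induced injection into $\mathrm{Aut}(T_n)$ (resp. $\mathrm{Aut}(T_\infty)$) has image $\tilde M_{r,s,n}$ (resp. $\tilde M_{r,s,\infty}$). *)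

theory Defs
  imports
    "HOL-Algebra.Algebraic_Closure_Type"
    "HOL-Algebra.Finite_Extensions"
    "HOL-Algebra.Generated_Fields"
    "HOL-Algebra.Bij"
    "HOL-Library.Z2"
    "HOL-Library.Sublist"
begin

section \<open>The binary tree and its automorphisms\<close>

datatype letter = La | Lb

instance letter :: finite
proof
  have "(UNIV :: letter set) = {La, Lb}"
    using letter.exhaust by auto
  then show "finite (UNIV :: letter set)"
    by (metis finite.emptyI finite_insert)
qed

type_synonym word = "letter list"

text \<open>
  Nodes are words, the root is the empty word, and the children of \<open>w\<close> are
  \<open>w @ [La]\<close> and \<open>w @ [Lb]\<close>.  The infinite tree has node set \<open>UNIV\<close>.
\<close>

definition words :: "nat \<Rightarrow> word set" where
  "words m = {w. length w = m}"

definition tree :: "nat \<Rightarrow> word set" where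
  "tree n = {w. length w \<le> n}"

lemma finite_words [simp]: "finite (words m)"
  using finite_lists_length_eq[of "UNIV :: letter set" m] by (simp add: words_def)

lemma finite_tree [simp]: "finite (tree n)"
  using finite_lists_length_le[of "UNIV :: letter set" n] by (simp add: tree_def)

text \<open>
  Automorphisms of the tree with node set \<open>W\<close>.  As everywhere in \<^const>\<open>BijGroup\<close>, maps are
  extensional, i.e. undefined outside \<open>W\<close>, so that an automorphism is a single function.
\<close>

definition tree_aut :: "word set \<Rightarrow> (word \<Rightarrow> word) monoid" where
  "tree_aut W = (BijGroup W) \<lparr>carrier :=
     {\<sigma> \<in> Bij W. (\<forall>w\<in>W. length (\<sigma> w) = length w) \<and>
                  (\<forall>u\<in>W. \<forall>v\<in>W. prefix u v \<longrightarrow> prefix (\<sigma> u) (\<sigma> v))}\<rparr>"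

abbreviation Aut_inf :: "(word \<Rightarrow> word) set" where
  "Aut_inf \<equiv> carrier (tree_aut UNIV)"


section \<open>Parities and the groups M, B, M-tilde\<close>

text \<open>The type \<^typ>\<open>bit\<close> is the field with two elements.\<close>

definition Par :: "(word \<Rightarrow> word) \<Rightarrow> word \<Rightarrow> bit" where
  "Par \<sigma> x = (if \<sigma> (x @ [La]) = \<sigma> x @ [La] then 0 else 1)"

definition Pa :: "nat \<Rightarrow> nat \<Rightarrow> (word \<Rightarrow> word) \<Rightarrow> word \<Rightarrow> bit" where
  "Pa r s \<sigma> x = (\<Sum>w\<in>words (r - 1). Par \<sigma> (x @ [La] @ w)) +
                (\<Sum>w'\<in>words (s - 1). Par \<sigma> (x @ [Lb] @ w'))"

definition Pb :: "nat \<Rightarrow> nat \<Rightarrow> (word \<Rightarrow> word) \<Rightarrow> word \<Rightarrow> bit" where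
  "Pb r s \<sigma> x = (\<Sum>w\<in>words (r - 1). Par \<sigma> (x @ [Lb] @ w)) +
                (\<Sum>w'\<in>words (s - 1). Par \<sigma> (x @ [La] @ w'))"

definition M_inf :: "nat \<Rightarrow> nat \<Rightarrow> (word \<Rightarrow> word) set" where
  "M_inf r s = {\<sigma> \<in> Aut_inf. \<exists>v. \<forall>x. Pa r s \<sigma> x = v \<and> Pb r s \<sigma> x = v}"

definition P_common :: "nat \<Rightarrow> nat \<Rightarrow> (word \<Rightarrow> word) \<Rightarrow> bit" where
  "P_common r s \<sigma> = (THE v. \<forall>x. Pa r s \<sigma> x = v \<and> Pb r s \<sigma> x = v)"

definition B_inf :: "nat \<Rightarrow> nat \<Rightarrow> (word \<Rightarrow> word) set" where
  "B_inf r s = {\<sigma> \<in> M_inf r s. P_common r s \<sigma> = 0}"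

definition R32 :: "(word \<Rightarrow> word) \<Rightarrow> word \<Rightarrow> bit" where
  "R32 \<sigma> x =
     (\<Sum>w\<in>words 2. Par \<sigma> (x @ w) + Par \<sigma> (x @ w @ [Lb]) +
                      (\<Sum>t\<in>UNIV. Par \<sigma> (x @ w @ [La, t]))) +
     (Par \<sigma> (x @ [La, La]) + Par \<sigma> (x @ [La, Lb])) *
     (Par \<sigma> (x @ [Lb, La]) + Par \<sigma> (x @ [Lb, Lb]))"

definition Rr1 :: "nat \<Rightarrow> (word \<Rightarrow> word) \<Rightarrow> word \<Rightarrow> bit" where
  "Rr1 r \<sigma> x = Par \<sigma> (x @ [La]) * Par \<sigma> (x @ [Lb]) +
     (\<Sum>w\<in>words (r - 2). Par \<sigma> (x @ [La, Lb] @ w) + Par \<sigma> (x @ [Lb, Lb] @ w))"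

text \<open>Only meaningful for \<open>r \<ge> 3\<close> and \<open>r > s \<ge> 1\<close>; the last case is then \<open>r \<ge> 4\<close>, \<open>s \<ge> 2\<close>.\<close>

definition Mt_inf :: "nat \<Rightarrow> nat \<Rightarrow> (word \<Rightarrow> word) set" where
  "Mt_inf r s =
     (if s = 1 then {\<sigma> \<in> B_inf r 1. \<exists>v. \<forall>x. Rr1 r \<sigma> x = v}
      else if r = 3 \<and> s = 2 then {\<sigma> \<in> M_inf 3 2. \<exists>v. \<forall>x. R32 \<sigma> x = v}
      else M_inf r s)"

definition Mt :: "nat \<Rightarrow> nat \<Rightarrow> nat \<Rightarrow> (word \<Rightarrow> word) set" where
  "Mt r s n = (\<lambda>\<sigma>. restrict \<sigma> (tree n)) ` Mt_inf r s"


section \<open>Fields inside the algebraic closure and Galois groups\<close>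

text \<open>
  The base field \<open>k\<close> is a type \<open>'a\<close>, embedded by \<^const>\<open>to_ac\<close> into its algebraic closure.
\<close>

abbreviation kbar :: "'a::field alg_closure ring" where
  "kbar \<equiv> ring_of_type_algebra"

abbreviation base :: "'a::field alg_closure set" where
  "base \<equiv> range to_ac"

definition adjoin :: "'a::field alg_closure set \<Rightarrow> 'a alg_closure set" where
  "adjoin S = generate_field kbar (base \<union> S)"

text \<open>\<open>ext_degree E n\<close> means \<open>[E : k] = n\<close>; in particular \<open>E\<close> is finite over \<open>k\<close>.\<close>

definition ext_degree :: "'a::field alg_closure set \<Rightarrow> nat \<Rightarrow> bool" where
  "ext_degree E n \<longleftrightarrow> ring.dimension kbar n base E"

definition gal :: "'a::field alg_closure set \<Rightarrow> ('a alg_closure \<Rightarrow> 'a alg_closure) monoid" where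
  "gal K = (BijGroup K) \<lparr>carrier :=
     {\<sigma> \<in> Bij K. \<sigma> \<in> ring_iso (kbar \<lparr>carrier := K\<rparr>) (kbar \<lparr>carrier := K\<rparr>) \<and>
                 (\<forall>y\<in>base. \<sigma> y = y)}\<rparr>"

definition primitive_root_of_unity :: "nat \<Rightarrow> 'b::field \<Rightarrow> bool" where
  "primitive_root_of_unity m z \<longleftrightarrow> z ^ m = 1 \<and> (\<forall>j. 0 < j \<and> j < m \<longrightarrow> z ^ j \<noteq> 1)"


section \<open>The quadratic polynomial and its arboreal representation\<close>

definition quad :: "'b::comm_ring_1 \<Rightarrow> 'b \<Rightarrow> 'b" where
  "quad c z = z ^ 2 + c"

definition periodic :: "('b \<Rightarrow> 'b) \<Rightarrow> 'b \<Rightarrow> bool" where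
  "periodic f y \<longleftrightarrow> (\<exists>n\<ge>1. (f ^^ n) y = y)"

definition preperiodic :: "('b \<Rightarrow> 'b) \<Rightarrow> 'b \<Rightarrow> bool" where
  "preperiodic f y \<longleftrightarrow> (\<exists>m. periodic f ((f ^^ m) y))"

definition strictly_preperiodic :: "('b \<Rightarrow> 'b) \<Rightarrow> 'b \<Rightarrow> bool" where
  "strictly_preperiodic f y \<longleftrightarrow> preperiodic f y \<and> \<not> periodic f y"

definition preim :: "'a::field \<Rightarrow> 'a \<Rightarrow> nat \<Rightarrow> 'a alg_closure set" where
  "preim c x0 n = {z. (quad (to_ac c) ^^ n) z = to_ac x0}"

definition K_level :: "'a::field \<Rightarrow> 'a \<Rightarrow> nat \<Rightarrow> 'a alg_closure set" where
  "K_level c x0 n = adjoin (preim c x0 n)"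

definition K_inf :: "'a::field \<Rightarrow> 'a \<Rightarrow> 'a alg_closure set" where
  "K_inf c x0 = (\<Union>n\<in>{1..}. K_level c x0 n)"

text \<open>
  Bijectivity is required level by level only: a point may occur on several levels.
  If \<open>x0\<close> lies in the forward orbit of the critical value, there is no labeling.
\<close>

definition labeling :: "'a::field \<Rightarrow> 'a \<Rightarrow> (word \<Rightarrow> 'a alg_closure) \<Rightarrow> bool" where
  "labeling c x0 lab \<longleftrightarrow>
     lab [] = to_ac x0 \<and>
     (\<forall>n. bij_betw lab (words n) (preim c x0 n)) \<and>
     (\<forall>w. {lab (w @ [La]), lab (w @ [Lb])} = {z. quad (to_ac c) z = lab w})"

text \<open>The word \<open>v = \<sigma>(w)\<close> is determined by \<open>[v] = \<sigma>([w])\<close> on the level of \<open>w\<close>.\<close>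

definition word_action ::
  "(word \<Rightarrow> 'a::field alg_closure) \<Rightarrow> word set \<Rightarrow> ('a alg_closure \<Rightarrow> 'a alg_closure) \<Rightarrow> word \<Rightarrow> word"
where
  "word_action lab W \<sigma> = (\<lambda>w\<in>W. inv_into (words (length w)) lab (\<sigma> (lab w)))"

text \<open>
  \<open>Gal(K/k)\<close> equals the subgroup \<open>M\<close> of the automorphism group of the tree \<open>W\<close>, as groups acting
  on the tree: for a suitable labeling the induced homomorphism is injective with image \<open>M\<close>.
\<close>

definition gal_equals ::
  "'a::field \<Rightarrow> 'a \<Rightarrow> word set \<Rightarrow> 'a alg_closure set \<Rightarrow> (word \<Rightarrow> word) set \<Rightarrow> bool"
where
  "gal_equals c x0 W K M \<longleftrightarrow>
     (\<exists>lab. labeling c x0 lab \<and>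
            word_action lab W \<in> iso (gal K) ((tree_aut W) \<lparr>carrier := M\<rparr>))"

definition D_elem :: "'a::field \<Rightarrow> 'a \<Rightarrow> nat \<Rightarrow> 'a" where
  "D_elem c x0 i = (if i = 1 then x0 - c else (quad c ^^ i) 0 - x0)"

text \<open>\<open>\<gamma>\<close> is a square root of 2, or a primitive 8th or 4th root of unity; any choice is allowed.\<close>

definition is_gamma :: "nat \<Rightarrow> nat \<Rightarrow> 'b::field \<Rightarrow> bool" where
  "is_gamma r s \<gamma> \<longleftrightarrow>
     (if s = 1 then \<gamma> ^ 2 = 2
      else if r = 3 \<and> s = 2 then primitive_root_of_unity 8 \<gamma>
      else primitive_root_of_unity 4 \<gamma>)"

definition e_shift :: "nat \<Rightarrow> nat \<Rightarrow> nat" where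
  "e_shift r s = (if r = 3 \<and> s = 2 then 2 else 1)"

end

(*
  Group side: a subgroup H of the tree group M (the group called M-tilde in the statement) is shown
  to be dense as soon as the N = r + e sign characters of M take all values on H.  Level by level,
  the functionals on the congruence subgroup of M that are invariant under conjugation are spanned
  by one functional Phi; below level N it is the next character, and from level N on it is hit by a
  commutator.

  Field side: for p_m = f^m(0) the products Pi_m(u) of the [uwa] with |w| = m - 1 are square roots
  of p_m - [u] (of [u] - c if m = 1).  The relation p_r = -p_s makes Pi_r(xa) a multiple of Pi_s(xb)
  by a root of unity, and for s = 1 and (r, s) = (3, 2) there is one more relation, which involves
  the square root of 2.  The labeling can be chosen so that the constants in these relations do not
  depend on x.  Galois then acts through M, the characters being the signs of Galois on the square
  roots of D_1, ..., D_r and on the roots of unity, and the degree condition says that all signs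
  occur.  If some D_i vanishes, the same relations show that the degree of K_N is too small.
*)
theory Submission
  imports Defs
begin

text \<open>The portraits at one level turn the quotient of two successive level stabilizers into a
  vector space over the field with two elements, so a subgroup that is not dense is detected by a
  linear functional. Conjugation translates such a functional by a tree automorphism, and the
  translate differs from it by a functional of smaller \<open>height\<close>; one of least height
  among those that separate is therefore invariant. Relabeling the tree by a portrait and letting a
  Galois element act change products of labels by the same signs (\<open>PI_act\<close>), so the
  rules for how relations change serve twice: to normalise a labeling, and to place Galois in
  \<open>M\<close>. The square root of 2 enters for \<open>s = 1\<close> through
  \<open>(p - b - b')^2 = 2 (p - b) (p - b')\<close>, valid if \<open>b^2 + b'^2 = p^2\<close>, and
  for \<open>(r, s) = (3, 2)\<close> through a polynomial \<open>EE\<close> whose square is half of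
  a product of eight linear factors. Embeddings are extended to a field closed under square roots
  before signs are read, so that the roots of unity and the root of 2 are acted upon too.\<close>

declare add_bit_eq_xor [simp del] mult_bit_eq_and [simp del]

section \<open>Arithmetic modulo 2\<close>

lemma bit_add_self [simp]: "(b::bit) + b = 0"
  by (cases b) simp_all

lemma bit_add_self_left [simp]: "(b::bit) + (b + c) = c"
  by (cases b) (simp_all flip: add.assoc)

lemma bit_mult_self [simp]: "(b::bit) * b = b"
  by (cases b) simp_all

lemma bit_add_0_iff: "(a::bit) + b = 0 \<longleftrightarrow> a = b" "0 = a + b \<longleftrightarrow> a = b"
  by (cases a; cases b; simp)+

lemma bit_eqI: "(a::bit) + b = 0 \<Longrightarrow> a = b"
  by (simp add: bit_add_0_iff)

lemma bit_minus [simp]: "(a::bit) - b = a + b" "- a = (a::bit)"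
  by simp_all

lemma bit_add_eq_iff: "(a::bit) + b = c \<longleftrightarrow> a = b + c"
  by (cases a; cases b; cases c) simp_all

text \<open>A linear functional on a subspace of a finite coordinate space is a combination of
  coordinates. The subspace is the image of a set \<open>G\<close> under \<open>P\<close>, with
  closure under addition as an assumption, so that the lemma applies to level stabilizers as well as
  to pairs of a scalar and a group element. The induction eliminates one coordinate at a
  time.\<close>

lemma bit_additive_rep:
  fixes P :: "'g \<Rightarrow> 'x \<Rightarrow> bit" and l :: "'g \<Rightarrow> bit"
  assumes "finite Y"
    and "\<And>a b. a \<in> G \<Longrightarrow> b \<in> G \<Longrightarrow> \<exists>c\<in>G. (\<forall>x\<in>Y. P c x = P a x + P b x) \<and> l c = l a + l b"
    and "\<And>a. a \<in> G \<Longrightarrow> (\<forall>x\<in>Y. P a x = 0) \<Longrightarrow> l a = 0"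
  shows "\<exists>\<phi>. \<forall>a\<in>G. l a = (\<Sum>x\<in>Y. \<phi> x * P a x)"
  using assms
proof (induction Y arbitrary: l rule: finite_induct)
  case empty
  then show ?case by auto
next
  case (insert x0 Y)
  show ?case
  proof (cases "\<exists>e\<in>G. (\<forall>x\<in>Y. P e x = 0) \<and> P e x0 = 1")
    case True
    then obtain e where e: "e \<in> G" "\<forall>x\<in>Y. P e x = 0" "P e x0 = 1" by auto
    \<comment> \<open>This multiple of the coordinate \<open>x0\<close> makes the functional vanish
      at \<open>e\<close>, so that it factors through the remaining coordinates.\<close>
    define l' where "l' a = l a + l e * P a x0" for a
    have "\<exists>\<phi>. \<forall>a\<in>G. l' a = (\<Sum>x\<in>Y. \<phi> x * P a x)"
    proof (rule insert.IH)
      fix a b assume "a \<in> G" "b \<in> G"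
      then obtain c where c: "c \<in> G" "\<forall>x\<in>insert x0 Y. P c x = P a x + P b x" "l c = l a + l b"
        using insert.prems(1) by blast
      then have "l' c = l' a + l' b"
        by (simp add: l'_def algebra_simps)
      with c show "\<exists>c\<in>G. (\<forall>x\<in>Y. P c x = P a x + P b x) \<and> l' c = l' a + l' b" by auto
    next
      fix a assume a: "a \<in> G" "\<forall>x\<in>Y. P a x = 0"
      show "l' a = 0"
      proof (cases "P a x0 = 0")
        case True
        then show ?thesis using a insert.prems(2)[of a] by (simp add: l'_def)
      next
        case False
        then have 1: "P a x0 = 1" by simp
        obtain c where c: "c \<in> G" "\<forall>x\<in>insert x0 Y. P c x = P a x + P e x" "l c = l a + l e"
          using insert.prems(1) a e by blast
        then have "l c = 0"
          using insert.prems(2)[of c] a e 1 by simp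
        with c 1 show ?thesis by (simp add: l'_def)
      qed
    qed
    then obtain \<phi> where \<phi>: "\<forall>a\<in>G. l' a = (\<Sum>x\<in>Y. \<phi> x * P a x)" by auto
    have "l a = (\<Sum>x\<in>insert x0 Y. (\<phi>(x0 := l e)) x * P a x)" if "a \<in> G" for a
    proof -
      have "l a = l e * P a x0 + l' a" by (simp add: l'_def ac_simps)
      also have "\<dots> = l e * P a x0 + (\<Sum>x\<in>Y. (\<phi>(x0 := l e)) x * P a x)"
        using \<phi> that insert.hyps by (auto intro!: sum.cong)
      finally show ?thesis using insert.hyps by simp
    qed
    then show ?thesis by blast
  next
    case False
    have "\<exists>\<phi>. \<forall>a\<in>G. l a = (\<Sum>x\<in>Y. \<phi> x * P a x)"
    proof (rule insert.IH)
      fix a b assume "a \<in> G" "b \<in> G"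
      then show "\<exists>c\<in>G. (\<forall>x\<in>Y. P c x = P a x + P b x) \<and> l c = l a + l b"
        using insert.prems(1) by (meson insertCI)
    next
      fix a assume "a \<in> G" "\<forall>x\<in>Y. P a x = 0"
      then show "l a = 0" using False insert.prems(2)[of a] by (metis bit_not_one_iff insertE)
    qed
    then obtain \<phi> where \<phi>: "\<forall>a\<in>G. l a = (\<Sum>x\<in>Y. \<phi> x * P a x)" by auto
    have "l a = (\<Sum>x\<in>insert x0 Y. (\<phi>(x0 := 0)) x * P a x)" if "a \<in> G" for a
      using \<phi> that insert.hyps by (auto intro!: sum.cong)
    then show ?thesis by blast
  qed
qed

section \<open>Words and tree automorphisms\<close>

lemma words_0 [simp]: "words 0 = {[]}"
  by (auto simp: words_def)

lemma mem_words [simp]: "w \<in> words m \<longleftrightarrow> length w = m"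
  by (simp add: words_def)

lemma UNIV_letter: "UNIV = {La, Lb}"
  by (auto intro: letter.exhaust)

lemma words_Suc_Cons: "words (Suc m) = (#) La ` words m \<union> (#) Lb ` words m"
proof
  show "words (Suc m) \<subseteq> (#) La ` words m \<union> (#) Lb ` words m"
  proof
    fix w assume "w \<in> words (Suc m)"
    then obtain l v where "w = l # v" "length v = m" by (auto simp: length_Suc_conv)
    then show "w \<in> (#) La ` words m \<union> (#) Lb ` words m" by (cases l) auto
  qed
qed auto

lemma words_Suc_snoc: "words (Suc m) = (\<lambda>w. w @ [La]) ` words m \<union> (\<lambda>w. w @ [Lb]) ` words m"
proof
  show "words (Suc m) \<subseteq> (\<lambda>w. w @ [La]) ` words m \<union> (\<lambda>w. w @ [Lb]) ` words m"
  proof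
    fix w :: word assume "w \<in> words (Suc m)"
    then obtain l v where "w = v @ [l]" "length v = m" by (auto simp: length_Suc_conv_rev)
    then show "w \<in> (\<lambda>w. w @ [La]) ` words m \<union> (\<lambda>w. w @ [Lb]) ` words m" by (cases l) auto
  qed
qed auto

lemma sum_words_Suc_Cons:
  "sum f (words (Suc m)) = (\<Sum>w\<in>words m. f (La # w)) + (\<Sum>w\<in>words m. f (Lb # w))"
  unfolding words_Suc_Cons
  by (subst sum.union_disjoint) (auto simp: sum.reindex inj_on_def)

lemma sum_words_Suc_snoc:
  "sum f (words (Suc m)) = (\<Sum>w\<in>words m. f (w @ [La])) + (\<Sum>w\<in>words m. f (w @ [Lb]))"
  unfolding words_Suc_snoc
  by (subst sum.union_disjoint) (auto simp: sum.reindex inj_on_def)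

lemma prod_words_Suc_Cons:
  "prod f (words (Suc m)) = (\<Prod>w\<in>words m. f (La # w)) * (\<Prod>w\<in>words m. f (Lb # w))"
  unfolding words_Suc_Cons
  by (subst prod.union_disjoint) (auto simp: prod.reindex inj_on_def)

lemma prod_words_Suc_snoc:
  "prod f (words (Suc m)) = (\<Prod>w\<in>words m. f (w @ [La])) * (\<Prod>w\<in>words m. f (w @ [Lb]))"
  unfolding words_Suc_snoc
  by (subst prod.union_disjoint) (auto simp: prod.reindex inj_on_def)

lemma sum_words_add:
  fixes f :: "word \<Rightarrow> 'c::comm_monoid_add"
  shows "sum f (words (m + n)) = (\<Sum>u\<in>words m. \<Sum>w\<in>words n. f (u @ w))"
proof (induction m arbitrary: f)
  case (Suc m)
  show ?case by (simp add: sum_words_Suc_Cons Suc)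
qed simp

lemma card_words [simp]: "card (words m) = 2 ^ m"
proof (induction m)
  case (Suc m)
  then show ?case unfolding words_Suc_Cons
    by (subst card_Un_disjoint) (auto simp: card_image inj_on_def)
qed simp

section \<open>Tree automorphisms and their portraits\<close>

fun other :: "letter \<Rightarrow> letter" where
  "other La = Lb" | "other Lb = La"

lemma other_other [simp]: "other (other l) = l"
  by (cases l) auto

lemma other_neq [simp]: "other l \<noteq> l" "l \<noteq> other l"
  by (cases l; simp)+

definition turn :: "bit \<Rightarrow> letter \<Rightarrow> letter" where
  "turn b l = (if b = 0 then l else other l)"

lemma turn_0 [simp]: "turn 0 l = l" and turn_1 [simp]: "turn 1 l = other l"
  by (simp_all add: turn_def)

lemma turn_other: "turn b (other l) = other (turn b l)"
  by (simp add: turn_def)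

lemma turn_turn: "turn a (turn b l) = turn (a + b) l"
  by (cases a; cases b) simp_all

lemma turn_inj [simp]: "turn b l = turn b l' \<longleftrightarrow> l = l'"
  by (cases b; cases l; cases l') simp_all

lemma aut_iff: "\<sigma> \<in> Aut_inf \<longleftrightarrow> bij \<sigma> \<and> (\<forall>w. length (\<sigma> w) = length w) \<and>
    (\<forall>u v. prefix u v \<longrightarrow> prefix (\<sigma> u) (\<sigma> v))"
  by (auto simp: tree_aut_def Bij_def)

lemma aut_length [simp]: "\<sigma> \<in> Aut_inf \<Longrightarrow> length (\<sigma> w) = length w"
  by (simp add: aut_iff)

lemma aut_bij: "\<sigma> \<in> Aut_inf \<Longrightarrow> bij \<sigma>"
  by (simp add: aut_iff)

lemma aut_eq_iff: "\<sigma> \<in> Aut_inf \<Longrightarrow> \<sigma> u = \<sigma> v \<longleftrightarrow> u = v"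
  using aut_bij[of \<sigma>] by (auto simp: bij_def inj_def)

lemma aut_Nil [simp]: "\<sigma> \<in> Aut_inf \<Longrightarrow> \<sigma> [] = []"
  by (metis aut_length length_0_conv)

lemma aut_snoc:
  assumes "\<sigma> \<in> Aut_inf"
  shows "\<sigma> (x @ [l]) = \<sigma> x @ [turn (Par \<sigma> x) l]"
proof -
  have ex: "\<exists>l'. \<sigma> (x @ [l]) = \<sigma> x @ [l']" for l
  proof -
    have "prefix (\<sigma> x) (\<sigma> (x @ [l]))" using assms by (simp add: aut_iff)
    then obtain z where z: "\<sigma> (x @ [l]) = \<sigma> x @ z" by (auto simp: prefix_def)
    from arg_cong[OF this, of length] assms have "length z = 1" by simp
    then show ?thesis using z by (auto simp: length_Suc_conv)
  qed
  obtain a b where a: "\<sigma> (x @ [La]) = \<sigma> x @ [a]" and b: "\<sigma> (x @ [Lb]) = \<sigma> x @ [b]"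
    using ex by blast
  have "a \<noteq> b" using a b aut_eq_iff[OF assms, of "x @ [La]" "x @ [Lb]"] by auto
  then show ?thesis using a b by (cases l; cases a; cases b) (auto simp: Par_def)
qed

lemma aut_append_ex:
  assumes "\<sigma> \<in> Aut_inf"
  shows "\<exists>z. length z = length w \<and> \<sigma> (x @ w) = \<sigma> x @ z"
proof (induction w rule: rev_induct)
  case (snoc l w)
  then obtain z where "length z = length w" "\<sigma> (x @ w) = \<sigma> x @ z" by blast
  then show ?case using aut_snoc[OF assms, of "x @ w" l] by auto
qed simp

text \<open>Inverse of \<open>Par\<close>: parities are indexed by source words, not by their
  images, so the recursion passes on \<open>p\<close> below the original letter
  \<open>l\<close>.\<close>

fun act :: "(word \<Rightarrow> bit) \<Rightarrow> word \<Rightarrow> word" where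
  "act p [] = []"
| "act p (l # w) = turn (p []) l # act (\<lambda>v. p (l # v)) w"

lemma act_snoc: "act p (x @ [l]) = act p x @ [turn (p x) l]"
  by (induction x arbitrary: p) auto

lemma length_act [simp]: "length (act p w) = length w"
  by (induction w arbitrary: p) auto

lemma act_inj: "act p u = act p v \<Longrightarrow> u = v"
proof (induction u arbitrary: p v)
  case Nil
  then show ?case by (metis length_act list.size(3) length_0_conv)
next
  case (Cons l u)
  then obtain l' v' where v: "v = l' # v'" by (cases v) auto
  with Cons.prems have "l = l'" by simp
  with Cons v show ?case by auto
qed

lemma act_surj: "\<exists>u. act p u = v"
proof (induction v arbitrary: p)
  case Nil
  then show ?case by (intro exI[of _ "[]"]) simp
next
  case (Cons l v)
  obtain u where "act (\<lambda>v. p (turn (p []) l # v)) u = v" using Cons by blast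
  then have "act p (turn (p []) l # u) = l # v" by (simp add: turn_turn)
  then show ?case by blast
qed

lemma act_aut [simp, intro]: "act p \<in> Aut_inf"
  unfolding aut_iff
proof (intro conjI allI impI)
  show "bij (act p)" by (metis act_inj act_surj bij_def injI surjI surj_def)
next
  fix u v :: word assume "prefix u v"
  then obtain z where "v = u @ z" by (auto simp: prefix_def)
  moreover have "prefix (act p u) (act p (u @ z))"
  proof (induction z rule: rev_induct)
    case (snoc l z)
    then show ?case using act_snoc[of p "u @ z" l] by (auto simp: prefix_def)
  qed simp
  ultimately show "prefix (act p u) (act p v)" by simp
qed simp

lemma Par_act [simp]: "Par (act p) = p"
proof
  fix x show "Par (act p) x = p x"
    by (cases "p x") (auto simp: Par_def act_snoc)
qed

lemma aut_eq_level:
  assumes "\<sigma> \<in> Aut_inf" "\<tau> \<in> Aut_inf" "\<And>x. length x < n \<Longrightarrow> Par \<sigma> x = Par \<tau> x" "length w \<le> n"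
  shows "\<sigma> w = \<tau> w"
  using assms(4)
  by (induction w rule: rev_induct) (auto simp: assms aut_snoc)

lemma aut_level_Par:
  assumes "\<sigma> \<in> Aut_inf" "\<tau> \<in> Aut_inf" "\<And>w. length w \<le> n \<Longrightarrow> \<sigma> w = \<tau> w" "length x < n"
  shows "Par \<sigma> x = Par \<tau> x"
  using assms by (simp add: Par_def)

lemma aut_eqI: "\<sigma> \<in> Aut_inf \<Longrightarrow> \<tau> \<in> Aut_inf \<Longrightarrow> Par \<sigma> = Par \<tau> \<Longrightarrow> \<sigma> = \<tau>"
  using aut_eq_level by (metis ext lessI less_or_eq_imp_le)

lemma act_Par: "\<sigma> \<in> Aut_inf \<Longrightarrow> act (Par \<sigma>) = \<sigma>"
  by (rule aut_eqI) auto

lemma aut_id [simp]: "id \<in> Aut_inf"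
  by (simp add: aut_iff)

lemma aut_comp [intro]: "\<sigma> \<in> Aut_inf \<Longrightarrow> \<tau> \<in> Aut_inf \<Longrightarrow> \<sigma> \<circ> \<tau> \<in> Aut_inf"
  by (simp add: aut_iff bij_comp)

lemma Par_id [simp]: "Par id x = 0"
  by (simp add: Par_def)

text \<open>The letter below \<open>x\<close> is turned by \<open>\<tau>\<close> at \<open>x\<close>
  and then by \<open>\<sigma>\<close> at the moved node, and turns add up modulo 2. All additivity
  statements on parities go back to this cocycle rule.\<close>

lemma Par_comp:
  assumes "\<sigma> \<in> Aut_inf" "\<tau> \<in> Aut_inf"
  shows "Par (\<sigma> \<circ> \<tau>) x = Par \<tau> x + Par \<sigma> (\<tau> x)"
proof -
  have "(\<sigma> \<circ> \<tau>) (x @ [La]) = \<sigma> (\<tau> x) @ [turn (Par \<sigma> (\<tau> x) + Par \<tau> x) La]"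
    using assms by (simp add: aut_snoc turn_turn)
  moreover have "(\<sigma> \<circ> \<tau>) (x @ [La]) = \<sigma> (\<tau> x) @ [turn (Par (\<sigma> \<circ> \<tau>) x) La]"
    using aut_snoc[OF aut_comp[OF assms]] by simp
  ultimately show ?thesis
    by (cases "Par (\<sigma> \<circ> \<tau>) x"; cases "Par \<tau> x"; cases "Par \<sigma> (\<tau> x)") auto
qed

lemma aut_inv [intro]:
  assumes "\<sigma> \<in> Aut_inf"
  shows "inv_into UNIV \<sigma> \<in> Aut_inf"
proof -
  have b: "bij \<sigma>" using assms by (rule aut_bij)
  have s: "\<sigma> (inv_into UNIV \<sigma> w) = w" for w using b by (simp add: bij_is_surj surj_f_inv_f)
  have len: "length (inv_into UNIV \<sigma> w) = length w" for w
    using aut_length[OF assms, of "inv_into UNIV \<sigma> w"] by (simp add: s)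
  have "prefix (inv_into UNIV \<sigma> u) (inv_into UNIV \<sigma> (u @ z))" for u z
  proof -
    let ?v = "inv_into UNIV \<sigma> (u @ z)" and ?n = "length u"
    have "?v = take ?n ?v @ drop ?n ?v" by simp
    then obtain y where "u @ z = \<sigma> (take ?n ?v) @ y"
      using aut_append_ex[OF assms, of "drop ?n ?v" "take ?n ?v"] s by metis
    moreover have "length (\<sigma> (take ?n ?v)) = ?n" using assms by (simp add: len)
    ultimately have "u = \<sigma> (take ?n ?v)" by (metis append_eq_append_conv)
    then have "inv_into UNIV \<sigma> u = take ?n ?v" using b by (metis bij_is_inj inv_f_f)
    then show ?thesis by (simp add: take_is_prefix)
  qed
  then have "prefix u v \<longrightarrow> prefix (inv_into UNIV \<sigma> u) (inv_into UNIV \<sigma> v)" for u v by (auto simp: prefix_def)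
  with b len show ?thesis by (simp add: aut_iff bij_imp_bij_inv)
qed

lemma aut_inv_apply [simp]:
  assumes "\<sigma> \<in> Aut_inf"
  shows "\<sigma> (inv_into UNIV \<sigma> w) = w" "inv_into UNIV \<sigma> (\<sigma> w) = w"
  using aut_bij[OF assms] by (simp_all add: bij_is_surj surj_f_inv_f bij_is_inj)

lemma Par_inv:
  assumes "\<sigma> \<in> Aut_inf"
  shows "Par (inv_into UNIV \<sigma>) (\<sigma> x) = Par \<sigma> x"
proof -
  have "inv_into UNIV \<sigma> \<circ> \<sigma> = id" using aut_bij[OF assms] by (simp add: bij_is_inj)
  then show ?thesis using Par_comp[OF aut_inv[OF assms] assms, of x]
    by (metis Par_id bit_eqI)
qed

lemma aut_bij_words: "\<sigma> \<in> Aut_inf \<Longrightarrow> bij_betw \<sigma> (words m) (words m)"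
  by (rule bij_betw_byWitness[where f' = "inv_into UNIV \<sigma>"]) (auto simp: aut_inv)

lemma sum_words_aut: "\<sigma> \<in> Aut_inf \<Longrightarrow> (\<Sum>w\<in>words m. f (\<sigma> w)) = sum f (words m)"
  using sum.reindex_bij_betw[OF aut_bij_words] .

lemma aut_bij_below:
  assumes "\<sigma> \<in> Aut_inf"
  shows "bij_betw \<sigma> ((@) u ` words m) ((@) (\<sigma> u) ` words m)"
proof -
  have "\<sigma> ` ((@) u ` words m) \<subseteq> (@) (\<sigma> u) ` words m"
  proof
    fix v assume "v \<in> \<sigma> ` ((@) u ` words m)"
    then obtain w where "length w = m" "v = \<sigma> (u @ w)" by auto
    then show "v \<in> (@) (\<sigma> u) ` words m"
      using aut_append_ex[OF assms, of w u] by auto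
  qed
  moreover have "inj_on \<sigma> ((@) u ` words m)" using aut_bij[OF assms] by (auto simp: bij_def inj_on_def)
  moreover have "card ((@) u ` words m) = card ((@) (\<sigma> u) ` words m)"
    by (simp add: card_image inj_on_def)
  ultimately show ?thesis
    by (metis bij_betw_imageI card_image card_subset_eq finite_imageI finite_words)
qed

lemma sum_below_aut:
  assumes "\<sigma> \<in> Aut_inf"
  shows "(\<Sum>w\<in>words m. f (\<sigma> (u @ w))) = (\<Sum>w\<in>words m. f (\<sigma> u @ w))"
proof -
  have "(\<Sum>w\<in>words m. f (\<sigma> (u @ w))) = (\<Sum>v\<in>(@) u ` words m. f (\<sigma> v))"
    by (simp add: sum.reindex inj_on_def)
  also have "\<dots> = (\<Sum>v\<in>(@) (\<sigma> u) ` words m. f v)"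
    by (rule sum.reindex_bij_betw[OF aut_bij_below[OF assms]])
  finally show ?thesis by (simp add: sum.reindex inj_on_def)
qed

lemma prod_below_aut:
  assumes "\<sigma> \<in> Aut_inf"
  shows "(\<Prod>w\<in>words m. f (\<sigma> (u @ w))) = (\<Prod>w\<in>words m. f (\<sigma> u @ w))"
proof -
  have "(\<Prod>w\<in>words m. f (\<sigma> (u @ w))) = (\<Prod>v\<in>(@) u ` words m. f (\<sigma> v))"
    by (simp add: prod.reindex inj_on_def)
  also have "\<dots> = (\<Prod>v\<in>(@) (\<sigma> u) ` words m. f v)"
    by (rule prod.reindex_bij_betw[OF aut_bij_below[OF assms]])
  finally show ?thesis by (simp add: prod.reindex inj_on_def)
qed

text \<open>Recursion along a measure, stated as the existence of a fixed point of \<open>T\<close>;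
  it produces portraits and labelings whose value at a word refers to words of smaller
  measure.\<close>

lemma measure_recursion:
  fixes T :: "('x \<Rightarrow> 'b) \<Rightarrow> 'x \<Rightarrow> 'b" and f :: "'x \<Rightarrow> nat"
  assumes T: "\<And>p q w. (\<And>v. f v < f w \<Longrightarrow> p v = q v) \<Longrightarrow> T p w = T q w"
  shows "\<exists>p. \<forall>w. p w = T p w"
proof -
  define p where "p = wfrec (measure f) T"
  have "p w = T (cut p (measure f) w) w" for w
    unfolding p_def by (rule wfrec) simp
  moreover have "T (cut p (measure f) w) w = T p w" for w
    by (rule T) (simp add: cut_def)
  ultimately show ?thesis by metis
qed

section \<open>Dense subgroups of groups of tree automorphisms\<close>

lemma bit_add_right_cancel: "(a::bit) + b + c = d + c + b \<Longrightarrow> a = d"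
  by (cases a; cases b; cases c; cases d) simp_all

text \<open>
  A function on words of length \<open>m\<close> is a polynomial in \<open>m\<close> bits that is linear in each of them;
  the height is its position in the lexicographic order of the leading monomials.
\<close>

fun height :: "nat \<Rightarrow> (word \<Rightarrow> bit) \<Rightarrow> nat" where
  "height 0 f = (if f [] = 0 then 0 else 1)"
| "height (Suc m) f = (let h = height m (\<lambda>w. f (w @ [La]) + f (w @ [Lb])) in
     if h = 0 then height m (\<lambda>w. f (w @ [La])) else 2 ^ m + h)"

lemma height_le: "height m f \<le> 2 ^ m"
proof (induction m arbitrary: f)
  case (Suc m)
  show ?case using Suc[of "\<lambda>w. f (w @ [La]) + f (w @ [Lb])"] Suc[of "\<lambda>w. f (w @ [La])"]
    by (simp add: Let_def)
qed simp

lemma height_cong: "(\<And>w. length w = m \<Longrightarrow> f w = g w) \<Longrightarrow> height m f = height m g"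
proof (induction m arbitrary: f g)
  case (Suc m)
  have "height m (\<lambda>w. f (w @ [La]) + f (w @ [Lb])) = height m (\<lambda>w. g (w @ [La]) + g (w @ [Lb]))"
    "height m (\<lambda>w. f (w @ [La])) = height m (\<lambda>w. g (w @ [La]))"
    by (rule Suc.IH; simp add: Suc.prems)+
  then show ?case by (simp add: Let_def)
qed simp

lemma height_eq_0_iff: "height m f = 0 \<longleftrightarrow> (\<forall>w\<in>words m. f w = 0)"
proof (induction m arbitrary: f)
  case (Suc m)
  have "(\<forall>w\<in>words (Suc m). f w = 0) \<longleftrightarrow> (\<forall>w\<in>words m. f (w @ [La]) + f (w @ [Lb]) = 0 \<and> f (w @ [La]) = 0)"
  proof -
    have "(\<forall>w\<in>words (Suc m). f w = 0) \<longleftrightarrow> (\<forall>w\<in>words m. f (w @ [La]) = 0) \<and> (\<forall>w\<in>words m. f (w @ [Lb]) = 0)"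
      unfolding words_Suc_snoc by blast
    also have "\<dots> \<longleftrightarrow> (\<forall>w\<in>words m. f (w @ [La]) + f (w @ [Lb]) = 0 \<and> f (w @ [La]) = 0)"
      by (metis add_0)
    finally show ?thesis .
  qed
  then show ?case
    by (simp add: Let_def Suc del: mem_words) blast
qed simp

text \<open>
  Tree automorphisms act on the bits of a word by translations that depend on the preceding bits,
  so they do not change leading monomials.
\<close>

lemma height_translate_less:
  assumes "g \<in> Aut_inf" "height m f \<noteq> 0"
  shows "height m (\<lambda>w. f (g w) + f w) < height m f"
  using assms(2)
proof (induction m arbitrary: f)
  case 0
  then show ?case using assms(1) by (simp split: if_splits)
next
  case (Suc m)
  define f1 where "f1 = (\<lambda>w. f (w @ [La]) + f (w @ [Lb]))"
  define h where "h = (\<lambda>w. f (g w) + f w)"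
  \<comment> \<open>An automorphism at most exchanges the two extensions of a word by one letter,
    which leaves the sum \<open>f1\<close> over them unaffected; so the last-bit coefficient of the
    increment is the increment of \<open>f1\<close>.\<close>
  have h1: "h (w @ [La]) + h (w @ [Lb]) = f1 (g w) + f1 w" for w
    by (cases "Par g w") (simp_all add: h_def f1_def aut_snoc[OF assms(1)] ac_simps)
  show ?case
  proof (cases "height m f1 = 0")
    case True
    then have f1: "f1 w = 0" if "length w = m" for w using that by (simp add: height_eq_0_iff)
    have "h (w @ [La]) = f (g w @ [La]) + f (w @ [La])" if "length w = m" for w
      using f1[of "g w"] that
      by (cases "Par g w") (simp_all add: h_def f1_def aut_snoc[OF assms(1)] assms(1) bit_add_0_iff)
    then have "height m (\<lambda>w. h (w @ [La])) = height m (\<lambda>w. f (g w @ [La]) + f (w @ [La]))"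
      by (intro height_cong) auto
    also have "\<dots> < height m (\<lambda>w. f (w @ [La]))"
      using Suc.IH[of "\<lambda>w. f (w @ [La])"] Suc.prems True by (simp add: f1_def)
    finally have "height m (\<lambda>w. h (w @ [La])) < height m (\<lambda>w. f (w @ [La]))" .
    moreover have "height m (\<lambda>w. h (w @ [La]) + h (w @ [Lb])) = 0"
      unfolding height_eq_0_iff h1 using f1 by (simp add: assms(1))
    ultimately have "height (Suc m) h < height (Suc m) f"
      using True by (simp add: f1_def)
    then show ?thesis by (simp add: h_def)
  next
    case False
    have "height m (\<lambda>w. f1 (g w) + f1 w) < height m f1"
      by (rule Suc.IH[OF False])
    \<comment> \<open>Either the coefficient of the last bit keeps a nonzero but smaller height, or
      it disappears and what is left has height at most \<open>2 ^ m\<close>.\<close>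
    then have "height (Suc m) h < height (Suc m) f"
      using height_le[of m "\<lambda>w. h (w @ [La])"] False
      by (auto simp: Let_def h1 simp flip: f1_def)
    then show ?thesis by (simp add: h_def)
  qed
qed

text \<open>What the density argument needs from a group. On the stabilizer of level
  \<open>m\<close> the functional \<open>\<Phi> m\<close> is the next character when
  \<open>m < N\<close> and a conjugation invariant from \<open>N\<close> on. The last assumption
  compares \<open>g \<circ> h\<close> with \<open>h \<circ> g\<close>, which avoids inverses: the
  two agree up to level \<open>m\<close>, so they differ by an element of the stabilizer.\<close>

locale tree_group =
  fixes M :: "(word \<Rightarrow> word) set" and N :: nat
    and \<chi> :: "nat \<Rightarrow> (word \<Rightarrow> word) \<Rightarrow> bit" and \<Phi> :: "nat \<Rightarrow> (word \<Rightarrow> bit) \<Rightarrow> bit"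
  assumes M_aut: "M \<subseteq> Aut_inf"
    and M_id: "id \<in> M"
    and M_comp: "\<sigma> \<in> M \<Longrightarrow> \<tau> \<in> M \<Longrightarrow> \<sigma> \<circ> \<tau> \<in> M"
    and M_inv: "\<sigma> \<in> M \<Longrightarrow> inv_into UNIV \<sigma> \<in> M"
    and \<chi>_comp: "\<sigma> \<in> M \<Longrightarrow> \<tau> \<in> M \<Longrightarrow> i \<in> {1..N} \<Longrightarrow> \<chi> i (\<sigma> \<circ> \<tau>) = \<chi> i \<sigma> + \<chi> i \<tau>"
    and \<chi>_level: "\<sigma> \<in> M \<Longrightarrow> \<tau> \<in> M \<Longrightarrow> i \<in> {1..N} \<Longrightarrow> (\<And>w. length w \<le> i \<Longrightarrow> \<sigma> w = \<tau> w) \<Longrightarrow>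
        \<chi> i \<sigma> = \<chi> i \<tau>"
    and \<Phi>_add: "\<Phi> m (\<lambda>w. f w + g w) = \<Phi> m f + \<Phi> m g"
    and \<Phi>_level: "(\<And>w. length w = m \<Longrightarrow> f w = g w) \<Longrightarrow> \<Phi> m f = \<Phi> m g"
    and \<Phi>_low: "m < N \<Longrightarrow> \<sigma> \<in> M \<Longrightarrow> (\<And>w. length w \<le> m \<Longrightarrow> \<sigma> w = w) \<Longrightarrow> \<Phi> m (Par \<sigma>) = \<chi> (Suc m) \<sigma>"
    and \<Phi>_invariant: "N \<le> m \<Longrightarrow> \<sigma> \<in> M \<Longrightarrow> (\<And>w. length w \<le> m \<Longrightarrow> \<sigma> w = w) \<Longrightarrow> \<tau> \<in> M \<Longrightarrow>
        \<Phi> m (\<lambda>w. Par \<sigma> (\<tau> w)) = \<Phi> m (Par \<sigma>)"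
    and invariants: "(\<And>\<sigma> \<tau>. \<sigma> \<in> M \<Longrightarrow> (\<And>w. length w \<le> m \<Longrightarrow> \<sigma> w = w) \<Longrightarrow> \<tau> \<in> M \<Longrightarrow>
          (\<Sum>w\<in>words m. f (\<tau> w) * Par \<sigma> w) = (\<Sum>w\<in>words m. f w * Par \<sigma> w)) \<Longrightarrow>
        \<exists>c. \<forall>\<sigma>\<in>M. (\<forall>w. length w \<le> m \<longrightarrow> \<sigma> w = w) \<longrightarrow> (\<Sum>w\<in>words m. f w * Par \<sigma> w) = c * \<Phi> m (Par \<sigma>)"
    and commutators: "N \<le> m \<Longrightarrow> \<exists>g\<in>M. \<exists>h\<in>M. (\<forall>w. length w \<le> m \<longrightarrow> g (h w) = h (g w)) \<and>
        \<Phi> m (Par (g \<circ> h)) \<noteq> \<Phi> m (Par (h \<circ> g))"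
begin

definition stab :: "nat \<Rightarrow> (word \<Rightarrow> word) set" where
  "stab m = {\<sigma> \<in> M. \<forall>w. length w \<le> m \<longrightarrow> \<sigma> w = w}"

lemma aut: "\<sigma> \<in> M \<Longrightarrow> \<sigma> \<in> Aut_inf"
  using M_aut by auto

lemma stabD: "\<sigma> \<in> stab m \<Longrightarrow> \<sigma> \<in> M" "\<sigma> \<in> stab m \<Longrightarrow> length w \<le> m \<Longrightarrow> \<sigma> w = w"
  by (auto simp: stab_def)

lemma stab_comp: "\<sigma> \<in> stab m \<Longrightarrow> \<tau> \<in> stab m \<Longrightarrow> \<sigma> \<circ> \<tau> \<in> stab m"
  by (auto simp: stab_def M_comp)

lemma Par_stab_comp: "\<sigma> \<in> M \<Longrightarrow> \<tau> \<in> stab m \<Longrightarrow> length w = m \<Longrightarrow> Par (\<sigma> \<circ> \<tau>) w = Par \<sigma> w + Par \<tau> w"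
  by (simp add: Par_comp aut stabD ac_simps)

text \<open>Conjugation translates the parities at level \<open>m\<close>: the contributions of
  \<open>\<tau>\<close> and of its inverse cancel because \<open>\<sigma>\<close> fixes the nodes of
  that level.\<close>

lemma stab_conj:
  assumes "\<sigma> \<in> stab m" "\<tau> \<in> M"
  shows "inv_into UNIV \<tau> \<circ> (\<sigma> \<circ> \<tau>) \<in> stab m"
    and "length w = m \<Longrightarrow> Par (inv_into UNIV \<tau> \<circ> (\<sigma> \<circ> \<tau>)) w = Par \<sigma> (\<tau> w)"
proof -
  have a: "\<tau> \<in> Aut_inf" "\<sigma> \<in> Aut_inf" using assms aut stabD by auto
  show "inv_into UNIV \<tau> \<circ> (\<sigma> \<circ> \<tau>) \<in> stab m"
    using assms a by (auto simp: stab_def M_comp M_inv)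
  show "Par (inv_into UNIV \<tau> \<circ> (\<sigma> \<circ> \<tau>)) w = Par \<sigma> (\<tau> w)" if "length w = m"
    using that assms a
    by (simp add: Par_comp aut_comp aut_inv stabD(2) Par_inv ac_simps)
qed

lemma eq_stab:
  assumes "\<sigma> \<in> M" "\<tau> \<in> M" "\<And>w. length w \<le> m \<Longrightarrow> \<sigma> w = \<tau> w"
  shows "inv_into UNIV \<tau> \<circ> \<sigma> \<in> stab m" "\<sigma> = \<tau> \<circ> (inv_into UNIV \<tau> \<circ> \<sigma>)"
  using assms aut[OF assms(2)] by (auto simp: stab_def M_comp M_inv fun_eq_iff)

text \<open>A homomorphism to an abelian group is constant on conjugacy classes, so on the
  stabilizer of the last level but one it is an invariant functional, hence a multiple of the last
  character. Subtracting this multiple removes the dependence on the last level, and induction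
  applies.\<close>

lemma homs:
  assumes "m \<le> N"
    and \<mu>: "\<And>\<sigma> \<tau>. \<sigma> \<in> M \<Longrightarrow> \<tau> \<in> M \<Longrightarrow> \<mu> (\<sigma> \<circ> \<tau>) = \<mu> \<sigma> + \<mu> \<tau>"
    and lev: "\<And>\<sigma> \<tau>. \<sigma> \<in> M \<Longrightarrow> \<tau> \<in> M \<Longrightarrow> (\<And>w. length w \<le> m \<Longrightarrow> \<sigma> w = \<tau> w) \<Longrightarrow> \<mu> \<sigma> = \<mu> \<tau>"
  shows "\<exists>c::nat \<Rightarrow> bit. \<forall>\<sigma>\<in>M. \<mu> \<sigma> = (\<Sum>i\<in>{1..m}. c i * \<chi> i \<sigma>)"
  using assms
proof (induction m arbitrary: \<mu>)
  case 0
  have "\<mu> id = 0" using 0(2)[OF M_id M_id] unfolding comp_id by (metis bit_add_self)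
  moreover have "\<mu> \<sigma> = \<mu> id" if "\<sigma> \<in> M" for \<sigma>
    using that by (intro 0(3) M_id) (simp_all add: aut)
  ultimately show ?case by simp
next
  case (Suc m)
  note \<mu>_comp = Suc.prems(2) and \<mu>_level = Suc.prems(3)
  have \<mu>_id: "\<mu> id = 0" using \<mu>_comp[OF M_id M_id] unfolding comp_id by (metis bit_add_self)
  have \<mu>_stab: "\<mu> \<sigma> = \<mu> \<tau>" if "\<sigma> \<in> stab m" "\<tau> \<in> stab m" "\<And>w. length w = m \<Longrightarrow> Par \<sigma> w = Par \<tau> w"
    for \<sigma> \<tau>
  proof (rule \<mu>_level)
    show "\<sigma> \<in> M" "\<tau> \<in> M" using that stabD by auto
    show "\<sigma> w = \<tau> w" if "length w \<le> Suc m" for w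
    proof (rule aut_eq_level[OF _ _ _ that])
      show "\<sigma> \<in> Aut_inf" "\<tau> \<in> Aut_inf" using \<open>\<sigma> \<in> M\<close> \<open>\<tau> \<in> M\<close> aut by auto
      show "Par \<sigma> x = Par \<tau> x" if "length x < Suc m" for x
      proof (cases "length x = m")
        case False
        with that have "length x < m" by simp
        then show ?thesis using stabD(2)[OF \<open>\<sigma> \<in> stab m\<close>] stabD(2)[OF \<open>\<tau> \<in> stab m\<close>]
          by (simp add: Par_def)
      qed (use \<open>\<And>w. length w = m \<Longrightarrow> Par \<sigma> w = Par \<tau> w\<close> in simp)
    qed
  qed
  have "\<exists>f. \<forall>\<sigma>\<in>stab m. \<mu> \<sigma> = (\<Sum>w\<in>words m. f w * Par \<sigma> w)"
  proof (rule bit_additive_rep)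
    fix \<sigma> \<tau> assume "\<sigma> \<in> stab m" "\<tau> \<in> stab m"
    then show "\<exists>\<rho>\<in>stab m. (\<forall>w\<in>words m. Par \<rho> w = Par \<sigma> w + Par \<tau> w) \<and> \<mu> \<rho> = \<mu> \<sigma> + \<mu> \<tau>"
      by (intro bexI[of _ "\<sigma> \<circ> \<tau>"]) (auto simp: stab_comp Par_stab_comp stabD \<mu>_comp)
  next
    fix \<sigma> assume "\<sigma> \<in> stab m" "\<forall>w\<in>words m. Par \<sigma> w = 0"
    then show "\<mu> \<sigma> = 0"
      using \<mu>_stab[of \<sigma> id] \<mu>_id by (simp add: stab_def M_id)
  qed simp
  then obtain f where f: "\<And>\<sigma>. \<sigma> \<in> stab m \<Longrightarrow> \<mu> \<sigma> = (\<Sum>w\<in>words m. f w * Par \<sigma> w)" by auto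
  have "\<exists>c. \<forall>\<sigma>\<in>M. (\<forall>w. length w \<le> m \<longrightarrow> \<sigma> w = w) \<longrightarrow> (\<Sum>w\<in>words m. f w * Par \<sigma> w) = c * \<Phi> m (Par \<sigma>)"
  proof (rule invariants)
    fix \<sigma> \<tau> assume \<sigma>: "\<sigma> \<in> M" "\<And>w. length w \<le> m \<Longrightarrow> \<sigma> w = w" and \<tau>: "\<tau> \<in> M"
    \<comment> \<open>Conjugation by the inverse, followed by the substitution of
      \<open>\<tau> w\<close> for \<open>w\<close> in the sum, moves \<open>\<tau>\<close> from the
      parities to the coefficients \<open>f\<close>.\<close>
    let ?i = "inv_into UNIV \<tau>"
    have s: "\<sigma> \<in> stab m" using \<sigma> by (simp add: stab_def)
    have i: "?i \<in> M" using \<tau> by (rule M_inv)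
    let ?c = "inv_into UNIV ?i \<circ> (\<sigma> \<circ> ?i)"
    have "\<mu> ?c = \<mu> (inv_into UNIV ?i) + (\<mu> \<sigma> + \<mu> ?i)"
      unfolding \<mu>_comp[OF M_inv[OF i] M_comp[OF \<sigma>(1) i]] \<mu>_comp[OF \<sigma>(1) i] ..
    moreover have "\<mu> (inv_into UNIV ?i \<circ> ?i) = \<mu> (inv_into UNIV ?i) + \<mu> ?i"
      by (rule \<mu>_comp[OF M_inv[OF i] i])
    moreover have "inv_into UNIV ?i \<circ> ?i = id" using aut_inv_apply(2)[OF aut[OF i]] by (intro ext) (simp only: comp_apply id_apply)
    ultimately have "\<mu> ?c = \<mu> \<sigma>" by (metis \<mu>_id add.commute add.left_commute add.right_neutral)
    then have "(\<Sum>w\<in>words m. f w * Par \<sigma> (?i w)) = (\<Sum>w\<in>words m. f w * Par \<sigma> w)"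
      using f[OF s] f[OF stab_conj(1)[OF s i]] stab_conj(2)[OF s i] by simp
    moreover have "(\<Sum>w\<in>words m. f w * Par \<sigma> (?i w)) = (\<Sum>w\<in>words m. f (\<tau> w) * Par \<sigma> w)"
      using sum_words_aut[OF aut[OF \<tau>], of "\<lambda>w. f w * Par \<sigma> (?i w)" m] aut[OF \<tau>] by simp
    ultimately show "(\<Sum>w\<in>words m. f (\<tau> w) * Par \<sigma> w) = (\<Sum>w\<in>words m. f w * Par \<sigma> w)" by simp
  qed
  then obtain c where c0: "\<forall>\<sigma>\<in>M. (\<forall>w. length w \<le> m \<longrightarrow> \<sigma> w = w) \<longrightarrow>
      (\<Sum>w\<in>words m. f w * Par \<sigma> w) = c * \<Phi> m (Par \<sigma>)" by blast
  have c: "\<mu> \<sigma> = c * \<chi> (Suc m) \<sigma>" if "\<sigma> \<in> stab m" for \<sigma>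
  proof -
    have "\<mu> \<sigma> = c * \<Phi> m (Par \<sigma>)" using c0 f[OF that] that by (simp add: stab_def)
    also have "\<Phi> m (Par \<sigma>) = \<chi> (Suc m) \<sigma>"
      using that Suc.prems(1) by (intro \<Phi>_low) (auto simp: stab_def)
    finally show ?thesis .
  qed
  define \<nu> where "\<nu> \<sigma> = \<mu> \<sigma> + c * \<chi> (Suc m) \<sigma>" for \<sigma>
  have \<nu>_comp: "\<nu> (\<sigma> \<circ> \<tau>) = \<nu> \<sigma> + \<nu> \<tau>" if "\<sigma> \<in> M" "\<tau> \<in> M" for \<sigma> \<tau>
    using that Suc.prems(1) by (simp add: \<nu>_def \<mu>_comp \<chi>_comp algebra_simps)
  have "\<exists>d::nat \<Rightarrow> bit. \<forall>\<sigma>\<in>M. \<nu> \<sigma> = (\<Sum>i\<in>{1..m}. d i * \<chi> i \<sigma>)"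
  proof (rule Suc.IH)
    show "m \<le> N" using Suc.prems(1) by simp
    fix \<sigma> \<tau> assume st: "\<sigma> \<in> M" "\<tau> \<in> M"
    then show "\<nu> (\<sigma> \<circ> \<tau>) = \<nu> \<sigma> + \<nu> \<tau>" by (rule \<nu>_comp)
    assume "\<And>w. length w \<le> m \<Longrightarrow> \<sigma> w = \<tau> w"
    note e = eq_stab[OF st this]
    have "\<nu> \<sigma> = \<nu> \<tau> + \<nu> (inv_into UNIV \<tau> \<circ> \<sigma>)"
      using e(2) \<nu>_comp[OF st(2) stabD(1)[OF e(1)]] by simp
    moreover have "\<nu> (inv_into UNIV \<tau> \<circ> \<sigma>) = 0" using c[OF e(1)] by (simp add: \<nu>_def)
    ultimately show "\<nu> \<sigma> = \<nu> \<tau>" by simp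
  qed
  then obtain d where d: "\<And>\<sigma>. \<sigma> \<in> M \<Longrightarrow> \<nu> \<sigma> = (\<Sum>i\<in>{1..m}. d i * \<chi> i \<sigma>)" by auto
  have "\<mu> \<sigma> = (\<Sum>i\<in>{1..Suc m}. (d(Suc m := c)) i * \<chi> i \<sigma>)" if "\<sigma> \<in> M" for \<sigma>
  proof -
    have "\<mu> \<sigma> = \<nu> \<sigma> + c * \<chi> (Suc m) \<sigma>" by (simp add: \<nu>_def)
    moreover have "\<nu> \<sigma> = (\<Sum>i\<in>{1..m}. (d(Suc m := c)) i * \<chi> i \<sigma>)"
      unfolding d[OF that] by (rule sum.cong) auto
    ultimately show ?thesis by simp
  qed
  then show ?case by blast
qed

text \<open>By induction \<open>H\<close> acts on level \<open>m\<close> like \<open>M\<close>. If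
  it missed an element on the next level, a functional of least height that vanishes on
  \<open>U\<close> but not on the stabilizer would be invariant, hence equal to
  \<open>\<Phi> m\<close>. For \<open>m < N\<close> this yields a linear relation between the
  characters on \<open>H\<close>, against \<open>surj\<close>; for larger \<open>m\<close> a
  commutator of two lifts to \<open>H\<close> lies in \<open>U\<close> and has a nonzero
  value.\<close>

theorem dense:
  assumes H: "H \<subseteq> M" "id \<in> H" "\<And>\<sigma> \<tau>. \<sigma> \<in> H \<Longrightarrow> \<tau> \<in> H \<Longrightarrow> \<sigma> \<circ> \<tau> \<in> H"
      "\<And>\<sigma>. \<sigma> \<in> H \<Longrightarrow> inv_into UNIV \<sigma> \<in> H"
    and surj: "\<And>e. \<exists>h\<in>H. \<forall>i\<in>{1..N}. \<chi> i h = e i"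
  shows "\<sigma> \<in> M \<Longrightarrow> \<exists>h\<in>H. \<forall>w. length w \<le> m \<longrightarrow> h w = \<sigma> w"
proof (induction m arbitrary: \<sigma>)
  case 0
  then show ?case using H(1,2) aut by (intro bexI[of _ id]) auto
next
  case (Suc m)
  note lift = Suc.IH
  define U where "U = H \<inter> stab m"
  have U_comp: "\<sigma> \<circ> \<tau> \<in> U" if "\<sigma> \<in> U" "\<tau> \<in> U" for \<sigma> \<tau>
    using that H(3) stab_comp by (auto simp: U_def)
  show ?case
  proof (rule ccontr)
    assume no: "\<not> ?thesis"
    obtain h0 where h0: "h0 \<in> H" "\<And>w. length w \<le> m \<Longrightarrow> \<sigma> w = h0 w"
      using lift[OF Suc.prems] by metis
    define v where "v = inv_into UNIV h0 \<circ> \<sigma>"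
    have v: "v \<in> stab m" "\<sigma> = h0 \<circ> v"
      using eq_stab[OF Suc.prems _ h0(2)] h0(1) H(1) by (auto simp: v_def)
    have vU: False if u: "u \<in> U" "\<And>w. length w = m \<Longrightarrow> Par u w = Par v w" for u
    proof -
      have us: "u \<in> stab m" using u by (simp add: U_def)
      have "u w = v w" if "length w \<le> Suc m" for w
      proof (rule aut_eq_level[OF _ _ _ that])
        show "u \<in> Aut_inf" "v \<in> Aut_inf" using us v stabD aut by auto
        show "Par u x = Par v x" if "length x < Suc m" for x
          using u(2)[of x] that stabD(2)[OF us] stabD(2)[OF v(1)]
          by (cases "length x = m") (auto simp: Par_def)
      qed
      then have "\<forall>w. length w \<le> Suc m \<longrightarrow> (h0 \<circ> u) w = \<sigma> w" by (simp add: v(2))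
      moreover have "h0 \<circ> u \<in> H" using u h0 H(3) by (auto simp: U_def)
      ultimately show False using no by blast
    qed
    define sep where "sep f \<longleftrightarrow> (\<forall>u\<in>U. (\<Sum>w\<in>words m. f w * Par u w) = 0) \<and>
       (\<exists>x\<in>stab m. (\<Sum>w\<in>words m. f w * Par x w) \<noteq> 0)" for f :: "word \<Rightarrow> bit"
    \<comment> \<open>On the span of \<open>U\<close> and \<open>v\<close>, parametrised by pairs of
      a scalar and an element of \<open>U\<close>, this functional reads off the coefficient of
      \<open>v\<close>; \<open>vU\<close> makes the coefficient well defined.\<close>
    have "\<exists>f. \<forall>a\<in>UNIV \<times> U. fst a = (\<Sum>w\<in>words m. f w * (Par (snd a) w + fst a * Par v w))"
    proof (rule bit_additive_rep)
      fix a b :: "bit \<times> (word \<Rightarrow> word)" assume ab: "a \<in> UNIV \<times> U" "b \<in> UNIV \<times> U"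
      define c where "c = (fst a + fst b, snd a \<circ> snd b)"
      have "c \<in> UNIV \<times> U" using ab U_comp by (auto simp: c_def)
      moreover have "Par (snd c) w + fst c * Par v w =
          (Par (snd a) w + fst a * Par v w) + (Par (snd b) w + fst b * Par v w)" if "w \<in> words m" for w
      proof -
        have "snd a \<in> stab m" "snd b \<in> stab m" using ab by (auto simp: U_def)
        then have "Par (snd c) w = Par (snd a) w + Par (snd b) w"
          using that stabD(1) by (simp add: c_def Par_stab_comp)
        then show ?thesis by (simp add: c_def algebra_simps)
      qed
      ultimately show "\<exists>c\<in>UNIV \<times> U. (\<forall>w\<in>words m. Par (snd c) w + fst c * Par v w =
          (Par (snd a) w + fst a * Par v w) + (Par (snd b) w + fst b * Par v w)) \<and> fst c = fst a + fst b"
        by (intro bexI[of _ c]) (auto simp: c_def)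
    next
      fix a :: "bit \<times> (word \<Rightarrow> word)"
      assume a: "a \<in> UNIV \<times> U" "\<forall>w\<in>words m. Par (snd a) w + fst a * Par v w = 0"
      show "fst a = 0"
      proof (rule ccontr)
        assume "fst a \<noteq> 0"
        then have "Par (snd a) w = Par v w" if "length w = m" for w
          using a(2) that by (simp add: bit_add_0_iff)
        then show False using vU[of "snd a"] a(1) by auto
      qed
    qed simp
    then obtain f0 where f0: "\<And>b u. u \<in> U \<Longrightarrow> b = (\<Sum>w\<in>words m. f0 w * (Par u w + b * Par v w))"
      by auto
    have "id \<in> U" using H M_id by (simp add: U_def stab_def)
    have "sep f0" unfolding sep_def
    proof
      show "\<forall>u\<in>U. (\<Sum>w\<in>words m. f0 w * Par u w) = 0" using f0[of _ 0] by simp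
      show "\<exists>x\<in>stab m. (\<Sum>w\<in>words m. f0 w * Par x w) \<noteq> 0"
        using f0[OF \<open>id \<in> U\<close>, of 1] v(1) by (intro bexI[of _ v]) (auto simp flip: id_def)
    qed
    then obtain f where f: "sep f" and min: "\<And>g. sep g \<Longrightarrow> height m f \<le> height m g"
      using exists_least_lemma[of "\<lambda>n. \<exists>g. sep g \<and> height m g = n"] arg_min_nat_lemma[of sep f0 "height m"] by metis
    have fU: "(\<Sum>w\<in>words m. f w * Par u w) = 0" if "u \<in> U" for u using f that by (simp add: sep_def)
    obtain x where x: "x \<in> stab m" "(\<Sum>w\<in>words m. f w * Par x w) \<noteq> 0" using f by (auto simp: sep_def)
    have h_nz: "height m f \<noteq> 0"
    proof
      assume "height m f = 0"
      then have "\<forall>w\<in>words m. f w = 0" by (simp only: height_eq_0_iff)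
      then have "(\<Sum>w\<in>words m. f w * Par x w) = 0" by (intro sum.neutral) auto
      then show False using x(2) by simp
    qed
    have "\<exists>c. \<forall>\<sigma>\<in>M. (\<forall>w. length w \<le> m \<longrightarrow> \<sigma> w = w) \<longrightarrow> (\<Sum>w\<in>words m. f w * Par \<sigma> w) = c * \<Phi> m (Par \<sigma>)"
    proof (rule invariants)
      fix y \<tau> assume y: "y \<in> M" "\<And>w. length w \<le> m \<Longrightarrow> y w = w" and \<tau>: "\<tau> \<in> M"
      have ys: "y \<in> stab m" using y by (simp add: stab_def)
      define g where "g = (\<lambda>w. f (\<tau> w) + f w)"
      have gs: "(\<Sum>w\<in>words m. g w * z w) = (\<Sum>w\<in>words m. f (\<tau> w) * z w) + (\<Sum>w\<in>words m. f w * z w)" for z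
        by (simp add: g_def algebra_simps sum.distrib)
      \<comment> \<open>By minimality the increment separates nothing; since it is shown to vanish
        on \<open>U\<close>, it vanishes on the whole stabilizer.\<close>
      have "height m g < height m f" using height_translate_less[OF aut[OF \<tau>] h_nz] by (simp add: g_def)
      then have "\<not> sep g" using min[of g] by linarith
      moreover have "(\<Sum>w\<in>words m. g w * Par u w) = 0" if u: "u \<in> U" for u
      proof -
        \<comment> \<open>The induction hypothesis supplies an element of \<open>H\<close> that acts
          on level \<open>m\<close> like the inverse of \<open>\<tau>\<close>, and conjugation by it
          preserves \<open>U\<close>.\<close>
        obtain h where h: "h \<in> H" "\<And>w. length w \<le> m \<Longrightarrow> h w = inv_into UNIV \<tau> w"
          using lift[OF M_inv[OF \<tau>]] by blast
        have us: "u \<in> stab m" and uH: "u \<in> H" using u by (auto simp: U_def)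
        have hM: "h \<in> M" using h H(1) by auto
        let ?c = "inv_into UNIV h \<circ> (u \<circ> h)"
        have "?c \<in> U" using stab_conj(1)[OF us hM] H h uH by (simp add: U_def)
        then have "0 = (\<Sum>w\<in>words m. f w * Par ?c w)" using fU by simp
        also have "\<dots> = (\<Sum>w\<in>words m. f w * Par u (inv_into UNIV \<tau> w))"
          using stab_conj(2)[OF us hM] h(2) by (intro sum.cong) auto
        also have "\<dots> = (\<Sum>w\<in>words m. f (\<tau> w) * Par u w)"
          using sum_words_aut[OF aut[OF \<tau>], of "\<lambda>w. f w * Par u (inv_into UNIV \<tau> w)" m] aut[OF \<tau>] by simp
        finally show ?thesis using fU[OF u] by (simp add: gs)
      qed
      ultimately have "(\<Sum>w\<in>words m. g w * Par y w) = 0" using ys by (auto simp: sep_def)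
      then show "(\<Sum>w\<in>words m. f (\<tau> w) * Par y w) = (\<Sum>w\<in>words m. f w * Par y w)"
        by (simp add: gs bit_add_0_iff)
    qed
    then obtain c where c: "\<And>y. y \<in> stab m \<Longrightarrow> (\<Sum>w\<in>words m. f w * Par y w) = c * \<Phi> m (Par y)"
      by (auto simp: stab_def)
    then have "c = 1" using x by (cases c) auto
    then have \<Phi>U: "\<Phi> m (Par u) = 0" if "u \<in> U" for u using c[of u] fU[OF that] that by (simp add: U_def)
    show False
    proof (cases "m < N")
      case True
      \<comment> \<open>As \<open>\<chi> (Suc m)\<close> vanishes on \<open>U\<close>, on
        \<open>H\<close> it depends on the first \<open>m\<close> levels only. Transported to
        \<open>M\<close> along lifts it becomes a homomorphism to which \<open>homs\<close>
        applies.\<close>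
      define \<mu> where "\<mu> \<sigma> = \<chi> (Suc m) (SOME h. h \<in> H \<and> (\<forall>w. length w \<le> m \<longrightarrow> h w = \<sigma> w))" for \<sigma>
      have \<mu>: "\<mu> \<sigma> = \<chi> (Suc m) h" if "\<sigma> \<in> M" "h \<in> H" "\<And>w. length w \<le> m \<Longrightarrow> h w = \<sigma> w" for \<sigma> h
      proof -
        define h' where "h' = (SOME h. h \<in> H \<and> (\<forall>w. length w \<le> m \<longrightarrow> h w = \<sigma> w))"
        have h': "h' \<in> H" "\<And>w. length w \<le> m \<Longrightarrow> h' w = \<sigma> w"
          using someI_ex[of "\<lambda>h. h \<in> H \<and> (\<forall>w. length w \<le> m \<longrightarrow> h w = \<sigma> w)"] that by (auto simp: h'_def)
        have M: "h' \<in> M" "h \<in> M" using h' that H(1) by auto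
        have e: "inv_into UNIV h \<circ> h' \<in> stab m" "h' = h \<circ> (inv_into UNIV h \<circ> h')"
          using eq_stab[OF M, of m] h'(2) that(3) by simp_all
        have "inv_into UNIV h \<circ> h' \<in> U" using e H that h' by (simp add: U_def)
        then have "\<chi> (Suc m) (inv_into UNIV h \<circ> h') = 0"
          using \<Phi>U \<Phi>_low[OF True, of "inv_into UNIV h \<circ> h'"] e(1) by (simp add: stab_def)
        then have "\<chi> (Suc m) h' = \<chi> (Suc m) h"
          using e(2) \<chi>_comp[OF M(2) stabD(1)[OF e(1)], of "Suc m"] True by simp
        then show ?thesis by (simp add: \<mu>_def h'_def)
      qed
      have "\<exists>c::nat \<Rightarrow> bit. \<forall>\<sigma>\<in>M. \<mu> \<sigma> = (\<Sum>i\<in>{1..m}. c i * \<chi> i \<sigma>)"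
      proof (rule homs)
        fix \<sigma> \<tau> assume st: "\<sigma> \<in> M" "\<tau> \<in> M"
        obtain h where h: "h \<in> H" "\<And>w. length w \<le> m \<Longrightarrow> h w = \<sigma> w" using lift[OF st(1)] by blast
        obtain k where k: "k \<in> H" "\<And>w. length w \<le> m \<Longrightarrow> k w = \<tau> w" using lift[OF st(2)] by blast
        have "\<mu> (\<sigma> \<circ> \<tau>) = \<chi> (Suc m) (h \<circ> k)"
          by (rule \<mu>) (use st h k H(3) aut in \<open>auto simp: M_comp\<close>)
        also have "\<dots> = \<chi> (Suc m) h + \<chi> (Suc m) k"
          using h k H(1) True by (intro \<chi>_comp) auto
        finally show "\<mu> (\<sigma> \<circ> \<tau>) = \<mu> \<sigma> + \<mu> \<tau>"
          using \<mu>[OF st(1) h] \<mu>[OF st(2) k] by simp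
        assume "\<And>w. length w \<le> m \<Longrightarrow> \<sigma> w = \<tau> w"
        then show "\<mu> \<sigma> = \<mu> \<tau>" using \<mu>[OF st(1) h] \<mu>[OF st(2) h(1)] h(2) by simp
      qed (use True in simp)
      then obtain d where d: "\<And>\<sigma>. \<sigma> \<in> M \<Longrightarrow> \<mu> \<sigma> = (\<Sum>i\<in>{1..m}. d i * \<chi> i \<sigma>)" by auto
      \<comment> \<open>An element of \<open>H\<close> on which character \<open>m + 1\<close> is
        the only nonzero one violates the relation just found.\<close>
      obtain h where h: "h \<in> H" "\<And>i. i \<in> {1..N} \<Longrightarrow> \<chi> i h = (if i = Suc m then 1 else 0)"
        using surj[of "\<lambda>i. if i = Suc m then 1 else 0"] by auto
      have hM: "h \<in> M" using h H by auto
      have "\<mu> h = 1" using \<mu>[OF hM h(1)] h(2)[of "Suc m"] True by simp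
      moreover have "(\<Sum>i\<in>{1..m}. d i * \<chi> i h) = 0" using h(2) True by (intro sum.neutral) auto
      ultimately show False using d[OF hM] by simp
    next
      case False
      then obtain g1 g2 where g: "g1 \<in> M" "g2 \<in> M" "\<And>w. length w \<le> m \<Longrightarrow> g1 (g2 w) = g2 (g1 w)"
        "\<Phi> m (Par (g1 \<circ> g2)) \<noteq> \<Phi> m (Par (g2 \<circ> g1))"
        using commutators[of m] by auto
      obtain h1 where h1: "h1 \<in> H" "\<And>w. length w \<le> m \<Longrightarrow> h1 w = g1 w" using lift[OF g(1)] by blast
      obtain h2 where h2: "h2 \<in> H" "\<And>w. length w \<le> m \<Longrightarrow> h2 w = g2 w" using lift[OF g(2)] by blast
      have hM: "h1 \<in> M" "h2 \<in> M" using h1 h2 H(1) by auto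
      define v1 where "v1 = inv_into UNIV g1 \<circ> h1"
      define v2 where "v2 = inv_into UNIV g2 \<circ> h2"
      have v: "v1 \<in> stab m" "h1 = g1 \<circ> v1" "v2 \<in> stab m" "h2 = g2 \<circ> v2"
        using eq_stab[OF hM(1) g(1) h1(2)] eq_stab[OF hM(2) g(2) h2(2)] by (auto simp: v1_def v2_def)
      have au: "g1 \<in> Aut_inf" "g2 \<in> Aut_inf" "h1 \<in> Aut_inf" "h2 \<in> Aut_inf" using g hM aut by auto
      \<comment> \<open>By invariance the corrections \<open>v1\<close> and \<open>v2\<close>
        contribute equally to both orders of multiplication, so passing from \<open>g1\<close>,
        \<open>g2\<close> to their lifts does not change the difference of the two values of
        \<open>\<Phi> m\<close>.\<close>
      have inv: "\<Phi> m (\<lambda>w. Par v1 (g2 w)) = \<Phi> m (Par v1)" "\<Phi> m (\<lambda>w. Par v2 (g1 w)) = \<Phi> m (Par v2)"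
        using False v(1,3) g(1,2) by (auto intro!: \<Phi>_invariant simp: stab_def)
      have "\<Phi> m (Par (h1 \<circ> h2)) = \<Phi> m (\<lambda>w. (Par (g1 \<circ> g2) w + Par v2 w) + Par v1 (g2 w))"
      proof (rule \<Phi>_level)
        fix w :: word assume w: "length w = m"
        have "Par (h1 \<circ> h2) w = Par h2 w + Par h1 (g2 w)" using w h2(2) au by (simp add: Par_comp)
        also have "\<dots> = (Par g2 w + Par v2 w) + (Par g1 (g2 w) + Par v1 (g2 w))"
          using w v g Par_stab_comp by (simp add: au)
        finally show "Par (h1 \<circ> h2) w = (Par (g1 \<circ> g2) w + Par v2 w) + Par v1 (g2 w)"
          using au by (simp add: Par_comp ac_simps)
      qed
      then have e1: "\<Phi> m (Par (h1 \<circ> h2)) = \<Phi> m (Par (g1 \<circ> g2)) + \<Phi> m (Par v2) + \<Phi> m (Par v1)"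
        by (simp add: \<Phi>_add inv)
      have "\<Phi> m (Par (h2 \<circ> h1)) = \<Phi> m (\<lambda>w. (Par (g2 \<circ> g1) w + Par v1 w) + Par v2 (g1 w))"
      proof (rule \<Phi>_level)
        fix w :: word assume w: "length w = m"
        have "Par (h2 \<circ> h1) w = Par h1 w + Par h2 (g1 w)" using w h1(2) au by (simp add: Par_comp)
        also have "\<dots> = (Par g1 w + Par v1 w) + (Par g2 (g1 w) + Par v2 (g1 w))"
          using w v g Par_stab_comp by (simp add: au)
        finally show "Par (h2 \<circ> h1) w = (Par (g2 \<circ> g1) w + Par v1 w) + Par v2 (g1 w)"
          using au by (simp add: Par_comp ac_simps)
      qed
      then have e2: "\<Phi> m (Par (h2 \<circ> h1)) = \<Phi> m (Par (g2 \<circ> g1)) + \<Phi> m (Par v1) + \<Phi> m (Par v2)"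
        by (simp add: \<Phi>_add inv)
      have hc: "(h1 \<circ> h2) w = (h2 \<circ> h1) w" if "length w \<le> m" for w
        using that h1(2) h2(2) g(3) au by simp
      have hcM: "h1 \<circ> h2 \<in> M" "h2 \<circ> h1 \<in> M" using hM M_comp by auto
      define c where "c = inv_into UNIV (h2 \<circ> h1) \<circ> (h1 \<circ> h2)"
      have cs: "c \<in> stab m" "h1 \<circ> h2 = (h2 \<circ> h1) \<circ> c"
        using eq_stab[OF hcM, of m] hc unfolding c_def by (metis, metis)
      have "c \<in> H" unfolding c_def by (intro H(3,4) h1(1) h2(1))
      then have "c \<in> U" using cs(1) by (simp add: U_def)
      have "\<Phi> m (Par (h1 \<circ> h2)) = \<Phi> m (\<lambda>w. Par (h2 \<circ> h1) w + Par c w)"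
        using Par_stab_comp[OF hcM(2) cs(1)] cs(2) by (intro \<Phi>_level) simp
      then have "\<Phi> m (Par (h1 \<circ> h2)) = \<Phi> m (Par (h2 \<circ> h1))"
        using \<Phi>U[OF \<open>c \<in> U\<close>] by (simp add: \<Phi>_add)
      then have "\<Phi> m (Par (g1 \<circ> g2)) + \<Phi> m (Par v2) + \<Phi> m (Par v1) =
          \<Phi> m (Par (g2 \<circ> g1)) + \<Phi> m (Par v1) + \<Phi> m (Par v2)"
        unfolding e1 e2 .
      then show False using g(4) bit_add_right_cancel by blast
    qed
  qed
qed

end

section \<open>The groups as groups of portraits\<close>

definition lev :: "(word \<Rightarrow> bit) \<Rightarrow> nat \<Rightarrow> word \<Rightarrow> bit" where
  "lev p m u = (\<Sum>w\<in>words m. p (u @ w))"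

text \<open>One formula for \<open>Pa\<close> (letter \<open>a\<close>) and \<open>Pb\<close>
  (letter \<open>b\<close>).\<close>

definition Pc :: "nat \<Rightarrow> nat \<Rightarrow> (word \<Rightarrow> bit) \<Rightarrow> word \<Rightarrow> letter \<Rightarrow> bit" where
  "Pc r s p x l = lev p (r - 1) (x @ [l]) + lev p (s - 1) (x @ [other l])"

text \<open>Covers \<open>Rr1\<close> and \<open>R32\<close>; the value 0 in the remaining case
  gives \<open>ok\<close> the same form for all parameters.\<close>

definition Rc :: "nat \<Rightarrow> nat \<Rightarrow> (word \<Rightarrow> bit) \<Rightarrow> word \<Rightarrow> bit" where
  "Rc r s p x =
     (if s = 1 then p (x @ [La]) * p (x @ [Lb]) + lev p (r - 2) (x @ [La, Lb]) + lev p (r - 2) (x @ [Lb, Lb])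
      else if r = 3 \<and> s = 2 then
        (\<Sum>w\<in>words 2. p (x @ w) + (p (x @ w @ [Lb]) + lev p 1 (x @ w @ [La]))) + lev p 1 (x @ [La]) * lev p 1 (x @ [Lb])
      else 0)"

text \<open>The clause for \<open>s = 1\<close> encodes the passage from \<open>M_inf\<close> to
  \<open>B_inf\<close>. For generic parameters the last clause forces \<open>R = 0\<close>.\<close>

definition ok :: "nat \<Rightarrow> nat \<Rightarrow> bit \<Rightarrow> bit \<Rightarrow> (word \<Rightarrow> bit) \<Rightarrow> bool" where
  "ok r s P R p \<longleftrightarrow> (s = 1 \<longrightarrow> P = 0) \<and> (\<forall>x l. Pc r s p x l = P) \<and> (\<forall>x. Rc r s p x = R)"

lemma lev_0 [simp]: "lev p 0 u = p u"
  by (simp add: lev_def)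

lemma lev_Suc: "lev p (Suc m) u = lev p m (u @ [La]) + lev p m (u @ [Lb])"
  by (simp add: lev_def sum_words_Suc_Cons)

lemma lev_Suc_other: "lev p (Suc m) u = lev p m (u @ [l]) + lev p m (u @ [other l])"
  by (cases l) (simp_all add: lev_Suc ac_simps)

lemma lev_1: "lev p 1 u = p (u @ [La]) + p (u @ [Lb])" "lev p (Suc 0) u = p (u @ [La]) + p (u @ [Lb])"
  by (simp_all add: lev_Suc)

lemma lev_cong: "(\<And>w. length w = m \<Longrightarrow> p (u @ w) = q (u @ w)) \<Longrightarrow> lev p m u = lev q m u"
  by (simp add: lev_def)

lemma lev_comp:
  assumes "\<sigma> \<in> Aut_inf" "\<tau> \<in> Aut_inf"
  shows "lev (Par (\<sigma> \<circ> \<tau>)) m u = lev (Par \<tau>) m u + lev (Par \<sigma>) m (\<tau> u)"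
  using assms by (simp add: lev_def Par_comp sum.distrib sum_below_aut)

lemma Mt_inf_iff:
  assumes "1 \<le> s" "s < r" "3 \<le> r"
  shows "\<sigma> \<in> Mt_inf r s \<longleftrightarrow> \<sigma> \<in> Aut_inf \<and> (\<exists>P R. ok r s P R (Par \<sigma>))"
proof -
  have Pa: "Pa r s \<sigma> x = Pc r s (Par \<sigma>) x La" and Pb: "Pb r s \<sigma> x = Pc r s (Par \<sigma>) x Lb" for x r s
    by (simp_all add: Pa_def Pb_def Pc_def lev_def)
  have all: "(\<forall>x. Pa r s \<sigma> x = v \<and> Pb r s \<sigma> x = v) \<longleftrightarrow> (\<forall>x l. Pc r s (Par \<sigma>) x l = v)" for v r s
    unfolding Pa Pb by (metis letter.exhaust)
  have common: "P_common r s \<sigma> = v" if "\<forall>x. Pa r s \<sigma> x = v \<and> Pb r s \<sigma> x = v" for v r s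
    unfolding P_common_def using that by (intro the_equality) auto
  consider "s = 1" | "r = 3" "s = 2" | "s \<noteq> 1" "\<not> (r = 3 \<and> s = 2)" by blast
  then show ?thesis
  proof cases
    case 1
    have R: "Rr1 r \<sigma> x = Rc r 1 (Par \<sigma>) x" for x
      by (simp add: Rr1_def Rc_def lev_def sum.distrib ac_simps)
    have "\<sigma> \<in> B_inf r 1 \<longleftrightarrow> \<sigma> \<in> Aut_inf \<and> (\<forall>x l. Pc r 1 (Par \<sigma>) x l = 0)"
    proof
      assume "\<sigma> \<in> B_inf r 1"
      then obtain v where a: "\<sigma> \<in> Aut_inf" "\<forall>x. Pa r 1 \<sigma> x = v \<and> Pb r 1 \<sigma> x = v" "P_common r 1 \<sigma> = 0"
        unfolding B_inf_def M_inf_def by blast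
      with common[OF a(2)] show "\<sigma> \<in> Aut_inf \<and> (\<forall>x l. Pc r 1 (Par \<sigma>) x l = 0)"
        unfolding all[symmetric] by metis
    next
      assume "\<sigma> \<in> Aut_inf \<and> (\<forall>x l. Pc r 1 (Par \<sigma>) x l = 0)"
      then show "\<sigma> \<in> B_inf r 1"
        using common[of r 1 0] unfolding all[symmetric] B_inf_def M_inf_def by blast
    qed
    then show ?thesis using 1 by (auto simp: Mt_inf_def ok_def R)
  next
    case 2
    have R: "R32 \<sigma> x = Rc 3 2 (Par \<sigma>) x" for x
      by (simp add: R32_def Rc_def lev_def UNIV_letter numeral_2_eq_2 sum_words_Suc_Cons ac_simps)
    show ?thesis using 2 by (auto simp: Mt_inf_def M_inf_def ok_def R all)
  next
    case 3
    then show ?thesis using assms by (auto simp: Mt_inf_def M_inf_def ok_def Rc_def all)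
  qed
qed

lemma Pc_comp:
  assumes "\<sigma> \<in> Aut_inf" "\<tau> \<in> Aut_inf"
  shows "Pc r s (Par (\<sigma> \<circ> \<tau>)) x l = Pc r s (Par \<tau>) x l + Pc r s (Par \<sigma>) (\<tau> x) (turn (Par \<tau> x) l)"
  using assms by (simp add: Pc_def lev_comp aut_snoc turn_other ac_simps)

text \<open>
  In both exceptional cases the failure of \<open>Rc\<close> to be additive is measured by the sum of its block
  with the sibling block, and this sum is rewritten with the help of the constant value of \<open>Pc\<close>.
\<close>

lemma Pc_sum_32:
  assumes "\<forall>x l. Pc 3 2 p x l = P"
  shows "(p (z @ [l, l', Lb]) + lev p 1 (z @ [l, l', La])) + (p (z @ [l, l', La]) + lev p 1 (z @ [l, l', Lb]))
    = lev p 1 (z @ [other l])"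
proof -
  have a1: "lev p 2 (z @ [l, l']) = P + lev p 1 (z @ [l, other l'])"
    using assms[rule_format, of "z @ [l]" l'] by (simp add: Pc_def bit_add_eq_iff ac_simps)
  have a2: "lev p 2 (z @ [l]) = P + lev p 1 (z @ [other l])"
    using assms[rule_format, of "z" l] by (simp add: Pc_def bit_add_eq_iff ac_simps)
  have a3: "lev p 2 (z @ [l]) = lev p 1 (z @ [l, l']) + lev p 1 (z @ [l, other l'])"
    using lev_Suc_other[of p 1 "z @ [l]" l'] by (simp add: numeral_2_eq_2)
  have a4: "lev p 2 (z @ [l, l']) = lev p 1 (z @ [l, l', La]) + lev p 1 (z @ [l, l', Lb])"
    using lev_Suc[of p 1 "z @ [l, l']"] by (simp add: numeral_2_eq_2)
  have a5: "lev p 1 (z @ [l, l']) = p (z @ [l, l', La]) + p (z @ [l, l', Lb])"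
    by (simp add: lev_1)
  have "(p (z @ [l, l', Lb]) + lev p 1 (z @ [l, l', La])) + (p (z @ [l, l', La]) + lev p 1 (z @ [l, l', Lb]))
      = lev p 1 (z @ [l, l']) + lev p 2 (z @ [l, l'])"
    unfolding a4 a5 by (simp only: ac_simps)
  also have "\<dots> = P + lev p 2 (z @ [l])" unfolding a1 a3 by (simp only: ac_simps)
  also have "\<dots> = lev p 1 (z @ [other l])" unfolding a2 by simp
  finally show ?thesis .
qed

text \<open>Where \<open>\<tau>\<close> turns, the blocks \<open>A\<close> and \<open>B\<close> of
  \<open>\<sigma>\<close> change places, so additivity of the block sum fails by the terms
  \<open>A + B\<close>. By \<open>Pc_sum_32\<close> these depend on the first letter only, and their
  total is exactly the cross term that the product in \<open>Rc\<close> produces.\<close>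

lemma Rc_comp_32:
  assumes "\<sigma> \<in> Aut_inf" "\<tau> \<in> Aut_inf" "\<forall>x l. Pc 3 2 (Par \<sigma>) x l = P"
  shows "Rc 3 2 (Par (\<sigma> \<circ> \<tau>)) x = Rc 3 2 (Par \<tau>) x + Rc 3 2 (Par \<sigma>) (\<tau> x)"
proof -
  define A where "A p u = p (u @ [Lb]) + lev p 1 (u @ [La])" for p :: "word \<Rightarrow> bit" and u
  define B where "B p u = p (u @ [La]) + lev p 1 (u @ [Lb])" for p :: "word \<Rightarrow> bit" and u
  define C where "C l = lev (Par \<sigma>) 1 (\<tau> (x @ [l]))" for l
  define D where "D l = lev (Par \<tau>) 1 (x @ [l])" for l
  have R: "Rc 3 2 p x = (\<Sum>w\<in>words 2. p (x @ w)) + (\<Sum>w\<in>words 2. A p (x @ w)) + lev p 1 (x @ [La]) * lev p 1 (x @ [Lb])"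
    for p x by (simp add: Rc_def A_def sum.distrib)
  have A1: "A (Par (\<sigma> \<circ> \<tau>)) u = A (Par \<tau>) u + A (Par \<sigma>) (\<tau> u) + Par \<tau> u * (A (Par \<sigma>) (\<tau> u) + B (Par \<sigma>) (\<tau> u))" for u
    using assms(1,2) by (cases "Par \<tau> u") (simp_all add: A_def B_def lev_comp Par_comp aut_snoc ac_simps)
  have AB: "A (Par \<sigma>) (\<tau> (x @ [l, l'])) + B (Par \<sigma>) (\<tau> (x @ [l, l'])) = C (other l)" for l l'
  proof -
    have "\<tau> (x @ [l, l']) = \<tau> x @ [turn (Par \<tau> x) l, turn (Par \<tau> (x @ [l])) l']"
      using aut_snoc[OF assms(2), of "x @ [l]" l'] aut_snoc[OF assms(2), of x l] by simp
    moreover have "\<tau> (x @ [other l]) = \<tau> x @ [other (turn (Par \<tau> x) l)]"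
      using aut_snoc[OF assms(2), of x "other l"] by (simp add: turn_other)
    ultimately show ?thesis
      using Pc_sum_32[OF assms(3), of "\<tau> x" "turn (Par \<tau> x) l"] by (simp add: A_def B_def C_def)
  qed
  have "(\<Sum>w\<in>words 2. Par \<tau> (x @ w) * (A (Par \<sigma>) (\<tau> (x @ w)) + B (Par \<sigma>) (\<tau> (x @ w)))) = D La * C Lb + D Lb * C La"
    by (simp add: numeral_2_eq_2 sum_words_Suc_Cons AB) (simp add: D_def lev_1 algebra_simps)
  then have e1: "(\<Sum>w\<in>words 2. A (Par (\<sigma> \<circ> \<tau>)) (x @ w)) =
      (\<Sum>w\<in>words 2. A (Par \<tau>) (x @ w)) + (\<Sum>w\<in>words 2. A (Par \<sigma>) (\<tau> x @ w)) + (D La * C Lb + D Lb * C La)"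
    using sum_below_aut[OF assms(2), of "A (Par \<sigma>)" x 2] by (simp add: A1 sum.distrib)
  have e2: "(\<Sum>w\<in>words 2. Par (\<sigma> \<circ> \<tau>) (x @ w)) = (\<Sum>w\<in>words 2. Par \<tau> (x @ w)) + (\<Sum>w\<in>words 2. Par \<sigma> (\<tau> x @ w))"
    using sum_below_aut[OF assms(2), of "Par \<sigma>" x 2] by (simp add: Par_comp assms sum.distrib)
  have e3: "lev (Par (\<sigma> \<circ> \<tau>)) 1 (x @ [l]) = D l + C l" for l
    using assms by (simp add: lev_comp C_def D_def)
  have e4: "lev (Par \<sigma>) 1 (\<tau> x @ [La]) * lev (Par \<sigma>) 1 (\<tau> x @ [Lb]) = C La * C Lb"
    by (cases "Par \<tau> x") (simp_all add: C_def aut_snoc[OF assms(2)] mult.commute)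
  show ?thesis
    unfolding R e1 e2 e3 e4 D_def[symmetric] by (simp only: distrib_left distrib_right ac_simps bit_add_self bit_add_self_left)
qed

text \<open>The mechanism of \<open>Rc_comp_32\<close> with half blocks: the defect at
  \<open>u\<close> is the whole block of \<open>\<sigma>\<close> at \<open>\<tau> u\<close>, which
  the vanishing of \<open>Pc\<close> identifies with the parity at the sibling.\<close>

lemma Rc_comp_1:
  assumes "\<sigma> \<in> Aut_inf" "\<tau> \<in> Aut_inf" "\<forall>x l. Pc r 1 (Par \<sigma>) x l = 0" "3 \<le> r"
  shows "Rc r 1 (Par (\<sigma> \<circ> \<tau>)) x = Rc r 1 (Par \<tau>) x + Rc r 1 (Par \<sigma>) (\<tau> x)"
proof -
  define A where "A p u = lev p (r - 2) (u @ [Lb])" for p :: "word \<Rightarrow> bit" and u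
  define C where "C l = Par \<sigma> (\<tau> (x @ [l]))" for l
  have r: "r - Suc 0 = Suc (r - 2)" using assms(4) by simp
  have A1: "A (Par (\<sigma> \<circ> \<tau>)) u = A (Par \<tau>) u + A (Par \<sigma>) (\<tau> u) + Par \<tau> u * lev (Par \<sigma>) (r - 1) (\<tau> u)" for u
    using assms(1,2) by (cases "Par \<tau> u") (simp_all add: A_def r lev_Suc lev_comp aut_snoc ac_simps)
  have AB: "lev (Par \<sigma>) (r - 1) (\<tau> (x @ [l])) = C (other l)" for l
  proof -
    have "\<tau> (x @ [other l]) = \<tau> x @ [other (turn (Par \<tau> x) l)]"
      using aut_snoc[OF assms(2), of x "other l"] by (simp add: turn_other)
    then show ?thesis
      using assms(3)[rule_format, of "\<tau> x" "turn (Par \<tau> x) l"]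
      by (simp add: C_def Pc_def aut_snoc[OF assms(2), of x l] bit_add_0_iff)
  qed
  have s: "A (Par \<sigma>) (\<tau> x @ [La]) + A (Par \<sigma>) (\<tau> x @ [Lb]) = A (Par \<sigma>) (\<tau> (x @ [La])) + A (Par \<sigma>) (\<tau> (x @ [Lb]))"
    by (cases "Par \<tau> x") (simp_all add: aut_snoc[OF assms(2)] add.commute)
  have t: "Par \<sigma> (\<tau> x @ [La]) * Par \<sigma> (\<tau> x @ [Lb]) = C La * C Lb"
    by (cases "Par \<tau> x") (simp_all add: C_def aut_snoc[OF assms(2)] mult.commute)
  have R: "Rc r 1 p x = p (x @ [La]) * p (x @ [Lb]) + (A p (x @ [La]) + A p (x @ [Lb]))" for p x
    by (simp add: Rc_def A_def ac_simps)
  have e: "Par (\<sigma> \<circ> \<tau>) (x @ [l]) = Par \<tau> (x @ [l]) + C l" for l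
    using assms by (simp add: Par_comp C_def)
  show ?thesis
    unfolding R A1 AB s t e other.simps by (simp only: distrib_left distrib_right ac_simps bit_add_self bit_add_self_left)
qed

text \<open>Additivity with an arbitrary automorphism as right factor lets \<open>ok_inv\<close>
  solve for the values at an inverse.\<close>

lemma ok_comp:
  assumes "1 \<le> s" "s < r" "3 \<le> r" "\<sigma> \<in> Aut_inf" "\<tau> \<in> Aut_inf" "ok r s P R (Par \<sigma>)"
  shows "Rc r s (Par (\<sigma> \<circ> \<tau>)) x = Rc r s (Par \<tau>) x + R"
    and "Pc r s (Par (\<sigma> \<circ> \<tau>)) x l = Pc r s (Par \<tau>) x l + P"
proof -
  show "Pc r s (Par (\<sigma> \<circ> \<tau>)) x l = Pc r s (Par \<tau>) x l + P"
    using assms by (simp add: Pc_comp ok_def)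
  consider "s = 1" | "r = 3" "s = 2" | "s \<noteq> 1" "\<not> (r = 3 \<and> s = 2)" by blast
  then show "Rc r s (Par (\<sigma> \<circ> \<tau>)) x = Rc r s (Par \<tau>) x + R"
  proof cases
    case 1
    then show ?thesis using Rc_comp_1[OF assms(4,5), of r x] assms by (auto simp: ok_def)
  next
    case 2
    then show ?thesis using Rc_comp_32[OF assms(4,5), of P x] assms by (auto simp: ok_def)
  next
    case 3
    then show ?thesis using assms by (auto simp: ok_def Rc_def)
  qed
qed

lemma ok_comp_ok:
  assumes "1 \<le> s" "s < r" "3 \<le> r" "\<sigma> \<in> Aut_inf" "\<tau> \<in> Aut_inf" "ok r s P R (Par \<sigma>)" "ok r s P' R' (Par \<tau>)"
  shows "ok r s (P + P') (R + R') (Par (\<sigma> \<circ> \<tau>))"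
  using assms(6,7) ok_comp[OF assms(1-6)] by (simp add: ok_def ac_simps)

lemma ok_id: "ok r s 0 0 (Par id)"
  by (simp add: ok_def Pc_def Rc_def lev_def)

lemma ok_inv:
  assumes "1 \<le> s" "s < r" "3 \<le> r" "\<sigma> \<in> Aut_inf" "ok r s P R (Par \<sigma>)"
  shows "ok r s P R (Par (inv_into UNIV \<sigma>))"
proof -
  let ?i = "inv_into UNIV \<sigma>"
  have i: "\<sigma> \<circ> ?i = id" using assms(4) by (auto simp: fun_eq_iff)
  have "Par (\<sigma> \<circ> ?i) = (\<lambda>_. 0)" by (rule ext) (simp only: i Par_id)
  then have "Rc r s (Par (\<sigma> \<circ> ?i)) x = 0" "Pc r s (Par (\<sigma> \<circ> ?i)) x l = 0" for x l
    by (simp_all add: Pc_def Rc_def lev_def)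
  then show ?thesis
    using ok_comp[OF assms(1-4) aut_inv[OF assms(4)] assms(5)] assms(5)
    by (simp add: ok_def bit_add_0_iff)
qed

section \<open>Prescribing portraits\<close>

text \<open>
  The block of \<open>u\<close> is solved for the value at \<open>u a\<^sup>r\<^sup>-\<^sup>1\<close>, and the equation \<open>Rc\<close> at \<open>x\<close> for the value
  at the node \<open>xaba\<^sup>r\<^sup>-\<^sup>2\<close> if \<open>s = 1\<close>, and \<open>xaaba\<close> if \<open>(r, s) = (3, 2)\<close>.
\<close>

definition SP :: "nat \<Rightarrow> word \<Rightarrow> bool" where
  "SP r w \<longleftrightarrow> (\<exists>u. u \<noteq> [] \<and> w = u @ replicate (r - 1) La)"

definition rtail :: "nat \<Rightarrow> nat \<Rightarrow> word" where
  "rtail r s = (if s = 1 then [La, Lb] @ replicate (r - 2) La else [La, La, Lb, La])"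

definition SR :: "nat \<Rightarrow> nat \<Rightarrow> word \<Rightarrow> bool" where
  "SR r s w \<longleftrightarrow> (s = 1 \<or> r = 3 \<and> s = 2) \<and> (\<exists>x. w = x @ rtail r s)"

lemma append_replicate_eq:
  "u @ replicate m La = v @ w \<Longrightarrow> length w \<le> m \<Longrightarrow> w = replicate (length w) La"
proof -
  assume a: "u @ replicate m La = v @ w" and "length w \<le> m"
  then have "u @ replicate (m - length w) La @ replicate (length w) La = v @ w"
    by (simp flip: replicate_add)
  then have "(u @ replicate (m - length w) La) @ replicate (length w) La = v @ w" by simp
  then show ?thesis by (subst (asm) append_eq_append_conv) auto
qed

lemma SP_append: "r \<ge> 1 \<Longrightarrow> length z = r - 1 \<Longrightarrow> SP r (u @ z) \<longleftrightarrow> u \<noteq> [] \<and> z = replicate (r - 1) La"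
  by (auto simp: SP_def)

lemma SP_D: "SP r (u @ z) \<Longrightarrow> length z \<le> r - 1 \<Longrightarrow> z = replicate (length z) La"
  unfolding SP_def using append_replicate_eq by metis

lemma not_SP_Lb: "length z < r - 1 \<Longrightarrow> \<not> SP r (u @ Lb # z)"
proof
  assume "SP r (u @ Lb # z)" "length z < r - 1"
  then have "Lb # z = replicate (Suc (length z)) La" using SP_D[of r u "Lb # z"] by simp
  then show False by simp
qed

lemma SP_take: "SP r w \<Longrightarrow> \<exists>x l. take (length w - (r - 1)) w = x @ [l] \<and> w = x @ [l] @ replicate (r - 1) La"
  by (auto simp: SP_def) (metis append_butlast_last_id append.assoc append_Cons append_Nil)

lemma not_SR_append:
  "length z = length (rtail r s) \<Longrightarrow> z \<noteq> rtail r s \<Longrightarrow> \<not> SR r s (x @ z)"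
  by (auto simp: SR_def)

lemma length_rtail: "2 \<le> r \<Longrightarrow> length (rtail r s) = (if s = 1 then r else 4)"
  by (cases "s = 1") (auto simp: rtail_def)

text \<open>A position solved for \<open>Rc\<close> ends in \<open>b\<close> followed by exactly
  \<open>r - 2\<close> letters \<open>a\<close>, one too few for a position solved for
  \<open>Pc\<close>.\<close>

lemma SR_not_SP: "3 \<le> r \<Longrightarrow> SR r s w \<Longrightarrow> \<not> SP r w"
proof
  assume "3 \<le> r" "SR r s w" "SP r w"
  then obtain x where x: "s = 1 \<or> r = 3 \<and> s = 2" "w = x @ rtail r s" by (auto simp: SR_def)
  show False
  proof (cases "s = 1")
    case True
    then have "w = (x @ [La]) @ Lb # replicate (r - 2) La" using x by (simp add: rtail_def)
    then show False using not_SP_Lb[of "replicate (r - 2) La" r "x @ [La]"] \<open>SP r w\<close> \<open>3 \<le> r\<close> by simp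
  next
    case False
    then have "w = (x @ [La, La]) @ Lb # [La]" using x by (simp add: rtail_def)
    then show False using not_SP_Lb[of "[La]" r "x @ [La, La]"] \<open>SP r w\<close> False x(1) by simp
  qed
qed

lemma lev_split:
  "length z0 = m \<Longrightarrow> lev p m u = p (u @ z0) + (\<Sum>z\<in>words m - {z0}. p (u @ z))"
  unfolding lev_def by (rule sum.remove) auto

text \<open>For \<open>(r, s) = (3, 2)\<close> the equation enters with the last part of each block
  exchanged, \<open>a\<close> for \<open>b\<close> after \<open>x v\<close>, which by
  \<open>Pc_sum_32\<close> does not change the sum over \<open>v\<close>. In this form its deepest
  positions \<open>x v b a\<close> and \<open>x v b b\<close> are not claimed by any block
  equation.\<close>

definition solve :: "nat \<Rightarrow> nat \<Rightarrow> bit \<Rightarrow> bit \<Rightarrow> (word \<Rightarrow> bit) \<Rightarrow> (word \<Rightarrow> bit) \<Rightarrow> word \<Rightarrow> bit" where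
  "solve r s P R q p w =
    (if SP r w then
       let u = take (length w - (r - 1)) w in
         P + lev p (s - 1) (butlast u @ [other (last u)]) + (\<Sum>z\<in>words (r - 1) - {replicate (r - 1) La}. p (u @ z))
     else if SR r s w then
       let x = take (length w - length (rtail r s)) w in
         if s = 1 then R + p (x @ [La]) * p (x @ [Lb]) + lev p (r - 2) (x @ [Lb, Lb]) +
           (\<Sum>z\<in>words (r - 2) - {replicate (r - 2) La}. p (x @ [La, Lb] @ z))
         else R + (\<Sum>v\<in>words 2. p (x @ v) + p (x @ v @ [La]) + p (x @ v @ [Lb, Lb])) +
           (\<Sum>v\<in>words 2 - {[La, La]}. p (x @ v @ [Lb, La])) + lev p 1 (x @ [La]) * lev p 1 (x @ [Lb])
     else q w)"

lemma solve_P: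
  assumes "1 \<le> r"
  shows "solve r s P R q p (x @ [l] @ replicate (r - 1) La) =
    P + lev p (s - 1) (x @ [other l]) + (\<Sum>z\<in>words (r - 1) - {replicate (r - 1) La}. p (x @ [l] @ z))"
proof -
  have "SP r (x @ [l] @ replicate (r - 1) La)" unfolding SP_def by (intro exI[of _ "x @ [l]"]) simp
  then show ?thesis using assms by (simp add: solve_def Let_def)
qed

text \<open>The value at a word refers to shorter words and to words of the same length of a simpler
  kind, where the kinds are ordered as free, solved for \<open>Rc\<close>, solved for
  \<open>Pc\<close>. The factor 3 on the length leaves room for the three kinds.\<close>

lemma solve_measure:
  assumes r: "3 \<le> r" "s < r"
    and eq: "\<And>v. 3 * length v + (if SP r v then 2 else if SR r s v then 1 else 0)
                < 3 * length w + (if SP r w then 2 else if SR r s w then 1 else (0::nat)) \<Longrightarrow> p v = p' v"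
  shows "solve r s P R q p w = solve r s P R q p' w"
proof -
  have short: "p v = p' v" if "length v < length w" for v
    using that by (intro eq) auto
  show ?thesis
  proof (cases "SP r w")
    case True
    then obtain x l where w: "w = x @ [l] @ replicate (r - 1) La" using SP_take by blast
    have "p (x @ [l] @ z) = p' (x @ [l] @ z)" if "z \<in> words (r - 1) - {replicate (r - 1) La}" for z
    proof -
      have "\<not> SP r ((x @ [l]) @ z)" using that r by (subst SP_append) auto
      then show ?thesis using True that by (intro eq) (auto simp: w)
    qed
    then have "(\<Sum>z\<in>words (r - 1) - {replicate (r - 1) La}. p (x @ [l] @ z)) =
        (\<Sum>z\<in>words (r - 1) - {replicate (r - 1) La}. p' (x @ [l] @ z))"
      by (intro sum.cong refl)
    moreover have "lev p (s - 1) (x @ [other l]) = lev p' (s - 1) (x @ [other l])"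
      using r by (intro lev_cong short) (auto simp: w)
    moreover have "1 \<le> r" using r by simp
    ultimately show ?thesis unfolding w by (simp only: solve_P)
  next
    case False
    show ?thesis
    proof (cases "SR r s w")
      case True
      then obtain x where w: "w = x @ rtail r s" and s: "s = 1 \<or> r = 3 \<and> s = 2" by (auto simp: SR_def)
      have len: "p v = p' v" if "length v = length w" "\<not> SP r v" "\<not> SR r s v" for v
        using that True False by (intro eq) auto
      have tk: "take (length w - length (rtail r s)) w = x" by (simp add: w)
      show ?thesis
      proof (cases "s = 1")
        case s1: True
        have lw: "length w = length x + r" using r by (simp add: w length_rtail s1)
        have "p (x @ [La]) = p' (x @ [La])" "p (x @ [Lb]) = p' (x @ [Lb])"
          using r by (auto intro!: short simp: lw)
        moreover have "lev p (r - 2) (x @ [Lb, Lb]) = lev p' (r - 2) (x @ [Lb, Lb])"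
        proof (rule lev_cong, rule len)
          fix z :: word assume z: "length z = r - 2"
          show "length ((x @ [Lb, Lb]) @ z) = length w" using z r by (simp add: lw)
          show "\<not> SP r ((x @ [Lb, Lb]) @ z)" using not_SP_Lb[of z r "x @ [Lb]"] z r by simp
          show "\<not> SR r s ((x @ [Lb, Lb]) @ z)"
            using not_SR_append[of "[Lb, Lb] @ z" r s x] z r by (simp add: s1 rtail_def)
        qed
        moreover have "p (x @ [La, Lb] @ z) = p' (x @ [La, Lb] @ z)"
          if "z \<in> words (r - 2) - {replicate (r - 2) La}" for z
        proof (rule len)
          show "length (x @ [La, Lb] @ z) = length w" using that r by (simp add: lw)
          show "\<not> SP r (x @ [La, Lb] @ z)" using not_SP_Lb[of z r "x @ [La]"] that r by simp
          show "\<not> SR r s (x @ [La, Lb] @ z)"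
            using not_SR_append[of "[La, Lb] @ z" r s x] that r by (simp add: s1 rtail_def)
        qed
        then have "(\<Sum>z\<in>words (r - 2) - {replicate (r - 2) La}. p (x @ [La, Lb] @ z)) =
            (\<Sum>z\<in>words (r - 2) - {replicate (r - 2) La}. p' (x @ [La, Lb] @ z))" by (intro sum.cong refl)
        ultimately show ?thesis
          unfolding solve_def Let_def tk if_not_P[OF False] if_P[OF True] if_P[OF s1] by (simp only:)
      next
        case False2: False
        then have rs: "r = 3" "s = 2" using s by auto
        have lw: "length w = length x + 4" by (simp add: w length_rtail rs)
        have e1: "p (x @ v) + p (x @ v @ [La]) + p (x @ v @ [Lb, Lb]) =
            p' (x @ v) + p' (x @ v @ [La]) + p' (x @ v @ [Lb, Lb])" if "v \<in> words 2" for v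
        proof -
          have "p (x @ v @ [Lb, Lb]) = p' (x @ v @ [Lb, Lb])"
          proof (rule len)
            show "length (x @ v @ [Lb, Lb]) = length w" using that by (simp add: lw)
            show "\<not> SP r (x @ v @ [Lb, Lb])" using not_SP_Lb[of "[Lb]" r "x @ v"] by (simp add: rs)
            show "\<not> SR r s (x @ v @ [Lb, Lb])"
              using not_SR_append[of "v @ [Lb, Lb]" r s x] that by (auto simp: rs rtail_def append_eq_Cons_conv)
          qed
          then show ?thesis using that short[of "x @ v"] short[of "x @ v @ [La]"] by (simp add: lw)
        qed
        have e2: "p (x @ v @ [Lb, La]) = p' (x @ v @ [Lb, La])" if "v \<in> words 2 - {[La, La]}" for v
        proof (rule len)
          show "length (x @ v @ [Lb, La]) = length w" using that by (simp add: lw)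
          show "\<not> SP r (x @ v @ [Lb, La])" using not_SP_Lb[of "[La]" r "x @ v"] by (simp add: rs)
          show "\<not> SR r s (x @ v @ [Lb, La])"
            using not_SR_append[of "v @ [Lb, La]" r s x] that by (auto simp: rs rtail_def append_eq_Cons_conv)
        qed
        have e3: "lev p 1 (x @ [l]) = lev p' 1 (x @ [l])" for l
          by (intro lev_cong short) (simp add: lw)
        have "(\<Sum>v\<in>words 2. p (x @ v) + p (x @ v @ [La]) + p (x @ v @ [Lb, Lb])) =
            (\<Sum>v\<in>words 2. p' (x @ v) + p' (x @ v @ [La]) + p' (x @ v @ [Lb, Lb]))"
          by (intro sum.cong refl e1)
        moreover have "(\<Sum>v\<in>words 2 - {[La, La]}. p (x @ v @ [Lb, La])) =
            (\<Sum>v\<in>words 2 - {[La, La]}. p' (x @ v @ [Lb, La]))"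
          by (intro sum.cong refl e2)
        ultimately show ?thesis
          unfolding solve_def Let_def tk if_not_P[OF False] if_P[OF True] if_not_P[OF False2] e3
          by (simp only:)
      qed
    next
      case False
      then show ?thesis using \<open>\<not> SP r w\<close> by (simp add: solve_def)
    qed
  qed
qed

text \<open>Each equation determines its own solved position from values settled earlier, so
  \<open>q\<close> survives at all free positions. Below level \<open>n\<close> the values of
  \<open>q\<close> are kept as well, which is consistent because the equations lying there are
  assumed; in this way stabilizer elements can be built from data on a single level.\<close>

lemma portrait_extension:
  assumes rs: "1 \<le> s" "s < r" "3 \<le> r"
    and P: "s = 1 \<longrightarrow> P = 0" and R: "\<not> (s = 1 \<or> r = 3 \<and> s = 2) \<longrightarrow> R = 0"
    and qP: "\<And>x l. length x + r < n \<Longrightarrow> Pc r s q x l = P"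
    and qR: "\<And>x. length x + (if s = 1 then r else 4) < n \<Longrightarrow> Rc r s q x = R"
  shows "\<exists>p. ok r s P R p \<and> (\<forall>w. length w < n \<or> \<not> SP r w \<and> \<not> SR r s w \<longrightarrow> p w = q w)"
proof -
  define f where "f w = 3 * length w + (if SP r w then 2 else if SR r s w then 1 else (0::nat))" for w
  have "\<exists>p. \<forall>w. p w = (if length w < n then q w else solve r s P R q p w)"
    by (rule measure_recursion[where f = f]) (auto simp: f_def intro!: solve_measure rs)
  then obtain p where p: "\<And>w. p w = (if length w < n then q w else solve r s P R q p w)" by blast
  have pq: "p w = q w" if "length w < n" for w using p[of w] that by simp
  have Pp: "Pc r s p x l = P" for x l
  proof (cases "length x + r < n")
    case True
    have "Pc r s p x l = Pc r s q x l"
      unfolding Pc_def using rs True by (intro arg_cong2[where f = "(+)"] lev_cong pq) auto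
    then show ?thesis using qP[OF True] by simp
  next
    case False
    let ?z = "replicate (r - 1) La"
    have "p (x @ [l] @ ?z) = P + lev p (s - 1) (x @ [other l]) + (\<Sum>z\<in>words (r - 1) - {?z}. p (x @ [l] @ z))"
      using p[of "x @ [l] @ ?z"] solve_P[of r] rs False by simp
    moreover have "lev p (r - 1) (x @ [l]) = p (x @ [l] @ ?z) + (\<Sum>z\<in>words (r - 1) - {?z}. p (x @ [l] @ z))"
      using lev_split[of ?z "r - 1" p "x @ [l]"] by simp
    ultimately show ?thesis unfolding Pc_def by (simp only: ac_simps bit_add_self bit_add_self_left add_0_right add_0_left)
  qed
  have Rp: "Rc r s p x = R" for x
  proof (cases "length x + (if s = 1 then r else 4) < n")
    case True
    have "Rc r s p x = Rc r s q x"
    proof (cases "s = 1")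
      case s1: True
      have "lev p (r - 2) (x @ [l, l']) = lev q (r - 2) (x @ [l, l'])" for l l'
        using rs True s1 by (intro lev_cong pq) auto
      moreover have "p (x @ [l]) = q (x @ [l])" for l using rs True s1 by (intro pq) auto
      ultimately show ?thesis using s1 by (simp add: Rc_def)
    next
      case s2: False
      have "lev p 1 (x @ v) = lev q 1 (x @ v)" if "length v \<le> 3" for v
        using True s2 that by (intro lev_cong pq) auto
      moreover have "p (x @ v) = q (x @ v)" if "length v \<le> 3" for v using True s2 that by (intro pq) auto
      ultimately show ?thesis using s2 by (simp add: Rc_def)
    qed
    then show ?thesis using qR[OF True] by simp
  next
    case False
    consider "s = 1" | "r = 3" "s = 2" | "s \<noteq> 1" "\<not> (r = 3 \<and> s = 2)" by blast
    then show ?thesis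
    proof cases
      case 1
      let ?z = "replicate (r - 2) La"
      have SR: "SR r s (x @ [La, Lb] @ ?z)" using 1 by (auto simp: SR_def rtail_def)
      then have "\<not> SP r (x @ [La, Lb] @ ?z)" using SR_not_SP[OF rs(3)] by blast
      moreover have "\<not> length (x @ [La, Lb] @ ?z) < n" using False 1 rs by simp
      ultimately have "p (x @ [La, Lb] @ ?z) = R + p (x @ [La]) * p (x @ [Lb]) + lev p (r - 2) (x @ [Lb, Lb]) +
           (\<Sum>z\<in>words (r - 2) - {?z}. p (x @ [La, Lb] @ z))"
        using p[of "x @ [La, Lb] @ ?z"] SR 1 rs by (simp add: solve_def rtail_def)
      moreover have "lev p (r - 2) (x @ [La, Lb]) = p (x @ [La, Lb] @ ?z) + (\<Sum>z\<in>words (r - 2) - {?z}. p (x @ [La, Lb] @ z))"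
        using lev_split[of ?z "r - 2" p "x @ [La, Lb]"] by simp
      moreover have "Rc r s p x = p (x @ [La]) * p (x @ [Lb]) + lev p (r - 2) (x @ [La, Lb]) + lev p (r - 2) (x @ [Lb, Lb])"
        using 1 by (simp add: Rc_def)
      ultimately show ?thesis by (simp only: ac_simps bit_add_self bit_add_self_left add_0_right add_0_left)
    next
      case 2
      have SR: "SR r s (x @ [La, La] @ [Lb, La])" using 2 by (auto simp: SR_def rtail_def)
      then have "\<not> SP r (x @ [La, La] @ [Lb, La])" using SR_not_SP[OF rs(3)] by blast
      then have e1: "p (x @ [La, La] @ [Lb, La]) = R + (\<Sum>v\<in>words 2. p (x @ v) + p (x @ v @ [La]) + p (x @ v @ [Lb, Lb])) +
           (\<Sum>v\<in>words 2 - {[La, La]}. p (x @ v @ [Lb, La])) + lev p 1 (x @ [La]) * lev p 1 (x @ [Lb])"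
        using p[of "x @ [La, La] @ [Lb, La]"] SR False 2 by (simp add: solve_def length_rtail)
      have "(\<Sum>v\<in>words 2. p (x @ v @ [Lb, La])) = p (x @ [La, La] @ [Lb, La]) + (\<Sum>v\<in>words 2 - {[La, La]}. p (x @ v @ [Lb, La]))"
        by (subst sum.remove[of "words 2" "[La, La]"]) auto
      then have e2: "(\<Sum>v\<in>words 2. p (x @ v @ [Lb, La])) = R + ((\<Sum>v\<in>words 2. p (x @ v) + p (x @ v @ [La]) + p (x @ v @ [Lb, Lb]))
           + lev p 1 (x @ [La]) * lev p 1 (x @ [Lb]))"
        unfolding e1 by (simp only: ac_simps bit_add_self bit_add_self_left add_0_right add_0_left)
      \<comment> \<open>Passes from the blocks in \<open>Rc\<close> to those used in
        \<open>solve\<close>. The correction occurs twice for each first letter \<open>l\<close> and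
        cancels in the sum over all four words.\<close>
      have AB: "(p (x @ [l, l', Lb]) + lev p 1 (x @ [l, l', La])) = (p (x @ [l, l', La]) + lev p 1 (x @ [l, l', Lb]))
          + lev p 1 (x @ [other l])" for l l'
        using Pc_sum_32[of p P x l l'] Pp 2 by (simp only: bit_add_eq_iff) simp
      have "Rc r s p x = (\<Sum>v\<in>words 2. p (x @ v)) + ((\<Sum>v\<in>words 2. p (x @ v @ [Lb]) + lev p 1 (x @ v @ [La])))
          + lev p 1 (x @ [La]) * lev p 1 (x @ [Lb])"
        using 2 by (simp add: Rc_def sum.distrib)
      also have "(\<Sum>v\<in>words 2. p (x @ v @ [Lb]) + lev p 1 (x @ v @ [La])) = (\<Sum>v\<in>words 2. p (x @ v @ [La]) + lev p 1 (x @ v @ [Lb]))"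
        by (simp add: numeral_2_eq_2 sum_words_Suc_Cons AB[simplified] ac_simps)
      also have "\<dots> = (\<Sum>v\<in>words 2. p (x @ v @ [La]) + p (x @ v @ [Lb, Lb])) + (\<Sum>v\<in>words 2. p (x @ v @ [Lb, La]))"
        by (simp add: lev_1 sum.distrib ac_simps)
      finally show ?thesis unfolding e2 sum.distrib
        by (simp only: ac_simps bit_add_self bit_add_self_left add_0_right add_0_left)
    next
      case 3
      then show ?thesis using R by (auto simp: Rc_def)
    qed
  qed
  have "p w = q w" if "\<not> SP r w" "\<not> SR r s w" for w using p[of w] that by (simp add: solve_def)
  with Pp Rp P pq show ?thesis by (intro exI[of _ p]) (auto simp: ok_def)
qed

section \<open>Invariant functionals on the level stabilizers\<close>

definition ind :: "word list \<Rightarrow> word \<Rightarrow> bit" where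
  "ind ys w = (\<Sum>y\<leftarrow>ys. if w = y then 1 else 0)"

lemma ind_simps [simp]: "ind [] w = 0" "ind (y # ys) w = (if w = y then 1 else 0) + ind ys w"
  by (simp_all add: ind_def)

lemma ind_zero: "(\<And>y. y \<in> set ys \<Longrightarrow> length y = m) \<Longrightarrow> length w \<noteq> m \<Longrightarrow> ind ys w = 0"
  by (induction ys) auto

lemma sum_ind:
  "(\<And>y. y \<in> set ys \<Longrightarrow> length y = m) \<Longrightarrow> (\<Sum>w\<in>words m. f w * ind ys w) = (\<Sum>y\<leftarrow>ys. f y)"
proof (induction ys)
  case (Cons y ys)
  have "(\<Sum>w\<in>words m. f w * (if w = y then 1 else 0)) = (\<Sum>w\<in>words m. if w = y then f y else 0)"
    by (rule sum.cong) auto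
  also have "\<dots> = f y" using Cons.prems by simp
  finally show ?case using Cons by (simp add: distrib_left sum.distrib)
qed simp

lemma lev_zero: "(\<And>w. length w = m \<Longrightarrow> p (u @ w) = 0) \<Longrightarrow> lev p m u = 0"
  by (simp add: lev_def)

lemma lev_add: "lev (\<lambda>w. p w + q w) m u = lev p m u + lev q m u"
  by (simp add: lev_def sum.distrib)

lemma lev_ind:
  "(\<And>y. y \<in> set ys \<Longrightarrow> length y = length u + k) \<Longrightarrow>
   lev (ind ys) k u = (\<Sum>y\<leftarrow>ys. if take (length u) y = u then 1 else 0)"
proof (induction ys)
  case Nil
  then show ?case by (simp add: lev_zero)
next
  case (Cons y ys)
  have "lev (\<lambda>w. if w = y then 1 else 0) k u = (if take (length u) y = u then 1 else 0)"
  proof (cases "take (length u) y = u")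
    case True
    then have y: "y = u @ drop (length u) y" by (metis append_take_drop_id)
    have "(u @ w = y) = (w = drop (length u) y)" for w using y by (metis append_eq_conv_conj)
    then have "lev (\<lambda>w. if w = y then 1 else 0) k u = (\<Sum>w\<in>words k. if w = drop (length u) y then 1 else 0)"
      by (simp add: lev_def)
    also have "\<dots> = 1" using Cons.prems[of y] by simp
    finally show ?thesis using True by simp
  next
    case False
    then have "lev (\<lambda>w. if w = y then 1 else 0) k u = 0" by (intro lev_zero) auto
    then show ?thesis using False by simp
  qed
  moreover have "lev (ind (y # ys)) k u = lev (\<lambda>w. if w = y then 1 else 0) k u + lev (ind ys) k u"
    by (simp add: lev_def sum.distrib)
  moreover have "lev (ind ys) k u = (\<Sum>y\<leftarrow>ys. if take (length u) y = u then 1 else 0)"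
    using Cons by simp
  ultimately show ?case by (simp only: list.map sum_list.Cons)
qed

lemma act_0 [simp]: "act (\<lambda>_. 0) w = w"
  by (induction w) auto

lemma act_transitive: "length z = length z' \<Longrightarrow> \<exists>g. act g z = z'"
proof (induction z arbitrary: z')
  case (Cons l z)
  then obtain l' w where z': "z' = l' # w" "length z = length w" by (cases z') auto
  then obtain g where "act g z = w" using Cons.IH by blast
  moreover have "\<exists>b. turn b l = l'" using turn_0 turn_1 by (cases l; cases l') (metis other.simps)+
  then obtain b where "turn b l = l'" by blast
  ultimately have "act (\<lambda>v. if v = [] then b else g (tl v)) (l # z) = z'" using z' by simp
  then show ?case by blast
qed simp

section \<open>Transitivity on levels, and the constraints on level stabilizers\<close>

abbreviation bs :: "nat \<Rightarrow> word" where "bs k \<equiv> replicate k Lb"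

locale params =
  fixes r s :: nat
  assumes s1: "1 \<le> s" and sr: "s < r" and r3: "3 \<le> r"
begin

definition stabM :: "nat \<Rightarrow> (word \<Rightarrow> word) set" where
  "stabM m = {\<sigma> \<in> Mt_inf r s. \<forall>w. length w \<le> m \<longrightarrow> \<sigma> w = w}"

lemma M_iff: "\<sigma> \<in> Mt_inf r s \<longleftrightarrow> \<sigma> \<in> Aut_inf \<and> (\<exists>P R. ok r s P R (Par \<sigma>))"
  by (rule Mt_inf_iff[OF s1 sr r3])

lemma M_aut: "\<sigma> \<in> Mt_inf r s \<Longrightarrow> \<sigma> \<in> Aut_inf"
  by (simp add: M_iff)

lemma SP_length: "SP r w \<Longrightarrow> r \<le> length w"
proof -
  assume "SP r w"
  then obtain u where u: "u \<noteq> []" "w = u @ replicate (r - 1) La" by (auto simp: SP_def)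
  then show ?thesis using r3 by (cases u) auto
qed

lemma SR_length: "SR r s w \<Longrightarrow> r \<le> length w"
  using r3 by (auto simp: SR_def length_rtail)

lemma prescribe:
  assumes "s = 1 \<longrightarrow> P = 0" "\<not> (s = 1 \<or> r = 3 \<and> s = 2) \<longrightarrow> R = 0"
    and "\<And>x l. length x + r < n \<Longrightarrow> Pc r s q x l = P"
    and "\<And>x. length x + (if s = 1 then r else 4) < n \<Longrightarrow> Rc r s q x = R"
  obtains \<sigma> where "\<sigma> \<in> Mt_inf r s" "\<sigma> \<in> Aut_inf" "ok r s P R (Par \<sigma>)" "\<And>w. length w < n \<Longrightarrow> Par \<sigma> w = q w"
    "\<And>w. \<not> SP r w \<Longrightarrow> \<not> SR r s w \<Longrightarrow> Par \<sigma> w = q w"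
proof -
  obtain p where p: "ok r s P R p" "\<And>w. length w < n \<or> \<not> SP r w \<and> \<not> SR r s w \<Longrightarrow> p w = q w"
    using portrait_extension[OF s1 sr r3 assms] by blast
  show ?thesis
    by (rule that[of "act p"]) (use p in \<open>auto simp: M_iff\<close>)
qed

lemma path_turns:
  assumes "\<sigma> \<in> Aut_inf" "length w = length y"
    and "\<And>j. j < length w \<Longrightarrow> turn (Par \<sigma> (take j w)) (w ! j) = y ! j"
  shows "\<sigma> w = y"
  using assms(2,3)
proof (induction w arbitrary: y rule: rev_induct)
  case Nil
  then show ?case using assms(1) by simp
next
  case (snoc l w)
  then obtain v k where y: "y = v @ [k]" "length w = length v" by (metis length_append_singleton length_Suc_conv_rev)
  have "\<sigma> w = v"
  proof (rule snoc.IH)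
    fix j assume "j < length w"
    then show "turn (Par \<sigma> (take j w)) (w ! j) = v ! j" using snoc.prems(2)[of j] y by (simp add: nth_append)
  qed (use y in simp)
  moreover have "turn (Par \<sigma> w) l = k" using snoc.prems(2)[of "length w"] y by (simp add: nth_append)
  ultimately show ?case using y by (simp add: aut_snoc[OF assms(1)])
qed

lemma bs_not_special: "\<not> SP r (bs k)" "\<not> SR r s (bs k)"
proof -
  have "La \<notin> set (bs k)" by simp
  moreover have "La \<in> set w" if "SP r w \<or> SR r s w" for w
    using that r3 by (auto simp: SP_def SR_def rtail_def split: if_splits)
  ultimately show "\<not> SP r (bs k)" "\<not> SR r s (bs k)" by blast+
qed

text \<open>Every solved position contains the letter \<open>a\<close>, so the parities along the
  path of letters \<open>b\<close> are free and can steer that path to any word.\<close>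

lemma transitive:
  assumes "length y = m"
  obtains \<sigma> where "\<sigma> \<in> Mt_inf r s" "\<sigma> (bs m) = y"
proof -
  define q where "q w = (if y ! length w = Lb then 0 else 1 :: bit)" for w :: word
  obtain \<sigma> where \<sigma>: "\<sigma> \<in> Mt_inf r s" "\<sigma> \<in> Aut_inf" "\<And>w. \<not> SP r w \<Longrightarrow> \<not> SR r s w \<Longrightarrow> Par \<sigma> w = q w"
    by (rule prescribe[of 0 0 0 q]) auto
  have "\<sigma> (bs m) = y"
  proof (rule path_turns[OF \<sigma>(2)])
    fix j assume "j < length (bs m)"
    then show "turn (Par \<sigma> (take j (bs m))) (bs m ! j) = y ! j"
      by (cases "y ! j") (auto simp: \<sigma>(3)[OF bs_not_special] q_def take_replicate min_def)
  qed (use assms in simp)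
  then show ?thesis using \<sigma> that by blast
qed

lemma below_bs_not_special:
  assumes "length z < r - 1"
  shows "\<not> SP r (bs k @ z)"
proof (cases k)
  case 0
  then show ?thesis using SP_length[of z] assms by auto
next
  case (Suc k')
  have "bs k @ z = bs k' @ Lb # z" by (simp add: Suc replicate_app_Cons_same)
  then show ?thesis using not_SP_Lb[OF assms] by metis
qed

lemma below_bs_not_SR:
  assumes "length z < length (rtail r s)"
  shows "\<not> SR r s (bs k @ z)"
proof
  assume "SR r s (bs k @ z)"
  then obtain x t where x: "bs k @ z = x @ La # t" "length z \<le> length t"
    using assms by (auto simp: SR_def rtail_def split: if_splits)
  have "length x < k" using arg_cong[OF x(1), of length] x(2) by simp
  then have "(bs k @ z) ! length x = Lb" by (simp add: nth_append)
  then show False by (simp add: x(1))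
qed

lemma act_below:
  assumes "\<sigma> \<in> Aut_inf" "\<And>j. j < k \<Longrightarrow> Par \<sigma> (bs j) = 0" "\<And>z. length z < n \<Longrightarrow> Par \<sigma> (bs k @ z) = d z"
    and "length z \<le> n"
  shows "\<sigma> (bs k @ z) = bs k @ act d z"
  using assms(4)
proof (induction z rule: rev_induct)
  case Nil
  have "\<sigma> (bs k) = bs k"
    by (rule path_turns[OF assms(1)]) (auto simp: take_replicate min_def assms(2))
  then show ?case by simp
next
  case (snoc l z)
  then show ?case using aut_snoc[OF assms(1), of "bs k @ z" l] by (simp add: act_snoc assms(3))
qed

text \<open>The first \<open>r - 1\<close> levels of parities below \<open>b^k\<close> contain no
  solved position. One more level is available for \<open>k = 0\<close>, where the words are too
  short to end a block, and for \<open>s = 1\<close>, where the block sum at \<open>b^k\<close>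
  equals the parity at its sibling and can be adjusted there.\<close>

lemma full_below:
  assumes "length_bound = (if k = 0 \<or> s = 1 then r else r - 1)"
  obtains \<sigma> where "\<sigma> \<in> Mt_inf r s" "\<And>z. length z \<le> length_bound \<Longrightarrow> \<sigma> (bs k @ z) = bs k @ act d z"
proof -
  define v where "v = bs (k - 1) @ [La]"
  \<comment> \<open>For \<open>s = 1\<close> the sibling \<open>v\<close> receives the block sum of
    \<open>d\<close>, so that the value solved for at the end of the block comes out as the
    prescribed one.\<close>
  define q where "q w = (if s = 1 \<and> k > 0 \<and> w = v then lev d (r - 1) [] else
      if take k w = bs k \<and> k \<le> length w then d (drop k w) else 0)" for w
  obtain \<sigma> where \<sigma>: "\<sigma> \<in> Mt_inf r s" "\<sigma> \<in> Aut_inf" "ok r s 0 0 (Par \<sigma>)"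
      "\<And>w. \<not> SP r w \<Longrightarrow> \<not> SR r s w \<Longrightarrow> Par \<sigma> w = q w"
    by (rule prescribe[of 0 0 0 q]) auto
  have qd: "q (bs k @ z) = d z" for z
  proof -
    have "\<not> (k > 0 \<and> bs k @ z = v)"
    proof
      have b: "k > 0 \<Longrightarrow> (bs k @ z) ! (k - 1) = Lb" by (simp add: nth_append)
      assume a: "k > 0 \<and> bs k @ z = v"
      then have "v ! (k - 1) = Lb" using b by metis
      moreover have "v ! (k - 1) = La" by (simp add: v_def nth_append)
      ultimately show False by simp
    qed
    then show ?thesis by (auto simp: q_def)
  qed
  have nSR: "\<not> SR r s (bs k @ z)" if "length z < r" for z
    using that r3 s1 sr below_bs_not_SR[of z k] by (auto simp: length_rtail SR_def)
  have low: "Par \<sigma> (bs k @ z) = d z" if "length z < r - 1" for z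
    using \<sigma>(4)[OF below_bs_not_special nSR, of z] that qd by simp
  have "Par \<sigma> (bs k @ z) = d z" if z: "length z < length_bound" for z
  proof (cases "length z < r - 1")
    case False
    then have lz: "length z = r - 1" and ks: "k = 0 \<or> s = 1" using z assms by (auto split: if_splits)
    have nz: "Par \<sigma> (bs k @ w) = d w" if "length w = r - 1" "w \<noteq> replicate (r - 1) La" for w
      using \<sigma>(4)[OF _ nSR, of w] that r3 qd by (simp add: SP_append)
    show ?thesis
    proof (cases "k = 0")
      case True
      have "\<not> SP r z" using SP_length[of z] lz r3 by auto
      then show ?thesis using \<sigma>(4)[OF _ nSR, of z] True lz r3 qd[of z] by simp
    next
      case False
      then have s: "s = 1" using ks by simp
      have bk: "bs k = bs (k - 1) @ [Lb]" using False by (metis Suc_pred' bot_nat_0.not_eq_extremum replicate_Suc replicate_append_same)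
      have "Pc r s (Par \<sigma>) (bs (k - 1)) Lb = 0" using \<sigma>(3) by (simp add: ok_def)
      then have "lev (Par \<sigma>) (r - 1) (bs k) = Par \<sigma> v"
        by (simp add: Pc_def s bit_add_0_iff v_def bk)
      also have "Par \<sigma> v = q v"
      proof (rule \<sigma>(4))
        show "\<not> SP r v" using below_bs_not_special[of "[La]" "k - 1"] r3 by (simp add: v_def)
        show "\<not> SR r s v" using below_bs_not_SR[of "[La]" "k - 1"] r3 by (simp add: v_def length_rtail s)
      qed
      also have "q v = lev d (r - 1) []" using False s by (simp add: q_def)
      finally have e: "lev (Par \<sigma>) (r - 1) (bs k) = lev d (r - 1) []" .
      let ?z = "replicate (r - 1) La"
      have "(\<Sum>w\<in>words (r - 1) - {?z}. Par \<sigma> (bs k @ w)) = (\<Sum>w\<in>words (r - 1) - {?z}. d w)"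
        using nz by (intro sum.cong) auto
      then have "Par \<sigma> (bs k @ ?z) = d ?z"
        using e lev_split[of ?z "r - 1" "Par \<sigma>" "bs k"] lev_split[of ?z "r - 1" d "[]"] by simp
      then show ?thesis using nz lz by (cases "z = ?z") auto
    qed
  qed (use low in blast)
  moreover have "Par \<sigma> (bs j) = 0" if "j < k" for j
  proof -
    have "bs j \<noteq> v" by (metis in_set_conv_decomp in_set_replicate letter.distinct(1) v_def)
    then show ?thesis using \<sigma>(4)[OF bs_not_special, of j] that by (simp add: q_def)
  qed
  ultimately show ?thesis using that[OF \<sigma>(1)] act_below[OF \<sigma>(2)] by blast
qed

lemma stab_Par_low: "\<sigma> \<in> stabM m \<Longrightarrow> length w < m \<Longrightarrow> Par \<sigma> w = 0"
  by (simp add: stabM_def Par_def)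

lemma stab_lev_low: "\<sigma> \<in> stabM m \<Longrightarrow> length u + k < m \<Longrightarrow> lev (Par \<sigma>) k u = 0"
  by (intro lev_zero stab_Par_low) auto

lemma stab_ok: "\<sigma> \<in> stabM m \<Longrightarrow> \<exists>P R. ok r s P R (Par \<sigma>)"
  by (auto simp: stabM_def M_iff)

text \<open>The block equations at the root lie entirely in words shorter than \<open>m\<close>,
  where the parities vanish. So their common value is 0, and it is also the value of the blocks that
  reach level \<open>m\<close>.\<close>

lemma stab_block:
  assumes "\<sigma> \<in> stabM m" "r < m" "u \<noteq> []" "length u + (r - 1) = m"
  shows "lev (Par \<sigma>) (r - 1) u = 0"
proof -
  obtain P R where ok: "ok r s P R (Par \<sigma>)" using stab_ok[OF assms(1)] by blast
  have "lev (Par \<sigma>) k [l] = 0" if "k < r" for k l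
    using assms(1,2) that by (intro stab_lev_low[of _ m]) auto
  then have "Pc r s (Par \<sigma>) [] La = 0" unfolding Pc_def using s1 sr r3 by simp
  then have "P = 0" using ok by (simp add: ok_def)
  obtain x l where u: "u = x @ [l]" using assms(3) by (metis rev_exhaust)
  have "lev (Par \<sigma>) (s - 1) (x @ [other l]) = 0"
    using assms u s1 sr by (intro stab_lev_low) auto
  moreover have "Pc r s (Par \<sigma>) x l = 0" using ok \<open>P = 0\<close> by (simp add: ok_def)
  ultimately show ?thesis by (simp add: Pc_def u)
qed

text \<open>At \<open>m = r\<close> the equations at the root themselves reach level
  \<open>m\<close>; their value stays free and only the equality of the two blocks remains.\<close>

lemma stab_block_top:
  assumes "\<sigma> \<in> stabM r" "s \<noteq> 1"
  shows "lev (Par \<sigma>) (r - 1) [La] = lev (Par \<sigma>) (r - 1) [Lb]"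
proof -
  obtain P R where ok: "ok r s P R (Par \<sigma>)" using stab_ok[OF assms(1)] by blast
  have "lev (Par \<sigma>) (s - 1) [l] = 0" for l using assms s1 sr by (intro stab_lev_low) auto
  moreover have "Pc r s (Par \<sigma>) [] La = Pc r s (Par \<sigma>) [] Lb" using ok by (simp add: ok_def)
  ultimately show ?thesis by (simp add: Pc_def)
qed

definition tv :: "nat \<Rightarrow> word list \<Rightarrow> bool" where
  "tv m ys \<longleftrightarrow> (\<forall>y\<in>set ys. length y = m) \<and> (\<exists>\<sigma>\<in>stabM m. \<forall>w. length w = m \<longrightarrow> Par \<sigma> w = ind ys w)"

text \<open>
  Words are counted with multiplicity in \<open>ys\<close>, so that no distinctness has to be checked.
\<close>

lemma test_vector:
  assumes len: "\<And>y. y \<in> set ys \<Longrightarrow> length y = m"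
    and P: "r \<le> m \<Longrightarrow> \<exists>P::bit. (s = 1 \<or> r < m \<longrightarrow> P = 0) \<and>
      (\<forall>u. u \<noteq> [] \<longrightarrow> length u + (r - 1) = m \<longrightarrow> (\<Sum>y\<leftarrow>ys. if take (length u) y = u then 1 else 0) = P)"
    and R1: "s = 1 \<Longrightarrow> r < m \<Longrightarrow> \<forall>x. length x + r = m \<longrightarrow>
      (\<Sum>y\<leftarrow>ys. if take (length x + 2) y = x @ [La, Lb] then 1 else 0) +
      (\<Sum>y\<leftarrow>ys. if take (length x + 2) y = x @ [Lb, Lb] then 1 else 0) = (0 :: bit)"
    and R2: "r = 3 \<Longrightarrow> s = 2 \<Longrightarrow> 4 < m \<Longrightarrow> \<forall>x. length x + 4 = m \<longrightarrow>
      (\<Sum>w\<in>words 2. \<Sum>y\<leftarrow>ys. if take (length x + 3) y = x @ w @ [La] then 1 else 0) = (0 :: bit)"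
  shows "tv m ys"
proof -
  have low: "ind ys w = 0" if "length w < m" for w
    using ind_zero[OF len] that by auto
  have levlow: "lev (ind ys) k u = 0" if "length u + k < m" for k u
    using that by (intro lev_zero low) auto
  define S where "S u = (\<Sum>y\<leftarrow>ys. if take (length u) y = u then 1 else (0::bit))" for u
  have S: "r \<le> m \<Longrightarrow> \<exists>P. (s = 1 \<or> r < m \<longrightarrow> P = 0) \<and> (\<forall>u. u \<noteq> [] \<longrightarrow> length u + (r - 1) = m \<longrightarrow> S u = P)"
    using P unfolding S_def .
  obtain P where P0: "s = 1 \<longrightarrow> P = 0" "r < m \<longrightarrow> P = 0" and
    P1: "\<And>u. r \<le> m \<Longrightarrow> u \<noteq> [] \<Longrightarrow> length u + (r - 1) = m \<Longrightarrow> S u = P"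
  proof (cases "r \<le> m")
    case True
    then obtain P where "s = 1 \<or> r < m \<longrightarrow> P = 0" "\<forall>u. u \<noteq> [] \<longrightarrow> length u + (r - 1) = m \<longrightarrow> S u = P"
      using S by blast
    then show ?thesis by (intro that[of P]) auto
  qed (use that[of 0] in auto)
  have Pq: "Pc r s (ind ys) x l = P" if "length x + r < m + 1" for x l
  proof -
    have "lev (ind ys) (s - 1) (x @ [other l]) = 0" using that s1 sr by (intro levlow) auto
    moreover have "lev (ind ys) (r - 1) (x @ [l]) = P"
    proof (cases "length x + r = m")
      case True
      then have "lev (ind ys) (r - 1) (x @ [l]) = S (x @ [l])"
        unfolding S_def using r3 len by (intro lev_ind) auto
      also have "\<dots> = P" using True r3 by (intro P1) auto
      finally show ?thesis .
    next
      case False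
      then show ?thesis using that P0 r3 by (subst levlow) auto
    qed
    ultimately show ?thesis by (simp add: Pc_def)
  qed
  \<comment> \<open>The constant is read off at the root; it can be nonzero only if
    \<open>Rc\<close> at the root reaches level \<open>m\<close>.\<close>
  define R where "R = Rc r s (ind ys) []"
  have Rq: "Rc r s (ind ys) x = R" if x: "length x + (if s = 1 then r else 4) < m + 1" for x
  proof (cases "x = []")
    case False
    have small: "Rc r s (ind ys) y = 0" if "length y + (if s = 1 then r else 4) < m" for y
    proof (cases "s = 1")
      case True
      then show ?thesis using that r3 by (simp add: Rc_def low levlow)
    next
      case s: False
      have "lev (ind ys) 1 (y @ w @ [La]) = 0" if "w \<in> words 2" for w
        using \<open>length y + _ < m\<close> that s by (intro levlow) auto
      moreover have "ind ys (y @ w) = 0" if "length w \<le> 3" for w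
        using \<open>length y + _ < m\<close> that s by (intro low) auto
      ultimately show ?thesis using that s by (simp add: Rc_def lev_1(2))
    qed
    have "R = 0" unfolding R_def using False x by (intro small) (cases x; auto)
    moreover have "Rc r s (ind ys) x = 0"
    proof (cases "length x + (if s = 1 then r else 4) = m")
      case True
      have m: "(if s = 1 then r else 4) < m" using True False by (cases x) auto
      consider "s = 1" | "r = 3" "s = 2" | "s \<noteq> 1" "\<not> (r = 3 \<and> s = 2)" by blast
      then show ?thesis
      proof cases
        case 1
        have "lev (ind ys) (r - 2) (x @ [l, Lb]) = (\<Sum>y\<leftarrow>ys. if take (length (x @ [l, Lb])) y = x @ [l, Lb] then 1 else 0)" for l
          using True 1 r3 len by (intro lev_ind) auto
        moreover have "ind ys (x @ [l]) = 0" for l using True 1 r3 by (intro low) auto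
        ultimately show ?thesis using R1 1 m True by (simp add: Rc_def)
      next
        case 2
        have "lev (ind ys) 1 (x @ w @ [La]) = (\<Sum>y\<leftarrow>ys. if take (length (x @ w @ [La])) y = x @ w @ [La] then 1 else 0)" if "w \<in> words 2" for w
          using True 2 len that by (intro lev_ind) auto
        then have e: "(\<Sum>w\<in>words 2. lev (ind ys) 1 (x @ w @ [La])) = (\<Sum>w\<in>words 2. \<Sum>y\<leftarrow>ys. if take (length x + 3) y = x @ w @ [La] then 1 else 0)"
          by (intro sum.cong) (auto simp: numeral_eq_Suc)
        have "ind ys (x @ w) = 0" if "length w \<le> 3" for w using True 2 that by (intro low) auto
        then have "Rc r s (ind ys) x = (\<Sum>w\<in>words 2. lev (ind ys) 1 (x @ w @ [La]))"
          using 2 by (simp add: Rc_def lev_1(2)[of _ "x @ [_]"])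
        then show ?thesis using e R2 2 m True by simp
      next
        case 3
        then show ?thesis by (auto simp: Rc_def)
      qed
    next
      case F: False
      then show ?thesis using x by (intro small) auto
    qed
    ultimately show ?thesis by simp
  qed (simp add: R_def)
  obtain \<sigma> where \<sigma>: "\<sigma> \<in> Mt_inf r s" "\<sigma> \<in> Aut_inf" "\<And>w. length w < m + 1 \<Longrightarrow> Par \<sigma> w = ind ys w"
  proof (rule prescribe[of P R "m + 1" "ind ys"])
    show "\<not> (s = 1 \<or> r = 3 \<and> s = 2) \<longrightarrow> R = 0" by (auto simp: R_def Rc_def)
  qed (use P0 Pq Rq in auto)
  have "\<sigma> w = id w" if "length w \<le> m" for w
    by (rule aut_eq_level[OF \<sigma>(2) aut_id _ that]) (simp add: \<sigma>(3) low)
  then have "\<sigma> \<in> stabM m" using \<sigma> by (simp add: stabM_def)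
  then show ?thesis unfolding tv_def using len \<sigma>(3) by (intro conjI bexI[of _ \<sigma>]) auto
qed

lemma full_below_ex:
  "\<exists>\<sigma>\<in>Mt_inf r s. \<forall>z. length z \<le> (if k = 0 \<or> s = 1 then r else r - 1) \<longrightarrow> \<sigma> (bs k @ z) = bs k @ act d z"
  by (rule full_below[OF refl, of k d]) blast

end

lemma sum_append_eq:
  assumes "length x = length x'"
  shows "(\<Sum>w\<in>words n. if x @ v @ t = x' @ w @ t then (1::bit) else 0) = (if x = x' \<and> length v = n then 1 else 0)"
proof (cases "x = x'")
  case True
  have "(\<Sum>w\<in>words n. if x @ v @ t = x' @ w @ t then (1::bit) else 0) = (\<Sum>w\<in>words n. if w = v then 1 else 0)"
    using True by (intro sum.cong) auto
  then show ?thesis using True by simp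
qed (use assms in simp)

lemma sum_append_neq:
  assumes "length x = length x'" "t \<noteq> t'"
  shows "(\<Sum>w\<in>words n. if x @ v @ [t] = x' @ w @ [t'] then (1::bit) else 0) = 0"
  by (rule sum.neutral) (use assms in auto)

section \<open>Functionals invariant under conjugation\<close>

context params
begin

text \<open>With no equation in force (\<open>m < r\<close>) this is the full level sum. Beyond
  that, the equations for \<open>Pc\<close> make the two halves of a block agree on the stabilizer,
  and those for \<open>Rc\<close> tie neighbouring blocks together once they apply. Each case adds
  up one representative of the pieces that agree.\<close>

definition Phi :: "nat \<Rightarrow> (word \<Rightarrow> bit) \<Rightarrow> bit" where
  "Phi m f =
    (if m < r then lev f m []
     else if m = r \<and> s \<noteq> 1 then lev f (r - 1) [Lb]
     else if s \<noteq> 1 \<and> \<not> (r = 3 \<and> s = 2) \<or> m = r \<or> r = 3 \<and> s = 2 \<and> m = 4 then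
       (\<Sum>u\<in>words (m - r + 1). lev f (r - 2) (u @ [Lb]))
     else if s = 1 then (\<Sum>x\<in>words (m - r). lev f (r - 2) (x @ [La, La]))
     else (\<Sum>x\<in>words (m - 4). lev f 1 (x @ [La, La, La]) + lev f 1 (x @ [La, Lb, La])))"

definition invariant :: "nat \<Rightarrow> (word \<Rightarrow> bit) \<Rightarrow> bool" where
  "invariant m f \<longleftrightarrow> (\<forall>\<sigma>\<in>stabM m. \<forall>\<tau>\<in>Mt_inf r s.
     (\<Sum>w\<in>words m. f (\<tau> w) * Par \<sigma> w) = (\<Sum>w\<in>words m. f w * Par \<sigma> w))"

lemma M_inv: "\<sigma> \<in> Mt_inf r s \<Longrightarrow> inv_into UNIV \<sigma> \<in> Mt_inf r s"
  using ok_inv[OF s1 sr r3] aut_inv unfolding M_iff by blast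

lemma M_comp: "\<sigma> \<in> Mt_inf r s \<Longrightarrow> \<tau> \<in> Mt_inf r s \<Longrightarrow> \<sigma> \<circ> \<tau> \<in> Mt_inf r s"
  using ok_comp_ok[OF s1 sr r3] unfolding M_iff by (meson aut_comp)

lemma M_id: "id \<in> Mt_inf r s"
  unfolding M_iff using ok_id[of r s] aut_id by blast

lemma invariant_tv:
  assumes "invariant m f" "tv m ys" "\<tau> \<in> Mt_inf r s"
  shows "(\<Sum>y\<leftarrow>ys. f (\<tau> y)) = (\<Sum>y\<leftarrow>ys. f y)"
proof -
  obtain \<sigma> where \<sigma>: "\<sigma> \<in> stabM m" "\<And>w. length w = m \<Longrightarrow> Par \<sigma> w = ind ys w" and len: "\<And>y. y \<in> set ys \<Longrightarrow> length y = m"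
    using assms(2) by (auto simp: tv_def)
  have "(\<Sum>w\<in>words m. g w * Par \<sigma> w) = (\<Sum>y\<leftarrow>ys. g y)" for g
    using sum_ind[OF len, where f = g] \<sigma>(2) by simp
  then show ?thesis using assms(1,3) \<sigma>(1) by (auto simp: invariant_def)
qed

lemma tv_single: "m < r \<Longrightarrow> length y = m \<Longrightarrow> tv m [y]"
  by (rule test_vector) auto

lemma tv_top:
  assumes "s \<noteq> 1" "length z = r - 1" "length z' = r - 1"
  shows "tv r [l # z, l' # z']"
proof (rule test_vector[of "[l # z, l' # z']" r])
  show "\<exists>P::bit. (s = 1 \<or> r < r \<longrightarrow> P = 0) \<and> (\<forall>u. u \<noteq> [] \<longrightarrow> length u + (r - 1) = r \<longrightarrow>
      (\<Sum>y\<leftarrow>[l # z, l' # z']. if take (length u) y = u then 1 else 0) = P)"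
  proof (intro exI conjI allI impI)
    fix u :: word assume "u \<noteq> []" "length u + (r - 1) = r"
    then have "length u = 1" using r3 by simp
    then obtain k where "u = [k]" by (auto simp: length_Suc_conv)
    then show "(\<Sum>y\<leftarrow>[l # z, l' # z']. if take (length u) y = u then 1 else 0) = (if l = l' then 0 else 1 :: bit)"
      by (cases k; cases l; cases l') auto
  qed (use assms in auto)
qed (use assms r3 in auto)

lemma tv_block:
  assumes "length z = r - 1" "length z' = r - 1" "u \<noteq> []" "length u + (r - 1) = m"
    and same: "s = 1 \<and> r < m \<or> r = 3 \<and> s = 2 \<and> 4 < m \<Longrightarrow> hd z = hd z'"
  shows "tv m [u @ z, u @ z']"
proof (rule test_vector[of "[u @ z, u @ z']" m])
  show "\<exists>P::bit. (s = 1 \<or> r < m \<longrightarrow> P = 0) \<and> (\<forall>v. v \<noteq> [] \<longrightarrow> length v + (r - 1) = m \<longrightarrow>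
      (\<Sum>y\<leftarrow>[u @ z, u @ z']. if take (length v) y = v then 1 else 0) = P)"
    using assms(4) by (intro exI[of _ 0]) auto
  show "\<forall>x. length x + r = m \<longrightarrow>
      (\<Sum>y\<leftarrow>[u @ z, u @ z']. if take (length x + 2) y = x @ [La, Lb] then 1 else 0) +
      (\<Sum>y\<leftarrow>[u @ z, u @ z']. if take (length x + 2) y = x @ [Lb, Lb] then 1 else 0) = (0 :: bit)" if "s = 1" "r < m"
  proof (intro allI impI)
    fix x :: word assume "length x + r = m"
    then have l: "length x + 2 = length u + 1" using assms(4) r3 by simp
    have "take 1 z = take 1 z'" using same that assms(1,2) r3 by (cases z; cases z') auto
    then have "take (length x + 2) (u @ z) = take (length x + 2) (u @ z')" unfolding l by simp
    then show "(\<Sum>y\<leftarrow>[u @ z, u @ z']. if take (length x + 2) y = x @ [La, Lb] then 1 else 0) +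
      (\<Sum>y\<leftarrow>[u @ z, u @ z']. if take (length x + 2) y = x @ [Lb, Lb] then 1 else 0) = (0 :: bit)" by simp
  qed
  show "\<forall>x. length x + 4 = m \<longrightarrow>
      (\<Sum>w\<in>words 2. \<Sum>y\<leftarrow>[u @ z, u @ z']. if take (length x + 3) y = x @ w @ [La] then 1 else 0) = (0 :: bit)"
    if "r = 3" "s = 2" "4 < m"
  proof (intro allI impI sum.neutral ballI)
    fix x w :: word assume "length x + 4 = m"
    then have l: "length x + 3 = length u + 1" using assms(4) that by simp
    have "take 1 z = take 1 z'" using same that assms(1,2) r3 by (cases z; cases z') auto
    then have "take (length x + 3) (u @ z) = take (length x + 3) (u @ z')" unfolding l by simp
    then show "(\<Sum>y\<leftarrow>[u @ z, u @ z']. if take (length x + 3) y = x @ w @ [La] then 1 else 0) = (0 :: bit)" by simp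
  qed
qed (use assms in auto)

lemma tv_quad_1:
  assumes "s = 1" "length x + r = m" "r < m" "length z1 = r - 2" "length z2 = r - 2" "length z3 = r - 2" "length z4 = r - 2"
  shows "tv m [x @ La # La # z1, x @ La # Lb # z2, x @ Lb # La # z3, x @ Lb # Lb # z4]" (is "tv m ?ys")
proof (rule test_vector[of ?ys m])
  show "\<exists>P::bit. (s = 1 \<or> r < m \<longrightarrow> P = 0) \<and> (\<forall>v. v \<noteq> [] \<longrightarrow> length v + (r - 1) = m \<longrightarrow>
      (\<Sum>y\<leftarrow>?ys. if take (length v) y = v then 1 else 0) = P)"
  proof (intro exI[of _ 0] conjI allI impI)
    fix v :: word assume "v \<noteq> []" "length v + (r - 1) = m"
    then have l: "length v = Suc (length x)" using assms(2) r3 by simp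
    show "(\<Sum>y\<leftarrow>?ys. if take (length v) y = v then 1 else 0) = (0 :: bit)"
      by (simp add: l)
  qed simp
  show "\<forall>y. length y + r = m \<longrightarrow>
      (\<Sum>z\<leftarrow>?ys. if take (length y + 2) z = y @ [La, Lb] then 1 else 0) +
      (\<Sum>z\<leftarrow>?ys. if take (length y + 2) z = y @ [Lb, Lb] then 1 else 0) = (0 :: bit)"
  proof (intro allI impI)
    fix y :: word assume "length y + r = m"
    then have l: "length y = length x" using assms(2) by simp
    then have t: "take (length y + 2) (x @ k # k' # z) = x @ [k, k']" for k k' z by simp
    have e: "x @ w = y @ w' \<longleftrightarrow> x = y \<and> w = w'" for w w' using l by simp
    show "(\<Sum>z\<leftarrow>?ys. if take (length y + 2) z = y @ [La, Lb] then 1 else 0) +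
      (\<Sum>z\<leftarrow>?ys. if take (length y + 2) z = y @ [Lb, Lb] then 1 else 0) = (0 :: bit)"
      unfolding list.map sum_list.Cons sum_list.Nil t e by simp
  qed
qed (use assms r3 in auto)

lemma tv_quad_32:
  assumes "r = 3" "s = 2" "length x + 4 = m" "4 < m" "length v = 2" "length v' = 2"
  shows "tv m [x @ v @ [La, t1], x @ v @ [Lb, t2], x @ v' @ [La, t3], x @ v' @ [Lb, t4]]" (is "tv m ?ys")
proof (rule test_vector[of ?ys m])
  show "\<exists>P::bit. (s = 1 \<or> r < m \<longrightarrow> P = 0) \<and> (\<forall>v. v \<noteq> [] \<longrightarrow> length v + (r - 1) = m \<longrightarrow>
      (\<Sum>y\<leftarrow>?ys. if take (length v) y = v then 1 else 0) = P)"
  proof (intro exI[of _ 0] conjI allI impI)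
    fix u :: word assume "u \<noteq> []" "length u + (r - 1) = m"
    then have l: "length u = length x + 2" using assms by simp
    show "(\<Sum>y\<leftarrow>?ys. if take (length u) y = u then 1 else 0) = (0 :: bit)"
      using assms by (simp add: l)
  qed simp
  show "\<forall>y. length y + 4 = m \<longrightarrow>
      (\<Sum>w\<in>words 2. \<Sum>z\<leftarrow>?ys. if take (length y + 3) z = y @ w @ [La] then 1 else 0) = (0 :: bit)"
  proof (intro allI impI)
    fix y :: word assume "length y + 4 = m"
    then have l: "length x = length y" using assms(3) by simp
    then have t: "take (length y + 3) (x @ u @ [k, k']) = x @ u @ [k]" if "length u = 2" for k k' u
      using that by simp
    show "(\<Sum>w\<in>words 2. \<Sum>z\<leftarrow>?ys. if take (length y + 3) z = y @ w @ [La] then 1 else 0) = (0 :: bit)"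
      unfolding list.map sum_list.Cons sum_list.Nil t[OF assms(5)] t[OF assms(6)] sum.distrib
        sum_append_eq[OF l] using sum_append_neq[OF l, of Lb La] assms(5,6) by simp
  qed
qed (use assms in auto)

text \<open>An element of the group carries \<open>y\<close> to a node below \<open>b^k\<close>,
  where the equality is known, and invariance on the test vector carries it back.\<close>

lemma transport_eq:
  assumes inv: "invariant m f"
    and base: "\<And>v z z'. length v = n \<Longrightarrow> length z + (k + n) = m \<Longrightarrow> length z' + (k + n) = m \<Longrightarrow> f (bs k @ v @ z) = f (bs k @ v @ z')"
    and tv: "tv m [y @ z, y @ z']" and len: "length y = k + n"
  shows "f (y @ z) = f (y @ z')"
proof -
  have lz: "length z + (k + n) = m" "length z' + (k + n) = m" using tv len by (auto simp: tv_def)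
  obtain \<sigma> where \<sigma>: "\<sigma> \<in> Mt_inf r s" "\<sigma> (bs k) = take k y" using transitive[of "take k y" k] len by auto
  let ?i = "inv_into UNIV \<sigma>"
  have i: "?i \<in> Mt_inf r s" using \<sigma>(1) by (rule M_inv)
  have ik: "?i (take k y) = bs k" using \<sigma> by (metis M_aut aut_inv_apply(2))
  obtain v where v: "length v = n" "?i y = bs k @ v"
    using aut_append_ex[OF M_aut[OF i], of "drop k y" "take k y"] ik len by auto
  obtain z1 where z1: "length z1 = length z" "?i (y @ z) = bs k @ v @ z1"
    using aut_append_ex[OF M_aut[OF i], of z y] v by auto
  obtain z2 where z2: "length z2 = length z'" "?i (y @ z') = bs k @ v @ z2"
    using aut_append_ex[OF M_aut[OF i], of z' y] v by auto
  have "f (?i (y @ z)) = f (?i (y @ z'))"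
    unfolding z1(2) z2(2) using lz z1 z2 v by (intro base) auto
  then show ?thesis using invariant_tv[OF inv tv i] by (simp add: bit_add_0_iff)
qed

text \<open>An element that moves words in one half of a block and fixes those in the other shows,
  on test vectors with one word in each half, that \<open>f\<close> is constant on each half. By
  transitivity the sum of its two values is the same for all blocks, and this sum is the factor
  \<open>c\<close>.\<close>

lemma half_blocks:
  assumes m: "m = k + Suc n" and inv: "invariant m f"
    and tv1: "\<And>u z z'. length u = k \<Longrightarrow> length z = n \<Longrightarrow> length z' = n \<Longrightarrow> tv m [u @ La # z, u @ Lb # z']"
    and tv2: "\<And>u l z z'. length u = k \<Longrightarrow> length z = n \<Longrightarrow> length z' = n \<Longrightarrow> tv m [u @ l # z, u @ l # z']"
    and full: "\<And>d. \<exists>\<sigma>\<in>Mt_inf r s. \<forall>z. length z \<le> Suc n \<longrightarrow> \<sigma> (bs k @ z) = bs k @ act d z"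
    and halves: "\<And>\<sigma> u. \<sigma> \<in> stabM m \<Longrightarrow> length u = k \<Longrightarrow> lev (Par \<sigma>) n (u @ [La]) = lev (Par \<sigma>) n (u @ [Lb])"
  shows "\<exists>c. \<forall>\<sigma>\<in>stabM m. (\<Sum>w\<in>words m. f w * Par \<sigma> w) = c * (\<Sum>u\<in>words k. lev (Par \<sigma>) n (u @ [Lb]))"
proof -
  have base: "f (bs k @ l # z) = f (bs k @ l # z')" if z: "length z = n" "length z' = n" for l z z'
  proof -
    obtain g where g: "act g z = z'" using act_transitive[of z z'] z by auto
    define d where "d w = (if w \<noteq> [] \<and> hd w = l then g (tl w) else 0)" for w
    obtain \<sigma> where \<sigma>: "\<sigma> \<in> Mt_inf r s" "\<And>z. length z \<le> Suc n \<Longrightarrow> \<sigma> (bs k @ z) = bs k @ act d z"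
      using full[of d] by blast
    have "\<sigma> (bs k @ l # z) = bs k @ l # z'" "\<sigma> (bs k @ other l # z) = bs k @ other l # z"
      using \<sigma>(2)[of "l # z"] \<sigma>(2)[of "other l # z"] z g by (auto simp: d_def)
    then show ?thesis using invariant_tv[OF inv tv1[of "bs k" z z] \<sigma>(1)] z by (cases l) auto
  qed
  have f: "f (u @ l # z) = f (u @ l # z')" if "length u = k" "length z = n" "length z' = n" for u l z z'
  proof -
    have "f ((u @ [l]) @ z) = f ((u @ [l]) @ z')"
    proof (rule transport_eq[OF inv, where n = 1 and k = k])
      fix v z z' :: word assume "length v = 1" "length z + (k + 1) = m" "length z' + (k + 1) = m"
      moreover from this obtain l where v: "v = [l]" by (auto simp: length_Suc_conv)
      ultimately have "f (bs k @ l # z) = f (bs k @ l # z')" using m by (intro base) auto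
      then show "f (bs k @ v @ z) = f (bs k @ v @ z')" by (simp add: v)
    qed (use tv2 that in auto)
    then show ?thesis by simp
  qed
  define F where "F u l = f (u @ l # bs n)" for u l
  have D: "F u La + F u Lb = F (bs k) La + F (bs k) Lb" if u: "length u = k" for u
  proof -
    obtain \<tau> where \<tau>: "\<tau> \<in> Mt_inf r s" "\<tau> (bs k) = u" using transitive[OF u] by blast
    have "f (\<tau> (bs k @ l # bs n)) = F u (turn (Par \<tau> (bs k)) l)" for l
    proof -
      obtain z where "length z = n" "\<tau> ((bs k @ [l]) @ bs n) = \<tau> (bs k @ [l]) @ z"
        using aut_append_ex[OF M_aut[OF \<tau>(1)], of "bs n" "bs k @ [l]"] by auto
      then show ?thesis using f[OF u, of z "bs n"] by (simp add: F_def aut_snoc[OF M_aut[OF \<tau>(1)]] \<tau>(2))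
    qed
    then have "F (bs k) La + F (bs k) Lb = F u (turn (Par \<tau> (bs k)) La) + F u (turn (Par \<tau> (bs k)) Lb)"
      using invariant_tv[OF inv tv1[of "bs k" "bs n" "bs n"] \<tau>(1)] by (simp add: F_def)
    then show ?thesis by (cases "Par \<tau> (bs k)") (simp_all add: add.commute)
  qed
  have "(\<Sum>w\<in>words m. f w * Par \<sigma> w) = (F (bs k) La + F (bs k) Lb) * (\<Sum>u\<in>words k. lev (Par \<sigma>) n (u @ [Lb]))"
    if \<sigma>: "\<sigma> \<in> stabM m" for \<sigma>
  proof -
    have half: "(\<Sum>z\<in>words n. f (u @ l # z) * Par \<sigma> (u @ l # z)) = F u l * lev (Par \<sigma>) n (u @ [l])"
      if u: "length u = k" for u l
    proof -
      have "f (u @ l # z) = F u l" if "z \<in> words n" for z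
        unfolding F_def by (rule f[OF u]) (use that in auto)
      then have "(\<Sum>z\<in>words n. f (u @ l # z) * Par \<sigma> (u @ l # z)) = (\<Sum>z\<in>words n. F u l * Par \<sigma> (u @ l # z))"
        by (intro sum.cong refl) simp
      then show ?thesis by (simp add: lev_def sum_distrib_left)
    qed
    have "(\<Sum>w\<in>words m. f w * Par \<sigma> w) = (\<Sum>u\<in>words k. F u La * lev (Par \<sigma>) n (u @ [La]) + F u Lb * lev (Par \<sigma>) n (u @ [Lb]))"
      unfolding m sum_words_add sum_words_Suc_Cons by (intro sum.cong refl) (simp add: half)
    also have "\<dots> = (\<Sum>u\<in>words k. (F (bs k) La + F (bs k) Lb) * lev (Par \<sigma>) n (u @ [Lb]))"
    proof (intro sum.cong refl)
      fix u assume "u \<in> words k"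
      then have u: "length u = k" by simp
      show "F u La * lev (Par \<sigma>) n (u @ [La]) + F u Lb * lev (Par \<sigma>) n (u @ [Lb]) =
          (F (bs k) La + F (bs k) Lb) * lev (Par \<sigma>) n (u @ [Lb])"
        unfolding halves[OF \<sigma> u] D[OF u, symmetric] distrib_right ..
    qed
    finally show ?thesis by (simp add: sum_distrib_left)
  qed
  then show ?thesis by blast
qed

lemma invariants_low:
  assumes "m < r" "invariant m f"
  shows "\<exists>c. \<forall>\<sigma>\<in>stabM m. (\<Sum>w\<in>words m. f w * Par \<sigma> w) = c * lev (Par \<sigma>) m []"
proof -
  have fc: "f w = f (bs m)" if w: "length w = m" for w
  proof -
    obtain \<sigma> where \<sigma>: "\<sigma> \<in> Mt_inf r s" "\<sigma> (bs m) = w" using transitive[OF w] by blast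
    show ?thesis using invariant_tv[OF assms(2) tv_single[OF assms(1), of "bs m"] \<sigma>(1)] \<sigma>(2) by simp
  qed
  have "(\<Sum>w\<in>words m. f w * Par \<sigma> w) = (\<Sum>w\<in>words m. f (bs m) * Par \<sigma> w)" for \<sigma>
  proof (rule sum.cong[OF refl])
    fix w assume "w \<in> words m"
    then have "f w = f (bs m)" by (intro fc) simp
    then show "f w * Par \<sigma> w = f (bs m) * Par \<sigma> w" by (rule arg_cong)
  qed
  then have "(\<Sum>w\<in>words m. f w * Par \<sigma> w) = f (bs m) * lev (Par \<sigma>) m []" for \<sigma>
    by (simp add: lev_def sum_distrib_left)
  then show ?thesis by blast
qed

lemma invariants_top:
  assumes "s \<noteq> 1" "invariant r f"
  shows "\<exists>c. \<forall>\<sigma>\<in>stabM r. (\<Sum>w\<in>words r. f w * Par \<sigma> w) = c * lev (Par \<sigma>) (r - 1) [Lb]"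
proof -
  have "\<exists>c. \<forall>\<sigma>\<in>stabM r. (\<Sum>w\<in>words r. f w * Par \<sigma> w) = c * (\<Sum>u\<in>words 0. lev (Par \<sigma>) (r - 1) (u @ [Lb]))"
  proof (rule half_blocks[OF _ assms(2)])
    show "\<exists>\<sigma>\<in>Mt_inf r s. \<forall>z. length z \<le> Suc (r - 1) \<longrightarrow> \<sigma> (bs 0 @ z) = bs 0 @ act d z" for d
      by (rule full_below[of r 0 d]) (use r3 in auto)
  qed (use assms r3 stab_block_top in \<open>auto intro!: tv_top\<close>)
  then show ?thesis by simp
qed

lemma invariants_block:
  assumes "r \<le> m" "s = 1 \<longrightarrow> m = r" "r = 3 \<and> s = 2 \<longrightarrow> m = 4" "s \<noteq> 1 \<longrightarrow> r < m" "invariant m f"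
  and halves: "\<And>\<sigma> u. \<sigma> \<in> stabM m \<Longrightarrow> length u = m - r + 1 \<Longrightarrow> lev (Par \<sigma>) (r - 1) u = 0"
  shows "\<exists>c. \<forall>\<sigma>\<in>stabM m. (\<Sum>w\<in>words m. f w * Par \<sigma> w) = c * (\<Sum>u\<in>words (m - r + 1). lev (Par \<sigma>) (r - 2) (u @ [Lb]))"
proof (rule half_blocks[OF _ assms(5)])
  show "\<exists>\<sigma>\<in>Mt_inf r s. \<forall>z. length z \<le> Suc (r - 2) \<longrightarrow> \<sigma> (bs (m - r + 1) @ z) = bs (m - r + 1) @ act d z" for d
  proof -
    obtain \<sigma> where "\<sigma> \<in> Mt_inf r s" "\<forall>z. length z \<le> (if m - r + 1 = 0 \<or> s = 1 then r else r - 1) \<longrightarrow> \<sigma> (bs (m - r + 1) @ z) = bs (m - r + 1) @ act d z"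
      using full_below_ex[of "m - r + 1" d] by blast
    moreover have "n \<le> Suc (r - 2) \<Longrightarrow> n \<le> (if m - r + 1 = 0 \<or> s = 1 then r else r - 1)" for n
      using r3 by auto
    ultimately show ?thesis by blast
  qed
  show "lev (Par \<sigma>) (r - 2) (u @ [La]) = lev (Par \<sigma>) (r - 2) (u @ [Lb])" if "\<sigma> \<in> stabM m" "length u = m - r + 1" for \<sigma> u
    using halves[OF that] lev_Suc[of "Par \<sigma>" "r - 2" u] r3 by (simp add: Suc_diff_Suc numeral_2_eq_2 bit_add_0_iff)
  show "tv m [u @ l # z, u @ l # z']" if "length u = m - r + 1" "length z = r - 2" "length z' = r - 2" for u l z z'
    using assms r3 that by (intro tv_block) auto
  show "tv m [u @ La # z, u @ Lb # z']" if "length u = m - r + 1" "length z = r - 2" "length z' = r - 2" for u z z'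
    using assms r3 that by (intro tv_block) auto
qed (use assms r3 in auto)

lemma stab_R_1:
  assumes "\<sigma> \<in> stabM m" "s = 1" "r < m" "length x + r = m"
  shows "lev (Par \<sigma>) (r - 2) (x @ [La, Lb]) = lev (Par \<sigma>) (r - 2) (x @ [Lb, Lb])"
proof -
  obtain P R where ok: "ok r s P R (Par \<sigma>)" using stab_ok[OF assms(1)] by blast
  have low: "Par \<sigma> w = 0" if "length w < m" for w using stab_Par_low[OF assms(1) that] .
  have "Rc r s (Par \<sigma>) [] = 0"
    using assms r3 stab_lev_low[OF assms(1), of "[La, Lb]" "r - 2"] stab_lev_low[OF assms(1), of "[Lb, Lb]" "r - 2"]
    by (simp add: Rc_def low)
  then have "Rc r s (Par \<sigma>) x = 0" using ok by (simp add: ok_def)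
  then show ?thesis using assms r3 by (simp add: Rc_def low bit_add_0_iff)
qed

lemma stab_R_32:
  assumes "\<sigma> \<in> stabM m" "r = 3" "s = 2" "4 < m" "length x + 4 = m"
  shows "(\<Sum>w\<in>words 2. lev (Par \<sigma>) 1 (x @ w @ [La])) = 0"
proof -
  obtain P R where ok: "ok r s P R (Par \<sigma>)" using stab_ok[OF assms(1)] by blast
  have low: "Par \<sigma> w = 0" if "length w < m" for w using stab_Par_low[OF assms(1) that] .
  have R: "Rc r s (Par \<sigma>) y = (\<Sum>w\<in>words 2. lev (Par \<sigma>) 1 (y @ w @ [La]))" if "length y + 4 \<le> m" for y
  proof -
    have "lev (Par \<sigma>) 1 (y @ [l]) = 0" for l using that by (intro stab_lev_low[OF assms(1)]) auto
    then show ?thesis using assms(2,3) that by (simp add: Rc_def low)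
  qed
  have "Rc r s (Par \<sigma>) [] = 0" using assms(4) stab_lev_low[OF assms(1)] by (subst R) (auto intro!: sum.neutral)
  then have "Rc r s (Par \<sigma>) x = 0" using ok by (simp add: ok_def)
  then show ?thesis using R[of x] assms(5) by simp
qed

text \<open>The additional equation leaves test vectors with one word in each of the four quarters
  below \<open>x\<close>. They force the sum \<open>D x\<close> of the four values of
  \<open>f\<close> to be independent of \<open>x\<close>, while on the stabilizer the four quarters
  have equal sums of parities.\<close>

lemma invariants_quad_1:
  assumes "s = 1" "r < m" and inv: "invariant m f"
  shows "\<exists>c. \<forall>\<sigma>\<in>stabM m. (\<Sum>w\<in>words m. f w * Par \<sigma> w) = c * (\<Sum>x\<in>words (m - r). lev (Par \<sigma>) (r - 2) (x @ [La, La]))"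
proof -
  define k where "k = m - r"
  define n where "n = r - 2"
  have m: "m = k + Suc (Suc n)" "k + r = m" and n: "r - 2 = n" "r = Suc (Suc n)" using assms(2) r3 by (auto simp: k_def n_def)
  note tvq = tv_quad_1[OF assms(1) _ assms(2), unfolded n(1)]
  have base: "f (bs k @ l # l' # z) = f (bs k @ l # l' # z')" if z: "length z = n" "length z' = n" for l l' z z'
  proof -
    obtain g where g: "act g z = z'" using act_transitive[of z z'] z by auto
    define d where "d w = (if take 2 w = [l, l'] then g (drop 2 w) else 0)" for w
    obtain \<sigma> where \<sigma>: "\<sigma> \<in> Mt_inf r s" "\<And>z. length z \<le> r \<Longrightarrow> \<sigma> (bs k @ z) = bs k @ act d z"
      using full_below_ex[of k d] assms(1) by auto
    have "act d (h # h' # z) = h # h' # (if h = l \<and> h' = l' then z' else z)" for h h'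
      using g by (auto simp: d_def)
    then have \<sigma>z: "\<sigma> (bs k @ h # h' # z) = bs k @ h # h' # (if h = l \<and> h' = l' then z' else z)" for h h'
      using \<sigma>(2)[of "h # h' # z"] z n by simp
    show ?thesis
      using invariant_tv[OF inv tvq[of "bs k" z z z z] \<sigma>(1)] z m(2)
      by (cases l; cases l') (simp_all add: \<sigma>z)
  qed
  have f: "f (x @ l # l' # z) = f (x @ l # l' # z')" if x: "length x = k" "length z = n" "length z' = n" for x l l' z z'
  proof -
    have "f ((x @ [l, l']) @ z) = f ((x @ [l, l']) @ z')"
    proof (rule transport_eq[OF inv, where n = 2 and k = k])
      fix v z z' :: word assume v: "length v = 2" "length z + (k + 2) = m" "length z' + (k + 2) = m"
      then obtain h h' where h: "v = [h, h']" by (auto simp: numeral_2_eq_2 length_Suc_conv)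
      have "f (bs k @ h # h' # z) = f (bs k @ h # h' # z')" using v m by (intro base) auto
      then show "f (bs k @ v @ z) = f (bs k @ v @ z')" by (simp add: h)
    next
      have "tv m [(x @ [l]) @ (l' # z), (x @ [l]) @ (l' # z')]"
        by (rule tv_block) (use x m n in auto)
      then show "tv m [(x @ [l, l']) @ z, (x @ [l, l']) @ z']" by simp
    qed (use x in auto)
    then show ?thesis by simp
  qed
  define F where "F x l l' = f (x @ l # l' # bs n)" for x l l'
  define D where "D x = F x La La + F x La Lb + (F x Lb La + F x Lb Lb)" for x
  have D: "D x = D (bs k)" if x: "length x = k" for x
  proof -
    obtain \<tau> where \<tau>: "\<tau> \<in> Mt_inf r s" "\<tau> (bs k) = x" using transitive[OF x] by blast
    note sn = aut_snoc[OF M_aut[OF \<tau>(1)]]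
    have "f (\<tau> (bs k @ l # l' # bs n)) = F x (turn (Par \<tau> (bs k)) l) (turn (Par \<tau> (bs k @ [l])) l')" for l l'
    proof -
      obtain z where z: "length z = n" "\<tau> ((bs k @ [l, l']) @ bs n) = \<tau> (bs k @ [l, l']) @ z"
        using aut_append_ex[OF M_aut[OF \<tau>(1)], of "bs n" "bs k @ [l, l']"] by auto
      have "\<tau> (bs k @ [l, l']) = x @ [turn (Par \<tau> (bs k)) l, turn (Par \<tau> (bs k @ [l])) l']"
        using sn[of "bs k @ [l]" l'] sn[of "bs k" l] \<tau>(2) by simp
      then have "\<tau> (bs k @ l # l' # bs n) = x @ turn (Par \<tau> (bs k)) l # turn (Par \<tau> (bs k @ [l])) l' # z" using z by simp
      then show ?thesis unfolding F_def using f[OF x z(1), of "bs n"] by simp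
    qed
    then have "F x (turn (Par \<tau> (bs k)) La) (turn (Par \<tau> (bs k @ [La])) La) + (F x (turn (Par \<tau> (bs k)) La) (turn (Par \<tau> (bs k @ [La])) Lb)
        + (F x (turn (Par \<tau> (bs k)) Lb) (turn (Par \<tau> (bs k @ [Lb])) La) + F x (turn (Par \<tau> (bs k)) Lb) (turn (Par \<tau> (bs k @ [Lb])) Lb)))
        = D (bs k)"
      using invariant_tv[OF inv tvq[of "bs k" "bs n" "bs n" "bs n" "bs n"] \<tau>(1)] m(2)
      by (simp add: D_def F_def add.assoc)
    then show ?thesis
      by (cases "Par \<tau> (bs k)"; cases "Par \<tau> (bs k @ [La])"; cases "Par \<tau> (bs k @ [Lb])") (simp_all add: D_def ac_simps)
  qed
  have "(\<Sum>w\<in>words m. f w * Par \<sigma> w) = D (bs k) * (\<Sum>x\<in>words k. lev (Par \<sigma>) n (x @ [La, La]))"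
    if \<sigma>: "\<sigma> \<in> stabM m" for \<sigma>
  proof -
    have quarter: "(\<Sum>z\<in>words n. f (x @ l # l' # z) * Par \<sigma> (x @ l # l' # z)) = F x l l' * lev (Par \<sigma>) n (x @ [l, l'])"
      if x: "length x = k" for x l l'
    proof -
      have "f (x @ l # l' # z) = F x l l'" if "z \<in> words n" for z
        unfolding F_def by (rule f[OF x]) (use that in auto)
      then have "(\<Sum>z\<in>words n. f (x @ l # l' # z) * Par \<sigma> (x @ l # l' # z)) = (\<Sum>z\<in>words n. F x l l' * Par \<sigma> (x @ l # l' # z))"
        by (intro sum.cong refl) simp
      then show ?thesis by (simp add: lev_def sum_distrib_left)
    qed
    have eq: "lev (Par \<sigma>) n (x @ [l, l']) = lev (Par \<sigma>) n (x @ [La, La])" if x: "length x = k" for x l l'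
    proof -
      have "lev (Par \<sigma>) (r - 1) (x @ [l]) = 0" for l
        by (rule stab_block[OF \<sigma>]) (use x m n assms in auto)
      then have "lev (Par \<sigma>) n (x @ [l, La]) = lev (Par \<sigma>) n (x @ [l, Lb])" for l
        using lev_Suc[of "Par \<sigma>" n "x @ [l]"] n by (simp add: bit_add_0_iff)
      moreover have "lev (Par \<sigma>) n (x @ [La, Lb]) = lev (Par \<sigma>) n (x @ [Lb, Lb])"
        using stab_R_1[OF \<sigma> assms(1,2), of x] x m n by simp
      ultimately show ?thesis by (cases l; cases l') auto
    qed
    have "(\<Sum>w\<in>words m. f w * Par \<sigma> w) = (\<Sum>x\<in>words k. D (bs k) * lev (Par \<sigma>) n (x @ [La, La]))"
      unfolding m(1) sum_words_add
    proof (intro sum.cong refl)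
      fix x assume "x \<in> words k"
      then have x: "length x = k" by simp
      show "(\<Sum>w\<in>words (Suc (Suc n)). f (x @ w) * Par \<sigma> (x @ w)) = D (bs k) * lev (Par \<sigma>) n (x @ [La, La])"
        unfolding sum_words_Suc_Cons quarter[OF x] eq[OF x, of _ Lb] eq[OF x, of Lb La] D[OF x, symmetric]
        by (simp add: D_def distrib_right)
    qed
    then show ?thesis by (simp add: sum_distrib_left)
  qed
  then show ?thesis unfolding k_def[symmetric] n(1) by blast
qed

lemma turn_pair:
  assumes "\<sigma> \<in> Mt_inf r s"
  shows "\<sigma> (x @ [l, l']) = \<sigma> x @ [turn (Par \<sigma> x) l, turn (Par \<sigma> (x @ [l])) l']"
  using aut_snoc[OF M_aut[OF assms], of "x @ [l]" l'] aut_snoc[OF M_aut[OF assms], of x l] by simp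

text \<open>The dependence of \<open>f\<close> is reduced from the bottom up: the last letter does
  not matter; for \<open>d u\<close>, the sum over the letter before it, the second letter below
  \<open>x\<close> does not matter; and the sum \<open>D x\<close> of the two values that remain
  does not depend on \<open>x\<close>. On the stabilizer the parities of the two halves below
  \<open>x\<close> have matching sums.\<close>

lemma invariants_quad_32:
  assumes rs: "r = 3" "s = 2" and "4 < m" and inv: "invariant m f"
  shows "\<exists>c. \<forall>\<sigma>\<in>stabM m. (\<Sum>w\<in>words m. f w * Par \<sigma> w) =
    c * (\<Sum>x\<in>words (m - 4). lev (Par \<sigma>) 1 (x @ [La, La, La]) + lev (Par \<sigma>) 1 (x @ [La, Lb, La]))"
proof -
  define k where "k = m - 4"
  have m: "m = k + 4" "k > 0" using assms(3) by (auto simp: k_def)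
  note tvq = tv_quad_32[OF rs _ assms(3)]
  have b2: "bs (k + 2) = bs k @ [Lb, Lb]" unfolding replicate_add by (simp add: numeral_2_eq_2)
  have flip: "f (bs (k + 2) @ [l, t]) = f (bs (k + 2) @ [l, other t])" for l t
  proof -
    \<comment> \<open>A single turn at a word of length \<open>k + 3\<close>, just above the last
      letter. It lies beyond the range in which shorter parities are set to 0 and survives because
      the word is not a solved position.\<close>
    define q where "q w = (if w = bs (k + 2) @ [l] then 1 else 0 :: bit)" for w
    have low: "q w = 0" if "length w < k + 3" for w using that by (auto simp: q_def)
    obtain \<sigma> where \<sigma>: "\<sigma> \<in> Mt_inf r s" "\<sigma> \<in> Aut_inf" "\<And>w. length w < k + 3 \<Longrightarrow> Par \<sigma> w = q w"
      "\<And>w. \<not> SP r w \<Longrightarrow> \<not> SR r s w \<Longrightarrow> Par \<sigma> w = q w"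
    proof (rule prescribe[of 0 0 "k + 3" q])
      fix x :: word and l assume x: "length x + r < k + 3"
      have "lev q (r - 1) (x @ [l]) = 0" "lev q (s - 1) (x @ [other l]) = 0"
        by (rule lev_zero, rule low, use x rs in simp)+
      then show "Pc r s q x l = 0" by (simp add: Pc_def)
    next
      fix x :: word assume x: "length x + (if s = 1 then r else 4) < k + 3"
      have "lev q 1 (x @ v) = 0" if "length v \<le> 3" for v
        by (rule lev_zero, rule low) (use x rs that in simp)
      moreover have "q (x @ v) = 0" if "length v \<le> 3" for v by (rule low) (use x rs that in simp)
      ultimately show "Rc r s q x = 0" using rs by (simp add: Rc_def)
    qed auto
    have fix3: "\<sigma> w = w" if "length w \<le> k + 3" for w
      using aut_eq_level[OF \<sigma>(2) aut_id _ that] by (simp add: \<sigma>(3) low)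
    have P1: "Par \<sigma> (bs (k + 2) @ [h]) = (if h = l then 1 else 0)" for h
      using \<sigma>(4)[of "bs (k + 2) @ [h]"] below_bs_not_special[of "[h]" "k + 2"] below_bs_not_SR[of "[h]" "k + 2"] rs
      by (simp add: q_def length_rtail)
    have P2: "Par \<sigma> (bs k @ [La, Lb, h]) = 0" for h
    proof -
      have "\<not> SP r (bs k @ [La, Lb, h])" using not_SP_Lb[of "[h]" r "bs k @ [La]"] rs by simp
      moreover have "\<not> SR r s (bs k @ [La, Lb, h])" using below_bs_not_SR[of "[La, Lb, h]" k] rs by (simp add: length_rtail)
      ultimately have "Par \<sigma> (bs k @ [La, Lb, h]) = q (bs k @ [La, Lb, h])" by (rule \<sigma>(4))
      moreover have "bs k @ [La, Lb, h] \<noteq> bs (k + 2) @ [l]" unfolding b2 by simp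
      ultimately show ?thesis by (simp only: q_def if_False)
    qed
    have e1: "\<sigma> (bs k @ [Lb, Lb, h, t]) = bs k @ [Lb, Lb, h, turn (if h = l then 1 else 0) t]" for h t
      using aut_snoc[OF \<sigma>(2), of "bs (k + 2) @ [h]" t] fix3[of "bs (k + 2) @ [h]"] P1[of h] unfolding b2 by simp
    have e2: "\<sigma> (bs k @ [La, Lb, h, t]) = bs k @ [La, Lb, h, t]" for h t
      using aut_snoc[OF \<sigma>(2), of "bs k @ [La, Lb, h]" t] fix3[of "bs k @ [La, Lb, h]"] P2[of h] by simp
    show ?thesis
      using invariant_tv[OF inv tvq[of "bs k" "[Lb, Lb]" "[La, Lb]" t t t t] \<sigma>(1)] m
      unfolding b2 by (cases l) (simp_all add: e1 e2)
  qed
  have f: "f (u @ [l, t]) = f (u @ [l, La])" if u: "length u = k + 2" for u l t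
  proof -
    have "f ((u @ [l]) @ [t]) = f ((u @ [l]) @ [La])"
    proof (rule transport_eq[OF inv, where n = 1 and k = "k + 2"])
      fix v z z' :: word assume v: "length v = 1" "length z + (k + 2 + 1) = m" "length z' + (k + 2 + 1) = m"
      then have "length z = Suc 0" "length z' = Suc 0" using m by auto
      then obtain h t t' where h: "v = [h]" "z = [t]" "z' = [t']" using v(1) by (auto simp: length_Suc_conv)
      show "f (bs (k + 2) @ v @ z) = f (bs (k + 2) @ v @ z')"
        using flip[of h t] unfolding h by (cases t; cases t') auto
    next
      have "tv m [u @ [l, t], u @ [l, La]]" by (rule tv_block) (use u m rs in auto)
      then show "tv m [(u @ [l]) @ [t], (u @ [l]) @ [La]]" by simp
    qed (use u in auto)
    then show ?thesis by simp
  qed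
  define F where "F u l = f (u @ [l, La])" for u l
  define d where "d u = F u La + F u Lb" for u
  have G: "d (\<tau> (x @ v)) + d (\<tau> (x @ v')) = d (x @ v) + d (x @ v')"
    if \<tau>: "\<tau> \<in> Mt_inf r s" and x: "length x = k" "length v = 2" "length v' = 2" for \<tau> x v v'
  proof -
    have len: "length (\<tau> w) = length w" for w using M_aut[OF \<tau>] by simp
    have "f (\<tau> (u @ [l, La])) = F (\<tau> u) (turn (Par \<tau> u) l)" if "length u = k + 2" for u l
      unfolding F_def turn_pair[OF \<tau>] by (rule f) (use that len in simp)
    then have e: "f (\<tau> (u @ [La, La])) + f (\<tau> (u @ [Lb, La])) = d (\<tau> u)" if "length u = k + 2" for u
      using that by (cases "Par \<tau> u") (simp_all add: d_def add.commute)
    show ?thesis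
      using invariant_tv[OF inv tvq[of x v v' La La La La] \<tau>] x m e[of "x @ v"] e[of "x @ v'"]
      by (simp add: d_def F_def add.assoc) (simp flip: add.assoc)
  qed
  have d_bs: "d (bs k @ [l, La]) = d (bs k @ [l, Lb])" for l
  proof -
    obtain \<sigma> where \<sigma>: "\<sigma> \<in> Mt_inf r s" "\<And>z. length z \<le> 2 \<Longrightarrow> \<sigma> (bs k @ z) = bs k @ act (\<lambda>w. if w = [l] then 1 else 0) z"
      using full_below_ex[of k "\<lambda>w. if w = [l] then 1 else 0"] rs m(2) by auto
    show ?thesis using G[OF \<sigma>(1), of "bs k" "[l, La]" "[other l, La]"] \<sigma>(2)[of "[l, La]"] \<sigma>(2)[of "[other l, La]"]
      by simp
  qed
  have d: "d (x @ [l, t]) = d (x @ [l, La])" if x: "length x = k" for x l t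
  proof -
    obtain \<tau> where \<tau>: "\<tau> \<in> Mt_inf r s" "\<tau> (bs k) = x" using transitive[OF x] by blast
    define l0 where "l0 = turn (Par \<tau> (bs k)) l"
    have l0: "turn (Par \<tau> (bs k)) l0 = l" by (simp add: l0_def turn_turn)
    have "d (x @ [l, turn (Par \<tau> (bs k @ [l0])) La]) + d (x @ [l, turn (Par \<tau> (bs k @ [l0])) Lb]) = 0"
      using G[OF \<tau>(1), of "bs k" "[l0, La]" "[l0, Lb]"] d_bs[of l0] by (simp add: turn_pair[OF \<tau>(1)] \<tau>(2) l0)
    then show ?thesis by (cases "Par \<tau> (bs k @ [l0])"; cases t) (simp_all add: bit_add_0_iff)
  qed
  define D where "D x = d (x @ [La, La]) + d (x @ [Lb, La])" for x
  have D: "D x = D (bs k)" if x: "length x = k" for x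
  proof -
    obtain \<tau> where \<tau>: "\<tau> \<in> Mt_inf r s" "\<tau> (bs k) = x" using transitive[OF x] by blast
    show ?thesis
      using G[OF \<tau>(1), of "bs k" "[La, La]" "[Lb, La]"] d[OF x, of _ "turn (Par \<tau> (bs k @ [_])) La"]
      by (cases "Par \<tau> (bs k)") (simp_all add: D_def turn_pair[OF \<tau>(1)] \<tau>(2) add.commute)
  qed
  have "(\<Sum>w\<in>words m. f w * Par \<sigma> w) =
      D (bs k) * (\<Sum>x\<in>words k. lev (Par \<sigma>) 1 (x @ [La, La, La]) + lev (Par \<sigma>) 1 (x @ [La, Lb, La]))"
    if \<sigma>: "\<sigma> \<in> stabM m" for \<sigma>
  proof -
    define p where "p u = lev (Par \<sigma>) 1 (u @ [La])" for u
    have half: "lev (Par \<sigma>) 1 (u @ [Lb]) = p u" if "length u = k + 2" for u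
    proof -
      have "lev (Par \<sigma>) (r - 1) u = 0" by (rule stab_block[OF \<sigma>]) (use that m rs in auto)
      then show ?thesis using lev_Suc[of "Par \<sigma>" 1 u] rs by (simp add: p_def numeral_2_eq_2 bit_add_0_iff)
    qed
    have inner: "(\<Sum>w\<in>words 2. f (u @ w) * Par \<sigma> (u @ w)) = d u * p u" if u: "length u = k + 2" for u
    proof -
      have "(\<Sum>w\<in>words 2. f (u @ w) * Par \<sigma> (u @ w)) = F u La * lev (Par \<sigma>) 1 (u @ [La]) + F u Lb * lev (Par \<sigma>) 1 (u @ [Lb])"
        using f[OF u, of La Lb] f[OF u, of Lb Lb]
        by (simp add: numeral_2_eq_2 sum_words_Suc_Cons F_def lev_1 distrib_left add.assoc)
      then show ?thesis unfolding half[OF u] by (simp add: d_def p_def distrib_right)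
    qed
    have "(\<Sum>w\<in>words m. f w * Par \<sigma> w) = (\<Sum>x\<in>words k. \<Sum>v\<in>words 2. \<Sum>w\<in>words 2. f (x @ v @ w) * Par \<sigma> (x @ v @ w))"
    proof -
      have m22: "m = k + (2 + 2)" using m(1) by simp
      show ?thesis unfolding m22 sum_words_add by simp
    qed
    also have "\<dots> = (\<Sum>x\<in>words k. D (bs k) * (p (x @ [La, La]) + p (x @ [La, Lb])))"
    proof (intro sum.cong refl)
      fix x assume "x \<in> words k"
      then have x: "length x = k" by simp
      have "(\<Sum>w\<in>words 2. p (x @ w)) = 0"
        using stab_R_32[OF \<sigma> rs assms(3), of x] x m by (simp add: p_def)
      then have p: "p (x @ [Lb, La]) + p (x @ [Lb, Lb]) = p (x @ [La, La]) + p (x @ [La, Lb])"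
        by (simp add: numeral_2_eq_2 sum_words_Suc_Cons bit_add_0_iff)
      have "(\<Sum>v\<in>words 2. \<Sum>w\<in>words 2. f (x @ v @ w) * Par \<sigma> (x @ v @ w)) = (\<Sum>v\<in>words 2. d (x @ v) * p (x @ v))"
        using inner[of "x @ _"] x by (intro sum.cong) auto
      also have "\<dots> = d (x @ [La, La]) * (p (x @ [La, La]) + p (x @ [La, Lb])) + d (x @ [Lb, La]) * (p (x @ [Lb, La]) + p (x @ [Lb, Lb]))"
        using d[OF x, of _ Lb] by (simp add: numeral_2_eq_2 sum_words_Suc_Cons distrib_left)
      also have "\<dots> = D x * (p (x @ [La, La]) + p (x @ [La, Lb]))"
        unfolding p D_def distrib_right ..
      finally show "(\<Sum>v\<in>words 2. \<Sum>w\<in>words 2. f (x @ v @ w) * Par \<sigma> (x @ v @ w)) = D (bs k) * (p (x @ [La, La]) + p (x @ [La, Lb]))"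
        unfolding D[OF x] .
    qed
    finally show ?thesis by (simp add: sum_distrib_left p_def)
  qed
  then show ?thesis unfolding k_def[symmetric] by blast
qed

end

section \<open>Commutators\<close>

definition pairp :: "(word \<Rightarrow> bit) \<Rightarrow> (word \<Rightarrow> bit) \<Rightarrow> word \<Rightarrow> bit" where
  "pairp p q w = (case w of [] \<Rightarrow> 0 | l # z \<Rightarrow> (if l = La then p z else q z))"

definition pair :: "(word \<Rightarrow> word) \<Rightarrow> (word \<Rightarrow> word) \<Rightarrow> word \<Rightarrow> word" where
  "pair g h w = (case w of [] \<Rightarrow> [] | l # z \<Rightarrow> l # (if l = La then g z else h z))"

definition swap :: "word \<Rightarrow> word" where
  "swap = act (\<lambda>w. if w = [] then 1 else 0)"

lemma pairp_simps [simp]: "pairp p q [] = 0" "pairp p q (La # z) = p z" "pairp p q (Lb # z) = q z"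
  by (simp_all add: pairp_def)

lemma pair_simps [simp]: "pair g h [] = []" "pair g h (La # z) = La # g z" "pair g h (Lb # z) = Lb # h z"
  by (simp_all add: pair_def)

lemma pair_eq_act:
  assumes "g \<in> Aut_inf" "h \<in> Aut_inf"
  shows "pair g h = act (pairp (Par g) (Par h))"
proof
  fix w
  have "(\<lambda>v. pairp p q (La # v)) = p" "(\<lambda>v. pairp p q (Lb # v)) = q" for p q by (simp_all add: fun_eq_iff)
  then show "pair g h w = act (pairp (Par g) (Par h)) w"
    using act_Par assms by (cases w rule: list.exhaust; cases "hd w") auto
qed

lemma pair_aut: "g \<in> Aut_inf \<Longrightarrow> h \<in> Aut_inf \<Longrightarrow> pair g h \<in> Aut_inf"
  by (simp add: pair_eq_act)

lemma Par_pair: "g \<in> Aut_inf \<Longrightarrow> h \<in> Aut_inf \<Longrightarrow> Par (pair g h) = pairp (Par g) (Par h)"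
  by (simp add: pair_eq_act)

lemma pair_comp: "pair g h \<circ> pair g' h' = pair (g \<circ> g') (h \<circ> h')"
proof
  fix w show "(pair g h \<circ> pair g' h') w = pair (g \<circ> g') (h \<circ> h') w"
    by (cases w rule: list.exhaust; cases "hd w") auto
qed

lemma lev_pairp [simp]: "lev (pairp p q) m (La # u) = lev p m u" "lev (pairp p q) m (Lb # u) = lev q m u"
  by (simp_all add: lev_def)

lemma lev_pairp_Nil: "lev (pairp p q) (Suc m) [] = lev p m [] + lev q m []"
  by (simp add: lev_Suc)

lemma swap_aut [simp]: "swap \<in> Aut_inf"
  by (simp add: swap_def)

lemma Par_swap: "Par swap w = (if w = [] then 1 else 0)"
  by (simp add: swap_def)

lemma lev_swap: "u \<noteq> [] \<or> m > 0 \<Longrightarrow> lev (Par swap) m u = 0"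
  by (rule lev_zero) (auto simp: Par_swap)

lemma lev_id [simp]: "lev (Par id) m u = 0"
  by (simp add: lev_def)

section \<open>Pairs of elements that commute up to a given level\<close>

context params
begin

text \<open>Both constants vanish here. Membership of a pair then reduces to the equations at its
  root, that is, to a few level sums and one value of \<open>Rc\<close>
  (\<open>M0_pair\<close>).\<close>

definition M0 :: "(word \<Rightarrow> word) set" where
  "M0 = {\<sigma> \<in> Aut_inf. ok r s 0 0 (Par \<sigma>)}"

definition cc :: "nat \<Rightarrow> (word \<Rightarrow> word) \<Rightarrow> bit" where
  "cc j \<sigma> = lev (Par \<sigma>) j []"

lemma M0_aut: "\<sigma> \<in> M0 \<Longrightarrow> \<sigma> \<in> Aut_inf"
  by (simp add: M0_def)

lemma M0_M: "\<sigma> \<in> M0 \<Longrightarrow> \<sigma> \<in> Mt_inf r s"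
  by (auto simp: M0_def M_iff)

lemma M0_comp: "\<sigma> \<in> M0 \<Longrightarrow> \<tau> \<in> M0 \<Longrightarrow> \<sigma> \<circ> \<tau> \<in> M0"
  using ok_comp_ok[OF s1 sr r3, of \<sigma> \<tau> 0 0 0 0] by (auto simp: M0_def)

lemma M0_id: "id \<in> M0"
  using ok_id by (auto simp: M0_def)

lemma M0_swap: "swap \<in> M0"
proof -
  have "Pc r s (Par swap) x l = 0" for x l by (simp add: Pc_def lev_swap)
  moreover have "Rc r s (Par swap) x = 0" for x by (auto simp: Rc_def lev_swap Par_swap intro!: sum.neutral)
  ultimately show ?thesis by (simp add: M0_def ok_def)
qed

lemma Rc_pairp: "Rc r s (pairp p q) (La # y) = Rc r s p y" "Rc r s (pairp p q) (Lb # y) = Rc r s q y"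
  by (simp_all add: Rc_def)

lemma M0_pair:
  assumes "g \<in> M0" "h \<in> M0" "cc (r - 1) g = cc (s - 1) h" "cc (r - 1) h = cc (s - 1) g"
    "Rc r s (pairp (Par g) (Par h)) [] = 0"
  shows "pair g h \<in> M0"
proof -
  have "Pc r s (pairp (Par g) (Par h)) x l = 0" for x l
  proof (cases x)
    case Nil
    then show ?thesis using assms(3,4) by (cases l) (simp_all add: Pc_def cc_def)
  next
    case (Cons k y)
    then show ?thesis using assms(1,2) by (cases k) (simp_all add: M0_def ok_def Pc_def)
  qed
  moreover have "Rc r s (pairp (Par g) (Par h)) x = 0" for x
  proof (cases x)
    case Nil
    then show ?thesis using assms(5) by simp
  next
    case (Cons k y)
    have "Rc r s (Par g) y = 0" "Rc r s (Par h) y = 0" using assms(1,2) by (auto simp: M0_def ok_def)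
    then show ?thesis unfolding Cons by (cases k) (simp_all add: Rc_pairp)
  qed
  ultimately show ?thesis
    using assms(1,2) by (simp add: M0_def ok_def Par_pair pair_aut)
qed

lemma cc_pair: "g \<in> M0 \<Longrightarrow> h \<in> M0 \<Longrightarrow> cc (Suc j) (pair g h) = cc j g + cc j h"
  "g \<in> M0 \<Longrightarrow> h \<in> M0 \<Longrightarrow> cc 0 (pair g h) = 0"
  by (simp_all add: cc_def Par_pair M0_aut lev_pairp_Nil)

lemma cc_comp: "\<sigma> \<in> M0 \<Longrightarrow> \<tau> \<in> M0 \<Longrightarrow> cc j (\<sigma> \<circ> \<tau>) = cc j \<sigma> + cc j \<tau>"
  using lev_comp[of \<sigma> \<tau> j "[]"] M0_aut[of \<sigma>] M0_aut[of \<tau>] by (simp add: cc_def add.commute)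

lemma cc_id [simp]: "cc j id = 0"
  by (simp add: cc_def)

lemma cc_swap: "cc j swap = (if j = 0 then 1 else 0)"
  by (cases "j = 0") (simp_all add: cc_def lev_swap Par_swap)

lemma M0_prescribe:
  "\<exists>g\<in>M0. (\<forall>w. length w < r \<longrightarrow> Par g w = q w) \<and> (\<forall>w. \<not> SP r w \<longrightarrow> \<not> SR r s w \<longrightarrow> Par g w = q w)"
proof -
  obtain \<sigma> where \<sigma>: "\<sigma> \<in> Aut_inf" "ok r s 0 0 (Par \<sigma>)" "\<And>w. \<not> SP r w \<Longrightarrow> \<not> SR r s w \<Longrightarrow> Par \<sigma> w = q w"
    by (rule prescribe[of 0 0 0 q]) auto
  then have "Par \<sigma> w = q w" if "length w < r" for w
    using SP_length[of w] SR_length[of w] that by auto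
  then show ?thesis using \<sigma> by (auto simp: M0_def)
qed

lemma M0_cc: "\<exists>g\<in>M0. \<forall>j<r. cc j g = e j"
proof -
  obtain g where g: "g \<in> M0" "\<And>w. length w < r \<Longrightarrow> Par g w = (if w = bs (length w) then e (length w) else 0)"
    using M0_prescribe[of "\<lambda>w. if w = bs (length w) then e (length w) else 0"] by blast
  have "cc j g = e j" if "j < r" for j
  proof -
    have "cc j g = (\<Sum>w\<in>words j. if w = bs j then e j else 0)"
      unfolding cc_def lev_def using that by (intro sum.cong) (auto simp: g(2))
    then show ?thesis by simp
  qed
  then show ?thesis using g(1) by blast
qed

text \<open>The functional is a parameter because the inductions start at levels where the closed
  formulas \<open>Psi\<close>, \<open>Psi1\<close>, \<open>Psi2\<close> differ from
  \<open>Phi\<close>.\<close>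

definition bad :: "nat \<Rightarrow> (nat \<Rightarrow> (word \<Rightarrow> bit) \<Rightarrow> bit) \<Rightarrow> (word \<Rightarrow> word) \<Rightarrow> (word \<Rightarrow> word) \<Rightarrow> bool" where
  "bad m F g h \<longleftrightarrow> g \<in> M0 \<and> h \<in> M0 \<and> (\<forall>w. length w \<le> m \<longrightarrow> g (h w) = h (g w)) \<and>
     F m (Par (g \<circ> h)) \<noteq> F m (Par (h \<circ> g))"

text \<open>One level is gained by placing \<open>g\<close> and \<open>g'\<close> below the letter
  \<open>a\<close>. The commuting companions \<open>h\<close> and \<open>h'\<close> below
  \<open>b\<close> serve to satisfy the equations at the root without affecting the
  commutator.\<close>

lemma bad_pair:
  assumes "bad m F g g'" "h \<in> M0" "h' \<in> M0" "h \<circ> h' = h' \<circ> h" "pair g h \<in> M0" "pair g' h' \<in> M0"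
    and F: "\<And>p q. F (Suc m) (pairp p q) = F m p + F m q"
  shows "bad (Suc m) F (pair g h) (pair g' h')"
proof -
  have M: "g \<in> M0" "g' \<in> M0" using assms(1) by (auto simp: bad_def)
  have "Par (pair g h \<circ> pair g' h') = pairp (Par (g \<circ> g')) (Par (h \<circ> h'))"
    "Par (pair g' h' \<circ> pair g h) = pairp (Par (g' \<circ> g)) (Par (h \<circ> h'))"
    unfolding pair_comp using M assms M0_comp[THEN M0_aut] by (simp_all add: Par_pair)
  moreover have "pair g h (pair g' h' w) = pair g' h' (pair g h w)" if "length w \<le> Suc m" for w
  proof (cases w)
    case (Cons l z)
    have "h (h' z) = h' (h z)" using fun_cong[OF assms(4), of z] by simp
    then show ?thesis using Cons assms(1) that by (cases l) (auto simp: bad_def)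
  qed simp
  ultimately show ?thesis using assms by (auto simp: bad_def)
qed

definition Psi :: "nat \<Rightarrow> (word \<Rightarrow> bit) \<Rightarrow> bit" where
  "Psi m f = (\<Sum>u\<in>words (Suc m - r). lev f (r - 2) (u @ [Lb]))"

text \<open>Companions must commute and realise all values of \<open>cc (s - 1)\<close> and
  \<open>cc (r - 1)\<close>, so they are generated by two elements with disjoint supports. For
  \<open>r = s + 1\<close> the obvious choice \<open>(b, id)\<close> fails, because its level
  \<open>r - 2\<close> is then level \<open>s - 1\<close> and violates an equation at the root; the
  supports are nested one level deeper.\<close>

lemma commuting_pair:
  assumes "2 \<le> s" "4 \<le> r"
  shows "\<exists>\<alpha>\<in>M0. \<exists>\<beta>\<in>M0. \<alpha> \<circ> \<beta> = \<beta> \<circ> \<alpha> \<and> cc (s - 1) \<alpha> = 1 \<and> cc (r - 1) \<alpha> = 0 \<and> cc (s - 1) \<beta> = 0 \<and> cc (r - 1) \<beta> = 1"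
proof -
  have R0: "Rc r s p x = 0" for p x using assms by (simp add: Rc_def)
  note mem = M0_pair[OF _ _ _ _ R0]
  have [simp]: "s - Suc 0 = Suc (s - 2)" "r - Suc 0 = Suc (r - 2)" using assms by auto
  show ?thesis
  proof (cases "r = Suc s")
    case False
    obtain g where g: "g \<in> M0" "\<And>j. j < r \<Longrightarrow> cc j g = (if j = s - 2 then 1 else 0)"
      using M0_cc[of "\<lambda>j. if j = s - 2 then 1 else 0"] by blast
    obtain b where b: "b \<in> M0" "\<And>j. j < r \<Longrightarrow> cc j b = (if j = r - 2 then 1 else 0)"
      using M0_cc[of "\<lambda>j. if j = r - 2 then 1 else 0"] by blast
    have "pair id g \<in> M0" by (rule mem) (use g M0_id assms sr in auto)
    moreover have "pair b id \<in> M0" by (rule mem) (use b M0_id assms sr False in auto)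
    ultimately show ?thesis
      using g b M0_id assms sr False
      by (intro bexI[of _ "pair id g"] bexI[of _ "pair b id"]) (auto simp: pair_comp cc_pair)
  next
    case True
    then have s3: "3 \<le> s" using assms by simp
    have [simp]: "s - 2 = Suc (s - 3)" "r - 2 = Suc (s - 2)" using s3 True by auto
    obtain g' where g': "g' \<in> M0" "\<And>j. j < r \<Longrightarrow> cc j g' = (if j = s - 3 then 1 else 0)"
      using M0_cc[of "\<lambda>j. if j = s - 3 then 1 else 0"] by blast
    obtain k' where k': "k' \<in> M0" "\<And>j. j < r \<Longrightarrow> cc j k' = (if j = s - 2 then 1 else 0)"
      using M0_cc[of "\<lambda>j. if j = s - 2 then 1 else 0"] by blast
    obtain b where b: "b \<in> M0" "\<And>j. j < r \<Longrightarrow> cc j b = (if j = r - 1 then 1 else 0)"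
      using M0_cc[of "\<lambda>j. if j = r - 1 then 1 else 0"] by blast
    have g: "pair id g' \<in> M0" by (rule mem) (use g' M0_id assms sr in auto)
    have k: "pair k' id \<in> M0" by (rule mem) (use k' M0_id assms sr in auto)
    have a: "pair id (pair id g') \<in> M0"
      by (rule mem) (use g g' M0_id assms sr in \<open>auto simp: cc_pair\<close>)
    have b': "pair b (pair k' id) \<in> M0"
      by (rule mem) (use k k' b M0_id assms sr in \<open>auto simp: cc_pair\<close>)
    have "pair id (pair id g') \<circ> pair b (pair k' id) = pair b (pair k' id) \<circ> pair id (pair id g')"
      by (simp add: pair_comp)
    moreover have "cc (s - 1) (pair id (pair id g')) = 1" "cc (r - 1) (pair id (pair id g')) = 0"
      "cc (s - 1) (pair b (pair k' id)) = 0" "cc (r - 1) (pair b (pair k' id)) = 1"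
      using g k g' k' b M0_id assms sr by (auto simp: cc_pair)
    ultimately show ?thesis using a b' by blast
  qed
qed

text \<open>At level \<open>r - 1\<close> the pair consists of \<open>swap\<close> and an element
  \<open>k\<close> that turns a single node of that level: \<open>swap\<close> moves the turn from
  the half below \<open>a\<close> to the half below \<open>b\<close>, and \<open>Psi\<close> sees
  one half only.\<close>

lemma bad_generic:
  assumes "2 \<le> s" "4 \<le> r"
  shows "\<exists>g h. bad (r - 1 + n) Psi g h"
proof (induction n)
  case 0
  define q where "q w = (if w = La # bs (r - 2) then 1 else 0 :: bit)" for w
  obtain k where k: "k \<in> M0" "\<And>w. length w < r \<Longrightarrow> Par k w = q w"
    using M0_prescribe[of q] by blast
  have l: "lev (Par k) (r - 2) [l] = (if l = La then 1 else 0)" for l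
  proof -
    have "lev (Par k) (r - 2) [l] = (\<Sum>z\<in>words (r - 2). if z = bs (r - 2) then (if l = La then 1 else 0) else 0)"
      unfolding lev_def using assms by (intro sum.cong) (auto simp: k(2) q_def)
    then show ?thesis by simp
  qed
  have kfix: "k w = w" if "length w \<le> r - 1" for w
  proof -
    have "Par k x = Par id x" if "length x < r - 1" for x
      using k(2)[of x] that r3 by (auto simp: q_def)
    then show ?thesis using aut_eq_level[OF M0_aut[OF k(1)] aut_id _ that] by simp
  qed
  have "swap (k w) = k (swap w)" if "length w \<le> r - 1" for w
    using kfix[OF that] kfix[of "swap w"] that by simp
  moreover have "Psi (r - 1) (Par (swap \<circ> k)) = lev (Par k) (r - 2) [Lb]"
    using assms kfix[of "[Lb]"] by (simp add: Psi_def lev_comp M0_aut k(1) lev_swap)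
  moreover have "Psi (r - 1) (Par (k \<circ> swap)) = lev (Par k) (r - 2) [La]"
    using assms by (simp add: Psi_def lev_comp M0_aut k(1) lev_swap) (simp add: swap_def)
  ultimately have "bad (r - 1) Psi swap k" using M0_swap k(1) by (simp add: bad_def l)
  then show ?case by auto
next
  case (Suc n)
  then obtain g g' where b: "bad (r - 1 + n) Psi g g'" by blast
  then have gM: "g \<in> M0" "g' \<in> M0" by (auto simp: bad_def)
  have R0: "Rc r s p x = 0" for p x using assms by (simp add: Rc_def)
  note mem = M0_pair[OF _ _ _ _ R0]
  obtain \<alpha> \<beta> where ab: "\<alpha> \<in> M0" "\<beta> \<in> M0" "\<alpha> \<circ> \<beta> = \<beta> \<circ> \<alpha>" "cc (s - 1) \<alpha> = 1" "cc (r - 1) \<alpha> = 0" "cc (s - 1) \<beta> = 0" "cc (r - 1) \<beta> = 1"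
    using commuting_pair[OF assms] by blast
  define h where "h x y = (if x = (0::bit) then id else \<alpha>) \<circ> (if y = (0::bit) then id else \<beta>)" for x y
  have h: "h x y \<in> M0" "cc (s - 1) (h x y) = x" "cc (r - 1) (h x y) = y" for x y
    using ab M0_id by (auto simp: h_def M0_comp cc_comp)
  have "h x y \<circ> h x' y' = h x' y' \<circ> h x y" for x y x' y'
  proof -
    have c: "\<alpha> (\<beta> w) = \<beta> (\<alpha> w)" for w using fun_cong[OF ab(3), of w] by simp
    show ?thesis by (auto simp: h_def c fun_eq_iff)
  qed
  then have "bad (Suc (r - 1 + n)) Psi (pair g (h (cc (r - 1) g) (cc (s - 1) g))) (pair g' (h (cc (r - 1) g') (cc (s - 1) g')))"
  proof (rule bad_pair[OF b h(1) h(1)])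
    show "pair g (h (cc (r - 1) g) (cc (s - 1) g)) \<in> M0" "pair g' (h (cc (r - 1) g') (cc (s - 1) g')) \<in> M0"
      using gM h by (auto intro!: mem)
    show "Psi (Suc (r - 1 + n)) (pairp p q) = Psi (r - 1 + n) p + Psi (r - 1 + n) q" for p q
      using r3 by (simp add: Psi_def Suc_diff_le sum_words_Suc_Cons sum.distrib)
  qed
  then show ?case by auto
qed

definition Psi1 :: "nat \<Rightarrow> (word \<Rightarrow> bit) \<Rightarrow> bit" where
  "Psi1 m f = (\<Sum>x\<in>words (m - r). lev f (r - 2) (x @ [La, La]))"

text \<open>For \<open>s = 1\<close> the root parity of one coordinate has to match the block sum of
  the other, as it does in \<open>(swap, k)\<close> and \<open>(k, swap)\<close>. The equalities
  carried along ensure that the same companion, \<open>id\<close> or \<open>swap\<close>, fits both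
  elements and keeps \<open>Rc\<close> at the root equal to 0.\<close>

lemma bad_1:
  assumes s: "s = 1"
  shows "\<exists>g h. bad (r + n) Psi1 g h \<and> (\<forall>j<r. cc j g = cc j h) \<and> cc 0 g = 0 \<and>
    lev (Par g) (r - 2) [Lb] = 0 \<and> lev (Par h) (r - 2) [Lb] = 0"
proof (induction n)
  case 0
  have s0: "s - Suc 0 = 0" using s by simp
  define q where "q w = (if w = La # bs (r - 2) then 1 else 0 :: bit)" for w
  obtain k where k: "k \<in> M0" "\<And>w. length w < r \<Longrightarrow> Par k w = q w"
    using M0_prescribe[of q] by blast
  have l: "lev (Par k) (r - 2) [l] = (if l = La then 1 else 0)" for l
  proof -
    have "lev (Par k) (r - 2) [l] = (\<Sum>z\<in>words (r - 2). if z = bs (r - 2) then (if l = La then 1 else 0) else 0)"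
      unfolding lev_def using r3 by (intro sum.cong) (auto simp: k(2) q_def)
    then show ?thesis by simp
  qed
  have r2: "r - Suc 0 = Suc (r - 2)" "r - 2 = Suc (r - 3)" using r3 by auto
  have cr: "cc (r - 1) k = 1" using l[of La] l[of Lb] lev_Suc[of "Par k" "r - 2" "[]"] by (simp add: cc_def r2(1))
  have cl: "cc j k = 0" if "j < r - 1" for j
    unfolding cc_def by (rule lev_zero) (use that in \<open>auto simp: k(2) q_def\<close>)
  have kfix: "k w = w" if "length w \<le> r - 1" for w
  proof -
    have "Par k x = Par id x" if "length x < r - 1" for x
      using k(2)[of x] that r3 by (auto simp: q_def)
    then show ?thesis using aut_eq_level[OF M0_aut[OF k(1)] aut_id _ that] by simp
  qed
  have R: "Rc r s (pairp (Par swap) (Par k)) [] = 0" "Rc r s (pairp (Par k) (Par swap)) [] = 0"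
    using s cl[of 0] r3 by (simp_all add: Rc_def l lev_swap cc_def)
  have g: "pair swap k \<in> M0" "pair k swap \<in> M0"
    by (rule M0_pair; use M0_swap k(1) R cr cl[of 0] r3 s0 in \<open>simp add: cc_swap\<close>)+
  have comm: "swap (k w) = k (swap w)" if "length w \<le> r - 1" for w
    using kfix[OF that] kfix[of "swap w"] that by simp
  have "pair swap k (pair k swap w) = pair k swap (pair swap k w)" if "length w \<le> r" for w
  proof (cases w)
    case (Cons l z)
    then show ?thesis using comm[of z] that by (cases l) auto
  qed simp
  moreover have "Psi1 r (Par (pair swap k \<circ> pair k swap)) = lev (Par k) (r - 2) [La]"
    using kfix[of "[La]"] r3 k(1)
    by (simp add: pair_comp Psi1_def Par_pair aut_comp M0_aut lev_comp lev_swap)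
  moreover have "Psi1 r (Par (pair k swap \<circ> pair swap k)) = lev (Par k) (r - 2) [Lb]"
    using r3 k(1)
    by (simp add: pair_comp Psi1_def Par_pair aut_comp M0_aut lev_comp lev_swap) (simp add: swap_def)
  ultimately have "bad r Psi1 (pair swap k) (pair k swap)" using g by (simp add: bad_def l)
  moreover have "cc j (pair swap k) = cc j (pair k swap)" "cc 0 (pair swap k) = 0" for j
    using k(1) M0_swap by (cases j; simp add: cc_pair add.commute)+
  moreover have "lev (Par (pair swap k)) (r - 2) [Lb] = 0"
    using cl[of "r - 2"] r3 k(1) by (simp add: Par_pair M0_aut cc_def)
  moreover have "lev (Par (pair k swap)) (r - 2) [Lb] = 0"
    using r3 k(1) by (simp add: Par_pair M0_aut lev_swap)
  ultimately have "bad r Psi1 (pair swap k) (pair k swap) \<and> (\<forall>j<r. cc j (pair swap k) = cc j (pair k swap)) \<and>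
      cc 0 (pair swap k) = 0 \<and> lev (Par (pair swap k)) (r - 2) [Lb] = 0 \<and> lev (Par (pair k swap)) (r - 2) [Lb] = 0"
    by simp
  then show ?case unfolding add_0_right by blast
next
  case (Suc n)
  have s0: "s - Suc 0 = 0" using s by simp
  obtain g g' where b: "bad (r + n) Psi1 g g'" "\<forall>j<r. cc j g = cc j g'" "cc 0 g = 0"
    "lev (Par g) (r - 2) [Lb] = 0" "lev (Par g') (r - 2) [Lb] = 0" using Suc by blast
  then have gM: "g \<in> M0" "g' \<in> M0" by (auto simp: bad_def)
  define h where "h = (if cc (r - 1) g = 0 then id else swap)"
  have h: "h \<in> M0" "cc 0 h = cc (r - 1) g" "lev (Par h) (r - 2) [Lb] = 0" and hj: "\<And>j. j > 0 \<Longrightarrow> cc j h = 0"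
    using M0_id M0_swap by (auto simp: h_def cc_swap lev_swap)
  have c0: "cc 0 g' = 0" and cr: "cc (r - 1) g' = cc (r - 1) g" using b(2,3) r3 by auto
  have R: "Rc r s (pairp (Par g) (Par h)) [] = 0" "Rc r s (pairp (Par g') (Par h)) [] = 0"
    using s b(3-5) c0 h(3) by (simp_all add: Rc_def cc_def)
  have p: "pair g h \<in> M0" "pair g' h \<in> M0"
    by (rule M0_pair; use gM h hj[of "r - 1"] R b(3) c0 cr s0 r3 in simp)+
  have "bad (Suc (r + n)) Psi1 (pair g h) (pair g' h)"
  proof (rule bad_pair[OF b(1) h(1) h(1) refl p])
    show "Psi1 (Suc (r + n)) (pairp p q) = Psi1 (r + n) p + Psi1 (r + n) q" for p q
      using r3 by (simp add: Psi1_def Suc_diff_le sum_words_Suc_Cons sum.distrib)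
  qed
  moreover have "cc j (pair g h) = cc j (pair g' h)" if "j < r" for j
    using that b(2) gM h(1) by (cases j) (simp_all add: cc_pair)
  moreover have "cc 0 (pair g h) = 0" using gM h(1) by (simp add: cc_pair)
  moreover have "lev (Par (pair x h)) (r - 2) [Lb] = 0" if "x \<in> M0" for x
    using hj[of "r - 2"] r3 that h(1) by (simp add: Par_pair M0_aut cc_def)
  ultimately show ?case using gM by auto
qed

text \<open>\<open>\<rho>\<close> is the contribution of a coordinate to the block sum in
  \<open>Rc\<close> at the root of a pair, and \<open>\<theta>\<close> is its analogue one level
  higher: \<open>\<rho>\<close> of a pair is the sum of the two values of \<open>\<theta>\<close>
  (\<open>pair_32\<close>).\<close>

definition \<theta> :: "(word \<Rightarrow> word) \<Rightarrow> bit" where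
  "\<theta> g = Par g [Lb] + lev (Par g) (Suc 0) [La]"

definition \<rho> :: "(word \<Rightarrow> word) \<Rightarrow> bit" where
  "\<rho> g = (Par g [La, Lb] + lev (Par g) (Suc 0) [La, La]) + (Par g [Lb, Lb] + lev (Par g) (Suc 0) [Lb, La])"

definition Psi2 :: "nat \<Rightarrow> (word \<Rightarrow> bit) \<Rightarrow> bit" where
  "Psi2 m f = (\<Sum>x\<in>words (m - 4). lev f 1 (x @ [La, La, La]) + lev f 1 (x @ [La, Lb, La]))"

lemma M0_pair_32:
  assumes rs: "r = 3" "s = 2" and "g \<in> M0" "h \<in> M0" "cc 2 g = cc (Suc 0) h" "cc 2 h = cc (Suc 0) g"
    "cc (Suc 0) g + cc (Suc 0) h + (\<rho> g + \<rho> h) + cc (Suc 0) g * cc (Suc 0) h = 0"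
  shows "pair g h \<in> M0"
proof -
  have "Rc r s (pairp (Par g) (Par h)) [] = cc (Suc 0) g + cc (Suc 0) h + (\<rho> g + \<rho> h) + cc (Suc 0) g * cc (Suc 0) h"
    by (simp add: rs Rc_def numeral_2_eq_2 sum_words_Suc_Cons cc_def \<rho>_def lev_1 ac_simps)
  then show ?thesis using assms by (intro M0_pair) auto
qed

lemma pair_32:
  assumes "g \<in> M0" "h \<in> M0"
  shows "\<theta> (pair g h) = cc 0 h + cc (Suc 0) g" "\<rho> (pair g h) = \<theta> g + \<theta> h"
  using assms by (simp_all add: \<theta>_def \<rho>_def cc_def Par_pair M0_aut)

lemma M0_32:
  assumes rs: "r = 3" "s = 2"
  shows "\<exists>h\<in>M0. cc 0 h = e0 \<and> cc (Suc 0) h = e1 \<and> cc 2 h = e2 \<and> \<theta> h = t \<and> \<rho> h = y \<and>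
    Par h [La] = 0 \<and> Par h [Lb] = e1 \<and> lev (Par h) (Suc 0) [La] = t + e1"
proof -
  \<comment> \<open>Each invariant has a node of its own; the additional summands at
    \<open>ba\<close> and \<open>abb\<close> cancel the contributions of the other choices.\<close>
  define q where "q w = (if w = [] then e0 else if w = [Lb] then e1 else if w = [La, La] then t + e1
    else if w = [Lb, La] then e2 + (t + e1) else if w = [La, Lb, Lb] then y + e2 else 0)" for w
  obtain h where h: "h \<in> M0" "\<And>w. length w < r \<Longrightarrow> Par h w = q w"
    "\<And>w. \<not> SP r w \<Longrightarrow> \<not> SR r s w \<Longrightarrow> Par h w = q w"
    using M0_prescribe[of q] by blast
  have low: "Par h w = q w" if "length w \<le> 2" for w using h(2)[of w] that rs by simp
  have l3: "Par h [l, Lb, l'] = q [l, Lb, l']" for l l'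
  proof (rule h(3))
    show "\<not> SP r [l, Lb, l']" using not_SP_Lb[of "[l']" r "[l]"] rs by simp
    show "\<not> SR r s [l, Lb, l']" by (auto simp: SR_def rtail_def rs append_eq_Cons_conv)
  qed
  have P: "Pc r s (Par h) [] l = 0" for l using h(1) by (simp add: M0_def ok_def)
  have "lev (Par h) (Suc 0) [l, La] = lev (Par h) (Suc 0) [l, Lb] + lev (Par h) (Suc 0) [other l]" for l
    using P[of l] lev_Suc[of "Par h" "Suc 0" "[l]"] by (simp add: Pc_def rs numeral_2_eq_2 bit_add_0_iff bit_add_eq_iff ac_simps)
  then have "lev (Par h) (Suc 0) [La, La] = (y + e2) + (e2 + (t + e1))" "lev (Par h) (Suc 0) [Lb, La] = t + e1"
    by (simp_all add: lev_1 l3 low q_def)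
  then have "\<rho> h = y" by (simp add: \<rho>_def low q_def ac_simps)
  moreover have "cc 0 h = e0" "cc (Suc 0) h = e1" "cc 2 h = e2" "\<theta> h = t" "Par h [La] = 0" "Par h [Lb] = e1" "lev (Par h) (Suc 0) [La] = t + e1"
    by (simp_all add: cc_def \<theta>_def lev_1 numeral_2_eq_2 lev_Suc low q_def ac_simps)
  ultimately show ?thesis using h(1) by blast
qed

text \<open>At level 4 the pairs \<open>(p, q)\<close> and \<open>(q, p)\<close> have different
  values of \<open>\<theta>\<close>, which with a common companion would make \<open>\<rho>\<close>
  differ one level later. The step to level 5 therefore uses two commuting companions
  \<open>(x, id)\<close> and \<open>(id, x)\<close> whose \<open>\<theta>\<close> differ as well.
  From there on all five invariants agree and a common companion works.\<close>

lemma bad_32: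
  assumes rs: "r = 3" "s = 2"
  shows "\<exists>g h. bad (5 + n) Psi2 g h \<and> cc 0 g = cc 0 h \<and> cc (Suc 0) g = cc (Suc 0) h \<and> cc 2 g = cc 2 h \<and> \<theta> g = \<theta> h \<and> \<rho> g = \<rho> h"
proof (induction n)
  case 0
  obtain k where k: "k \<in> M0" "cc 0 k = 0" "cc (Suc 0) k = 0" "cc 2 k = 1" "\<theta> k = 0" "\<rho> k = 0"
    "Par k [La] = 0" "Par k [Lb] = 0" "lev (Par k) (Suc 0) [La] = 0"
    using M0_32[OF rs, of 0 0 1 0 0] by auto
  obtain j where j: "j \<in> M0" "cc 0 j = 0" "cc (Suc 0) j = 1" "cc 2 j = 0" "\<theta> j = 1" "\<rho> j = 1"
    using M0_32[OF rs, of 0 1 0 1 1] by auto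
  note pair32 = M0_pair_32[OF rs] and cc2 = cc_pair(1)[of _ _ "Suc 0", folded numeral_2_eq_2] and cc1 = cc_pair(1)[of _ _ 0]
  have sw: "\<theta> swap = 0" "\<rho> swap = 0" "\<theta> id = 0" "\<rho> id = 0" by (simp_all add: \<theta>_def \<rho>_def Par_swap lev_swap)
  define p where "p = pair swap id"
  define q where "q = pair k j"
  have pM: "p \<in> M0" unfolding p_def by (rule pair32) (simp_all add: M0_swap M0_id cc_swap sw)
  have qM: "q \<in> M0" unfolding q_def by (rule pair32) (simp_all add: k j)
  have pv: "cc 0 p = 0" "cc (Suc 0) p = 1" "cc 2 p = 0" "\<rho> p = 0" "\<theta> p = 0"
    by (simp_all add: p_def cc_pair cc1 cc2 M0_swap M0_id cc_swap pair_32 sw)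
  have qv: "cc 0 q = 0" "cc (Suc 0) q = 0" "cc 2 q = 1" "\<rho> q = 1"
    using k j by (simp_all add: q_def cc_pair cc1 cc2 pair_32)
  have g: "pair p q \<in> M0" "pair q p \<in> M0" by (rule pair32; simp add: pM qM pv qv)+
  have kfix: "k w = w" if "length w \<le> 2" for w
  proof -
    have "Par k x = 0" if "length x < 2" for x
    proof (cases x)
      case Nil
      then show ?thesis using k(2) by (simp add: cc_def)
    next
      case (Cons l z)
      then show ?thesis using that k(7,8) by (cases l) auto
    qed
    then show ?thesis using aut_eq_level[OF M0_aut[OF k(1)] aut_id _ that] by simp
  qed
  have c1: "swap (k w) = k (swap w)" if "length w \<le> 2" for w
    using kfix[OF that] kfix[of "swap w"] that by simp
  have c2: "p (q w) = q (p w)" if "length w \<le> 3" for w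
  proof (cases w)
    case (Cons l z)
    then show ?thesis using c1[of z] that by (cases l) (auto simp: p_def q_def)
  qed (simp add: p_def q_def)
  have c3: "pair p q (pair q p w) = pair q p (pair p q w)" if "length w \<le> 4" for w
  proof (cases w)
    case (Cons l z)
    then show ?thesis using c2[of z] that by (cases l) auto
  qed simp
  have kb: "lev (Par k) (Suc 0) [Lb] = 1" using k(4,9) lev_Suc[of "Par k" "Suc 0" "[]"] by (simp add: cc_def numeral_2_eq_2)
  have au: "k \<in> Aut_inf" "j \<in> Aut_inf" "p \<in> Aut_inf" "q \<in> Aut_inf" using k(1) j(1) pM qM M0_aut by auto
  have "Psi2 4 (Par (pair p q \<circ> pair q p)) = lev (Par k) (Suc 0) [La] + lev (Par j) (Suc 0) [La]"
    using kfix[of "[La]"] au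
    by (simp add: pair_comp Psi2_def Par_pair aut_comp) (simp add: p_def q_def pair_comp Par_pair aut_comp lev_comp lev_swap)
  moreover have "Psi2 4 (Par (pair q p \<circ> pair p q)) = lev (Par k) (Suc 0) [Lb] + lev (Par j) (Suc 0) [La]"
    using au
    by (simp add: pair_comp Psi2_def Par_pair aut_comp)
       (simp add: p_def q_def pair_comp Par_pair aut_comp lev_comp lev_swap, simp add: swap_def)
  ultimately have "bad 4 Psi2 (pair p q) (pair q p)" using g c3 by (simp add: bad_def k(9) kb)
  then have b: "bad 4 Psi2 (pair p q) (pair q p)" .
  obtain x where x: "x \<in> M0" "cc 0 x = 1" "cc (Suc 0) x = 0" "cc 2 x = 0" "\<theta> x = 1" "\<rho> x = 0"
    using M0_32[OF rs, of 1 0 0 1 0] by auto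
  have h: "pair x id \<in> M0" "pair id x \<in> M0" by (rule pair32; simp add: M0_id x sw)+
  have hv: "cc 0 (pair x id) = 0" "cc 0 (pair id x) = 0" "cc (Suc 0) (pair x id) = 1" "cc (Suc 0) (pair id x) = 1"
    "cc 2 (pair x id) = 0" "cc 2 (pair id x) = 0" "\<theta> (pair x id) = 0" "\<theta> (pair id x) = 1"
    "\<rho> (pair x id) = 1" "\<rho> (pair id x) = 1"
    by (simp_all add: cc_pair cc1 cc2 pair_32 M0_id x sw)
  have gv: "cc 0 (pair p q) = 0" "cc 0 (pair q p) = 0" "cc (Suc 0) (pair p q) = 0" "cc (Suc 0) (pair q p) = 0"
    "cc 2 (pair p q) = 1" "cc 2 (pair q p) = 1" "\<theta> (pair p q) = 1" "\<theta> (pair q p) = 0"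
    "\<rho> (pair p q) = \<theta> p + \<theta> q" "\<rho> (pair q p) = \<theta> p + \<theta> q"
    by (simp_all add: cc_pair cc1 cc2 pair_32 pM qM pv qv add.commute)
  have \<theta>q: "\<theta> q = 0" using k j by (simp add: q_def pair_32)
  let ?g = "pair (pair p q) (pair x id)" and ?g' = "pair (pair q p) (pair id x)"
  have G: "?g \<in> M0" "?g' \<in> M0" by (rule pair32; simp add: g h hv gv \<theta>q pv)+
  have "bad (Suc 4) Psi2 ?g ?g'"
  proof (rule bad_pair[OF b h _ G])
    show "Psi2 (Suc 4) (pairp p q) = Psi2 4 p + Psi2 4 q" for p q
      by (simp add: Psi2_def sum_words_Suc_Cons)
  qed (simp add: pair_comp)
  moreover have "cc 0 ?g = cc 0 ?g'" "cc (Suc 0) ?g = cc (Suc 0) ?g'" "cc 2 ?g = cc 2 ?g'" "\<theta> ?g = \<theta> ?g'" "\<rho> ?g = \<rho> ?g'"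
    by (simp_all add: cc_pair cc1 cc2 pair_32 g h hv gv)
  ultimately show ?case by (auto simp: eval_nat_numeral)
next
  case (Suc n)
  then obtain g g' where b: "bad (5 + n) Psi2 g g'" and e: "cc 0 g = cc 0 g'" "cc (Suc 0) g = cc (Suc 0) g'" "cc 2 g = cc 2 g'" "\<theta> g = \<theta> g'" "\<rho> g = \<rho> g'"
    by blast
  then have gM: "g \<in> M0" "g' \<in> M0" by (auto simp: bad_def)
  obtain h where h: "h \<in> M0" "cc (Suc 0) h = cc 2 g" "cc 2 h = cc (Suc 0) g" "\<rho> h = cc (Suc 0) g + cc 2 g + \<rho> g + cc (Suc 0) g * cc 2 g"
    using M0_32[OF rs, of 0 "cc 2 g" "cc (Suc 0) g" 0 "cc (Suc 0) g + cc 2 g + \<rho> g + cc (Suc 0) g * cc 2 g"] by auto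
  note pair32 = M0_pair_32[OF rs] and cc2 = cc_pair(1)[of _ _ "Suc 0", folded numeral_2_eq_2] and cc1 = cc_pair(1)[of _ _ 0]
  have p: "pair g h \<in> M0" "pair g' h \<in> M0"
    by (rule pair32; simp add: gM h e ac_simps)+
  have "bad (Suc (5 + n)) Psi2 (pair g h) (pair g' h)"
  proof (rule bad_pair[OF b h(1) h(1) refl p])
    show "Psi2 (Suc (5 + n)) (pairp p q) = Psi2 (5 + n) p + Psi2 (5 + n) q" for p q
      by (simp add: Psi2_def Suc_diff_le sum_words_Suc_Cons sum.distrib)
  qed
  moreover have "cc 0 (pair g h) = cc 0 (pair g' h)" "cc (Suc 0) (pair g h) = cc (Suc 0) (pair g' h)"
    "cc 2 (pair g h) = cc 2 (pair g' h)" "\<theta> (pair g h) = \<theta> (pair g' h)" "\<rho> (pair g h) = \<rho> (pair g' h)"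
    using gM h(1) e by (simp_all add: cc_pair cc1 cc2 pair_32)
  ultimately show ?case by auto
qed

end

section \<open>Characters of the groups, and the size of their finite quotients\<close>

lemma finite_Mt: "finite (Mt r s n)"
proof (rule finite_subset)
  show "Mt r s n \<subseteq> tree n \<rightarrow>\<^sub>E tree n"
    by (auto simp: Mt_def Mt_inf_def M_inf_def B_inf_def tree_def split: if_splits)
qed (auto intro: finite_PiE)

lemma UNIV_bit: "(UNIV :: bit set) = {0, 1}"
  by (auto intro: bit.exhaust)

lemma card_words_less: "card {w::word. length w < n} = 2 ^ n - 1" "finite {w::word. length w < n}"
proof -
  have e: "{w::word. length w < n} = (\<Union>m<n. words m)" by auto
  show "finite {w::word. length w < n}" unfolding e by auto
  have "card {w::word. length w < n} = (\<Sum>m<n. card (words m))"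
    unfolding e by (rule card_UN_disjoint) auto
  also have "\<dots> = 2 ^ n - 1" by (induction n) auto
  finally show "card {w::word. length w < n} = 2 ^ n - 1" .
qed

context params
begin

definition NN :: nat where
  "NN = r + e_shift r s"

text \<open>After the \<open>r\<close> level sums come the constants \<open>P\<close> and
  \<open>R\<close> of the element. For \<open>s = 1\<close> the constant \<open>P\<close> is 0, so
  that character \<open>r + 1\<close> is already \<open>R\<close>.\<close>

definition chi :: "nat \<Rightarrow> (word \<Rightarrow> word) \<Rightarrow> bit" where
  "chi i \<sigma> = (if i \<le> r then lev (Par \<sigma>) (i - 1) [] else if i = Suc r \<and> s \<noteq> 1 then Pc r s (Par \<sigma>) [] La
     else Rc r s (Par \<sigma>) [])"

lemma NN_cases:
  obtains (one) "s = 1" "NN = Suc r" | (two) "r = 3" "s = 2" "NN = 5" | (gen) "2 \<le> s" "4 \<le> r" "NN = Suc r"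
proof -
  consider "s = 1" | "r = 3 \<and> s = 2" | "2 \<le> s" "4 \<le> r" using s1 sr r3 by linarith
  then show ?thesis
  proof cases
    case 1
    then show ?thesis by (intro one) (unfold NN_def e_shift_def, simp_all)
  next
    case 2
    then show ?thesis by (intro two) (unfold NN_def e_shift_def, simp_all)
  next
    case 3
    then show ?thesis by (intro gen) (unfold NN_def e_shift_def, simp_all)
  qed
qed

lemma Phi_cases:
  "m < r \<Longrightarrow> Phi m f = lev f m []"
  "s \<noteq> 1 \<Longrightarrow> Phi r f = lev f (r - 1) [Lb]"
  "r \<le> m \<Longrightarrow> s \<noteq> 1 \<and> \<not> (r = 3 \<and> s = 2) \<and> r < m \<or> m = r \<and> s = 1 \<or> r = 3 \<and> s = 2 \<and> m = 4 \<Longrightarrow>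
    Phi m f = (\<Sum>u\<in>words (m - r + 1). lev f (r - 2) (u @ [Lb]))"
  "s = 1 \<Longrightarrow> r < m \<Longrightarrow> Phi m f = (\<Sum>x\<in>words (m - r). lev f (r - 2) (x @ [La, La]))"
  "r = 3 \<Longrightarrow> s = 2 \<Longrightarrow> 4 < m \<Longrightarrow>
    Phi m f = (\<Sum>x\<in>words (m - 4). lev f 1 (x @ [La, La, La]) + lev f 1 (x @ [La, Lb, La]))"
  unfolding Phi_def by auto

lemma chi_cases:
  "i \<le> r \<Longrightarrow> chi i \<sigma> = lev (Par \<sigma>) (i - 1) []"
  "s = 1 \<Longrightarrow> chi (Suc r) \<sigma> = Rc r s (Par \<sigma>) []"
  "s \<noteq> 1 \<Longrightarrow> chi (Suc r) \<sigma> = Pc r s (Par \<sigma>) [] La"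
  "r = 3 \<Longrightarrow> chi 5 \<sigma> = Rc r s (Par \<sigma>) []"
  unfolding chi_def by auto

lemma chi_comp:
  assumes "\<sigma> \<in> Mt_inf r s" "\<tau> \<in> Mt_inf r s"
  shows "chi i (\<sigma> \<circ> \<tau>) = chi i \<sigma> + chi i \<tau>"
proof -
  have a: "\<sigma> \<in> Aut_inf" "\<tau> \<in> Aut_inf" using assms M_aut by auto
  obtain P R where ok: "ok r s P R (Par \<sigma>)" using assms(1) by (auto simp: M_iff)
  have "P = Pc r s (Par \<sigma>) [] La" "R = Rc r s (Par \<sigma>) []" using ok by (auto simp: ok_def)
  then show ?thesis
    using ok_comp[OF s1 sr r3 a ok, of "[]"] lev_comp[OF a, of "i - 1" "[]"] a by (simp add: chi_def add.commute)
qed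

lemma lev_cong_level:
  assumes "\<And>w. length w < n \<Longrightarrow> p w = q w" "length u + m < n"
  shows "lev p m u = lev q m u"
  by (rule lev_cong) (use assms in simp)

lemma Pc_Rc_cong:
  assumes pq: "\<And>w. length w < n \<Longrightarrow> p w = q w"
  shows "r < n \<Longrightarrow> Pc r s p [] l = Pc r s q [] l"
    and "(if s = 1 then r else 4) < n \<Longrightarrow> Rc r s p [] = Rc r s q []"
proof -
  show "Pc r s p [] l = Pc r s q [] l" if "r < n"
    unfolding Pc_def using that s1 sr r3 by (intro arg_cong2[where f = "(+)"] lev_cong_level[OF pq]) auto
  show "Rc r s p [] = Rc r s q []" if n: "(if s = 1 then r else 4) < n"
  proof (cases "s = 1")
    case True
    have "lev p (r - 2) [l, l'] = lev q (r - 2) [l, l']" for l l'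
      using n r3 True by (intro lev_cong_level[OF pq]) auto
    moreover have "p [l] = q [l]" for l using n r3 True by (intro pq) auto
    ultimately show ?thesis using True by (simp add: Rc_def)
  next
    case False
    have "lev p 1 w = lev q 1 w" if "length w \<le> 3" for w
      using n False that by (intro lev_cong_level[OF pq]) auto
    moreover have "p w = q w" if "length w \<le> 3" for w using n False that by (intro pq) auto
    ultimately show ?thesis using False by (simp add: Rc_def)
  qed
qed

lemma chi_level:
  assumes "\<sigma> \<in> Mt_inf r s" "\<tau> \<in> Mt_inf r s" "i \<in> {1..NN}" "\<And>w. length w \<le> i \<Longrightarrow> \<sigma> w = \<tau> w"
  shows "chi i \<sigma> = chi i \<tau>"
proof -
  have a: "\<sigma> \<in> Aut_inf" "\<tau> \<in> Aut_inf" using assms M_aut by auto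
  have eq: "Par \<sigma> w = Par \<tau> w" if "length w < i" for w
    using aut_level_Par[OF a assms(4) that] .
  show ?thesis
  proof (cases "i \<le> r")
    case True
    then show ?thesis using assms(3) by (simp add: chi_def) (rule lev_cong_level[OF eq], auto)
  next
    case False
    have "s \<noteq> 1 \<Longrightarrow> i \<noteq> Suc r \<Longrightarrow> 4 < i" using False assms(3) by (cases rule: NN_cases) auto
    then have "s = 1 \<or> i \<noteq> Suc r \<Longrightarrow> (if s = 1 then r else 4) < i" using False by auto
    then have "s = 1 \<or> i \<noteq> Suc r \<Longrightarrow> Rc r s (Par \<sigma>) [] = Rc r s (Par \<tau>) []"
      by (intro Pc_Rc_cong(2)[OF eq])
    moreover have "Pc r s (Par \<sigma>) [] La = Pc r s (Par \<tau>) [] La"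
      using False by (intro Pc_Rc_cong(1)[OF eq]) auto
    ultimately show ?thesis using False unfolding chi_def by (simp only: if_False simp_thms split: if_split) blast
  qed
qed

lemma halves:
  assumes "\<sigma> \<in> stabM m" "r < m" "length u = m - r + 1"
  shows "lev (Par \<sigma>) (r - 2) (u @ [l]) = lev (Par \<sigma>) (r - 2) (u @ [Lb])"
proof -
  have "lev (Par \<sigma>) (r - 1) u = 0" by (rule stab_block[OF assms(1,2)]) (use assms r3 in auto)
  moreover have "r - 1 = Suc (r - 2)" using r3 by simp
  ultimately have "lev (Par \<sigma>) (r - 2) (u @ [La]) = lev (Par \<sigma>) (r - 2) (u @ [Lb])"
    using lev_Suc[of "Par \<sigma>" "r - 2" u] by (simp add: bit_add_0_iff)
  then show ?thesis by (cases l) auto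
qed

lemma block_r_1:
  assumes "\<sigma> \<in> stabM r" "s = 1" "length u = 1"
  shows "lev (Par \<sigma>) (r - 1) u = 0"
proof -
  obtain P R where ok: "ok r s P R (Par \<sigma>)" using stab_ok[OF assms(1)] by blast
  obtain l where u: "u = [l]" using assms(3) by (auto simp: length_Suc_conv)
  have "Pc r s (Par \<sigma>) [] l = 0" using ok assms(2) by (simp add: ok_def)
  moreover have "Par \<sigma> [other l] = 0" using stab_Par_low[OF assms(1)] r3 by simp
  ultimately show ?thesis using assms(2) by (simp add: Pc_def u)
qed

text \<open>On the stabilizer only the deepest part of an equation at the root survives, so that its
  constant becomes a single block or a sum of half blocks.\<close>

lemma Phi_low:
  assumes "m < NN" "\<sigma> \<in> stabM m"
  shows "Phi m (Par \<sigma>) = chi (Suc m) \<sigma>"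
proof -
  have low: "Par \<sigma> w = 0" if "length w < m" for w using stab_Par_low[OF assms(2) that] .
  consider "m < r" | "m = r" "s \<noteq> 1" | "m = r" "s = 1" | "r = 3" "s = 2" "m = 4"
    using assms(1) by (cases rule: NN_cases) linarith+
  then show ?thesis
  proof cases
    case 1
    then show ?thesis by (simp add: Phi_cases(1) chi_cases(1))
  next
    case 2
    have "lev (Par \<sigma>) (s - 1) [Lb] = 0"
      using 2 assms(2) s1 sr by (intro stab_lev_low[OF assms(2)]) auto
    then show ?thesis
      unfolding 2(1) Phi_cases(2)[OF 2(2)] chi_cases(3)[OF 2(2)] Pc_def using 2 assms(2) stab_block_top by simp
  next
    case 3
    have b: "r \<le> m" "s \<noteq> 1 \<and> \<not> (r = 3 \<and> s = 2) \<and> r < m \<or> m = r \<and> s = 1 \<or> r = 3 \<and> s = 2 \<and> m = 4"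
      using 3 by auto
    show ?thesis
      unfolding Phi_cases(3)[OF b] unfolding 3(1) chi_cases(2)[OF 3(2)] Rc_def
      using r3 low 3 by (simp add: sum_words_Suc_Cons)
  next
    case 4
    have "lev (Par \<sigma>) 1 (u @ [La]) = lev (Par \<sigma>) 1 (u @ [Lb])" if "length u = 2" for u
      using halves[OF assms(2), of u La] that 4 by simp
    then have "(\<Sum>w\<in>words 2. lev (Par \<sigma>) 1 (w @ [La])) = (\<Sum>w\<in>words 2. lev (Par \<sigma>) 1 (w @ [Lb]))"
      by (intro sum.cong) auto
    moreover have "lev (Par \<sigma>) 1 [l] = 0" for l using 4 by (intro stab_lev_low[OF assms(2)]) auto
    moreover have b: "r \<le> m" "s \<noteq> 1 \<and> \<not> (r = 3 \<and> s = 2) \<and> r < m \<or> m = r \<and> s = 1 \<or> r = 3 \<and> s = 2 \<and> m = 4"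
      using 4 by auto
    moreover have m5: "Suc m = 5" using 4 by simp
    ultimately show ?thesis
      unfolding Phi_cases(3)[OF b] m5 chi_cases(4)[OF 4(1)] Rc_def using 4 low by (simp add: numeral_2_eq_2)
  qed
qed

lemma Phi_invariant:
  assumes "NN \<le> m" "\<sigma> \<in> stabM m" "\<tau> \<in> Mt_inf r s"
  shows "Phi m (\<lambda>w. Par \<sigma> (\<tau> w)) = Phi m (Par \<sigma>)"
proof -
  have a: "\<tau> \<in> Aut_inf" using assms(3) by (rule M_aut)
  have lt: "lev (\<lambda>w. Par \<sigma> (\<tau> w)) k u = lev (Par \<sigma>) k (\<tau> u)" for k u
    by (simp add: lev_def sum_below_aut[OF a])
  have rm: "r < m" using assms(1) by (cases rule: NN_cases) auto
  show ?thesis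
    using assms(1)
  proof (cases rule: NN_cases)
    case gen
    have "(\<Sum>u\<in>words (m - r + 1). lev (Par \<sigma>) (r - 2) (\<tau> (u @ [Lb]))) =
        (\<Sum>u\<in>words (m - r + 1). lev (Par \<sigma>) (r - 2) (\<tau> u @ [Lb]))"
    proof (intro sum.cong refl)
      fix u assume "u \<in> words (m - r + 1)"
      then show "lev (Par \<sigma>) (r - 2) (\<tau> (u @ [Lb])) = lev (Par \<sigma>) (r - 2) (\<tau> u @ [Lb])"
        unfolding aut_snoc[OF a] by (intro halves[OF assms(2) rm]) (simp add: a)
    qed
    also have "\<dots> = (\<Sum>u\<in>words (m - r + 1). lev (Par \<sigma>) (r - 2) (u @ [Lb]))"
      by (rule sum_words_aut[OF a])
    finally have e: "(\<Sum>u\<in>words (m - r + 1). lev (Par \<sigma>) (r - 2) (\<tau> (u @ [Lb]))) =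
      (\<Sum>u\<in>words (m - r + 1). lev (Par \<sigma>) (r - 2) (u @ [Lb]))" .
    have b: "r \<le> m" "s \<noteq> 1 \<and> \<not> (r = 3 \<and> s = 2) \<and> r < m \<or> m = r \<and> s = 1 \<or> r = 3 \<and> s = 2 \<and> m = 4"
      using gen rm by auto
    show ?thesis unfolding Phi_cases(3)[OF b] lt by (rule e)
  next
    case one
    have eq: "lev (Par \<sigma>) (r - 2) (x @ [l, l']) = lev (Par \<sigma>) (r - 2) (x @ [La, La])" if "length x = m - r" for x l l'
    proof -
      have "lev (Par \<sigma>) (r - 2) (x @ [l, l']) = lev (Par \<sigma>) (r - 2) (x @ [l, Lb])" for l l'
        using halves[OF assms(2) rm, of "x @ [l]" l'] that by simp
      moreover have "lev (Par \<sigma>) (r - 2) (x @ [La, Lb]) = lev (Par \<sigma>) (r - 2) (x @ [Lb, Lb])"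
        using stab_R_1[OF assms(2) one(1) rm, of x] that rm by simp
      ultimately show ?thesis by (metis letter.exhaust)
    qed
    have "(\<Sum>x\<in>words (m - r). lev (Par \<sigma>) (r - 2) (\<tau> (x @ [La, La]))) =
        (\<Sum>x\<in>words (m - r). lev (Par \<sigma>) (r - 2) (\<tau> x @ [La, La]))"
    proof (intro sum.cong refl)
      fix x assume "x \<in> words (m - r)"
      then show "lev (Par \<sigma>) (r - 2) (\<tau> (x @ [La, La])) = lev (Par \<sigma>) (r - 2) (\<tau> x @ [La, La])"
        unfolding turn_pair[OF assms(3)] by (intro eq) (simp add: a)
    qed
    also have "\<dots> = (\<Sum>x\<in>words (m - r). lev (Par \<sigma>) (r - 2) (x @ [La, La]))"
      by (rule sum_words_aut[OF a])
    finally show ?thesis unfolding Phi_cases(4)[OF one(1) rm] lt .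
  next
    case two
    have m: "4 < m" using two assms(1) by simp
    define p where "p u = lev (Par \<sigma>) 1 (u @ [La])" for u
    have pb: "lev (Par \<sigma>) 1 (u @ [l]) = p u" if "length u = m - 2" for u l
    proof -
      have h: "lev (Par \<sigma>) 1 (u @ [l]) = lev (Par \<sigma>) 1 (u @ [Lb])" for l
        using halves[OF assms(2) rm, of u l] that two m by simp
      show ?thesis unfolding p_def h[of l] h[of La] ..
    qed
    define Q where "Q x = p (x @ [La, La]) + p (x @ [La, Lb])" for x
    have Q: "p (x @ [Lb, La]) + p (x @ [Lb, Lb]) = Q x" if "length x = m - 4" for x
    proof -
      have "(\<Sum>w\<in>words 2. p (x @ w)) = 0"
        using stab_R_32[OF assms(2) two(1,2) m, of x] that m by (simp add: p_def)
      then show ?thesis by (simp add: numeral_2_eq_2 sum_words_Suc_Cons bit_add_0_iff Q_def)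
    qed
    have "lev (Par \<sigma>) 1 (\<tau> (x @ [La, La, La])) + lev (Par \<sigma>) 1 (\<tau> (x @ [La, Lb, La])) = Q (\<tau> x)"
      if x: "length x = m - 4" for x
    proof -
      have e: "lev (Par \<sigma>) 1 (\<tau> (x @ [La, l, La])) = p (\<tau> x @ [turn (Par \<tau> x) La, turn (Par \<tau> (x @ [La])) l])" for l
        using aut_snoc[OF a, of "x @ [La, l]" La] x m a pb[of "\<tau> x @ [turn (Par \<tau> x) La, turn (Par \<tau> (x @ [La])) l]"]
        by (simp add: turn_pair[OF assms(3)])
      show ?thesis unfolding e using Q[of "\<tau> x"] x a
        by (cases "Par \<tau> x"; cases "Par \<tau> (x @ [La])") (simp_all add: Q_def add.commute)
    qed
    then have "(\<Sum>x\<in>words (m - 4). lev (Par \<sigma>) 1 (\<tau> (x @ [La, La, La])) + lev (Par \<sigma>) 1 (\<tau> (x @ [La, Lb, La]))) =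
        (\<Sum>x\<in>words (m - 4). Q (\<tau> x))" by (intro sum.cong refl) simp
    also have "\<dots> = (\<Sum>x\<in>words (m - 4). Q x)" by (rule sum_words_aut[OF a])
    finally show ?thesis unfolding Phi_cases(5)[OF two(1,2) m] lt Q_def p_def by simp
  qed
qed

lemma Phi_add: "Phi m (\<lambda>w. f w + g w) = Phi m f + Phi m g"
  by (simp add: Phi_def lev_add sum.distrib ac_simps)

lemma Phi_level:
  assumes fg: "\<And>w. length w = m \<Longrightarrow> f w = g w"
  shows "Phi m f = Phi m g"
proof -
  have l: "lev f k u = lev g k u" if "length u + k = m" for k u
    by (rule lev_cong) (use fg that in simp)
  consider "m < r" | "m = r" "s \<noteq> 1" | "r \<le> m" "s \<noteq> 1 \<and> \<not> (r = 3 \<and> s = 2) \<and> r < m \<or> m = r \<and> s = 1 \<or> r = 3 \<and> s = 2 \<and> m = 4"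
    | "r < m" "s = 1" | "r < m" "r = 3" "s = 2" "m \<noteq> 4"
    by fastforce
  then show ?thesis
  proof cases
    case 1
    then show ?thesis by (simp add: Phi_cases(1) l)
  next
    case 2
    then show ?thesis using r3 by (simp add: Phi_cases(2) l)
  next
    case 3
    have "(\<Sum>u\<in>words (m - r + 1). lev f (r - 2) (u @ [Lb])) = (\<Sum>u\<in>words (m - r + 1). lev g (r - 2) (u @ [Lb]))"
      using 3 r3 by (intro sum.cong refl l) auto
    then show ?thesis unfolding Phi_cases(3)[OF 3] .
  next
    case 4
    have "(\<Sum>x\<in>words (m - r). lev f (r - 2) (x @ [La, La])) = (\<Sum>x\<in>words (m - r). lev g (r - 2) (x @ [La, La]))"
      using 4 r3 by (intro sum.cong refl l) auto
    then show ?thesis unfolding Phi_cases(4)[OF 4(2,1)] .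
  next
    case 5
    have "(\<Sum>x\<in>words (m - 4). lev f 1 (x @ [La, La, La]) + lev f 1 (x @ [La, Lb, La])) =
        (\<Sum>x\<in>words (m - 4). lev g 1 (x @ [La, La, La]) + lev g 1 (x @ [La, Lb, La]))"
      using 5 by (intro sum.cong refl arg_cong2[where f = "(+)"] l) auto
    moreover have "4 < m" using 5 by simp
    ultimately show ?thesis by (simp only: Phi_cases(5)[OF 5(2,3)])
  qed
qed

lemma invariant_functionals:
  assumes inv: "invariant m f"
  shows "\<exists>c. \<forall>\<sigma>\<in>stabM m. (\<Sum>w\<in>words m. f w * Par \<sigma> w) = c * Phi m (Par \<sigma>)"
proof -
  consider "m < r" | "m = r" "s \<noteq> 1" | "r \<le> m" "s \<noteq> 1 \<and> \<not> (r = 3 \<and> s = 2) \<and> r < m \<or> m = r \<and> s = 1 \<or> r = 3 \<and> s = 2 \<and> m = 4"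
    | "r < m" "s = 1" | "r < m" "r = 3" "s = 2" "m \<noteq> 4"
    by fastforce
  then show ?thesis
  proof cases
    case 1
    then show ?thesis using invariants_low[OF 1 inv] by (simp add: Phi_cases(1))
  next
    case 2
    then show ?thesis using invariants_top[OF 2(2)] inv by (simp add: Phi_cases(2))
  next
    case 3
    have "\<exists>c. \<forall>\<sigma>\<in>stabM m. (\<Sum>w\<in>words m. f w * Par \<sigma> w) = c * (\<Sum>u\<in>words (m - r + 1). lev (Par \<sigma>) (r - 2) (u @ [Lb]))"
    proof (rule invariants_block[OF _ _ _ _ inv])
      fix \<sigma> and u :: word assume \<sigma>: "\<sigma> \<in> stabM m" and u: "length u = m - r + 1"
      show "lev (Par \<sigma>) (r - 1) u = 0"
      proof (cases "m = r")
        case True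
        then show ?thesis using block_r_1[of \<sigma> u] 3 \<sigma> u by auto
      next
        case False
        show ?thesis by (rule stab_block[OF \<sigma>]) (use False 3 u r3 in auto)
      qed
    qed (use 3 in auto)
    then show ?thesis unfolding Phi_cases(3)[OF 3] .
  next
    case 4
    show ?thesis using invariants_quad_1[OF 4(2,1) inv] unfolding Phi_cases(4)[OF 4(2,1)] .
  next
    case 5
    have m: "4 < m" using 5 by simp
    show ?thesis using invariants_quad_32[OF 5(2,3) m inv] unfolding Phi_cases(5)[OF 5(2,3) m] .
  qed
qed

lemma commutators:
  assumes "NN \<le> m"
  shows "\<exists>g\<in>Mt_inf r s. \<exists>h\<in>Mt_inf r s. (\<forall>w. length w \<le> m \<longrightarrow> g (h w) = h (g w)) \<and>
    Phi m (Par (g \<circ> h)) \<noteq> Phi m (Par (h \<circ> g))"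
proof -
  have "\<exists>g h. bad m Phi g h"
    using assms
  proof (cases rule: NN_cases)
    case gen
    then obtain g h where "bad m Psi g h" using bad_generic[of "m - (r - 1)"] assms r3 by auto
    moreover have "Phi m f = Psi m f" for f
      using gen assms by (simp add: Phi_cases(3) Psi_def Suc_diff_le)
    ultimately show ?thesis by (auto simp: bad_def)
  next
    case one
    then obtain g h where "bad m Psi1 g h" using bad_1[OF one(1), of "m - r"] assms by auto
    moreover have "Phi m f = Psi1 m f" for f
      unfolding Psi1_def by (rule Phi_cases(4)) (use one assms in auto)
    ultimately show ?thesis by (auto simp: bad_def)
  next
    case two
    then obtain g h where "bad m Psi2 g h" using bad_32[OF two(1,2), of "m - 5"] assms by auto
    moreover have "Phi m f = Psi2 m f" for f
      unfolding Psi2_def by (rule Phi_cases(5)) (use two assms in auto)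
    ultimately show ?thesis by (auto simp: bad_def)
  qed
  then show ?thesis using M0_M by (auto simp: bad_def)
qed

sublocale tree_group "Mt_inf r s" NN chi Phi
proof
  show "Mt_inf r s \<subseteq> Aut_inf" using M_aut by auto
  show "id \<in> Mt_inf r s" by (rule M_id)
  show "\<sigma> \<circ> \<tau> \<in> Mt_inf r s" if "\<sigma> \<in> Mt_inf r s" "\<tau> \<in> Mt_inf r s" for \<sigma> \<tau> using that by (rule M_comp)
  show "inv_into UNIV \<sigma> \<in> Mt_inf r s" if "\<sigma> \<in> Mt_inf r s" for \<sigma> using that by (rule M_inv)
  show "chi i (\<sigma> \<circ> \<tau>) = chi i \<sigma> + chi i \<tau>" if "\<sigma> \<in> Mt_inf r s" "\<tau> \<in> Mt_inf r s" for \<sigma> \<tau> i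
    using that by (rule chi_comp)
  show "chi i \<sigma> = chi i \<tau>" if "\<sigma> \<in> Mt_inf r s" "\<tau> \<in> Mt_inf r s" "i \<in> {1..NN}" "\<And>w. length w \<le> i \<Longrightarrow> \<sigma> w = \<tau> w" for \<sigma> \<tau> i
    using that by (rule chi_level)
  show "Phi m (\<lambda>w. f w + g w) = Phi m f + Phi m g" for m f g by (rule Phi_add)
  show "Phi m f = Phi m g" if "\<And>w. length w = m \<Longrightarrow> f w = g w" for m f g using that by (rule Phi_level)
  show "Phi m (Par \<sigma>) = chi (Suc m) \<sigma>" if "m < NN" "\<sigma> \<in> Mt_inf r s" "\<And>w. length w \<le> m \<Longrightarrow> \<sigma> w = w" for m \<sigma>
    using that by (intro Phi_low) (auto simp: stabM_def)
  show "Phi m (\<lambda>w. Par \<sigma> (\<tau> w)) = Phi m (Par \<sigma>)"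
    if "NN \<le> m" "\<sigma> \<in> Mt_inf r s" "\<And>w. length w \<le> m \<Longrightarrow> \<sigma> w = w" "\<tau> \<in> Mt_inf r s" for m \<sigma> \<tau>
    using that by (intro Phi_invariant) (auto simp: stabM_def)
  show "\<exists>c. \<forall>\<sigma>\<in>Mt_inf r s. (\<forall>w. length w \<le> m \<longrightarrow> \<sigma> w = w) \<longrightarrow> (\<Sum>w\<in>words m. f w * Par \<sigma> w) = c * Phi m (Par \<sigma>)"
    if "\<And>\<sigma> \<tau>. \<sigma> \<in> Mt_inf r s \<Longrightarrow> (\<And>w. length w \<le> m \<Longrightarrow> \<sigma> w = w) \<Longrightarrow> \<tau> \<in> Mt_inf r s \<Longrightarrow>
          (\<Sum>w\<in>words m. f (\<tau> w) * Par \<sigma> w) = (\<Sum>w\<in>words m. f w * Par \<sigma> w)" for m f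
  proof -
    have "invariant m f" using that by (auto simp: invariant_def stabM_def)
    then show ?thesis using invariant_functionals[of m f] by (auto simp: stabM_def)
  qed
  show "\<exists>g\<in>Mt_inf r s. \<exists>h\<in>Mt_inf r s. (\<forall>w. length w \<le> m \<longrightarrow> g (h w) = h (g w)) \<and>
    Phi m (Par (g \<circ> h)) \<noteq> Phi m (Par (h \<circ> g))" if "NN \<le> m" for m using that by (rule commutators)
qed

lemma chi_surj: "\<exists>\<sigma>\<in>Mt_inf r s. \<forall>i\<in>{1..NN}. chi i \<sigma> = e i"
proof -
  define P where "P = (if s = 1 then 0 else e (Suc r))"
  define R where "R = (if s = 1 then e (Suc r) else if r = 3 \<and> s = 2 then e 5 else 0)"
  \<comment> \<open>One node per level, on the path of letters \<open>b\<close>, carries the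
    prescribed level sum.\<close>
  define q where "q w = (if w = bs (length w) then e (Suc (length w)) else 0)" for w
  obtain \<sigma> where \<sigma>: "\<sigma> \<in> Mt_inf r s" "ok r s P R (Par \<sigma>)" "\<And>w. \<not> SP r w \<Longrightarrow> \<not> SR r s w \<Longrightarrow> Par \<sigma> w = q w"
    by (rule prescribe[of P R 0 q]) (auto simp: P_def R_def)
  have low: "Par \<sigma> w = q w" if "length w < r" for w
    using SP_length[of w] SR_length[of w] that by (intro \<sigma>(3)) auto
  have "chi i \<sigma> = e i" if i: "i \<in> {1..NN}" for i
  proof (cases "i \<le> r")
    case True
    have "lev (Par \<sigma>) (i - 1) [] = (\<Sum>w\<in>words (i - 1). if w = bs (i - 1) then e i else 0)"
      unfolding lev_def using True i by (intro sum.cong) (auto simp: low q_def)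
    also have "\<dots> = e i" by simp
    finally show ?thesis using True by (simp add: chi_def)
  next
    case False
    have "Pc r s (Par \<sigma>) [] La = P" "Rc r s (Par \<sigma>) [] = R" using \<sigma>(2) by (auto simp: ok_def)
    note PR = this
    show ?thesis
    proof (cases rule: NN_cases)
      case one
      then have "i = Suc r" using False i by simp
      then show ?thesis using chi_cases(2)[OF one(1), of \<sigma>] PR one by (simp add: R_def)
    next
      case two
      then have "i = Suc r \<or> i = 5" "s \<noteq> 1" using False i by auto
      then show ?thesis using chi_cases(3)[of \<sigma>] chi_cases(4)[OF two(1), of \<sigma>] PR two(1,2) by (auto simp: P_def R_def)
    next
      case gen
      then have "i = Suc r" "s \<noteq> 1" using False i by auto
      then show ?thesis using chi_cases(3)[of \<sigma>] PR by (simp add: P_def)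
    qed
  qed
  then show ?thesis using \<sigma>(1) by blast
qed

lemma card_special:
  "card {w. length w < NN \<and> (SP r w \<or> SR r s w)} \<le>
    (if r = 3 \<and> s = 2 then 6 else 2) + (if s = 1 \<or> r = 3 \<and> s = 2 then 1 else 0)"
proof -
  define U where "U = {u::word. u \<noteq> [] \<and> length u \<le> e_shift r s}"
  have U: "card U = (if r = 3 \<and> s = 2 then 6 else 2)" "finite U"
  proof -
    have e: "U = {w::word. length w < Suc (e_shift r s)} - {[]}" by (auto simp: U_def)
    show "finite U" unfolding e using card_words_less(2) by blast
    have "card U = 2 ^ Suc (e_shift r s) - 1 - 1"
      unfolding e using card_words_less[of "Suc (e_shift r s)"] by (subst card_Diff_subset) auto
    then show "card U = (if r = 3 \<and> s = 2 then 6 else 2)" by (simp add: e_shift_def)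
  qed
  have "{w. length w < NN \<and> SP r w} \<subseteq> (\<lambda>u. u @ replicate (r - 1) La) ` U"
    using r3 by (auto simp: SP_def U_def NN_def)
  then have "card {w. length w < NN \<and> SP r w} \<le> card ((\<lambda>u. u @ replicate (r - 1) La) ` U)"
    by (intro card_mono finite_imageI U)
  then have c1: "card {w. length w < NN \<and> SP r w} \<le> (if r = 3 \<and> s = 2 then 6 else 2)"
    using card_image_le[OF U(2), of "\<lambda>u. u @ replicate (r - 1) La"] U(1) by linarith
  have "{w. length w < NN \<and> SR r s w} \<subseteq> (if s = 1 \<or> r = 3 \<and> s = 2 then {rtail r s} else {})"
  proof
    fix w assume "w \<in> {w. length w < NN \<and> SR r s w}"
    then obtain x where w: "length w < NN" "s = 1 \<or> r = 3 \<and> s = 2" "w = x @ rtail r s" by (auto simp: SR_def)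
    then have "NN \<le> length (rtail r s) + 1" using r3 by (cases rule: NN_cases) (auto simp: length_rtail)
    then have "x = []" using w by (cases x) auto
    then show "w \<in> (if s = 1 \<or> r = 3 \<and> s = 2 then {rtail r s} else {})" using w by simp
  qed
  then have "card {w. length w < NN \<and> SR r s w} \<le> card (if s = 1 \<or> r = 3 \<and> s = 2 then {rtail r s} else {})"
    by (intro card_mono) auto
  moreover have "card (if s = 1 \<or> r = 3 \<and> s = 2 then {rtail r s} else {}) = (if s = 1 \<or> r = 3 \<and> s = 2 then 1 else 0)"
    by simp
  ultimately have c2: "card {w. length w < NN \<and> SR r s w} \<le> (if s = 1 \<or> r = 3 \<and> s = 2 then 1 else 0)"
    by (simp only:)
  have e: "{w. length w < NN \<and> (SP r w \<or> SR r s w)} = {w. length w < NN \<and> SP r w} \<union> {w. length w < NN \<and> SR r s w}" by auto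
  show ?thesis unfolding e by (rule order_trans[OF card_Un_le add_mono[OF c1 c2]])
qed

text \<open>The free parities below level \<open>NN\<close> and the constants \<open>P\<close>,
  \<open>R\<close> can be chosen independently and are recovered from the restriction. Of the
  \<open>2 ^ NN - 1\<close> nodes, 2 or 6 are solved for \<open>Pc\<close>; the single node solved
  for \<open>Rc\<close> is balanced by the choice of \<open>R\<close>, and the choice of
  \<open>P\<close> adds one bit unless \<open>s = 1\<close>. The estimate is set against the count
  in \<open>degenerate\<close>.\<close>

lemma card_Mt_ge:
  "card (Mt r s NN) \<ge> 2 ^ (2 ^ NN - 1 - (if r = 3 \<and> s = 2 then 6 else 2) + (if s = 1 then 0 else 1))"
proof -
  define A where "A = {w::word. length w < NN \<and> \<not> SP r w \<and> \<not> SR r s w}"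
  define PP where "PP = (if s = 1 then {0} else UNIV :: bit set)"
  define RR where "RR = (if s = 1 \<or> r = 3 \<and> s = 2 then UNIV else {0} :: bit set)"
  have rN: "r < NN" "(if s = 1 then r else 4) < NN \<or> s \<noteq> 1 \<and> \<not> (r = 3 \<and> s = 2)" by (cases rule: NN_cases; simp)+
  have finA: "finite A" unfolding A_def by (rule finite_subset[OF _ card_words_less(2)[of NN]]) auto
  have "\<exists>\<sigma>\<in>Mt_inf r s. ok r s P R (Par \<sigma>) \<and> (\<forall>w\<in>A. Par \<sigma> w = (if w \<in> B then 1 else 0))"
    if PR: "P \<in> PP" "R \<in> RR" for B P R
  proof -
    obtain \<sigma> where "\<sigma> \<in> Mt_inf r s" "ok r s P R (Par \<sigma>)" "\<And>w. \<not> SP r w \<Longrightarrow> \<not> SR r s w \<Longrightarrow> Par \<sigma> w = (if w \<in> B then 1 else 0)"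
      by (rule prescribe[of P R 0 "\<lambda>w. if w \<in> B then 1 else 0"]) (use PR in \<open>auto simp: PP_def RR_def split: if_splits\<close>)
    then show ?thesis by (auto simp: A_def)
  qed
  note ex = this
  define Q where "Q B P R \<sigma> \<longleftrightarrow> \<sigma> \<in> Mt_inf r s \<and> ok r s P R (Par \<sigma>) \<and>
      (\<forall>w\<in>A. Par \<sigma> w = (if w \<in> B then 1 else 0))" for B P R \<sigma>
  define S where "S B P R = (SOME \<sigma>. Q B P R \<sigma>)" for B P R
  have SQ: "Q B P R (S B P R)" if "P \<in> PP" "R \<in> RR" for B P R
  proof -
    have "\<exists>\<sigma>. Q B P R \<sigma>" using ex[OF that, of B] unfolding Q_def by blast
    then show ?thesis unfolding S_def by (rule someI_ex)
  qed
  note S = SQ[unfolded Q_def]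
  define F where "F = (\<lambda>(B, P, R). restrict (S B P R) (tree NN))"
  have "inj_on F (Pow A \<times> PP \<times> RR)"
  proof (rule inj_onI)
    fix a b assume ab: "a \<in> Pow A \<times> PP \<times> RR" "b \<in> Pow A \<times> PP \<times> RR" "F a = F b"
    obtain B P R where a: "a = (B, P, R)" by (cases a)
    obtain B' P' R' where b: "b = (B', P', R')" by (cases b)
    have B: "B \<subseteq> A" "B' \<subseteq> A" and PR: "P \<in> PP" "R \<in> RR" "P' \<in> PP" "R' \<in> RR"
      using ab(1,2) unfolding a b by blast+
    have e: "F (B, P, R) = F (B', P', R')" using ab(3) unfolding a b .
    note S1 = S[OF PR(1,2), of B] and S2 = S[OF PR(3,4), of B']
    have au: "S B P R \<in> Aut_inf" "S B' P' R' \<in> Aut_inf" using S1 S2 M_aut by auto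
    have "S B P R w = S B' P' R' w" if "length w \<le> NN" for w
      using fun_cong[OF e, of w] that by (simp add: F_def tree_def)
    then have p: "Par (S B P R) w = Par (S B' P' R') w" if "length w < NN" for w
      using aut_level_Par[OF au _ that] by blast
    have "w \<in> B \<longleftrightarrow> w \<in> B'" if "w \<in> A" for w
    proof -
      have "Par (S B P R) w = Par (S B' P' R') w" using p that by (simp add: A_def)
      then show ?thesis using S1 S2 that by (auto split: if_splits)
    qed
    then have "B = B'" using B by blast
    moreover have "P = P'"
    proof -
      have "Pc r s (Par (S B P R)) [] La = Pc r s (Par (S B' P' R')) [] La"
        by (rule Pc_Rc_cong(1)[OF _ rN(1)]) (rule p)
      then show ?thesis using S1 S2 by (simp add: ok_def)
    qed
    moreover have "R = R'"
    proof (cases "s \<noteq> 1 \<and> \<not> (r = 3 \<and> s = 2)")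
      case True
      then show ?thesis using PR by (auto simp: RR_def)
    next
      case False
      then have "(if s = 1 then r else 4) < NN" using rN(2) by blast
      then have "Rc r s (Par (S B P R)) [] = Rc r s (Par (S B' P' R')) []"
        by (intro Pc_Rc_cong(2)[of NN]) (rule p)
      then show ?thesis using S1 S2 by (simp add: ok_def)
    qed
    ultimately show "a = b" by (simp add: a b)
  qed
  moreover have "F ` (Pow A \<times> PP \<times> RR) \<subseteq> Mt r s NN"
    using S by (auto simp: F_def Mt_def)
  ultimately have "card (Pow A \<times> PP \<times> RR) \<le> card (Mt r s NN)"
    by (rule card_inj_on_le[OF _ _ finite_Mt])
  moreover have "card (Pow A \<times> PP \<times> RR) = 2 ^ (card A + (if s = 1 then 0 else 1) + (if s = 1 \<or> r = 3 \<and> s = 2 then 1 else 0))"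
    by (simp add: card_cartesian_product card_Pow[OF finA] PP_def RR_def UNIV_bit power_add)
  moreover have "2 ^ NN - 1 - (if r = 3 \<and> s = 2 then 6 else 2) + (if s = 1 then 0 else 1)
      \<le> card A + (if s = 1 then 0 else 1) + (if s = 1 \<or> r = 3 \<and> s = 2 then 1 else 0)"
  proof -
    have "A = {w. length w < NN} - {w. length w < NN \<and> (SP r w \<or> SR r s w)}" by (auto simp: A_def)
    then have "card A = card {w::word. length w < NN} - card {w. length w < NN \<and> (SP r w \<or> SR r s w)}"
      using card_words_less(2)[of NN] by (simp add: card_Diff_subset_Int Int_absorb1 Collect_mono_iff)
    then show ?thesis using card_special card_words_less(1)[of NN] by linarith
  qed
  ultimately have up: "card (Pow A \<times> PP \<times> RR) \<le> card (Mt r s NN)"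
    and eq: "card (Pow A \<times> PP \<times> RR) = 2 ^ (card A + (if s = 1 then 0 else 1) + (if s = 1 \<or> r = 3 \<and> s = 2 then 1 else 0))"
    and le: "2 ^ NN - 1 - (if r = 3 \<and> s = 2 then 6 else 2) + (if s = 1 then 0 else 1)
      \<le> card A + (if s = 1 then 0 else 1) + (if s = 1 \<or> r = 3 \<and> s = 2 then 1 else 0)"
    by blast+
  show ?thesis
    by (rule order_trans[OF _ up]) (unfold eq, rule power_increasing[OF le], rule one_le_numeral)
qed

end

section \<open>Towers of quadratic extensions\<close>

text \<open>Subfields as sets of elements of a type class field, so that ordinary field arithmetic
  applies; \<open>sfield_subfield\<close> connects them with the dimension theory of
  \<open>HOL-Algebra\<close>.\<close>

definition sfield :: "'b::field set \<Rightarrow> bool" where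
  "sfield E \<longleftrightarrow> 1 \<in> E \<and> (\<forall>x\<in>E. \<forall>y\<in>E. x + y \<in> E \<and> x * y \<in> E) \<and> (\<forall>x\<in>E. - x \<in> E \<and> inverse x \<in> E)"

text \<open>An embedding of \<open>E\<close> into the ambient field: the image may leave
  \<open>E\<close>, and nothing is said about values outside \<open>E\<close>.\<close>

definition hom_on :: "'b::field set \<Rightarrow> ('b \<Rightarrow> 'b) \<Rightarrow> bool" where
  "hom_on E \<tau> \<longleftrightarrow> \<tau> 1 = 1 \<and> (\<forall>x\<in>E. \<forall>y\<in>E. \<tau> (x + y) = \<tau> x + \<tau> y \<and> \<tau> (x * y) = \<tau> x * \<tau> y)"

abbreviation rta :: "'b::field ring" where
  "rta \<equiv> ring_of_type_algebra"

lemma rta_simps [simp]: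
  "carrier (rta :: 'b::field ring) = UNIV" "\<one>\<^bsub>rta :: 'b ring\<^esub> = 1" "\<zero>\<^bsub>rta :: 'b ring\<^esub> = 0"
  "x \<oplus>\<^bsub>rta :: 'b ring\<^esub> y = x + y" "x \<otimes>\<^bsub>rta :: 'b ring\<^esub> y = x * y"
  by (simp_all add: ring_of_type_algebra_def)

lemma rta_inverses [simp]:
  fixes x :: "'b::field"
  shows "\<ominus>\<^bsub>rta\<^esub> x = - x" "x \<noteq> 0 \<Longrightarrow> inv\<^bsub>rta\<^esub> x = inverse x"
proof -
  interpret R: field "rta :: 'b ring" by (rule field_from_type_algebra)
  show "\<ominus>\<^bsub>rta\<^esub> x = - x" using R.minus_equality[of "- x" x] by simp
  show "x \<noteq> 0 \<Longrightarrow> inv\<^bsub>rta\<^esub> x = inverse x" using R.inv_unique'[of x "inverse x"] by simp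
qed

lemma sfieldD:
  assumes "sfield E"
  shows "1 \<in> E" "0 \<in> E" "x \<in> E \<Longrightarrow> y \<in> E \<Longrightarrow> x + y \<in> E" "x \<in> E \<Longrightarrow> y \<in> E \<Longrightarrow> x * y \<in> E"
    "x \<in> E \<Longrightarrow> - x \<in> E" "x \<in> E \<Longrightarrow> inverse x \<in> E" "x \<in> E \<Longrightarrow> y \<in> E \<Longrightarrow> x - y \<in> E"
    "x \<in> E \<Longrightarrow> y \<in> E \<Longrightarrow> x / y \<in> E" "x \<in> E \<Longrightarrow> x ^ n \<in> E"
proof -
  note d = assms[unfolded sfield_def]
  show "1 \<in> E" using d by blast
  have "1 + - 1 \<in> E" using d by blast
  then show "0 \<in> E" by simp
  show "x \<in> E \<Longrightarrow> y \<in> E \<Longrightarrow> x + y \<in> E" "x \<in> E \<Longrightarrow> y \<in> E \<Longrightarrow> x * y \<in> E"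
    "x \<in> E \<Longrightarrow> - x \<in> E" "x \<in> E \<Longrightarrow> inverse x \<in> E" using d by blast+
  show "x \<in> E \<Longrightarrow> y \<in> E \<Longrightarrow> x - y \<in> E" using d by (metis diff_conv_add_uminus)
  show "x \<in> E \<Longrightarrow> y \<in> E \<Longrightarrow> x / y \<in> E" using d by (metis divide_inverse)
  show "x \<in> E \<Longrightarrow> x ^ n \<in> E" using d by (induction n) auto
qed

lemma sfield_subfield: "sfield (E :: 'b::field set) \<Longrightarrow> subfield E rta"
proof -
  assume E: "sfield E"
  interpret R: field "rta :: 'b ring" by (rule field_from_type_algebra)
  show ?thesis
    by (rule R.subfieldI'[OF R.subringI]) (use sfieldD[OF E] in auto)
qed

lemma sfield_UN:
  assumes "\<And>n::nat. sfield (E n)" "\<And>n. E n \<subseteq> E (Suc n)"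
  shows "sfield (\<Union>n. E n)"
proof -
  have mono: "m \<le> n \<Longrightarrow> E m \<subseteq> E n" for m n using lift_Suc_mono_le[of E m n] assms(2) by blast
  have two: "\<exists>n. x \<in> E n \<and> y \<in> E n" if "x \<in> E m" "y \<in> E m'" for x y m m'
    using mono[of m "max m m'"] mono[of m' "max m m'"] that by (meson max.cobounded1 max.cobounded2 subsetD)
  have "x + y \<in> (\<Union>n. E n) \<and> x * y \<in> (\<Union>n. E n)" if xy: "x \<in> (\<Union>n. E n)" "y \<in> (\<Union>n. E n)" for x y
  proof -
    obtain n where "x \<in> E n" "y \<in> E n" using two xy by blast
    then show ?thesis using sfieldD(3,4)[OF assms(1)[of n]] by blast
  qed
  moreover have "- x \<in> (\<Union>n. E n) \<and> inverse x \<in> (\<Union>n. E n)" if x: "x \<in> (\<Union>n. E n)" for x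
    using x sfieldD(5,6)[OF assms(1)] by blast
  moreover have "1 \<in> (\<Union>n. E n)" using sfieldD(1)[OF assms(1)] by blast
  ultimately show ?thesis unfolding sfield_def by (intro conjI ballI) blast+
qed

abbreviation genf :: "'b::field set \<Rightarrow> 'b set" where
  "genf S \<equiv> generate_field rta S"

lemma genf_sfield [simp]: "sfield (genf S)"
proof -
  have "0 \<in> genf S"
    using generate_field.eng_add[OF generate_field.one generate_field.a_inv[OF generate_field.one], of rta S] by simp
  moreover have "inverse x \<in> genf S" if "x \<in> genf S" "x \<noteq> 0" for x
    using generate_field.m_inv[OF that(1)] that(2) by simp
  ultimately have "inverse x \<in> genf S" if "x \<in> genf S" for x using that by (cases "x = 0") auto
  then show ?thesis unfolding sfield_def
    using generate_field.one[of rta S] generate_field.a_inv[of _ rta S] generate_field.eng_add[of _ rta S]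
      generate_field.eng_mult[of _ rta S] by simp
qed

lemma genf_incl: "S \<subseteq> genf S"
  by (auto intro: generate_field.incl)

lemma genf_min: "sfield E \<Longrightarrow> S \<subseteq> E \<Longrightarrow> genf S \<subseteq> E"
proof
  fix x assume E: "sfield E" "S \<subseteq> E" "x \<in> genf S"
  from E(3) show "x \<in> E"
    by (induction rule: generate_field.induct) (use E(1,2) sfieldD[OF E(1)] in auto)
qed

lemma genf_eq: "sfield E \<Longrightarrow> S \<subseteq> E \<Longrightarrow> E \<subseteq> genf S \<Longrightarrow> genf S = E"
  using genf_min by blast

lemma genf_self: "sfield E \<Longrightarrow> genf E = E"
  using genf_min genf_incl by blast

lemma genf_mono: "S \<subseteq> T \<Longrightarrow> genf S \<subseteq> genf T"
  using genf_min[OF genf_sfield] genf_incl by (metis order_trans)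

lemma hom_onD:
  assumes "hom_on E \<tau>" "sfield E"
  shows "\<tau> 1 = 1" "\<tau> 0 = 0" "x \<in> E \<Longrightarrow> y \<in> E \<Longrightarrow> \<tau> (x + y) = \<tau> x + \<tau> y"
    "x \<in> E \<Longrightarrow> y \<in> E \<Longrightarrow> \<tau> (x * y) = \<tau> x * \<tau> y" "x \<in> E \<Longrightarrow> \<tau> (- x) = - \<tau> x"
    "x \<in> E \<Longrightarrow> \<tau> (inverse x) = inverse (\<tau> x)" "x \<in> E \<Longrightarrow> y \<in> E \<Longrightarrow> \<tau> (x - y) = \<tau> x - \<tau> y"
    "x \<in> E \<Longrightarrow> \<tau> (x ^ n) = \<tau> x ^ n" "x \<in> E \<Longrightarrow> \<tau> x = 0 \<longleftrightarrow> x = 0"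
proof -
  note f = sfieldD[OF assms(2)] and h = assms(1)[unfolded hom_on_def]
  show one: "\<tau> 1 = 1" and add: "\<And>x y. x \<in> E \<Longrightarrow> y \<in> E \<Longrightarrow> \<tau> (x + y) = \<tau> x + \<tau> y"
    and mult: "\<And>x y. x \<in> E \<Longrightarrow> y \<in> E \<Longrightarrow> \<tau> (x * y) = \<tau> x * \<tau> y" using h by blast+
  have "\<tau> 0 + 0 = \<tau> 0 + \<tau> 0" using add[OF f(2) f(2)] by simp
  then show zero: "\<tau> 0 = 0" by (simp only: add_left_cancel)
  have neg: "\<tau> (- x) = - \<tau> x" if "x \<in> E" for x
    using add[OF that f(5)[OF that]] zero by (simp add: add_eq_0_iff)
  then show "x \<in> E \<Longrightarrow> \<tau> (- x) = - \<tau> x" .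
  have inv: "\<tau> x * \<tau> (inverse x) = 1" if "x \<in> E" "x \<noteq> 0" for x
    using mult[OF that(1) f(6)[OF that(1)]] that one by simp
  show nz: "x \<in> E \<Longrightarrow> \<tau> x = 0 \<longleftrightarrow> x = 0" using inv zero by fastforce
  show "x \<in> E \<Longrightarrow> \<tau> (inverse x) = inverse (\<tau> x)"
    by (metis inv inverse_unique zero inverse_zero)
  show "x \<in> E \<Longrightarrow> y \<in> E \<Longrightarrow> \<tau> (x - y) = \<tau> x - \<tau> y"
    using add[of x "- y"] neg f(5) by simp
  show "x \<in> E \<Longrightarrow> \<tau> (x ^ n) = \<tau> x ^ n"
    using mult one f(9) by (induction n) auto
qed

lemma hom_on_inj: "hom_on E \<tau> \<Longrightarrow> sfield E \<Longrightarrow> inj_on \<tau> E"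
proof (rule inj_onI)
  fix x y assume a: "hom_on E \<tau>" "sfield E" "x \<in> E" "y \<in> E" "\<tau> x = \<tau> y"
  then have "\<tau> (x - y) = 0" using hom_onD(7)[OF a(1,2)] by simp
  then show "x = y" using hom_onD(9)[OF a(1,2), of "x - y"] sfieldD(7)[OF a(2)] a(3,4) by simp
qed

lemma hom_on_subset: "hom_on E \<tau> \<Longrightarrow> F \<subseteq> E \<Longrightarrow> hom_on F \<tau>"
  unfolding hom_on_def by blast

lemma hom_on_cong: "hom_on E \<tau> \<Longrightarrow> sfield E \<Longrightarrow> (\<And>x. x \<in> E \<Longrightarrow> \<tau> x = \<tau>' x) \<Longrightarrow> hom_on E \<tau>'"
  unfolding hom_on_def using sfieldD(1,3,4)[of E] by simp

lemma hom_on_comp: "hom_on E \<tau> \<Longrightarrow> hom_on F \<rho> \<Longrightarrow> \<tau> ` E \<subseteq> F \<Longrightarrow> hom_on E (\<rho> \<circ> \<tau>)"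
  unfolding hom_on_def by (auto simp: image_subset_iff)

lemma hom_on_image:
  assumes "hom_on E \<tau>" "sfield E"
  shows "sfield (\<tau> ` E)"
proof -
  note h = hom_onD[OF assms] and f = sfieldD[OF assms(2)]
  have "\<tau> x + \<tau> y \<in> \<tau> ` E \<and> \<tau> x * \<tau> y \<in> \<tau> ` E" if xy: "x \<in> E" "y \<in> E" for x y
    unfolding h(3)[OF xy, symmetric] h(4)[OF xy, symmetric] using f(3,4)[OF xy] by blast
  moreover have "- \<tau> x \<in> \<tau> ` E \<and> inverse (\<tau> x) \<in> \<tau> ` E" if x: "x \<in> E" for x
    unfolding h(5)[OF x, symmetric] h(6)[OF x, symmetric] using f(5,6)[OF x] by blast
  moreover have "1 \<in> \<tau> ` E" using f(1) h(1) by (metis imageI)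
  ultimately show ?thesis unfolding sfield_def by blast
qed

lemma hom_on_preimage: "hom_on E \<tau> \<Longrightarrow> sfield E \<Longrightarrow> sfield F \<Longrightarrow> sfield {x\<in>E. \<tau> x \<in> F}"
  using hom_onD[of E \<tau>] sfieldD[of E] sfieldD[of F] unfolding sfield_def[of "{x\<in>E. \<tau> x \<in> F}"] by simp

lemma hom_on_equaliser: "hom_on E \<tau> \<Longrightarrow> hom_on E \<rho> \<Longrightarrow> sfield E \<Longrightarrow> sfield {x\<in>E. \<tau> x = \<rho> x}"
  using hom_onD[of E \<tau>] hom_onD[of E \<rho>] sfieldD[of E] unfolding sfield_def[of "{x\<in>E. \<tau> x = \<rho> x}"] by simp

lemma hom_on_genf_eq:
  assumes "hom_on E \<tau>" "hom_on E \<rho>" "sfield E" "S \<subseteq> E" "\<And>x. x \<in> S \<Longrightarrow> \<tau> x = \<rho> x" "y \<in> genf S"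
  shows "\<tau> y = \<rho> y"
  using genf_min[OF hom_on_equaliser[OF assms(1-3)], of S] assms(4-6) by blast

lemma hom_on_genf_image:
  assumes "hom_on E \<tau>" "sfield E" "S \<subseteq> E" "\<tau> ` S \<subseteq> genf T"
  shows "\<tau> ` genf S \<subseteq> genf T"
  using genf_min[OF hom_on_preimage[OF assms(1,2) genf_sfield], of S T] assms(3,4) by blast

section \<open>Adjoining square roots one at a time\<close>

definition adj :: "'b::field set \<Rightarrow> 'b \<Rightarrow> 'b set" where
  "adj E z = {a + b * z | a b. a \<in> E \<and> b \<in> E}"

lemma adjI: "a \<in> E \<Longrightarrow> b \<in> E \<Longrightarrow> a + b * z \<in> adj E z"
  unfolding adj_def by blast

lemma adj_incl: "sfield E \<Longrightarrow> E \<subseteq> adj E z" "sfield E \<Longrightarrow> z \<in> adj E z"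
  using adjI[of _ E 0 z] adjI[of 0 E 1 z] sfieldD(1,2)[of E] by auto

lemma adj_id: "sfield E \<Longrightarrow> z \<in> E \<Longrightarrow> adj E z = E"
  using adj_incl(1)[of E z] sfieldD(3,4)[of E] unfolding adj_def by blast

lemma adj_sfield:
  fixes z :: "'b::field"
  assumes E: "sfield E" and z: "z ^ 2 \<in> E" and two: "(2::'b) \<noteq> 0"
  shows "sfield (adj E z)"
proof -
  note f = sfieldD[OF E]
  have add: "x + y \<in> adj E z" and mult: "x * y \<in> adj E z" if xy: "x \<in> adj E z" "y \<in> adj E z" for x y
  proof -
    obtain a b a' b' where e: "x = a + b * z" "y = a' + b' * z" "a \<in> E" "b \<in> E" "a' \<in> E" "b' \<in> E"
      using xy unfolding adj_def by blast
    have "x + y = (a + a') + (b + b') * z" "x * y = (a * a' + b * b' * z ^ 2) + (a * b' + a' * b) * z"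
      unfolding e by (simp_all add: algebra_simps power2_eq_square)
    then show "x + y \<in> adj E z" "x * y \<in> adj E z" using e f z by (metis adjI)+
  qed
  have neg: "- x \<in> adj E z" and inv: "inverse x \<in> adj E z" if x: "x \<in> adj E z" for x
  proof -
    obtain a b where e: "x = a + b * z" "a \<in> E" "b \<in> E" using x unfolding adj_def by blast
    have "- x = - a + (- b) * z" by (simp add: e)
    then show "- x \<in> adj E z" using e f by (metis adjI)
    define n where "n = a ^ 2 - b ^ 2 * z ^ 2"
    have n: "n = x * (a - b * z)" by (simp add: n_def e algebra_simps power2_eq_square)
    show "inverse x \<in> adj E z"
    proof (cases "n = 0")
      case True
      \<comment> \<open>If the norm vanishes, then \<open>a\<close> is \<open>b * z\<close> or
        \<open>- b * z\<close>, so the element is \<open>2 * a\<close> or 0 and lies in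
        \<open>E\<close>.\<close>
      then have "x = 0 \<or> x = 2 * a" unfolding n by (auto simp: e)
      moreover have "2 * a = a + a" by simp
      ultimately have "x \<in> E" using e f by metis
      then show ?thesis using f(6) adj_incl(1)[OF E] by blast
    next
      case False
      then have "x * ((a - b * z) / n) = 1" by (simp add: n)
      then have "inverse x = (a - b * z) / n" by (rule inverse_unique)
      then have i: "inverse x = a / n + (- b / n) * z" by (simp add: diff_divide_distrib)
      have "n \<in> E" unfolding n_def by (rule f(7)[OF f(9)[OF e(2)] f(4)[OF f(9)[OF e(3)] z]])
      then show ?thesis unfolding i using e f(5,8) by (intro adjI) auto
    qed
  qed
  have "1 \<in> adj E z" using adj_incl(1)[OF E] f(1) by blast
  then show ?thesis unfolding sfield_def by (intro conjI ballI add mult neg inv)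
qed

lemma adj_genf:
  fixes z :: "'b::field"
  assumes E: "sfield E" and z: "z ^ 2 \<in> E" and two: "(2::'b) \<noteq> 0"
  shows "adj E z = genf (insert z E)"
proof
  have "a + b * z \<in> genf (insert z E)" if "a \<in> E" "b \<in> E" for a b
    using that genf_incl[of "insert z E"] sfieldD(3,4)[OF genf_sfield, of _ "insert z E"] by (metis insert_subset subsetD)
  then show "adj E z \<subseteq> genf (insert z E)" unfolding adj_def by blast
  show "genf (insert z E) \<subseteq> adj E z"
    by (rule genf_min[OF adj_sfield[OF assms]]) (use adj_incl[OF E] in auto)
qed

lemma adj_unique:
  assumes "sfield E" "z \<notin> E" "a + b * z = a' + b' * z" "a \<in> E" "b \<in> E" "a' \<in> E" "b' \<in> E"
  shows "a = a' \<and> b = b'"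
proof -
  note f = sfieldD[OF assms(1)]
  have e: "(b - b') * z = a' - a" using assms(3) by (simp add: algebra_simps)
  have "b = b'"
  proof (rule ccontr)
    assume "b \<noteq> b'"
    then have "z = (a' - a) / (b - b')" using e by (simp add: field_simps)
    then show False using f(7,8) assms by metis
  qed
  then show ?thesis using e by simp
qed

lemma hom_extend:
  fixes z :: "'b::field"
  assumes E: "sfield E" and z: "z ^ 2 \<in> E" "z \<notin> E" and \<sigma>: "hom_on E \<sigma>" and z': "z' ^ 2 = \<sigma> (z ^ 2)"
  shows "\<exists>\<tau>. hom_on (adj E z) \<tau> \<and> (\<forall>x\<in>E. \<tau> x = \<sigma> x) \<and> \<tau> z = z'"
proof -
  note f = sfieldD[OF E] and h = hom_onD[OF \<sigma> E]
  define \<tau> where "\<tau> x = (THE y. \<exists>a\<in>E. \<exists>b\<in>E. x = a + b * z \<and> y = \<sigma> a + \<sigma> b * z')" for x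
  have t: "\<tau> (a + b * z) = \<sigma> a + \<sigma> b * z'" if "a \<in> E" "b \<in> E" for a b
    unfolding \<tau>_def
  proof (rule the_equality)
    show "\<exists>a'\<in>E. \<exists>b'\<in>E. a + b * z = a' + b' * z \<and> \<sigma> a + \<sigma> b * z' = \<sigma> a' + \<sigma> b' * z'" using that by blast
    fix y assume "\<exists>a'\<in>E. \<exists>b'\<in>E. a + b * z = a' + b' * z \<and> y = \<sigma> a' + \<sigma> b' * z'"
    then obtain a' b' where ab: "a' \<in> E" "b' \<in> E" "a + b * z = a' + b' * z" "y = \<sigma> a' + \<sigma> b' * z'" by blast
    then have "a = a' \<and> b = b'" using adj_unique[OF E z(2) ab(3) that ab(1,2)] by blast
    then show "y = \<sigma> a + \<sigma> b * z'" using ab(4) by simp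
  qed
  have tE: "\<tau> x = \<sigma> x" if "x \<in> E" for x using t[OF that f(2)] h(2) by simp
  have tz: "\<tau> z = z'" using t[OF f(2) f(1)] h(1,2) by simp
  have "\<tau> (x + y) = \<tau> x + \<tau> y \<and> \<tau> (x * y) = \<tau> x * \<tau> y" if xy: "x \<in> adj E z" "y \<in> adj E z" for x y
  proof -
    obtain a b a' b' where e: "x = a + b * z" "y = a' + b' * z" "a \<in> E" "b \<in> E" "a' \<in> E" "b' \<in> E"
      using xy unfolding adj_def by blast
    have s: "x + y = (a + a') + (b + b') * z" and m: "x * y = (a * a' + b * b' * z ^ 2) + (a * b' + a' * b) * z"
      unfolding e by (simp_all add: algebra_simps power2_eq_square)
    have "\<tau> (x + y) = \<sigma> (a + a') + \<sigma> (b + b') * z'" unfolding s by (rule t) (intro f(3) e)+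
    also have "\<dots> = (\<sigma> a + \<sigma> b * z') + (\<sigma> a' + \<sigma> b' * z')"
      using h(3)[OF e(3,5)] h(3)[OF e(4,6)] by (simp add: algebra_simps)
    finally have 1: "\<tau> (x + y) = \<tau> x + \<tau> y"
      unfolding t[OF e(3,4), folded e(1)] t[OF e(5,6), folded e(2)] .
    have "\<tau> (x * y) = \<sigma> (a * a' + b * b' * z ^ 2) + \<sigma> (a * b' + a' * b) * z'"
      unfolding m by (rule t) (intro f(3) f(4) e z(1))+
    also have "\<sigma> (a * a' + b * b' * z ^ 2) = \<sigma> a * \<sigma> a' + \<sigma> b * \<sigma> b' * \<sigma> (z ^ 2)"
      using h(3)[OF f(4)[OF e(3,5)] f(4)[OF f(4)[OF e(4,6)] z(1)]] h(4)[OF e(3,5)]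
        h(4)[OF f(4)[OF e(4,6)] z(1)] h(4)[OF e(4,6)] by simp
    also have "\<sigma> (a * b' + a' * b) = \<sigma> a * \<sigma> b' + \<sigma> a' * \<sigma> b"
      using h(3)[OF f(4)[OF e(3,6)] f(4)[OF e(5,4)]] h(4)[OF e(3,6)] h(4)[OF e(5,4)] by simp
    also have "\<sigma> a * \<sigma> a' + \<sigma> b * \<sigma> b' * \<sigma> (z ^ 2) + (\<sigma> a * \<sigma> b' + \<sigma> a' * \<sigma> b) * z' = (\<sigma> a + \<sigma> b * z') * (\<sigma> a' + \<sigma> b' * z')"
      unfolding z'[symmetric] by (simp add: algebra_simps power2_eq_square)
    finally have 2: "\<tau> (x * y) = \<tau> x * \<tau> y"
      unfolding t[OF e(3,4), folded e(1)] t[OF e(5,6), folded e(2)] .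
    show ?thesis using 1 2 by blast
  qed
  then have "hom_on (adj E z) \<tau>" unfolding hom_on_def using tE[OF f(1)] h(1) by simp
  then show ?thesis using tE tz by blast
qed

fun adjs :: "'b::field set \<Rightarrow> 'b list \<Rightarrow> 'b set" where
  "adjs E [] = E"
| "adjs E (z # zs) = adjs (adj E z) zs"

fun tower :: "'b::field set \<Rightarrow> 'b list \<Rightarrow> bool" where
  "tower E [] = True"
| "tower E (z # zs) = (z ^ 2 \<in> E \<and> tower (adj E z) zs)"

text \<open>A tower may contain roots that are already present; these count 0, so the degree is
  \<open>2 ^ steps\<close> whether or not the roots are independent.\<close>

fun steps :: "'b::field set \<Rightarrow> 'b list \<Rightarrow> nat" where
  "steps E [] = 0"
| "steps E (z # zs) = (if z \<in> E then 0 else 1) + steps (adj E z) zs"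

lemma steps_le: "steps E zs \<le> length zs"
  by (induction zs arbitrary: E) (auto intro: le_SucI)

lemma adjs_append: "adjs E (ys @ zs) = adjs (adjs E ys) zs"
  by (induction ys arbitrary: E) auto

lemma tower_append: "tower E (ys @ zs) \<longleftrightarrow> tower E ys \<and> tower (adjs E ys) zs"
  by (induction ys arbitrary: E) auto

lemma steps_append: "steps E (ys @ zs) = steps E ys + steps (adjs E ys) zs"
  by (induction ys arbitrary: E) auto

context
  assumes two: "(2 :: 'b::field) \<noteq> 0"
begin

lemma adjs_sfield: "sfield (E :: 'b set) \<Longrightarrow> tower E zs \<Longrightarrow> sfield (adjs E zs)"
  by (induction zs arbitrary: E) (auto intro: adj_sfield[OF _ _ two])

lemma adjs_genf: "sfield (E :: 'b set) \<Longrightarrow> tower E zs \<Longrightarrow> adjs E zs = genf (E \<union> set zs)"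
proof (induction zs arbitrary: E)
  case Nil
  then show ?case by (simp add: genf_self)
next
  case (Cons z zs)
  have a: "sfield (adj E z)" "adj E z = genf (insert z E)"
    using Cons.prems adj_sfield[OF _ _ two] adj_genf[OF _ _ two] by auto
  have "genf (adj E z \<union> set zs) = genf (E \<union> set (z # zs))"
  proof (rule genf_eq[OF genf_sfield])
    have "genf (insert z E) \<subseteq> genf (E \<union> set (z # zs))" by (rule genf_mono) auto
    then show "adj E z \<union> set zs \<subseteq> genf (E \<union> set (z # zs))"
      unfolding a(2) using genf_incl[of "E \<union> set (z # zs)"] by auto
    show "genf (E \<union> set (z # zs)) \<subseteq> genf (adj E z \<union> set zs)"
      by (rule genf_mono) (use adj_incl Cons.prems in auto)
  qed
  then show ?case using Cons.IH[of "adj E z"] Cons.prems a by simp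
qed

lemma tower_sq:
  assumes "sfield (E :: 'b set)" "\<And>z. z \<in> set zs \<Longrightarrow> z ^ 2 \<in> E"
  shows "tower E zs"
  using assms
proof (induction zs arbitrary: E)
  case (Cons z zs)
  have "tower (adj E z) zs"
    by (rule Cons.IH) (use Cons.prems adj_sfield[OF _ _ two] adj_incl(1)[of E z] in auto)
  then show ?case using Cons.prems by auto
qed auto

lemma dimension_adjs:
  assumes "sfield (E :: 'b set)" "tower E zs"
  shows "ring.dimension rta (2 ^ steps E zs) E (adjs E zs)"
  using assms
proof (induction zs arbitrary: E)
  interpret R: field "rta :: 'b ring" by (rule field_from_type_algebra)
  {
    case Nil
    then show ?case using R.dimension_one[OF sfield_subfield] by simp
  next
    case (Cons z zs)
    have a: "sfield (adj E z)" using Cons.prems adj_sfield[OF _ _ two] by auto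
    have sub: "subfield E rta" "subfield (adj E z) rta" using Cons.prems a sfield_subfield by blast+
    have IH: "R.dimension (2 ^ steps (adj E z) zs) (adj E z) (adjs (adj E z) zs)"
      using Cons a by simp
    show ?case
    proof (cases "z \<in> E")
      case True
      then show ?thesis using IH Cons.prems adj_id[of E z] by simp
    next
      case False
      have "R.line_extension E z E = adj E z"
        using R.line_extension_mem_iff[of _ E z E] by (auto simp: adj_def add.commute)
      moreover have "R.dimension (Suc 1) E (R.line_extension E z E)"
        by (rule R.Suc_dim) (use False R.dimension_one[OF sub(1)] in auto)
      ultimately have "R.dimension 2 E (adj E z)" by (simp add: numeral_2_eq_2)
      from R.telescopic_base[OF sub this IH] show ?thesis using False by simp
    qed
  }
qed

end

lemma dimension_unique:
  assumes "sfield (E :: 'b::field set)" "ring.dimension rta m E F" "ring.dimension rta n E F"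
  shows "m = n"
proof -
  interpret R: field "rta :: 'b ring" by (rule field_from_type_algebra)
  show ?thesis by (rule R.dimension_is_inj[OF sfield_subfield[OF assms(1)] assms(2,3)])
qed

section \<open>Counting and extending embeddings\<close>

definition homs :: "'b::field set \<Rightarrow> 'b set \<Rightarrow> ('b \<Rightarrow> 'b) \<Rightarrow> ('b \<Rightarrow> 'b) set" where
  "homs F E \<sigma> = {\<tau> \<in> extensional F. hom_on F \<tau> \<and> (\<forall>x\<in>E. \<tau> x = \<sigma> x)}"

text \<open>Each new root doubles the number of extensions: it may go to either square root of the
  image of its square, and the two are distinct because 2 is invertible.\<close>

lemma card_homs:
  assumes two: "(2 :: 'b::field) \<noteq> 0" and sq: "\<And>x::'b. \<exists>y. y ^ 2 = x"
    and "sfield (E :: 'b set)" "tower E zs" "hom_on E \<sigma>"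
  shows "finite (homs (adjs E zs) E \<sigma>) \<and> card (homs (adjs E zs) E \<sigma>) = 2 ^ steps E zs"
  using assms(3-)
proof (induction zs arbitrary: E \<sigma>)
  case Nil
  have "homs E E \<sigma> = {restrict \<sigma> E}"
    using Nil hom_on_cong[of E \<sigma> "restrict \<sigma> E"] by (auto simp: homs_def extensional_def fun_eq_iff)
  then show ?case by simp
next
  case (Cons z zs)
  let ?A = "adj E z" and ?F = "adjs E (z # zs)"
  have z: "z ^ 2 \<in> E" and tw: "tower ?A zs" using Cons.prems by auto
  note E = Cons.prems(1)
  have A: "sfield ?A" by (rule adj_sfield[OF E z two])
  have F: "sfield ?F" by (rule adjs_sfield[OF two E Cons.prems(2)])
  have AF: "?A \<subseteq> ?F" using adjs_genf[OF two A tw] genf_incl[of "?A \<union> set zs"] by auto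
  show ?case
  proof (cases "z \<in> E")
    case True
    then have "?A = E" by (rule adj_id[OF E])
    then show ?thesis using Cons.IH[OF E _ Cons.prems(3)] tw True by simp
  next
    case False
    obtain y where y: "y ^ 2 = \<sigma> (z ^ 2)" using sq by blast
    obtain \<tau>1 where t1: "hom_on ?A \<tau>1" "\<And>x. x \<in> E \<Longrightarrow> \<tau>1 x = \<sigma> x" "\<tau>1 z = y"
      using hom_extend[OF E z False Cons.prems(3) y] by blast
    have "(- y) ^ 2 = \<sigma> (z ^ 2)" using y by simp
    then obtain \<tau>2 where t2: "hom_on ?A \<tau>2" "\<And>x. x \<in> E \<Longrightarrow> \<tau>2 x = \<sigma> x" "\<tau>2 z = - y"
      using hom_extend[OF E z False Cons.prems(3), of "- y"] by blast
    have zA: "z \<in> ?A" "E \<subseteq> ?A" using adj_incl[OF E] by auto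
    have "z \<noteq> 0" using False sfieldD(2)[OF E] by blast
    then have y0: "y \<noteq> 0" using hom_onD(9)[OF t1(1) A zA(1)] t1(3) by simp
    then have yy: "y \<noteq> - y" using two by (metis add_eq_0_iff mult_2 mult_eq_0_iff)
    have agree: "\<tau> x = \<rho> x" if "hom_on ?A \<tau>" "hom_on ?A \<rho>" "\<And>x. x \<in> E \<Longrightarrow> \<tau> x = \<rho> x" "\<tau> z = \<rho> z" "x \<in> ?A" for \<tau> \<rho> x
      using hom_on_genf_eq[OF that(1,2) A, of "insert z E" x] that(3-5) zA adj_genf[OF E z two] by auto
    have "homs ?F E \<sigma> = homs ?F ?A \<tau>1 \<union> homs ?F ?A \<tau>2"
    proof (intro equalityI subsetI)
      fix \<tau> assume t: "\<tau> \<in> homs ?F E \<sigma>"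
      then have h: "hom_on ?F \<tau>" "\<And>x. x \<in> E \<Longrightarrow> \<tau> x = \<sigma> x" "\<tau> \<in> extensional ?F" unfolding homs_def by auto
      have hA: "hom_on ?A \<tau>" by (rule hom_on_subset[OF h(1) AF])
      have "\<tau> z ^ 2 = y ^ 2" using hom_onD(8)[OF hA A zA(1), of 2] h(2)[OF z] y by simp
      then have "\<tau> z = y \<or> \<tau> z = - y" by (simp add: power2_eq_iff)
      moreover have "\<tau> x = \<tau>1 x" if "\<tau> z = y" "x \<in> ?A" for x
        by (rule agree[OF hA t1(1) _ _ that(2)]) (simp_all only: h(2) t1(2,3) that(1))
      moreover have "\<tau> x = \<tau>2 x" if "\<tau> z = - y" "x \<in> ?A" for x
        by (rule agree[OF hA t2(1) _ _ that(2)]) (simp_all only: h(2) t2(2,3) that(1))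
      ultimately have "(\<forall>x\<in>?A. \<tau> x = \<tau>1 x) \<or> (\<forall>x\<in>?A. \<tau> x = \<tau>2 x)" by blast
      then show "\<tau> \<in> homs ?F ?A \<tau>1 \<union> homs ?F ?A \<tau>2"
        using h(1,3) by (simp add: homs_def)
    next
      fix \<tau> assume "\<tau> \<in> homs ?F ?A \<tau>1 \<union> homs ?F ?A \<tau>2"
      then have "\<tau> \<in> extensional ?F" "hom_on ?F \<tau>" "(\<forall>x\<in>?A. \<tau> x = \<tau>1 x) \<or> (\<forall>x\<in>?A. \<tau> x = \<tau>2 x)"
        by (auto simp: homs_def)
      moreover have "\<tau> x = \<sigma> x" if "x \<in> E" for x
        using calculation(3) t1(2)[OF that] t2(2)[OF that] zA(2) that by (metis subsetD)
      ultimately show "\<tau> \<in> homs ?F E \<sigma>" by (simp add: homs_def)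
    qed
    moreover have "homs ?F ?A \<tau>1 \<inter> homs ?F ?A \<tau>2 = {}"
    proof -
      have "\<tau> z = y" if "\<tau> \<in> homs ?F ?A \<tau>1" for \<tau> using that t1(3) zA(1) unfolding homs_def by simp
      moreover have "\<tau> z = - y" if "\<tau> \<in> homs ?F ?A \<tau>2" for \<tau> using that t2(3) zA(1) unfolding homs_def by simp
      ultimately show ?thesis using yy by (metis disjoint_iff)
    qed
    ultimately show ?thesis
      using Cons.IH[OF A tw t1(1)] Cons.IH[OF A tw t2(1)] False by (simp add: card_Un_disjoint)
  qed
qed

text \<open>Embeddings are extended by Zorn's lemma, applied to their graphs.\<close>

lemma hom_quadratic_closure:
  fixes E :: "'b::field set"
  assumes two: "(2 :: 'b::field) \<noteq> 0" and sq: "\<And>x::'b. \<exists>y. y ^ 2 = x"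
    and E: "sfield E" and \<sigma>: "hom_on E \<sigma>"
  shows "\<exists>F \<tau>. sfield F \<and> E \<subseteq> F \<and> hom_on F \<tau> \<and> (\<forall>x\<in>E. \<tau> x = \<sigma> x) \<and> (\<forall>z. z ^ 2 \<in> F \<longrightarrow> z \<in> F)"
proof -
  define fg where "fg r \<longleftrightarrow> (\<exists>F \<tau>. sfield F \<and> hom_on F \<tau> \<and> r = (\<lambda>x. (x, \<tau> x)) ` F)" for r :: "('b \<times> 'b) set"
  define A where "A = {r. fg r \<and> (\<lambda>x. (x, \<sigma> x)) ` E \<subseteq> r}"
  have "A \<noteq> {}" unfolding A_def fg_def using E \<sigma> by blast
  moreover have "\<Union>C \<in> A" if C: "C \<noteq> {}" "subset.chain A C" for C
  proof -
    have CA: "C \<subseteq> A" and ch: "\<And>r r'. r \<in> C \<Longrightarrow> r' \<in> C \<Longrightarrow> r \<subseteq> r' \<or> r' \<subseteq> r"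
      using C(2) unfolding subset.chain_def by blast+
    have common: "\<exists>r\<in>C. p \<in> r \<and> q \<in> r" if "p \<in> \<Union>C" "q \<in> \<Union>C" for p q using that ch by blast
    have fgC: "fg r" if "r \<in> C" for r using that CA unfolding A_def by blast
    define F where "F = fst ` \<Union>C"
    define \<tau> where "\<tau> x = (SOME y. (x, y) \<in> \<Union>C)" for x
    have fn: "y = y'" if xy: "(x, y) \<in> \<Union>C" "(x, y') \<in> \<Union>C" for x y y'
    proof -
      obtain r where r: "r \<in> C" "(x, y) \<in> r" "(x, y') \<in> r" using common[OF xy] by blast
      then show ?thesis using fgC[OF r(1)] unfolding fg_def by auto
    qed
    have tau: "\<tau> x = y" if "(x, y) \<in> \<Union>C" for x y
      using fn[OF _ that, of "\<tau> x"] someI[of "\<lambda>y. (x, y) \<in> \<Union>C", OF that] unfolding \<tau>_def by blast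
    have ops: "x + y \<in> F \<and> x * y \<in> F \<and> - x \<in> F \<and> inverse x \<in> F \<and> \<tau> (x + y) = \<tau> x + \<tau> y \<and> \<tau> (x * y) = \<tau> x * \<tau> y"
      if xy: "x \<in> F" "y \<in> F" for x y
    proof -
      obtain a b where ab: "a \<in> \<Union>C" "x = fst a" "b \<in> \<Union>C" "y = fst b" using xy unfolding F_def by blast
      obtain r where r: "r \<in> C" "a \<in> r" "b \<in> r" using common[OF ab(1,3)] by blast
      obtain G \<rho> where G: "sfield G" "hom_on G \<rho>" "r = (\<lambda>x. (x, \<rho> x)) ` G" using fgC[OF r(1)] unfolding fg_def by blast
      have GU: "(u, \<rho> u) \<in> \<Union>C" if "u \<in> G" for u using r(1) G(3) that by blast
      have uF: "u \<in> F" if "u \<in> G" for u unfolding F_def using GU[OF that] by (metis fst_conv imageI)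
      have ut: "\<tau> u = \<rho> u" if "u \<in> G" for u by (rule tau[OF GU[OF that]])
      have xy: "x \<in> G" "y \<in> G" using r(2,3) G(3) ab(2,4) by auto
      note g = sfieldD[OF G(1)]
      note ops = g(3)[OF xy] g(4)[OF xy] g(5)[OF xy(1)] g(6)[OF xy(1)]
      show ?thesis
        using uF[OF ops(1)] uF[OF ops(2)] uF[OF ops(3)] uF[OF ops(4)] hom_onD(3,4)[OF G(2,1) xy]
          ut[OF ops(1)] ut[OF ops(2)] ut[OF xy(1)] ut[OF xy(2)] by simp
    qed
    obtain r0 where "r0 \<in> C" using C(1) by blast
    then have EC: "(\<lambda>x. (x, \<sigma> x)) ` E \<subseteq> \<Union>C" using CA unfolding A_def by blast
    then have one: "(1, \<sigma> 1) \<in> \<Union>C" using sfieldD(1)[OF E] by blast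
    then have "1 \<in> F" "\<tau> 1 = 1" using tau hom_onD(1)[OF \<sigma> E] unfolding F_def by force+
    then have "sfield F" "hom_on F \<tau>" unfolding sfield_def hom_on_def using ops by blast+
    moreover have "\<Union>C = (\<lambda>x. (x, \<tau> x)) ` F" unfolding F_def using tau by force
    ultimately have "fg (\<Union>C)" unfolding fg_def by blast
    then show ?thesis unfolding A_def using EC by simp
  qed
  ultimately have "\<exists>M\<in>A. \<forall>r\<in>A. M \<subseteq> r \<longrightarrow> r = M" by (rule subset_Zorn_nonempty)
  then obtain M where M: "M \<in> A" "\<And>r. r \<in> A \<Longrightarrow> M \<subseteq> r \<Longrightarrow> r = M" by blast
  then obtain F \<tau> where F: "sfield F" "hom_on F \<tau>" "M = (\<lambda>x. (x, \<tau> x)) ` F" unfolding A_def fg_def by blast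
  have EM: "(\<lambda>x. (x, \<sigma> x)) ` E \<subseteq> M" using M(1) unfolding A_def by blast
  have "z \<in> F" if z: "z ^ 2 \<in> F" for z
  proof (rule ccontr)
    assume nz: "z \<notin> F"
    obtain y where "y ^ 2 = \<tau> (z ^ 2)" using sq by blast
    then obtain \<rho> where \<rho>: "hom_on (adj F z) \<rho>" "\<And>x. x \<in> F \<Longrightarrow> \<rho> x = \<tau> x"
      using hom_extend[OF F(1) z nz F(2)] by blast
    let ?r = "(\<lambda>x. (x, \<rho> x)) ` adj F z"
    have "M \<subseteq> ?r" unfolding F(3) using \<rho>(2) adj_incl(1)[OF F(1), of z] by force
    moreover have "fg ?r" unfolding fg_def using adj_sfield[OF F(1) z two] \<rho>(1) by blast
    ultimately have "?r = M" using M(2) EM unfolding A_def by blast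
    then show False using nz adj_incl(2)[OF F(1), of z] unfolding F(3) by force
  qed
  moreover have "E \<subseteq> F" "\<forall>x\<in>E. \<tau> x = \<sigma> x" using EM unfolding F(3) by force+
  ultimately show ?thesis using F(1,2) by blast
qed

section \<open>Labelings normalised along the post-critical relations\<close>

definition sg :: "bit \<Rightarrow> 'b::field" where
  "sg b = (if b = 0 then 1 else - 1)"

lemma sg_simps [simp]: "sg 0 = 1" "sg 1 = - 1" "sg b * sg b = 1" "sg b * (sg b * z) = z" "sg b \<noteq> 0"
  by (auto simp: sg_def)

lemma sg_add: "sg (a + b) = sg a * sg b"
  by (cases a; cases b) (simp_all add: sg_def)

lemma sg_sum: "sg (sum f A) = (\<Prod>x\<in>A. sg (f x))"
  by (induction A rule: infinite_finite_induct) (auto simp: sg_add)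

lemma sg_eq_iff: "(2::'b::field) \<noteq> 0 \<Longrightarrow> z \<noteq> 0 \<Longrightarrow> sg a * z = sg b * (z::'b) \<longleftrightarrow> a = b"
proof -
  assume a: "(2::'b) \<noteq> 0" "z \<noteq> 0"
  have "(1::'b) \<noteq> - 1"
  proof
    assume "(1::'b) = - 1"
    then have "(2::'b) = 0" by (metis add_eq_0_iff one_add_one)
    then show False using a by simp
  qed
  then show ?thesis using a(2) by (cases a; cases b) auto
qed

lemma square_sg: "x ^ 2 = (y::'b::field) ^ 2 \<Longrightarrow> \<exists>b. x = sg b * y"
  by (metis mult_1 mult_minus1 power2_eq_iff sg_simps(1,2))

text \<open>The index is one less than that of the critical value: \<open>PI lab m u\<close> squares
  to \<open>f^(m+1)(0)\<close> minus the label of \<open>u\<close>, with the opposite sign for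
  \<open>m = 0\<close> (\<open>PI_sq\<close>).\<close>

definition PI :: "(word \<Rightarrow> 'b::field) \<Rightarrow> nat \<Rightarrow> word \<Rightarrow> 'b" where
  "PI lab m u = (\<Prod>w\<in>words m. lab (u @ w @ [La]))"

lemma PI_0 [simp]: "PI lab 0 u = lab (u @ [La])"
  by (simp add: PI_def)

lemma PI_Suc: "PI lab (Suc m) u = PI lab m (u @ [La]) * PI lab m (u @ [Lb])"
  by (simp add: PI_def prod_words_Suc_Cons)

lemma PI_Suc_other: "PI lab (Suc m) u = PI lab m (u @ [l]) * PI lab m (u @ [other l])"
  by (cases l) (simp_all add: PI_Suc ac_simps)

lemma PI_cong: "(\<And>w. length w = m \<Longrightarrow> lab (u @ w @ [La]) = lab' (u @ w @ [La])) \<Longrightarrow> PI lab m u = PI lab' m u"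
  by (simp add: PI_def)

section \<open>The square root of 2 in the case (3, 2)\<close>

definition EE4 :: "'b::field \<Rightarrow> 'b \<Rightarrow> 'b \<Rightarrow> 'b \<Rightarrow> 'b \<Rightarrow> 'b" where
  "EE4 c S T u v = S*T*(u+v-2*c) - c^2*(S+T)*(u+v-2*c) + (4+2*c+2*c^2)*(u+v-2*c)
     + (2+4*c+c^2)*(S*T) + (4+6*c+4*c^2)*(S+T) + 4*(c-1)"

text \<open>On points subject to the relations \<open>pts\<close>, a square root of half the product
  of \<open>(x + c) (c^2 + c - x)\<close> over the four arguments (\<open>EE_square\<close>). Being
  polynomial in the points, it has a sign that can be followed when labels change.
  \<open>EE4\<close> expresses it through the sums and products of the two pairs.\<close>

definition EE :: "'b::field \<Rightarrow> 'b \<Rightarrow> 'b \<Rightarrow> 'b \<Rightarrow> 'b \<Rightarrow> 'b" where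
  "EE c x y z w = EE4 c (x + y) (z + w) (x * y) (z * w) / 4"

lemma EE_commute: "EE c x y z w = EE c z w x y" "EE c x y z w = EE c y x z w" "EE c x y z w = EE c x y w z"
  by (simp_all add: EE_def EE4_def ac_simps)

context
  fixes c :: "'b::field"
  assumes two: "(2::'b) \<noteq> 0" and cubic: "c^3 + 2*c^2 + 2*c + 2 = 0"
begin

lemma nonzero_powers_of_2: "(8::'b) \<noteq> 0" "(4::'b) \<noteq> 0"
proof -
  have "(8::'b) = 2 * 2 * 2" "(4::'b) = 2 * 2" by simp_all
  then show "(8::'b) \<noteq> 0" "(4::'b) \<noteq> 0" using two by (metis mult_eq_0_iff)+
qed

text \<open>The cofactors below come from polynomial division by the (monic) relations.\<close>

lemma EE4_flip:
  assumes r2: "x^2 + y^2 + 2*c = 0" and r4: "v^2 - x^2*(2*c+x^2) - 2*(c^2+c) = 0"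
  shows "- v * EE4 c (x+y) T (x*y) v = (x+c)*(c^2+c-x) * EE4 c (y-x) T (- (x*y)) v"
proof -
  note simps = algebra_simps power2_eq_square power3_eq_cube power4_eq_xxxx
  \<comment> \<open>\<open>EE4\<close> is affine in \<open>T\<close>, which is subject to no
    relation here, so the coefficient of \<open>T\<close> and the constant coefficient are compared
    separately.\<close>
  have "- v*((x+y)*(x*y+v-2*c) - c^2*(x*y+v-2*c) + (2+4*c+c^2)*(x+y) + (4+6*c+4*c^2))
     - (x+c)*(c^2+c-x)*((y-x)*(- (x*y)+v-2*c) - c^2*(- (x*y)+v-2*c) + (2+4*c+c^2)*(y-x) + (4+6*c+4*c^2))
   = (- 2*v - y*v - x*v + x*y^2 + 2*x^2 + x^2*y - c*v - c*y + c*x + c*x*v + c*x^2 - c*x^2*y - 2*c^2 + c^2*v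
       - c^2*y - c^2*x - c^2*x*y - 2*c^3) * (c^3+2*c^2+2*c+2)
    + (- 2*x - x*v - x^3 - 2*c*x - c^2*x + c^2*x^2) * (x^2+y^2+2*c)
    + (- y - x + c^2) * (v^2 - x^2*(2*c+x^2) - 2*(c^2+c))"
    by (simp add: simps)
  then have 1: "- v*((x+y)*(x*y+v-2*c) - c^2*(x*y+v-2*c) + (2+4*c+c^2)*(x+y) + (4+6*c+4*c^2))
     = (x+c)*(c^2+c-x)*((y-x)*(- (x*y)+v-2*c) - c^2*(- (x*y)+v-2*c) + (2+4*c+c^2)*(y-x) + (4+6*c+4*c^2))"
    unfolding cubic r2 r4 by simp
  have "- v*((4+2*c+2*c^2)*(x*y+v-2*c) - c^2*(x+y)*(x*y+v-2*c) + (4+6*c+4*c^2)*(x+y) + 4*(c-1))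
     - (x+c)*(c^2+c-x)*((4+2*c+2*c^2)*(- (x*y)+v-2*c) - c^2*(y-x)*(- (x*y)+v-2*c) + (4+6*c+4*c^2)*(y-x) + 4*(c-1))
   = (2*v - 2*y*v - 2*x*v - 2*x*y*v - 2*x^2 + 2*x^2*v + 2*x^2*y + 2*x^2*y^2 - 2*x^3 - 2*x^3*y - 4*c - c*y*v
       - c*x*v + c*x*y*v + c*x*y^2 - c*x^2*v + c*x^2*y - c*x^2*y^2 + c*x^3*y - 2*c^2*v - 2*c^2*y + c^2*y*v +
       6*c^2*x - c^2*x*v - c^2*x*y^2 + 2*c^2*x^2 + c^2*x^2*y + 4*c^3 - 2*c^3*y + 2*c^3*x) * (c^3+2*c^2+2*c+2)
    + (- 4*x^2 - 2*c*x - 2*c*x^2 + c^2*x*v - 2*c^2*x^2 + c^2*x^3) * (x^2+y^2+2*c)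
    + (- 4 - 2*c - 2*c^2 + c^2*y + c^2*x) * (v^2 - x^2*(2*c+x^2) - 2*(c^2+c))"
    by (simp add: simps)
  then have 2: "- v*((4+2*c+2*c^2)*(x*y+v-2*c) - c^2*(x+y)*(x*y+v-2*c) + (4+6*c+4*c^2)*(x+y) + 4*(c-1))
     = (x+c)*(c^2+c-x)*((4+2*c+2*c^2)*(- (x*y)+v-2*c) - c^2*(y-x)*(- (x*y)+v-2*c) + (4+6*c+4*c^2)*(y-x) + 4*(c-1))"
    unfolding cubic r2 r4 by simp
  have e: "EE4 c S T u v = ((4+2*c+2*c^2)*(u+v-2*c) - c^2*S*(u+v-2*c) + (4+6*c+4*c^2)*S + 4*(c-1))
      + (S*(u+v-2*c) - c^2*(u+v-2*c) + (2+4*c+c^2)*S + (4+6*c+4*c^2)) * T" for S u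
    unfolding EE4_def by (simp add: algebra_simps)
  have lin: "k * (a + b * T) = k * a + k * b * T" for k a b by (simp add: algebra_simps)
  have "- v * EE4 c (x+y) T (x*y) v =
      - v*((4+2*c+2*c^2)*(x*y+v-2*c) - c^2*(x+y)*(x*y+v-2*c) + (4+6*c+4*c^2)*(x+y) + 4*(c-1))
      + - v*((x+y)*(x*y+v-2*c) - c^2*(x*y+v-2*c) + (2+4*c+c^2)*(x+y) + (4+6*c+4*c^2)) * T"
    unfolding e lin ..
  also have "\<dots> = (x+c)*(c^2+c-x) * EE4 c (y-x) T (- (x*y)) v"
    unfolding 1 2 e lin ..
  finally show ?thesis .
qed

lemma EE4_square:
  assumes S: "S^2 = 2*u - 2*c" and T: "T^2 = 2*v - 2*c" and r4: "v^2 + u^2 - 2*(c^2+c) = 0"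
  shows "(EE4 c S T u v)^2 = 8 * (((u+c*S+c^2)*((c^2+c)^2-(c^2+c)*S+u)) * ((v+c*T+c^2)*((c^2+c)^2-(c^2+c)*T+v)))"
proof -
  note simps = algebra_simps power2_eq_square power3_eq_cube power4_eq_xxxx
  \<comment> \<open>Coefficients of \<open>EE4\<close> at 1, at \<open>S + T\<close> and at
    \<open>S T\<close>. Once \<open>S^2\<close> and \<open>T^2\<close> are eliminated, the claim is
    compared at 1, \<open>S\<close>, \<open>T\<close> and \<open>S T\<close>, and \<open>g0\<close>,
    \<open>g1\<close> are the coefficients of one factor on the right.\<close>
  define U0 U1 V1 where U: "U0 = (4+2*c+2*c^2)*(u+v-2*c) + 4*(c-1)" "U1 = 4+6*c+4*c^2 - c^2*(u+v-2*c)"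
    "V1 = u+v-2*c + (2+4*c+c^2)"
  define g0 g1 where g: "g0 u = u^2 + (u+1)*(2*c^2+2*c+4)" "g1 u = 2*c - c^2*u" for u
  have G: "(u+c*S+c^2)*((c^2+c)^2-(c^2+c)*S+u) = g0 u + g1 u * S" if S: "S^2 = 2*u - 2*c" for u S
  proof -
    have "(u+c*S+c^2)*((c^2+c)^2-(c^2+c)*S+u) - (g0 u + g1 u * S) =
      (- 2 - S^2 - c + c*u - c*S + c^2*S + c^3) * (c^3+2*c^2+2*c+2)
      + (2 + 2*c + c^2) * (S^2 - 2*u + 2*c)"
      unfolding g by (simp add: simps)
    then show ?thesis unfolding cubic using S by simp
  qed
  have "U0^2 + U1^2*((2*u-2*c)+(2*v-2*c)) + V1^2*((2*u-2*c)*(2*v-2*c)) - 8*(g0 u * g0 v) =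
    (- 56 - 64*u - 24*u^2 - 4*u^3 - 64*v - 40*v*u - 12*v*u^2 - 24*v^2 - 12*v^2*u - 4*v^3 + 8*c + 24*c*u +
       12*c*u^2 + 2*c*u^3 + 24*c*v - 4*c*v*u + 6*c*v*u^2 + 12*c*v^2 + 6*c*v^2*u + 2*c*v^3 - 56*c^2 - 4*c^2*u
       - 12*c^2*u^2 - 4*c^2*v - 24*c^2*v*u - 12*c^2*v^2 - 12*c^3 + 24*c^3*u + 24*c^3*v - 16*c^4) * (c^3+2*c^2+2*c+2)
    + (32 + 8*u + 8*v + 4*v*u + 8*c + 24*c^2 + 4*c^2*u + 4*c^2*v) * (v^2+u^2-2*(c^2+c))"
    unfolding U g by (simp add: simps)
  then have 1: "U0^2 + U1^2*((2*u-2*c)+(2*v-2*c)) + V1^2*((2*u-2*c)*(2*v-2*c)) = 8*(g0 u * g0 v)"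
    unfolding cubic r4 by simp
  have S1: "U0*U1 + U1*V1*(2*v-2*c) = 4*(g1 u * g0 v)"
  proof -
    have "U0*U1 + U1*V1*(2*v-2*c) - 4*(g1 u * g0 v) =
      (- 8 + 8*u + 4*u^2 + 16*v + 4*v*u + 8*v^2 - 44*c + 4*c*u - 2*c*u^2 + 2*c*v*u - 4*c*v^2 - 16*c^2 +
       10*c^2*u + 14*c^2*v - 12*c^3) * (c^3+2*c^2+2*c+2)
      + (- 8 - 4*c - 8*c^2 - 2*c^2*v) * (v^2+u^2-2*(c^2+c))"
      unfolding U g by (simp add: simps)
    then show ?thesis unfolding cubic r4 by simp
  qed
  have T1: "U0*U1 + U1*V1*(2*u-2*c) = 4*(g1 v * g0 u)"
  proof -
    have "U0*U1 + U1*V1*(2*u-2*c) - 4*(g1 v * g0 u) =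
      (- 8 + 16*u + 8*u^2 + 8*v + 4*v*u + 4*v^2 - 44*c - 4*c*u^2 + 4*c*v + 2*c*v*u - 2*c*v^2 - 16*c^2 +
       14*c^2*u + 10*c^2*v - 12*c^3) * (c^3+2*c^2+2*c+2)
      + (- 8 - 4*c - 8*c^2 - 2*c^2*u) * (v^2+u^2-2*(c^2+c))"
      unfolding U g by (simp add: simps)
    then show ?thesis unfolding cubic r4 by simp
  qed
  have "U0*V1 + U1^2 - 4*(g1 u * g1 v) =
      (4 + 2*u - 2*u^2 + 2*v + 4*v*u - 2*v^2 + 20*c + 2*c*u + c*u^2 + 2*c*v - 2*c*v*u + c*v^2 + 4*c^2 -
       4*c^2*u - 4*c^2*v + 4*c^3) * (c^3+2*c^2+2*c+2)
      + (8 + 4*c + 4*c^2) * (v^2+u^2-2*(c^2+c))"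
    unfolding U g by (simp add: simps)
  then have ST: "U0*V1 + U1^2 = 4*(g1 u * g1 v)" unfolding cubic r4 by simp
  have "EE4 c S T u v = U0 + U1*(S+T) + V1*(S*T)" unfolding EE4_def U by (simp add: algebra_simps)
  then have "(EE4 c S T u v)^2 = U0^2 + U1^2*(S^2+T^2) + V1^2*(S^2*T^2)
      + 2*(U0*U1 + U1*V1*T^2)*S + 2*(U0*U1 + U1*V1*S^2)*T + 2*(U0*V1 + U1^2)*(S*T)"
    by (simp add: simps)
  also have "\<dots> = 8*(g0 u * g0 v) + 2*(4*(g1 u * g0 v))*S + 2*(4*(g1 v * g0 u))*T + 2*(4*(g1 u * g1 v))*(S*T)"
    unfolding S T 1 S1 T1 ST ..
  also have "\<dots> = 8 * ((g0 u + g1 u * S) * (g0 v + g1 v * T))" by (simp add: algebra_simps)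
  finally show ?thesis unfolding G[OF S] G[OF T] .
qed

text \<open>Relations between the labels of \<open>xaaa\<close>, \<open>xaba\<close>,
  \<open>xbaa\<close>, \<open>xbba\<close> below a node \<open>x\<close>. They come from the
  vanishing sum of sibling labels and from the value \<open>f^2(0) = c^2 + c\<close>
  (\<open>facts_32\<close>).\<close>

definition pts :: "'b \<Rightarrow> 'b \<Rightarrow> 'b \<Rightarrow> 'b \<Rightarrow> bool" where
  "pts x y z w \<longleftrightarrow> x^2 + y^2 = - 2*c \<and> z^2 + w^2 = - 2*c \<and> x^2*y^2 + z^2*w^2 = 2*(c^2+c)"

lemma EE_flip:
  assumes "pts x y z w"
  shows "- (z * w) * EE c x y z w = (x + c) * (c^2 + c - x) * EE c (- x) y z w"
proof -
  have a: "x^2 + y^2 = - 2*c" "x^2*y^2 + z^2*w^2 = 2*(c^2+c)" using assms by (auto simp: pts_def)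
  then have y2: "y^2 = - 2*c - x^2" by (metis add_diff_cancel_left')
  have "x^2*y^2 = - (x^2*(2*c+x^2))" unfolding y2 by (simp add: algebra_simps)
  then have "(z*w)^2 - x^2*(2*c+x^2) - 2*(c^2+c) = x^2*y^2 + z^2*w^2 - 2*(c^2+c)" by (simp add: power_mult_distrib)
  then have r4: "(z*w)^2 - x^2*(2*c+x^2) - 2*(c^2+c) = 0" using a(2) by simp
  have "x^2 + y^2 + 2*c = 0" using a(1) by simp
  from EE4_flip[OF this r4, of "z + w"] show ?thesis
    by (simp add: EE_def)
qed

lemma EE_square:
  assumes "pts x y z w"
  shows "((x+c)*(c^2+c-x)) * ((y+c)*(c^2+c-y)) * (((z+c)*(c^2+c-z)) * ((w+c)*(c^2+c-w))) = 2 * (EE c x y z w)^2"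
proof -
  have a: "x^2 + y^2 = - 2*c" "z^2 + w^2 = - 2*c" "x^2*y^2 + z^2*w^2 = 2*(c^2+c)" using assms by (auto simp: pts_def)
  have sq: "(u + v)^2 = 2*(u*v) - 2*c" if "u^2 + v^2 = - 2*c" for u v
  proof -
    have "(u + v)^2 = (u^2 + v^2) + 2*(u*v)" by (simp add: power2_eq_square algebra_simps)
    then show ?thesis using that by simp
  qed
  have "(z*w)^2 + (x*y)^2 - 2*(c^2+c) = 0" using a(3) by (simp add: power_mult_distrib add.commute)
  from EE4_square[OF sq[OF a(1)] sq[OF a(2)] this]
  have "(EE4 c (x+y) (z+w) (x*y) (z*w))^2 = 8 * (((x*y+c*(x+y)+c^2)*((c^2+c)^2-(c^2+c)*(x+y)+x*y)) *
      ((z*w+c*(z+w)+c^2)*((c^2+c)^2-(c^2+c)*(z+w)+z*w)))" .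
  moreover have "(u*v+c*(u+v)+c^2)*((c^2+c)^2-(c^2+c)*(u+v)+u*v) = (u+c)*(c^2+c-u) * ((v+c)*(c^2+c-v))" for u v
  proof -
    have "u*v+c*(u+v)+c^2 = (u+c)*(v+c)" "(c^2+c)^2-(c^2+c)*(u+v)+u*v = (c^2+c-u)*(c^2+c-v)"
      by (simp_all add: power2_eq_square algebra_simps)
    then show ?thesis by (simp add: ac_simps)
  qed
  moreover have "EE4 c (x+y) (z+w) (x*y) (z*w) = 4 * EE c x y z w" using nonzero_powers_of_2 by (simp add: EE_def)
  ultimately have "8 * (2 * (EE c x y z w)^2) = 8 * (((x+c)*(c^2+c-x)) * ((y+c)*(c^2+c-y)) * (((z+c)*(c^2+c-z)) * ((w+c)*(c^2+c-w))))"
    by (simp add: power_mult_distrib)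
  then show ?thesis using nonzero_powers_of_2(1) by (metis mult_left_cancel)
qed

text \<open>Each of the four functions gives a square root for both labels of its point. The signs
  of the points are changed one at a time: \<open>EE_flip\<close> contributes -1, and the product of
  the two points of the other pair has by then changed sign according to their turns, which yields
  the quadratic term \<open>(i + j) * (k + l)\<close>. This is the origin of the product in
  \<open>R32\<close>.\<close>

lemma flip_signs:
  fixes q q' :: "bit \<Rightarrow> bit \<Rightarrow> bit \<Rightarrow> bit \<Rightarrow> 'b"
  assumes b: "pts x y z w"
    and nz: "(x+c)*(c^2+c-x) \<noteq> 0" "(y+c)*(c^2+c-y) \<noteq> 0" "(z+c)*(c^2+c-z) \<noteq> 0" "(w+c)*(c^2+c-w) \<noteq> 0"
    and f: "f1 1 * ((x+c)*(c^2+c-x)) = f1 0 * (z*w)" "f2 1 * ((y+c)*(c^2+c-y)) = f2 0 * (z*w)"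
      "f3 1 * ((z+c)*(c^2+c-z)) = f3 0 * (x*y)" "f4 1 * ((w+c)*(c^2+c-w)) = f4 0 * (x*y)"
    and base: "f1 0 * f2 0 * (f3 0 * f4 0) = \<rho> * EE c x y z w"
  shows "f1 i * f2 j * (f3 k * f4 l) = sg (i + j + (k + l) + (i + j) * (k + l)) * \<rho> *
    EE c (sg i * x) (sg j * y) (sg k * z) (sg l * w)"
proof -
  have sgn: "pts (sg i * x) (sg j * y) (sg k * z) (sg l * w)" for i j k l :: bit
    using b by (cases i; cases j; cases k; cases l) (simp_all add: pts_def)
  have rot: "pts x y z w \<Longrightarrow> pts y x z w" "pts x y z w \<Longrightarrow> pts z w x y" for x y z w
    by (auto simp: pts_def ac_simps)
  have 1: "f1 i * f2 0 * (f3 0 * f4 0) = sg i * \<rho> * EE c (sg i * x) y z w" for i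
  proof (cases i)
    case one
    have "(f1 1 * f2 0 * (f3 0 * f4 0)) * ((x+c)*(c^2+c-x)) = (f1 1 * ((x+c)*(c^2+c-x))) * f2 0 * (f3 0 * f4 0)"
      by (simp add: ac_simps)
    also have "\<dots> = z * w * (f1 0 * f2 0 * (f3 0 * f4 0))" unfolding f(1) by (simp add: ac_simps)
    also have "\<dots> = - \<rho> * (- (z * w) * EE c x y z w)" unfolding base by simp
    also have "\<dots> = (- \<rho> * EE c (- x) y z w) * ((x+c)*(c^2+c-x))"
      unfolding EE_flip[OF b] by (simp add: ac_simps)
    finally have "f1 1 * f2 0 * (f3 0 * f4 0) = - \<rho> * EE c (- x) y z w"
      by (rule mult_right_cancel[OF nz(1), THEN iffD1])
    then show ?thesis using one by simp
  qed (simp add: base)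
  have 2: "f1 i * f2 j * (f3 0 * f4 0) = sg (i + j) * \<rho> * EE c (sg i * x) (sg j * y) z w" for i j
  proof (cases j)
    case one
    have p: "pts y (sg i * x) z w" by (rule rot(1)) (use sgn[of i 0 0 0] in simp)
    have "(f1 i * f2 1 * (f3 0 * f4 0)) * ((y+c)*(c^2+c-y)) = (f2 1 * ((y+c)*(c^2+c-y))) * f1 i * (f3 0 * f4 0)"
      by (simp add: ac_simps)
    also have "\<dots> = z * w * (f1 i * f2 0 * (f3 0 * f4 0))" unfolding f(2) by (simp add: ac_simps)
    also have "\<dots> = - sg i * \<rho> * (- (z * w) * EE c y (sg i * x) z w)" unfolding 1 EE_commute(2)[of c y] by (simp add: ac_simps)
    also have "\<dots> = (- sg i * \<rho> * EE c (sg i * x) (- y) z w) * ((y+c)*(c^2+c-y))"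
      unfolding EE_flip[OF p] EE_commute(2)[of c "- y"] by (simp add: ac_simps)
    finally have "f1 i * f2 1 * (f3 0 * f4 0) = - sg i * \<rho> * EE c (sg i * x) (- y) z w"
      by (rule mult_right_cancel[OF nz(2), THEN iffD1])
    then show ?thesis using one by (simp add: sg_add)
  qed (simp add: 1)
  have 3: "f1 i * f2 j * (f3 k * f4 0) = sg (i + j + k + (i + j) * k) * \<rho> * EE c (sg i * x) (sg j * y) (sg k * z) w" for i j k
  proof (cases k)
    case one
    have p: "pts z w (sg i * x) (sg j * y)" by (rule rot(2)) (use sgn[of i j 0 0] in simp)
    have "(f1 i * f2 j * (f3 1 * f4 0)) * ((z+c)*(c^2+c-z)) = (f3 1 * ((z+c)*(c^2+c-z))) * (f1 i * f2 j * f4 0)"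
      by (simp add: ac_simps)
    also have "\<dots> = x * y * (f1 i * f2 j * (f3 0 * f4 0))" unfolding f(3) by (simp add: ac_simps)
    also have "\<dots> = - sg (i + j) * sg (i + j) * \<rho> * (- ((sg i * x) * (sg j * y)) * EE c z w (sg i * x) (sg j * y))"
      unfolding 2 EE_commute(1)[of c z w] sg_add by (cases i; cases j) simp_all
    also have "\<dots> = (- \<rho> * EE c (sg i * x) (sg j * y) (- z) w) * ((z+c)*(c^2+c-z))"
      unfolding EE_flip[OF p] EE_commute(1)[of c "- z" w] by (simp add: ac_simps)
    finally have "f1 i * f2 j * (f3 1 * f4 0) = - \<rho> * EE c (sg i * x) (sg j * y) (- z) w"
      by (rule mult_right_cancel[OF nz(3), THEN iffD1])
    moreover have "i + j + 1 + (i + j) * 1 = 1" by (cases i; cases j) simp_all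
    ultimately show ?thesis using one by simp
  qed (simp add: 2)
  show ?thesis
  proof (cases l)
    case one
    have p: "pts w (sg k * z) (sg i * x) (sg j * y)" by (rule rot(1), rule rot(2)) (use sgn[of i j k 0] in simp)
    have "(f1 i * f2 j * (f3 k * f4 1)) * ((w+c)*(c^2+c-w)) = (f4 1 * ((w+c)*(c^2+c-w))) * (f1 i * f2 j * f3 k)"
      by (simp add: ac_simps)
    also have "\<dots> = x * y * (f1 i * f2 j * (f3 k * f4 0))" unfolding f(4) by (simp add: ac_simps)
    also have "\<dots> = - sg (i + j) * sg (i + j + k + (i + j) * k) * \<rho> *
        (- ((sg i * x) * (sg j * y)) * EE c w (sg k * z) (sg i * x) (sg j * y))"
      unfolding 3 EE_commute(1)[of c w "sg k * z"] EE_commute(3)[of c "sg i * x" "sg j * y" w] sg_add by (cases i; cases j) (simp_all add: ac_simps)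
    also have "\<dots> = (- sg (i + j) * sg (i + j + k + (i + j) * k) * \<rho> * EE c (sg i * x) (sg j * y) (sg k * z) (- w)) * ((w+c)*(c^2+c-w))"
      unfolding EE_flip[OF p] EE_commute(1)[of c "- w" "sg k * z"] EE_commute(3)[of c "sg i * x" "sg j * y" "- w"] by (simp add: ac_simps)
    finally have "f1 i * f2 j * (f3 k * f4 1) = - sg (i + j) * sg (i + j + k + (i + j) * k) * \<rho> * EE c (sg i * x) (sg j * y) (sg k * z) (- w)"
      by (rule mult_right_cancel[OF nz(4), THEN iffD1])
    moreover have "- sg (i + j) * sg (i + j + k + (i + j) * k) = (sg (i + j + (k + 1) + (i + j) * (k + 1)) :: 'b)"
      by (cases i; cases j; cases k) simp_all
    ultimately have "f1 i * f2 j * (f3 k * f4 1) = sg (i + j + (k + 1) + (i + j) * (k + 1)) * \<rho> *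
        EE c (sg i * x) (sg j * y) (sg k * z) (- w)" by (simp only:)
    then show ?thesis using one by simp
  qed (simp add: 3 add.assoc)
qed

end

text \<open>Without bijectivity on levels such a map exists for every base point, including those in
  the critical orbit, for which \<open>labeling\<close> cannot be satisfied.\<close>

definition prelabeling :: "'b::field \<Rightarrow> 'b \<Rightarrow> (word \<Rightarrow> 'b) \<Rightarrow> bool" where
  "prelabeling c t lab \<longleftrightarrow> lab [] = t \<and>
     (\<forall>w. lab (w @ [Lb]) = - lab (w @ [La]) \<and> lab (w @ [La]) ^ 2 = lab w - c)"

lemma prelabeling_ex:
  assumes sq: "\<And>x::'b::field. \<exists>y. y ^ 2 = x"
  shows "\<exists>lab. prelabeling c t (lab :: word \<Rightarrow> 'b)"
proof -
  define T where "T q w = (if w = [] then t else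
      let y = (SOME y. y ^ 2 = q (butlast w) - c) in if last w = La then y else - y)" for q :: "word \<Rightarrow> 'b" and w
  have "\<exists>lab. \<forall>w. lab w = T lab w"
    by (rule measure_recursion[where f = length]) (auto simp: T_def)
  then obtain lab where lab: "\<And>w. lab w = T lab w" by blast
  have "(SOME y. y ^ 2 = lab w - c) ^ 2 = lab w - c" for w by (rule someI_ex[OF sq])
  moreover have "lab (w @ [La]) = (SOME y. y ^ 2 = lab w - c)" "lab (w @ [Lb]) = - (SOME y. y ^ 2 = lab w - c)" for w
    using lab[of "w @ [La]"] lab[of "w @ [Lb]"] by (simp_all add: T_def)
  moreover have "lab [] = t" using lab[of "[]"] by (simp add: T_def)
  ultimately show ?thesis unfolding prelabeling_def by (intro exI[of _ lab]) simp
qed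

lemma prelabeling_act: "prelabeling c t lab \<Longrightarrow> prelabeling c t (lab \<circ> act q)"
  unfolding prelabeling_def comp_def act_snoc by (auto simp: turn_def split: if_splits)

context
  fixes c t :: "'b::field" and lab :: "word \<Rightarrow> 'b"
  assumes lab: "prelabeling c t lab"
begin

lemma lab_Nil: "lab [] = t"
  using lab by (simp add: prelabeling_def)

lemma lab_Lb: "lab (w @ [Lb]) = - lab (w @ [La])"
  using lab by (simp add: prelabeling_def)

lemma lab_sq: "lab (w @ [l]) ^ 2 = lab w - c"
  using lab by (cases l) (auto simp: prelabeling_def)

lemma lab_other: "lab (w @ [other l]) = - lab (w @ [l])"
  by (cases l) (simp_all add: lab_Lb)

lemma lab_turn: "lab (w @ [turn b l]) = sg b * lab (w @ [l])"
  by (cases b) (simp_all add: lab_other)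

lemma lab_quad: "(quad c ^^ length w) (lab w) = t"
proof (induction w rule: rev_induct)
  case (snoc l w)
  have "quad c (lab (w @ [l])) = lab w" by (simp add: quad_def lab_sq)
  then show ?case using snoc by (simp add: funpow_Suc_right del: funpow.simps)
qed (simp add: lab_Nil)

text \<open>The subtree is carried along by the automorphism, and each turn at a node
  \<open>m\<close> levels below \<open>u\<close> changes one sign. The lemma serves for changes of
  labeling and for Galois elements alike, since the latter also turn \<open>lab\<close> into
  \<open>lab \<circ> act q\<close>.\<close>

lemma PI_act: "PI (lab \<circ> act q) m u = sg (lev q m u) * PI lab m (act q u)"
proof (induction m arbitrary: u)
  case 0
  have "lab (act q u @ [turn (q u) La]) = sg (q u) * lab (act q u @ [La])" by (rule lab_turn)
  then show ?case by (simp add: act_snoc)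
next
  case (Suc m)
  have "PI lab m (act q u @ [turn (q u) La]) * PI lab m (act q u @ [turn (q u) Lb]) = PI lab (Suc m) (act q u)"
    using PI_Suc_other[of lab m "act q u" "turn (q u) La"] by (simp flip: turn_other)
  then show ?case unfolding PI_Suc[of "lab \<circ> act q"] Suc.IH lev_Suc sg_add act_snoc by (simp add: ac_simps)
qed

lemma PI_sq:
  "PI lab 0 u ^ 2 = lab u - c"
  "PI lab (Suc m) u ^ 2 = (quad c ^^ (Suc (Suc m))) 0 - lab u"
proof -
  show "PI lab 0 u ^ 2 = lab u - c" by (simp add: lab_sq)
  show "PI lab (Suc m) u ^ 2 = (quad c ^^ (Suc (Suc m))) 0 - lab u"
  proof (induction m arbitrary: u)
    case 0
    have "PI lab (Suc 0) u ^ 2 = (lab (u @ [La]) - c) * (- lab (u @ [La]) - c)"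
      by (simp only: PI_Suc power_mult_distrib PI_0 lab_sq lab_Lb)
    also have "\<dots> = c ^ 2 - lab (u @ [La]) ^ 2" by (simp add: algebra_simps power2_eq_square)
    finally show ?case by (simp add: quad_def lab_sq)
  next
    case (Suc m)
    let ?p = "(quad c ^^ (Suc (Suc m))) 0"
    have "PI lab (Suc (Suc m)) u ^ 2 = (?p - lab (u @ [La])) * (?p - (- lab (u @ [La])))"
      unfolding PI_Suc[of lab "Suc m"] power_mult_distrib Suc.IH lab_Lb ..
    also have "\<dots> = ?p ^ 2 - lab (u @ [La]) ^ 2" by (simp add: algebra_simps power2_eq_square)
    also have "\<dots> = (quad c ^^ (Suc (Suc (Suc m)))) 0 - lab u" by (simp add: quad_def lab_sq)
    finally show ?case .
  qed
qed

end

text \<open>\<open>qq lab 0 w\<close> is a square root of \<open>- ([wa] + c) (f\<^sup>2(0) - [wa])\<close>, and \<open>qq lab 1 w\<close> belongs to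
  the labeling with \<open>wa\<close> and \<open>wb\<close> interchanged.\<close>

definition qq :: "(word \<Rightarrow> 'b::field) \<Rightarrow> bit \<Rightarrow> word \<Rightarrow> 'b" where
  "qq lab e u = PI lab 0 (u @ [turn e Lb]) * PI lab 1 (u @ [turn e La])"

section \<open>Relations between products of labels, and how a portrait changes them\<close>

locale postcritical = params r s for r s :: nat +
  fixes c t :: "'b::field"
  assumes two: "(2::'b) \<noteq> 0" and sq: "\<And>x::'b. \<exists>y. y ^ 2 = x"
    and pre: "(quad c ^^ r) 0 = - (quad c ^^ s) 0"
    and c32: "r = 3 \<Longrightarrow> s = 2 \<Longrightarrow> c^3 + 2*c^2 + 2*c + 2 = 0"
begin

definition N1 :: "'b \<Rightarrow> (word \<Rightarrow> 'b) \<Rightarrow> word \<Rightarrow> letter \<Rightarrow> bool" where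
  "N1 \<iota> lab x l \<longleftrightarrow> PI lab (r - 1) (x @ [l]) = \<iota> * PI lab (s - 1) (x @ [other l])"

text \<open>Both exceptional forms relate a product of square roots to a polynomial in labels by
  means of a square root of 2. In the remaining case there is no second relation.\<close>

definition N2 :: "'b \<Rightarrow> (word \<Rightarrow> 'b) \<Rightarrow> word \<Rightarrow> bool" where
  "N2 \<kappa> lab x \<longleftrightarrow>
     (if s = 1 then \<kappa> * (PI lab (r - 2) (x @ [La, Lb]) * PI lab (r - 2) (x @ [Lb, Lb])) =
        (quad c ^^ (r - 1)) 0 - lab (x @ [La, Lb]) - lab (x @ [Lb, Lb])
      else if r = 3 \<and> s = 2 then
        (\<Prod>w\<in>words 2. qq lab 0 (x @ w)) =
          \<kappa> * EE c (lab (x @ [La, La, La])) (lab (x @ [La, Lb, La])) (lab (x @ [Lb, La, La])) (lab (x @ [Lb, Lb, La]))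
      else True)"

text \<open>Depth below \<open>x\<close> of the deepest parity in \<open>Rc\<close> at
  \<open>x\<close>, in the exceptional cases; labels one level deeper enter
  \<open>N2\<close>.\<close>

definition reach :: nat where
  "reach = (if s = 1 then r else 4)"

text \<open>For \<open>s = 1\<close> the product on the right of \<open>N1\<close> squares to a
  label minus \<open>c\<close> and not to \<open>c\<close> minus a label, so \<open>\<iota>\<close>
  is a sign; for larger \<open>s\<close> it is a square root of -1.\<close>

definition iotaok :: "'b \<Rightarrow> bool" where
  "iotaok \<iota> \<longleftrightarrow> \<iota> ^ 2 = (if s = 1 then 1 else - 1)"

lemma N1_sq: "prelabeling c t lab \<Longrightarrow> iotaok \<iota> \<Longrightarrow>
  PI lab (r - 1) (x @ [l]) ^ 2 = (\<iota> * PI lab (s - 1) (x @ [other l])) ^ 2"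
proof -
  assume lab: "prelabeling c t lab" and i: "iotaok \<iota>"
  obtain m where m: "r - 1 = Suc m" "Suc (Suc m) = r" using r3 by (intro that[of "r - 2"]) auto
  have "PI lab (r - 1) (x @ [l]) ^ 2 = - (quad c ^^ s) 0 - lab (x @ [l])"
    unfolding m(1) PI_sq(2)[OF lab] m(2) pre ..
  also have "\<dots> = (\<iota> * PI lab (s - 1) (x @ [other l])) ^ 2"
  proof (cases "s = 1")
    case True
    then have i1: "\<iota> ^ 2 = 1" and s0: "s - 1 = 0" using i[unfolded iotaok_def] by simp_all
    show ?thesis unfolding power_mult_distrib s0 PI_sq(1)[OF lab] i1 by (simp add: True quad_def lab_other[OF lab])
  next
    case False
    then obtain k where k: "s - 1 = Suc k" "Suc (Suc k) = s" using s1 by (intro that[of "s - 2"]) auto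
    show ?thesis using i False unfolding k(1) power_mult_distrib PI_sq(2)[OF lab] k(2)
      by (simp add: iotaok_def lab_other[OF lab])
  qed
  finally show ?thesis .
qed

text \<open>Both products change by the signs of their level sums, and comparing the signs turns the
  relation into the equation for \<open>Pc\<close>. This explains the defining condition of
  \<open>M_inf\<close>.\<close>

lemma N1_change:
  assumes lab: "prelabeling c t lab" and nz: "\<And>w. w \<noteq> [] \<Longrightarrow> lab w \<noteq> 0"
    and N: "N1 \<iota> lab (act q x) (turn (q x) l)" and i: "iotaok \<iota>"
  shows "N1 (sg e * \<iota>) (lab \<circ> act q) x l \<longleftrightarrow> Pc r s q x l = e"
proof -
  let ?y = "act q x" and ?l = "turn (q x) l"
  have "PI lab (s - 1) u \<noteq> 0" for u unfolding PI_def using nz by simp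
  moreover have "\<iota> \<noteq> 0" using i by (auto simp: iotaok_def split: if_splits)
  ultimately have z: "\<iota> * PI lab (s - 1) (?y @ [other ?l]) \<noteq> 0" by simp
  have "N1 (sg e * \<iota>) (lab \<circ> act q) x l \<longleftrightarrow>
      sg (lev q (r - 1) (x @ [l])) * (\<iota> * PI lab (s - 1) (?y @ [other ?l])) =
      sg (e + lev q (s - 1) (x @ [other l])) * (\<iota> * PI lab (s - 1) (?y @ [other ?l]))"
    using N unfolding N1_def PI_act[OF lab] act_snoc turn_other sg_add by (simp add: ac_simps)
  then show ?thesis unfolding sg_eq_iff[OF two z] Pc_def bit_add_eq_iff by (simp only: add.commute)
qed

lemma N1_ex: "prelabeling c t lab \<Longrightarrow> iotaok \<iota> \<Longrightarrow> \<exists>e. N1 (sg e * \<iota>) lab x l"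
  using square_sg[OF N1_sq] unfolding N1_def by (metis mult.assoc)

text \<open>The two relations for \<open>s = 1\<close> that carry \<open>\<surd>2\<close> from one choice of the nodes below \<open>xa\<close>, \<open>xb\<close> to the others.\<close>

lemma pcr_1:
  assumes "s = 1"
  shows "((quad c ^^ (r - 1)) 0) ^ 2 = - 2 * c"
proof -
  obtain m where m: "r = Suc m" using r3 by (cases r) auto
  have "((quad c ^^ m) 0)^2 + c = - c" using pre unfolding m assms by (simp add: quad_def)
  then show ?thesis by (simp add: m eq_neg_iff_add_eq_0 add.assoc)
qed

lemma betas:
  assumes lab: "prelabeling c t lab"
  shows "lab (x @ [La, l]) ^ 2 + lab (x @ [Lb, l']) ^ 2 = - 2 * c"
proof -
  have "lab ((x @ [La]) @ [l]) ^ 2 = lab (x @ [La]) - c" "lab ((x @ [Lb]) @ [l']) ^ 2 = lab (x @ [Lb]) - c"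
    by (rule lab_sq[OF lab])+
  then show ?thesis by (simp add: lab_Lb[OF lab])
qed

lemma facts_32:
  assumes rs: "r = 3" "s = 2" and lab: "prelabeling c t lab"
    and N: "\<And>l. N1 \<iota> lab x l" "\<And>l l'. N1 \<iota> lab (x @ [l]) l'" and i: "iotaok \<iota>"
  shows "qq lab 0 (x @ [l, m]) ^ 2 = - ((lab (x @ [l, m, La]) + c) * (c^2 + c - lab (x @ [l, m, La])))"
    and "qq lab 1 (x @ [l, m]) * ((lab (x @ [l, m, La]) + c) * (c^2 + c - lab (x @ [l, m, La]))) =
      qq lab 0 (x @ [l, m]) * (lab (x @ [other l, La, La]) * lab (x @ [other l, Lb, La]))"
    and "pts c (lab (x @ [La, La, La])) (lab (x @ [La, Lb, La])) (lab (x @ [Lb, La, La])) (lab (x @ [Lb, Lb, La]))"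
proof -
  let ?u = "x @ [l, m]"
  have P1: "PI lab 1 w ^ 2 = c^2 + c - lab w" for w
    using PI_sq(2)[OF lab, of 0 w] by (simp add: quad_def)
  show sq0: "qq lab 0 ?u ^ 2 = - ((lab (x @ [l, m, La]) + c) * (c^2 + c - lab (x @ [l, m, La])))"
    using lab_Lb[OF lab, of ?u] unfolding qq_def power_mult_distrib turn_0 PI_sq(1)[OF lab] P1
    by (simp add: algebra_simps)
  have "\<iota> ^ 2 = - 1" using i[unfolded iotaok_def] rs(2) by simp
  then have ii: "\<iota> * (\<iota> * z) = - z" for z by (simp add: power2_eq_square mult.assoc[symmetric])
  have P2: "PI lab 2 w = PI lab 1 (w @ [La]) * PI lab 1 (w @ [Lb])" for w
    using PI_Suc[of lab 1 w] by (simp add: numeral_2_eq_2)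
  \<comment> \<open>The two choices together make full products below \<open>u\<close>.
    \<open>N1\<close> is then applied at \<open>xl\<close> and at \<open>x\<close>, and the two
    factors \<open>\<iota>\<close> combine to -1.\<close>
  have "qq lab 0 ?u * qq lab 1 ?u = PI lab 1 ?u * PI lab 2 ?u"
    unfolding P2 using PI_Suc[of lab 0 ?u] by (simp add: qq_def ac_simps)
  also have "PI lab 2 ?u = \<iota> * PI lab 1 (x @ [l, other m])"
    using N(2)[of l m, unfolded N1_def] rs by simp
  also have "PI lab 1 ?u * (\<iota> * PI lab 1 (x @ [l, other m])) = \<iota> * PI lab 2 (x @ [l])"
    unfolding P2 by (cases m) (simp_all add: ac_simps)
  also have "PI lab 2 (x @ [l]) = \<iota> * PI lab 1 (x @ [other l])"
    using N(1)[of l, unfolded N1_def] rs by simp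
  also have "PI lab 1 (x @ [other l]) = lab (x @ [other l, La, La]) * lab (x @ [other l, Lb, La])"
    using PI_Suc[of lab 0 "x @ [other l]"] by simp
  finally have q01: "qq lab 0 ?u * qq lab 1 ?u = - (lab (x @ [other l, La, La]) * lab (x @ [other l, Lb, La]))"
    unfolding ii .
  have "qq lab 1 ?u * ((lab (x @ [l, m, La]) + c) * (c^2 + c - lab (x @ [l, m, La]))) = - (qq lab 1 ?u * qq lab 0 ?u ^ 2)"
    unfolding sq0 by simp
  also have "\<dots> = qq lab 0 ?u * - (qq lab 0 ?u * qq lab 1 ?u)"
    by (simp only: power2_eq_square mult_minus_right mult.left_commute mult.commute)
  finally show "qq lab 1 ?u * ((lab (x @ [l, m, La]) + c) * (c^2 + c - lab (x @ [l, m, La]))) =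
      qq lab 0 ?u * (lab (x @ [other l, La, La]) * lab (x @ [other l, Lb, La]))"
    unfolding q01 by simp
  have "lab (x @ [l, La, La]) ^ 2 + lab (x @ [l, Lb, La]) ^ 2 = - 2 * c" for l
    using lab_sq[OF lab, of "x @ [l, La]" La] lab_sq[OF lab, of "x @ [l, Lb]" La] lab_Lb[OF lab, of "x @ [l]"] by simp
  moreover have "lab (x @ [l, La, La]) ^ 2 * lab (x @ [l, Lb, La]) ^ 2 = c^2 + c - lab (x @ [l])" for l
    using P1[of "x @ [l]"] PI_Suc[of lab 0 "x @ [l]"] by (simp add: power_mult_distrib)
  ultimately show "pts c (lab (x @ [La, La, La])) (lab (x @ [La, Lb, La])) (lab (x @ [Lb, La, La])) (lab (x @ [Lb, Lb, La]))"
    using lab_Lb[OF lab, of x] c32[OF rs] by (simp add: pts_def[OF two])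
qed

lemma prod_words_2: "(\<Prod>w\<in>words 2. f w) = f [La, La] * f [La, Lb] * (f [Lb, La] * f [Lb, Lb])" for f :: "word \<Rightarrow> 'b"
  by (simp add: numeral_2_eq_2 prod_words_Suc_Cons)

text \<open>Both sides have the same square, so the relation holds after a change of the sign of
  \<open>\<kappa>\<close>. For \<open>s = 1\<close> this rests on \<open>b^2 + b'^2 = p^2\<close>,
  obtained from \<open>betas\<close> and \<open>pcr_1\<close>; for \<open>(3, 2)\<close> it is
  \<open>EE_square\<close>.\<close>

lemma N2_sq:
  assumes lab: "prelabeling c t lab" and nz: "\<And>w. w \<noteq> [] \<Longrightarrow> lab w \<noteq> 0" and \<kappa>: "\<kappa> ^ 2 = 2"
    and N: "\<And>l. r = 3 \<Longrightarrow> s = 2 \<Longrightarrow> N1 \<iota> lab x l" "\<And>l l'. r = 3 \<Longrightarrow> s = 2 \<Longrightarrow> N1 \<iota> lab (x @ [l]) l'" and i: "iotaok \<iota>"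
  shows "\<exists>e. N2 (sg e * \<kappa>) lab x"
proof -
  consider (one) "s = 1" | (two) "r = 3" "s = 2" | (gen) "s \<noteq> 1" "\<not> (r = 3 \<and> s = 2)" by blast
  then show ?thesis
  proof cases
    case one
    let ?p = "(quad c ^^ (r - 1)) 0" and ?b = "lab (x @ [La, Lb])" and ?b' = "lab (x @ [Lb, Lb])"
    obtain m where m: "r - 2 = Suc m" "Suc (Suc m) = r - 1" using r3 by (intro that[of "r - 3"]) auto
    have "(\<kappa> * (PI lab (r - 2) (x @ [La, Lb]) * PI lab (r - 2) (x @ [Lb, Lb])))^2 = 2 * ((?p - ?b) * (?p - ?b'))"
      unfolding m(1) power_mult_distrib PI_sq(2)[OF lab] m(2) \<kappa> ..
    also have "\<dots> = 2*?p^2 - 2*?p*?b - 2*?p*?b' + 2*?b*?b'" by (simp add: algebra_simps power2_eq_square)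
    also have "\<dots> = ?p^2 + (?b^2 + ?b'^2) - 2*?p*?b - 2*?p*?b' + 2*?b*?b'"
      unfolding betas[OF lab] pcr_1[OF one] by simp
    also have "\<dots> = (?p - ?b - ?b')^2" by (simp add: algebra_simps power2_eq_square)
    finally have "(?p - ?b - ?b')^2 = (\<kappa> * (PI lab (r - 2) (x @ [La, Lb]) * PI lab (r - 2) (x @ [Lb, Lb])))^2" by simp
    from square_sg[OF this] obtain e where e: "?p - ?b - ?b' =
        sg e * (\<kappa> * (PI lab (r - 2) (x @ [La, Lb]) * PI lab (r - 2) (x @ [Lb, Lb])))" by blast
    have "N2 (sg e * \<kappa>) lab x" unfolding N2_def if_P[OF one] e by (simp only: mult.assoc)
    then show ?thesis ..
  next
    case two
    note F = facts_32[OF two lab N(1)[OF two] N(2)[OF two] i]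
    let ?b = "\<lambda>l m. lab (x @ [l, m, La])"
    let ?E = "EE c (?b La La) (?b La Lb) (?b Lb La) (?b Lb Lb)"
    have "(\<Prod>w\<in>words 2. qq lab 0 (x @ w)) ^ 2 = 2 * ?E ^ 2"
      unfolding prod_words_2 power_mult_distrib F(1)
        EE_square[OF postcritical.two[OF postcritical_axioms] c32[OF two] F(3), symmetric] by simp
    also have "\<dots> = (\<kappa> * ?E) ^ 2" unfolding power_mult_distrib \<kappa> ..
    finally obtain e where e: "(\<Prod>w\<in>words 2. qq lab 0 (x @ w)) = sg e * (\<kappa> * ?E)" using square_sg by blast
    have "s \<noteq> 1" using two by simp
    then have "N2 (sg e * \<kappa>) lab x" unfolding N2_def e using two by (simp add: mult.assoc)
    then show ?thesis ..
  next
    case gen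
    then show ?thesis unfolding N2_def by auto
  qed
qed

text \<open>The relation for the nodes \<open>ab\<close>, \<open>bb\<close> is carried to the other
  choices by \<open>ff\<close>, a form of \<open>N1\<close>, after multiplication by the square of
  the factor to be exchanged. Only the exchange on both sides produces a sign, which is the product
  of parities in \<open>Rr1\<close>.\<close>

lemma N2_change_1:
  assumes s: "s = 1" and lab: "prelabeling c t lab" and nz: "\<And>w. w \<noteq> [] \<Longrightarrow> lab w \<noteq> 0" and \<kappa>: "\<kappa> ^ 2 = 2"
    and N: "\<And>x l. N1 1 lab x l" and N2: "N2 \<kappa> lab (act q x)"
  shows "N2 (sg e * \<kappa>) (lab \<circ> act q) x \<longleftrightarrow> Rc r s q x = e"
proof -
  define y where "y = act q x"
  define f where "f l m = PI lab (r - 2) (y @ [l, m])" for l m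
  define \<beta> where "\<beta> l = lab (y @ [l, Lb])" for l
  let ?p = "(quad c ^^ (r - 1)) 0"
  have fn: "f l m \<noteq> 0" for l m unfolding f_def PI_def using nz by simp
  obtain m where m: "r - 2 = Suc m" "Suc (Suc m) = r - 1" using r3 by (intro that[of "r - 3"]) auto
  have la: "lab (y @ [l, La]) = - \<beta> l" for l
    using lab_Lb[OF lab, of "y @ [l]"] by (simp add: \<beta>_def)
  have fsq: "f l Lb ^ 2 = ?p - \<beta> l" for l
    unfolding f_def m(1) PI_sq(2)[OF lab] m(2) \<beta>_def ..
  have fnz: "?p - \<beta> l \<noteq> 0" for l using fn[of l Lb] unfolding fsq[symmetric] by simp
  have ff: "f l La * f l Lb = - \<beta> (other l)" for l
  proof -
    have "PI lab (r - 1) (y @ [l]) = PI lab 0 (y @ [other l])" using N[of y l, unfolded N1_def] s by simp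
    moreover have "PI lab (r - 1) (y @ [l]) = f l La * f l Lb"
      using PI_Suc[of lab "r - 2" "y @ [l]"] r3 by (simp add: f_def numeral_2_eq_2 Suc_diff_Suc)
    ultimately show ?thesis using la[of "other l"] by simp
  qed
  have bb: "\<beta> La ^ 2 + \<beta> Lb ^ 2 = ?p ^ 2" unfolding \<beta>_def betas[OF lab] pcr_1[OF s] ..
  have b0: "\<kappa> * (f La Lb * f Lb Lb) = ?p - \<beta> La - \<beta> Lb"
    using N2[unfolded N2_def if_P[OF s]] by (simp add: f_def \<beta>_def y_def)
  have b1: "\<kappa> * (f La La * f Lb Lb) = ?p + \<beta> La - \<beta> Lb"
  proof -
    have "(\<kappa> * (f La La * f Lb Lb)) * (?p - \<beta> La) = (f La La * f La Lb) * (\<kappa> * (f La Lb * f Lb Lb))"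
      unfolding fsq[of La, symmetric] by (simp add: power2_eq_square ac_simps)
    also have "\<dots> = - \<beta> Lb * (?p - \<beta> La - \<beta> Lb)" by (simp only: ff b0 other.simps)
    also have "\<dots> = (?p + \<beta> La - \<beta> Lb) * (?p - \<beta> La) + (\<beta> La ^ 2 + \<beta> Lb ^ 2 - ?p ^ 2)"
      by (simp add: algebra_simps power2_eq_square)
    finally show ?thesis unfolding bb diff_self add_0_right diff_0_right by (rule mult_right_cancel[OF fnz, THEN iffD1])
  qed
  have b2: "\<kappa> * (f La Lb * f Lb La) = ?p - \<beta> La + \<beta> Lb"
  proof -
    have "(\<kappa> * (f La Lb * f Lb La)) * (?p - \<beta> Lb) = (f Lb La * f Lb Lb) * (\<kappa> * (f La Lb * f Lb Lb))"
      unfolding fsq[of Lb, symmetric] by (simp add: power2_eq_square ac_simps)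
    also have "\<dots> = - \<beta> La * (?p - \<beta> La - \<beta> Lb)" by (simp only: ff b0 other.simps)
    also have "\<dots> = (?p - \<beta> La + \<beta> Lb) * (?p - \<beta> Lb) + (\<beta> La ^ 2 + \<beta> Lb ^ 2 - ?p ^ 2)"
      by (simp add: algebra_simps power2_eq_square)
    finally show ?thesis unfolding bb diff_self add_0_right diff_0_right by (rule mult_right_cancel[OF fnz, THEN iffD1])
  qed
  have b3: "\<kappa> * (f La La * f Lb La) = - (?p + \<beta> La + \<beta> Lb)"
  proof -
    have "(\<kappa> * (f La La * f Lb La)) * (?p - \<beta> Lb) = (f Lb La * f Lb Lb) * (\<kappa> * (f La La * f Lb Lb))"
      unfolding fsq[of Lb, symmetric] by (simp add: power2_eq_square ac_simps)
    also have "\<dots> = - \<beta> La * (?p + \<beta> La - \<beta> Lb)" by (simp only: ff b1 other.simps)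
    also have "\<dots> = - (?p + \<beta> La + \<beta> Lb) * (?p - \<beta> Lb) - (\<beta> La ^ 2 + \<beta> Lb ^ 2 - ?p ^ 2)"
      by (simp add: algebra_simps power2_eq_square)
    finally show ?thesis unfolding bb diff_self add_0_right diff_0_right by (rule mult_right_cancel[OF fnz, THEN iffD1])
  qed
  have step: "\<kappa> * (f l (turn i Lb) * f (other l) (turn j Lb)) =
      sg (i * j) * (?p - lab (y @ [l, turn i Lb]) - lab (y @ [other l, turn j Lb]))" for l i j
    using b0 b1 b2 b3 la
    by (cases l; cases i; cases j) (simp_all add: \<beta>_def[symmetric] ac_simps)
  let ?l = "turn (q x) La" and ?i = "q (x @ [La])" and ?j = "q (x @ [Lb])"
  have ol: "turn (q x) Lb = other ?l" by (simp flip: turn_other)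
  have a2: "act q (x @ [l, l']) = y @ [turn (q x) l, turn (q (x @ [l])) l']" for l l'
    using act_snoc[of q "x @ [l]" l'] by (simp add: act_snoc y_def)
  have "N2 (sg e * \<kappa>) (lab \<circ> act q) x \<longleftrightarrow>
      sg (e + (lev q (r - 2) (x @ [La, Lb]) + lev q (r - 2) (x @ [Lb, Lb]))) * (\<kappa> * (f ?l (turn ?i Lb) * f (other ?l) (turn ?j Lb))) =
      ?p - lab (y @ [?l, turn ?i Lb]) - lab (y @ [other ?l, turn ?j Lb])"
    unfolding N2_def if_P[OF s] PI_act[OF lab] comp_apply a2 f_def ol sg_add by (simp add: ac_simps)
  also have "?p - lab (y @ [?l, turn ?i Lb]) - lab (y @ [other ?l, turn ?j Lb]) =
      sg (?i * ?j) * (\<kappa> * (f ?l (turn ?i Lb) * f (other ?l) (turn ?j Lb)))"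
    unfolding step by simp
  finally have iff: "N2 (sg e * \<kappa>) (lab \<circ> act q) x \<longleftrightarrow>
      sg (e + (lev q (r - 2) (x @ [La, Lb]) + lev q (r - 2) (x @ [Lb, Lb]))) * (\<kappa> * (f ?l (turn ?i Lb) * f (other ?l) (turn ?j Lb))) =
      sg (?i * ?j) * (\<kappa> * (f ?l (turn ?i Lb) * f (other ?l) (turn ?j Lb)))" .
  show ?thesis
  proof -
    have "\<kappa> \<noteq> 0" using \<kappa> two by auto
    then have nz: "\<kappa> * (f ?l (turn ?i Lb) * f (other ?l) (turn ?j Lb)) \<noteq> 0" using fn by simp
    have "(e + (a + b) = d) = (d + a + b = e)" for a b d :: bit
      by (cases a; cases b; cases e; cases d) simp_all
    then show ?thesis unfolding iff sg_eq_iff[OF two nz] Rc_def if_P[OF s] .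
  qed
qed

text \<open>Turns at the four nodes of depth 2 are covered by \<open>flip_signs\<close>. Turns at
  depths 0 and 1 permute these nodes, and \<open>sw\<close> shows that the formula \<open>Fl\<close>
  respects the permutations. The deeper turns contribute the level sums that complete
  \<open>R32\<close>.\<close>

lemma N2_change_32:
  assumes rs: "r = 3" "s = 2" and lab: "prelabeling c t lab" and nz: "\<And>w. w \<noteq> [] \<Longrightarrow> lab w \<noteq> 0" and \<kappa>: "\<kappa> ^ 2 = 2"
    and N: "\<And>x l. N1 \<iota> lab x l" and i: "iotaok \<iota>" and N2: "N2 \<kappa> lab (act q x)"
  shows "N2 (sg e * \<kappa>) (lab \<circ> act q) x \<longleftrightarrow> Rc r s q x = e"
proof -
  define y where "y = act q x"
  note F = facts_32[OF rs lab N N i]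
  have qn: "qq lab e u \<noteq> 0" for e u unfolding qq_def PI_def using nz by simp
  define Fl where "Fl w1 w2 w3 w4 \<longleftrightarrow> (\<forall>i j k l. qq lab i (y @ w1) * qq lab j (y @ w2) * (qq lab k (y @ w3) * qq lab l (y @ w4)) =
      sg (i + j + (k + l) + (i + j) * (k + l)) * \<kappa> *
      EE c (sg i * lab (y @ w1 @ [La])) (sg j * lab (y @ w2 @ [La])) (sg k * lab (y @ w3 @ [La])) (sg l * lab (y @ w4 @ [La])))"
    for w1 w2 w3 w4
  have F0: "Fl [La, La] [La, Lb] [Lb, La] [Lb, Lb]"
    unfolding Fl_def
  proof (intro allI)
    fix i j k l
    have nN: "(lab (y @ [l, m, La]) + c) * (c^2 + c - lab (y @ [l, m, La])) \<noteq> 0" for l m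
      using F(1)[of y l m] qn[of 0 "y @ [l, m]"] by (metis neg_equal_0_iff_equal power_eq_0_iff zero_neq_numeral power2_eq_square mult_eq_0_iff)
    have base: "qq lab 0 (y @ [La, La]) * qq lab 0 (y @ [La, Lb]) * (qq lab 0 (y @ [Lb, La]) * qq lab 0 (y @ [Lb, Lb])) =
       \<kappa> * EE c (lab (y @ [La, La, La])) (lab (y @ [La, Lb, La])) (lab (y @ [Lb, La, La])) (lab (y @ [Lb, Lb, La]))"
      using N2 rs unfolding N2_def prod_words_2 y_def[symmetric] by simp
    show "qq lab i (y @ [La, La]) * qq lab j (y @ [La, Lb]) * (qq lab k (y @ [Lb, La]) * qq lab l (y @ [Lb, Lb])) =
      sg (i + j + (k + l) + (i + j) * (k + l)) * \<kappa> *
      EE c (sg i * lab (y @ [La, La] @ [La])) (sg j * lab (y @ [La, Lb] @ [La])) (sg k * lab (y @ [Lb, La] @ [La])) (sg l * lab (y @ [Lb, Lb] @ [La]))"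
      using flip_signs[OF two c32[OF rs] F(3)[of y] nN nN nN nN, where ?f1.0 = "\<lambda>i. qq lab i (y @ [La, La])"
        and ?f2.0 = "\<lambda>i. qq lab i (y @ [La, Lb])" and ?f3.0 = "\<lambda>i. qq lab i (y @ [Lb, La])"
        and ?f4.0 = "\<lambda>i. qq lab i (y @ [Lb, Lb])" and \<rho> = \<kappa> and i = i and j = j and k = k and l = l,
        OF _ _ _ _ base] F(2)[of y La] F(2)[of y Lb] by simp
  qed
  have sw: "Fl w2 w1 w3 w4" "Fl w1 w2 w4 w3" "Fl w3 w4 w1 w2" if "Fl w1 w2 w3 w4" for w1 w2 w3 w4
    unfolding Fl_def
  proof (safe)
    fix i j k l
    note f = that[unfolded Fl_def, rule_format]
    show "qq lab i (y @ w2) * qq lab j (y @ w1) * (qq lab k (y @ w3) * qq lab l (y @ w4)) =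
      sg (i + j + (k + l) + (i + j) * (k + l)) * \<kappa> *
      EE c (sg i * lab (y @ w2 @ [La])) (sg j * lab (y @ w1 @ [La])) (sg k * lab (y @ w3 @ [La])) (sg l * lab (y @ w4 @ [La]))"
      unfolding mult.commute[of "qq lab i (y @ w2)"] f[of j i k l] EE_commute(2)[of c "sg i * lab (y @ w2 @ [La])"] add.commute[of i j] ..
    show "qq lab i (y @ w1) * qq lab j (y @ w2) * (qq lab k (y @ w4) * qq lab l (y @ w3)) =
      sg (i + j + (k + l) + (i + j) * (k + l)) * \<kappa> *
      EE c (sg i * lab (y @ w1 @ [La])) (sg j * lab (y @ w2 @ [La])) (sg k * lab (y @ w4 @ [La])) (sg l * lab (y @ w3 @ [La]))"
      unfolding mult.commute[of "qq lab k (y @ w4)"] f[of i j l k] EE_commute(3)[of c _ _ "sg k * lab (y @ w4 @ [La])"] add.commute[of k l] ..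
    show "qq lab i (y @ w3) * qq lab j (y @ w4) * (qq lab k (y @ w1) * qq lab l (y @ w2)) =
      sg (i + j + (k + l) + (i + j) * (k + l)) * \<kappa> *
      EE c (sg i * lab (y @ w3 @ [La])) (sg j * lab (y @ w4 @ [La])) (sg k * lab (y @ w1 @ [La])) (sg l * lab (y @ w2 @ [La]))"
      unfolding mult.commute[of "qq lab i (y @ w3) * qq lab j (y @ w4)"] f[of k l i j]
        EE_commute(1)[of c "sg i * lab (y @ w3 @ [La])"] add.commute[of "i + j" "k + l"] mult.commute[of "i + j" "k + l"] ..
  qed
  let ?w = "\<lambda>l m. [turn (q x) l, turn (q (x @ [l])) m]"
  have "Fl [turn a La, turn b La] [turn a La, turn b Lb] [turn a Lb, turn d La] [turn a Lb, turn d Lb]" for a b d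
  proof (cases a)
    case zero
    then show ?thesis using F0 sw(1)[OF F0] sw(2)[OF F0] sw(2)[OF sw(1)[OF F0]] by (cases b; cases d) simp_all
  next
    case one
    note F1 = sw(3)[OF F0]
    show ?thesis using one F1 sw(1)[OF F1] sw(2)[OF F1] sw(2)[OF sw(1)[OF F1]] by (cases b; cases d) simp_all
  qed
  then have G: "Fl (?w La La) (?w La Lb) (?w Lb La) (?w Lb Lb)" .
  define \<beta> where "\<beta> l m = (lab \<circ> act q) (x @ [l, m, La])" for l m
  define S where "S = (\<lambda>l m. q (x @ [l, m, Lb]) + lev q 1 (x @ [l, m, La]))"
  have a2: "act q (x @ [l, m]) = y @ ?w l m" for l m
    using act_snoc[of q "x @ [l]" m] by (simp add: act_snoc y_def)
  have bt: "\<beta> l m = sg (q (x @ [l, m])) * lab (y @ ?w l m @ [La])" for l m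
    using PI_act[OF lab, of q 0 "x @ [l, m]"] unfolding a2 by (simp add: \<beta>_def)
  have q2: "qq (lab \<circ> act q) 0 (x @ [l, m]) = sg (S l m) * qq lab (q (x @ [l, m])) (y @ ?w l m)" for l m
  proof -
    have 3: "act q (x @ [l, m, k]) = y @ ?w l m @ [turn (q (x @ [l, m])) k]" for k
      using act_snoc[of q "x @ [l, m]" k] unfolding a2 by simp
    show ?thesis unfolding qq_def turn_0 PI_act[OF lab] by (simp add: 3 S_def sg_add ac_simps)
  qed
  let ?i = "q (x @ [La, La])" and ?j = "q (x @ [La, Lb])" and ?k = "q (x @ [Lb, La])" and ?l = "q (x @ [Lb, Lb])"
  let ?E = "EE c (\<beta> La La) (\<beta> La Lb) (\<beta> Lb La) (\<beta> Lb Lb)"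
  let ?S = "S La La + S La Lb + (S Lb La + S Lb Lb)" and ?T = "?i + ?j + (?k + ?l) + (?i + ?j) * (?k + ?l)"
  have Q: "(\<Prod>w\<in>words 2. qq (lab \<circ> act q) 0 (x @ w)) = sg (?S + ?T) * (\<kappa> * ?E)"
  proof -
    have "(\<Prod>w\<in>words 2. qq (lab \<circ> act q) 0 (x @ w)) = sg ?S *
      (qq lab ?i (y @ ?w La La) * qq lab ?j (y @ ?w La Lb) * (qq lab ?k (y @ ?w Lb La) * qq lab ?l (y @ ?w Lb Lb)))"
      unfolding prod_words_2 q2 by (simp only: sg_add ac_simps)
    also have "\<dots> = sg (?S + ?T) * (\<kappa> * ?E)"
      unfolding G[unfolded Fl_def, rule_format] bt[symmetric] by (simp only: sg_add ac_simps)
    finally show ?thesis .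
  qed
  have "(\<Prod>w\<in>words 2. qq (lab \<circ> act q) 0 (x @ w)) \<noteq> 0" unfolding prod_words_2 q2 using qn by simp
  then have En: "\<kappa> * ?E \<noteq> 0" unfolding Q by auto
  have "N2 (sg e * \<kappa>) (lab \<circ> act q) x \<longleftrightarrow> sg (?S + ?T) * (\<kappa> * ?E) = sg e * (\<kappa> * ?E)"
    using Q rs unfolding N2_def \<beta>_def by (simp add: mult.assoc)
  also have "\<dots> \<longleftrightarrow> Rc r s q x = e"
    unfolding sg_eq_iff[OF two En] using rs
    by (simp add: Rc_def S_def numeral_2_eq_2 sum_words_Suc_Cons lev_1 ac_simps)
  finally show ?thesis .
qed

lemma N2_change:
  assumes lab: "prelabeling c t lab" and nz: "\<And>w. w \<noteq> [] \<Longrightarrow> lab w \<noteq> 0" and \<kappa>: "\<kappa> ^ 2 = 2"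
    and N: "\<And>x l. N1 \<iota> lab x l" and i: "iotaok \<iota>" "s = 1 \<Longrightarrow> \<iota> = 1" and N2: "N2 \<kappa> lab (act q x)"
    and sp: "s = 1 \<or> r = 3 \<and> s = 2"
  shows "N2 (sg e * \<kappa>) (lab \<circ> act q) x \<longleftrightarrow> Rc r s q x = e"
  using N2_change_1[OF _ lab nz \<kappa> _ N2] N2_change_32[OF _ _ lab nz \<kappa> N i(1) N2] i(2) N sp by blast

section \<open>Removing the signs of the relations level by level\<close>

lemma sum_words_delta: "length z = m \<Longrightarrow> (\<Sum>w\<in>words m. if w = z then v else 0) = (v::bit)"
  by (simp add: sum.delta')

text \<open>A correction on level \<open>n\<close> alone with block sums \<open>d\<close> and,
  independently, sums \<open>e\<close> for the second relation. The value \<open>e x\<close> is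
  added at two nodes of one block, which keeps the block sum, and only one of the two is counted in
  the second sum.\<close>

lemma level_solve:
  "\<exists>q. (\<forall>w. length w \<noteq> n \<longrightarrow> q w = 0) \<and> (\<forall>x l. length x + r = n \<longrightarrow> lev q (r - 1) (x @ [l]) = d x l) \<and>
     (s = 1 \<longrightarrow> (\<forall>x. length x + r = n \<longrightarrow> lev q (r - 2) (x @ [La, Lb]) + lev q (r - 2) (x @ [Lb, Lb]) = e x)) \<and>
     (r = 3 \<and> s = 2 \<longrightarrow> (\<forall>x. length x + 4 = n \<longrightarrow> (\<Sum>v\<in>words 2. lev q 1 (x @ v @ [La])) = e x))"
proof -
  obtain m where m: "r = Suc (Suc m)" using r3 by (intro that[of "r - 2"]) auto
  define zz where "zz = replicate m La"
  define q1 where "q1 w = (if length w \<noteq> n \<or> n < r then 0 else let x = take (n - r) w; z = drop (n - r) w in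
      (if tl (tl z) = zz then (if hd z = La then (if hd (tl z) = Lb then (if s = 1 then e x else 0) else d x La + (if s = 1 then e x else 0))
         else if hd (tl z) = La then d x Lb else 0) else 0))" for w
  define q2 where "q2 w = (if length w \<noteq> n \<or> n < 3 then 0 else let y = take (n - 3) w; z = drop (n - 3) w in
      (if z = [hd z, Lb, Lb] then d y (hd z) + (if hd z = La \<and> y \<noteq> [] \<and> last y = La then e (butlast y) else 0)
       else if z = [La, La, La] \<and> y \<noteq> [] \<and> last y = La then e (butlast y) else 0))" for w
  show ?thesis
  proof (cases "r = 3 \<and> s = 2")
    case False
    have v: "q1 (x @ l # k # w) = (if w = zz then (if l = La then (if k = Lb then (if s = 1 then e x else 0) else d x La + (if s = 1 then e x else 0))
         else if k = La then d x Lb else 0) else 0)" if "length x + r = n" "length w = m" for x l k w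
      using that by (simp add: q1_def m Let_def)
    have lv: "lev q1 m (x @ [l, k]) = (if l = La then (if k = Lb then (if s = 1 then e x else 0) else d x La + (if s = 1 then e x else 0))
         else if k = La then d x Lb else 0)" if "length x + r = n" for x l k
    proof -
      have "lev q1 m (x @ [l, k]) = (\<Sum>w\<in>words m. if w = zz then (if l = La then (if k = Lb then (if s = 1 then e x else 0) else d x La + (if s = 1 then e x else 0))
         else if k = La then d x Lb else 0) else 0)"
        unfolding lev_def by (intro sum.cong refl) (use v[OF that] in simp)
      also have "\<dots> = (if l = La then (if k = Lb then (if s = 1 then e x else 0) else d x La + (if s = 1 then e x else 0))
         else if k = La then d x Lb else 0)" by (rule sum_words_delta) (simp add: zz_def)
      finally show ?thesis .
    qed
    have "lev q1 (r - 1) (x @ [l]) = d x l" if "length x + r = n" for x l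
      using lv[OF that, of l La] lv[OF that, of l Lb] by (cases l) (simp_all add: m lev_Suc ac_simps)
    moreover have "lev q1 (r - 2) (x @ [La, Lb]) + lev q1 (r - 2) (x @ [Lb, Lb]) = e x" if "s = 1" "length x + r = n" for x
      using lv[OF that(2)] that(1) by (simp add: m)
    moreover have "q1 w = 0" if "length w \<noteq> n" for w using that by (simp add: q1_def)
    ultimately show ?thesis using False by blast
  next
    case True
    have v: "q2 (y @ [l, k, k']) = (if k = Lb \<and> k' = Lb then d y l + (if l = La \<and> y \<noteq> [] \<and> last y = La then e (butlast y) else 0)
       else if l = La \<and> k = La \<and> k' = La \<and> y \<noteq> [] \<and> last y = La then e (butlast y) else 0)" if "length y + 3 = n" for y l k k'
      using that by (auto simp add: q2_def Let_def)
    have "lev q2 2 (y @ [l]) = d y l" if "length y + 3 = n" for y l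
      using v[OF that] by (cases l) (simp_all add: numeral_2_eq_2 lev_Suc ac_simps)
    moreover have "(\<Sum>w\<in>words 2. lev q2 1 (x @ w @ [La])) = e x" if "length x + 4 = n" for x
    proof -
      have "lev q2 1 (x @ [i, l, La]) = (if i = La \<and> l = La then e x else 0)" for i l
        using v[of "x @ [i]" l La La] v[of "x @ [i]" l La Lb] that by (auto simp: lev_1)
      then show ?thesis by (simp add: numeral_2_eq_2 sum_words_Suc_Cons)
    qed
    moreover have "q2 w = 0" if "length w \<noteq> n" for w using that by (simp add: q2_def)
    moreover have "r - 1 = 2" "s \<noteq> 1" "r = 3" using True by simp_all
    ultimately show ?thesis by (intro exI[of _ q2]) simp
  qed
qed

text \<open>The condition for a labeling to exist (\<open>labeling_iff\<close>): if it fails, some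
  node is labelled 0 and shares this label with its sibling.\<close>

definition nondeg :: bool where
  "nondeg \<longleftrightarrow> (\<forall>m\<ge>1. (quad c ^^ m) 0 \<noteq> t)"

lemma nondeg_nz: "nondeg \<Longrightarrow> prelabeling c t lab \<Longrightarrow> w \<noteq> [] \<Longrightarrow> lab w \<noteq> 0"
  using lab_quad[of c t lab w] by (auto simp: nondeg_def Suc_le_eq)

lemma N_cong:
  assumes "\<And>w. length w \<le> n \<Longrightarrow> lab w = lab' w"
  shows "length x + r < n \<Longrightarrow> N1 \<iota> lab x l \<longleftrightarrow> N1 \<iota> lab' x l"
    and "length x + reach < n \<Longrightarrow> N2 \<kappa> lab x \<longleftrightarrow> N2 \<kappa> lab' x"
proof -
  have P: "PI lab m u = PI lab' m u" if "length u + m < n" for m u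
    using that by (intro PI_cong assms) simp
  show "N1 \<iota> lab x l \<longleftrightarrow> N1 \<iota> lab' x l" if "length x + r < n"
    using that r3 sr s1 P[of "x @ [l]" "r - 1"] P[of "x @ [other l]" "s - 1"] by (simp add: N1_def)
  show "N2 \<kappa> lab x \<longleftrightarrow> N2 \<kappa> lab' x" if "length x + reach < n"
  proof (cases "s = 1")
    case True
    have "length x + r < n" using that unfolding reach_def if_P[OF True] .
    then show ?thesis unfolding N2_def if_P[OF True]
      using r3 P[of "x @ [La, Lb]" "r - 2"] P[of "x @ [Lb, Lb]" "r - 2"] assms[of "x @ [La, Lb]"] assms[of "x @ [Lb, Lb]"] by simp
  next
    case False
    then have l: "length x + 4 < n" using that unfolding reach_def by simp
    have "qq lab 0 (x @ w) = qq lab' 0 (x @ w)" if "w \<in> words 2" for w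
      using l that P[of "x @ w @ [La]" 1] P[of "x @ w @ [Lb]" 0] by (simp add: qq_def)
    then have "(\<Prod>w\<in>words 2. qq lab 0 (x @ w)) = (\<Prod>w\<in>words 2. qq lab' 0 (x @ w))" by (rule prod.cong[OF refl])
    then show ?thesis unfolding N2_def using False l assms by simp
  qed
qed

text \<open>First the signs of the relations \<open>N1\<close> that end at level \<open>n\<close>
  are corrected, then those of \<open>N2\<close> by a portrait with vanishing block sums, which
  preserves the first correction. Both portraits live on level \<open>n\<close>, so labels of length
  at most \<open>n\<close> stay as they are.\<close>

lemma normalised_step:
  assumes nd: nondeg and lab: "prelabeling c t lab" and \<kappa>: "\<kappa> ^ 2 = 2" and i: "iotaok \<iota>" "s = 1 \<Longrightarrow> \<iota> = 1"
    and N1n: "\<And>x l. length x + r < n \<Longrightarrow> N1 \<iota> lab x l" and N2n: "\<And>x. length x + reach < n \<Longrightarrow> N2 \<kappa> lab x"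
  shows "\<exists>lab'. prelabeling c t lab' \<and> (\<forall>x l. length x + r < Suc n \<longrightarrow> N1 \<iota> lab' x l) \<and>
    (\<forall>x. length x + reach < Suc n \<longrightarrow> N2 \<kappa> lab' x) \<and> (\<forall>w. length w \<le> n \<longrightarrow> lab' w = lab w)"
proof -
  have short: "act q w = w" if q: "\<And>w. length w \<noteq> n \<Longrightarrow> q w = 0" and w: "length w \<le> n" for q w
    using w by (induction w rule: rev_induct) (simp_all add: act_snoc q)
  have lev0: "lev q m u = 0" if q: "\<And>w. length w \<noteq> n \<Longrightarrow> q w = 0" and "length u + m \<noteq> n" for q m u
    using that by (intro lev_zero) auto
  have step1: "N1 \<iota> (lab \<circ> act q) x l" if lab: "prelabeling c t lab" and q: "\<And>w. length w \<noteq> n \<Longrightarrow> q w = 0"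
    and x: "length x + r = n" and N: "N1 (sg (lev q (r - 1) (x @ [l])) * \<iota>) lab x l" for q x l and lab :: "word \<Rightarrow> 'b"
  proof -
    let ?e = "lev q (r - 1) (x @ [l])"
    have xq: "act q x = x" "q x = 0" using short[where q = q and w = x, OF q] q[of x] x r3 by simp_all
    have "(sg ?e * \<iota>) ^ 2 = \<iota> ^ 2" by (simp add: power2_eq_square ac_simps)
    then have "iotaok (sg ?e * \<iota>)" using i(1) unfolding iotaok_def by (simp only:)
    moreover have "Pc r s q x l = ?e"
      using lev0[where q = q and u = "x @ [other l]" and m = "s - 1", OF q] x s1 sr by (simp add: Pc_def)
    ultimately have "N1 (sg ?e * (sg ?e * \<iota>)) (lab \<circ> act q) x l"
      using N1_change[OF lab nondeg_nz[OF nd lab], of "sg ?e * \<iota>" q x l ?e] N xq by simp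
    then show ?thesis by simp
  qed
  have keep1: "N1 \<iota> (lab \<circ> act q) x l \<longleftrightarrow> N1 \<iota> lab x l" if "\<And>w. length w \<noteq> n \<Longrightarrow> q w = 0" "length x + r < n"
    for q x l and lab :: "word \<Rightarrow> 'b"
    by (rule N_cong(1)[OF _ that(2)]) (use short[where q = q, OF that(1)] in simp)
  have keep2: "N2 \<kappa> (lab \<circ> act q) x \<longleftrightarrow> N2 \<kappa> lab x" if "\<And>w. length w \<noteq> n \<Longrightarrow> q w = 0" "length x + reach < n"
    for q x and lab :: "word \<Rightarrow> 'b"
    by (rule N_cong(2)[OF _ that(2)]) (use short[where q = q, OF that(1)] in simp)
  obtain d where d: "\<And>x l. N1 (sg (d x l) * \<iota>) lab x l" using N1_ex[OF lab i(1)] by metis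
  obtain q where q: "\<And>w. length w \<noteq> n \<Longrightarrow> q w = 0" "\<And>x l. length x + r = n \<Longrightarrow> lev q (r - 1) (x @ [l]) = d x l"
    using level_solve[of n d "\<lambda>_. 0"] by blast
  define lab1 where "lab1 = lab \<circ> act q"
  have p1: "prelabeling c t lab1" unfolding lab1_def by (rule prelabeling_act[OF lab])
  have n1: "N1 \<iota> lab1 x l" if "length x + r < Suc n" for x l
    using keep1[where q = q and x = x and lab = lab and l = l, OF q(1)] N1n[of x l] step1[where lab = lab and q = q and x = x and l = l, OF lab q(1)] q(2)[of x l] d[of x l] that
    unfolding lab1_def by (cases "length x + r = n") auto
  have n2: "N2 \<kappa> lab1 x" if "length x + reach < n" for x
    using keep2[where q = q and x = x and lab = lab, OF q(1) that] N2n[OF that] unfolding lab1_def by blast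
  have same1: "lab1 w = lab w" if "length w \<le> n" for w using short[where q = q and w = w, OF q(1) that] by (simp add: lab1_def)
  \<comment> \<open>For \<open>(r, s) = (3, 2)\<close> the sign of \<open>N2\<close> at
    \<open>x\<close> is available only once \<open>N1\<close> holds at \<open>x\<close> and at its
    children, whose relations end at level \<open>n\<close> too; hence the order of the two
    corrections.\<close>
  have "\<exists>e. N2 (sg e * \<kappa>) lab1 x" if "length x + reach = n" for x
  proof (rule N2_sq[OF p1 nondeg_nz[OF nd p1] \<kappa> _ _ i(1)])
    assume rs: "r = 3" "s = 2"
    then have "reach = 4" unfolding reach_def by simp
    then have "length x + 4 = n" using that by (simp only:)
    then have "length x + r < Suc n" "length (x @ [l]) + r < Suc n" for l unfolding rs(1) by simp_all
    then show "N1 \<iota> lab1 x l" "N1 \<iota> lab1 (x @ [l]) l'" for l l' using n1 by blast+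
  qed
  then obtain e where e: "\<And>x. length x + reach = n \<Longrightarrow> N2 (sg (e x) * \<kappa>) lab1 x" by metis
  obtain q' where q': "\<And>w. length w \<noteq> n \<Longrightarrow> q' w = 0" "\<And>x l. length x + r = n \<Longrightarrow> lev q' (r - 1) (x @ [l]) = 0"
    "\<And>x. s = 1 \<Longrightarrow> length x + r = n \<Longrightarrow> lev q' (r - 2) (x @ [La, Lb]) + lev q' (r - 2) (x @ [Lb, Lb]) = e x"
    "\<And>x. r = 3 \<and> s = 2 \<Longrightarrow> length x + 4 = n \<Longrightarrow> (\<Sum>v\<in>words 2. lev q' 1 (x @ v @ [La])) = e x"
    using level_solve[of n "\<lambda>_ _. 0" e] by blast
  define lab2 where "lab2 = lab1 \<circ> act q'"
  have p2: "prelabeling c t lab2" unfolding lab2_def by (rule prelabeling_act[OF p1])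
  have "N1 \<iota> lab2 x l" if "length x + r < Suc n" for x l
    using keep1[where q = q' and x = x and lab = lab1 and l = l, OF q'(1)] n1[OF that, of l] step1[where lab = lab1 and q = q' and x = x and l = l, OF p1 q'(1)] q'(2)[of x l] that
    unfolding lab2_def by (cases "length x + r = n") auto
  moreover have "N2 \<kappa> lab2 x" if "length x + reach < Suc n" for x
  proof (cases "length x + reach = n")
    case False
    then show ?thesis using keep2[where q = q' and x = x and lab = lab1, OF q'(1)] n2[of x] that unfolding lab2_def by simp
  next
    case len: True
    have ex: "N2 (sg (e x) * \<kappa>) lab1 x" by (rule e[OF len])
    show ?thesis
    proof (cases "s = 1")
      case True
      have lr: "length x + r = n" using len unfolding reach_def if_P[OF True] .
      have a: "act q' (x @ [l, Lb]) = x @ [l, Lb]" for l using short[where q = q', OF q'(1)] lr r3 by simp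
      have "\<kappa> * (PI lab2 (r - 2) (x @ [La, Lb]) * PI lab2 (r - 2) (x @ [Lb, Lb])) =
          sg (e x) * \<kappa> * (PI lab1 (r - 2) (x @ [La, Lb]) * PI lab1 (r - 2) (x @ [Lb, Lb]))"
        unfolding lab2_def PI_act[OF p1] a q'(3)[OF True lr, symmetric] sg_add by (simp only: ac_simps)
      then show ?thesis using ex a unfolding N2_def if_P[OF True] lab2_def comp_apply by simp
    next
      case s1: False
      show ?thesis
      proof (cases "r = 3 \<and> s = 2")
        case True
        have l4: "length x + 4 = n" using len unfolding reach_def if_not_P[OF s1] .
        have a: "act q' (x @ u) = x @ u" if "length u \<le> 4" for u using short[where q = q', OF q'(1)] l4 that by simp
        have "qq lab2 0 (x @ v) = sg (lev q' 1 (x @ v @ [La])) * qq lab1 0 (x @ v)" if "v \<in> words 2" for v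
        proof -
          have "q' (x @ v @ [Lb]) = 0" by (rule q'(1)) (use that l4 in simp)
          then show ?thesis using a[of "v @ [La]"] a[of "v @ [Lb]"] that
            unfolding qq_def lab2_def PI_act[OF p1] by simp
        qed
        then have "(\<Prod>v\<in>words 2. qq lab2 0 (x @ v)) = (\<Prod>v\<in>words 2. sg (lev q' 1 (x @ v @ [La])) * qq lab1 0 (x @ v))"
          by (rule prod.cong[OF refl])
        also have "\<dots> = sg (e x) * (\<Prod>v\<in>words 2. qq lab1 0 (x @ v))"
          unfolding prod.distrib q'(4)[OF True l4, symmetric] sg_sum ..
        finally show ?thesis using ex a True unfolding N2_def lab2_def by (simp add: mult.assoc)
      next
        case False
        then show ?thesis unfolding N2_def using s1 by auto
      qed
    qed
  qed
  moreover have "lab2 w = lab w" if "length w \<le> n" for w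
    using short[where q = q' and w = w, OF q'(1) that] same1[OF that] by (simp add: lab2_def)
  ultimately show ?thesis using p2 by blast
qed

text \<open>The corrections fix ever longer words, so they have a limit; each relation involves
  finitely many labels and passes to it.\<close>

lemma normalised_labeling:
  assumes nd: nondeg and \<kappa>: "\<kappa> ^ 2 = 2" and i: "iotaok \<iota>" "s = 1 \<Longrightarrow> \<iota> = 1"
  shows "\<exists>lab. prelabeling c t lab \<and> (\<forall>x l. N1 \<iota> lab x l) \<and> (\<forall>x. N2 \<kappa> lab x)"
proof -
  define good where "good n lab \<longleftrightarrow> prelabeling c t lab \<and> (\<forall>x l. length x + r < n \<longrightarrow> N1 \<iota> lab x l) \<and>
    (\<forall>x. length x + reach < n \<longrightarrow> N2 \<kappa> lab x)" for n lab
  have "\<exists>L. \<forall>n. good n (L n) \<and> (\<forall>w. length w \<le> n \<longrightarrow> L (Suc n) w = L n w)"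
  proof (rule dependent_nat_choice)
    show "\<exists>lab. good 0 lab" using prelabeling_ex[OF sq, of c t] by (auto simp: good_def)
    fix lab n assume "good n lab"
    then show "\<exists>lab'. good (Suc n) lab' \<and> (\<forall>w. length w \<le> n \<longrightarrow> lab' w = lab w)"
      using normalised_step[OF nd _ \<kappa> i, of lab n] unfolding good_def by blast
  qed
  then obtain L where L: "\<And>n. good n (L n)" "\<And>n w. length w \<le> n \<Longrightarrow> L (Suc n) w = L n w" by blast
  define lab where "lab w = L (length w) w" for w
  have eq: "L n w = lab w" if "length w \<le> n" for n w
    using that by (induction n rule: dec_induct) (auto simp: lab_def L(2))
  have "prelabeling c t lab"
    unfolding prelabeling_def
  proof (intro conjI allI)
    show "lab [] = t" using L(1)[of 0] by (simp add: lab_def good_def lab_Nil)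
    fix w :: word
    have p: "prelabeling c t (L (Suc (length w)))" using L(1) by (simp add: good_def)
    show "lab (w @ [Lb]) = - lab (w @ [La])" "lab (w @ [La]) ^ 2 = lab w - c"
      using lab_Lb[OF p, of w] lab_sq[OF p, of w La] eq[of _ "Suc (length w)"] by simp_all
  qed
  moreover have "N1 \<iota> lab x l" for x l
    using L(1)[of "Suc (length x + r)"] N_cong(1)[of "Suc (length x + r)" lab "L (Suc (length x + r))"] eq by (simp add: good_def)
  moreover have "N2 \<kappa> lab x" for x
    using L(1)[of "Suc (length x + reach)"] N_cong(2)[of "Suc (length x + reach)" lab "L (Suc (length x + reach))"] eq by (simp add: good_def)
  ultimately show ?thesis by blast
qed

end

section \<open>Counting steps and sign patterns\<close>

lemma steps_full: "steps E zs = length zs \<longleftrightarrow> (\<forall>ys z ys'. zs = ys @ z # ys' \<longrightarrow> z \<notin> adjs E ys)"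
proof (induction zs arbitrary: E)
  case (Cons z zs)
  have "steps E (z # zs) = length (z # zs) \<longleftrightarrow> z \<notin> E \<and> steps (adj E z) zs = length zs"
    using steps_le[of "adj E z" zs] by auto
  also have "\<dots> \<longleftrightarrow> (\<forall>ys y ys'. z # zs = ys @ y # ys' \<longrightarrow> y \<notin> adjs E ys)"
    unfolding Cons.IH by (auto simp: Cons_eq_append_conv) (metis adjs.simps(2) append_Cons)+
  finally show ?case .
qed simp

text \<open>Only an upper bound on the number of roots is recorded, so redundant roots do no
  harm.\<close>

definition bounded_tower :: "'b::field set \<Rightarrow> 'b set \<Rightarrow> nat \<Rightarrow> bool" where
  "bounded_tower E F m \<longleftrightarrow> (\<exists>zs. tower E zs \<and> adjs E zs = F \<and> length zs \<le> m)"

lemma bounded_tower_trans: "bounded_tower E F m \<Longrightarrow> bounded_tower F G n \<Longrightarrow> bounded_tower E G (m + n)"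
  unfolding bounded_tower_def by (metis add_mono adjs_append length_append tower_append)

lemma bounded_tower_gen:
  assumes "(2::'b::field) \<noteq> 0" "sfield (E :: 'b set)" "finite Z" "\<And>z. z \<in> Z \<Longrightarrow> z ^ 2 \<in> E"
  shows "bounded_tower E (genf (E \<union> Z)) (card Z)"
proof -
  obtain zs where zs: "set zs = Z" "distinct zs" using finite_distinct_list[OF assms(3)] by blast
  have "tower E zs" by (rule tower_sq[OF assms(1,2)]) (use assms(4) zs in auto)
  then show ?thesis unfolding bounded_tower_def
    using adjs_genf[OF assms(1,2)] zs distinct_card[OF zs(2)] by (intro exI[of _ zs]) simp
qed

lemma sign_extension:
  fixes E :: "'b::field set"
  assumes two: "(2::'b) \<noteq> 0" and "sfield E" "tower E zs" "steps E zs = length zs"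
    and "hom_on E \<sigma>" "\<And>z. z \<in> set zs \<Longrightarrow> z ^ 2 \<in> E \<and> \<sigma> (z ^ 2) = z ^ 2"
  shows "\<exists>\<tau>. hom_on (adjs E zs) \<tau> \<and> (\<forall>x\<in>E. \<tau> x = \<sigma> x) \<and> (\<forall>i<length zs. \<tau> (zs ! i) = sg (e i) * zs ! i)"
  using assms(2-)
proof (induction zs arbitrary: E \<sigma> e)
  case (Cons z zs)
  let ?A = "adj E z"
  note E = Cons.prems(1)
  have zE: "z \<notin> E" "z ^ 2 \<in> E" "\<sigma> (z ^ 2) = z ^ 2" and full: "steps ?A zs = length zs" and tw: "tower ?A zs"
    using Cons.prems steps_le[of ?A zs] by (auto split: if_splits)
  have A: "sfield ?A" by (rule adj_sfield[OF E zE(2) two])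
  have "(sg (e 0) * z) ^ 2 = \<sigma> (z ^ 2)" unfolding zE(3) by (simp add: power2_eq_square ac_simps)
  then obtain \<sigma>' where \<sigma>': "hom_on ?A \<sigma>'" "\<And>x. x \<in> E \<Longrightarrow> \<sigma>' x = \<sigma> x" "\<sigma>' z = sg (e 0) * z"
    using hom_extend[OF E zE(2,1) Cons.prems(4)] by blast
  have EA: "E \<subseteq> ?A" "z \<in> ?A" using adj_incl[OF E] by auto
  have "\<And>y. y \<in> set zs \<Longrightarrow> y ^ 2 \<in> ?A \<and> \<sigma>' (y ^ 2) = y ^ 2" using Cons.prems(5) \<sigma>'(2) EA by auto
  from Cons.IH[OF A tw full \<sigma>'(1) this, of "\<lambda>i. e (Suc i)"]
  obtain \<tau> where \<tau>: "hom_on (adjs ?A zs) \<tau>" "\<And>x. x \<in> ?A \<Longrightarrow> \<tau> x = \<sigma>' x"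
    "\<And>i. i < length zs \<Longrightarrow> \<tau> (zs ! i) = sg (e (Suc i)) * zs ! i" by blast
  have "\<tau> ((z # zs) ! i) = sg (e i) * (z # zs) ! i" if "i < length (z # zs)" for i
    using that \<tau>(3) \<tau>(2)[OF EA(2)] \<sigma>'(3) by (cases i) auto
  moreover have "\<tau> x = \<sigma> x" if "x \<in> E" for x using \<tau>(2) \<sigma>'(2) EA(1) that by auto
  ultimately show ?case using \<tau>(1) by (intro exI[of _ \<tau>]) simp
qed auto

text \<open>Converse of \<open>sign_extension\<close>: a root lying in the field of its predecessors
  would be fixed by every embedding that fixes them, against the sign pattern that changes this root
  alone.\<close>

lemma signs_full:
  fixes E :: "'b::field set"
  assumes two: "(2::'b) \<noteq> 0" and E: "sfield E" and z: "\<And>z. z \<in> set zs \<Longrightarrow> z ^ 2 \<in> E \<and> z \<noteq> 0"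
    and sgn: "\<And>e :: nat \<Rightarrow> bit. \<exists>L \<tau>. sfield L \<and> E \<subseteq> L \<and> set zs \<subseteq> L \<and> hom_on L \<tau> \<and> (\<forall>x\<in>E. \<tau> x = x) \<and>
        (\<forall>i<length zs. \<tau> (zs ! i) = sg (e i) * zs ! i)"
  shows "steps E zs = length zs"
  unfolding steps_full
proof (intro allI impI notI)
  fix ys y ys' assume zs: "zs = ys @ y # ys'" and y: "y \<in> adjs E ys"
  define n where "n = length ys"
  obtain L \<tau> where L: "sfield L" "E \<subseteq> L" "set zs \<subseteq> L" "hom_on L \<tau>" "\<And>x. x \<in> E \<Longrightarrow> \<tau> x = x"
    "\<And>i. i < length zs \<Longrightarrow> \<tau> (zs ! i) = sg (if i = n then 1 else 0) * zs ! i"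
    using sgn[of "\<lambda>i. if i = n then 1 else 0"] by blast
  have "tower E ys" by (rule tower_sq[OF two E]) (use z zs in auto)
  then have "y \<in> genf (E \<union> set ys)" using adjs_genf[OF two E] y by blast
  moreover have "\<tau> x = id x" if "x \<in> E \<union> set ys" for x
  proof (cases "x \<in> E")
    case False
    then have "x \<in> set ys" using that by simp
    then obtain i where "i < n" "x = ys ! i" unfolding n_def by (metis in_set_conv_nth)
    then show ?thesis using L(6)[of i] by (simp add: zs n_def nth_append)
  qed (simp add: L(5))
  moreover have "hom_on L id" by (simp add: hom_on_def)
  ultimately have "\<tau> y = y"
    using hom_on_genf_eq[OF L(4) _ L(1), of id "E \<union> set ys" y] L(2,3) zs by auto
  moreover have "\<tau> y = - y" using L(6)[of n] by (simp add: zs n_def)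
  ultimately have "2 * y = 0" by (metis add.right_inverse mult_2)
  then show False using two z[of y] zs by simp
qed

section \<open>The arboreal Galois representation\<close>

lemma sfield_base: "sfield (base :: 'a::field alg_closure set)"
proof -
  have "\<exists>z. to_ac x + to_ac y = to_ac z" "\<exists>z. to_ac x * to_ac y = to_ac z" "\<exists>z. - to_ac x = to_ac z" "\<exists>z. inverse (to_ac x) = to_ac z"
    for x y :: 'a
    using to_ac_add[of x y] to_ac_mult[of x y] to_ac_minus[of x] to_ac_inverse[of x] by metis+
  then show ?thesis unfolding sfield_def using to_ac_1 by (auto intro: rangeI) (metis rangeI)+
qed

locale arboreal = postcritical r s "to_ac c" "to_ac x0" for r s :: nat and c x0 :: "'a::field"
begin

abbreviation "pl \<equiv> prelabeling (to_ac c) (to_ac x0)"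
abbreviation "K \<equiv> K_level c x0"
abbreviation "KI \<equiv> K_inf c x0"

lemma preim_eq: "pl lab \<Longrightarrow> preim c x0 n = lab ` words n"
proof (induction n)
  case 0
  then show ?case by (auto simp: preim_def lab_Nil)
next
  case (Suc n)
  note lab = Suc.prems
  have "z \<in> preim c x0 (Suc n) \<longleftrightarrow> z \<in> lab ` words (Suc n)" for z
  proof
    assume "z \<in> preim c x0 (Suc n)"
    then have "quad (to_ac c) z \<in> preim c x0 n" by (simp add: preim_def funpow_swap1)
    then obtain w where w: "length w = n" "quad (to_ac c) z = lab w" using Suc by auto
    then have "z ^ 2 = lab (w @ [La]) ^ 2"
      unfolding lab_sq[OF lab, of w La] quad_def by (metis add_diff_cancel_right')
    then have "z = lab (w @ [La]) \<or> z = lab (w @ [Lb])" using lab_Lb[OF lab, of w] by (simp add: power2_eq_iff)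
    then show "z \<in> lab ` words (Suc n)" using w(1) by (metis imageI length_append_singleton mem_words)
  next
    assume "z \<in> lab ` words (Suc n)"
    then obtain w where "length w = Suc n" "z = lab w" by auto
    then show "z \<in> preim c x0 (Suc n)" using lab_quad[OF lab, of w] by (simp add: preim_def del: funpow.simps)
  qed
  then show ?case by blast
qed

lemma K_eq: "pl lab \<Longrightarrow> K n = genf (base \<union> lab ` words n)"
  by (simp add: K_level_def adjoin_def preim_eq)

lemma K_sfield [simp]: "sfield (K n)"
  by (simp add: K_level_def adjoin_def)

lemma base_K: "base \<subseteq> K n"
  using genf_incl[of "base \<union> preim c x0 n"] by (simp add: K_level_def adjoin_def)

lemma lab_K: "pl lab \<Longrightarrow> length w \<le> n \<Longrightarrow> lab w \<in> K n"
proof (induction "n - length w" arbitrary: w)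
  case 0
  then have "lab w \<in> lab ` words n" by auto
  then show ?case unfolding K_eq[OF 0(2)] using genf_incl[of "base \<union> lab ` words n"] by blast
next
  case (Suc m)
  have "lab (w @ [La]) \<in> K n" using Suc by simp
  moreover have "lab w = lab (w @ [La]) ^ 2 + to_ac c" using lab_sq[OF Suc(3), of w La] by simp
  ultimately show ?case using sfieldD(3,9)[OF K_sfield] base_K by (metis rangeI subsetD)
qed

lemma K_mono: "m \<le> n \<Longrightarrow> K m \<subseteq> K n"
proof -
  assume mn: "m \<le> n"
  obtain lab where lab: "pl lab" using prelabeling_ex[OF sq] by blast
  show ?thesis unfolding K_eq[OF lab, of m]
    by (rule genf_min[OF K_sfield]) (use base_K lab_K[OF lab] mn in auto)
qed

lemma KI_eq: "KI = (\<Union>n. K n)"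
proof -
  have "x \<in> (\<Union>n\<in>{1..}. K n)" if "x \<in> K n" for x n
    using that K_mono[of n "Suc n"] by (intro UN_I[of "Suc n"]) auto
  then show ?thesis unfolding K_inf_def by blast
qed

lemma KI_sfield [simp]: "sfield KI"
  unfolding KI_eq by (rule sfield_UN) (simp_all add: K_mono)

lemma K_KI: "K n \<subseteq> KI"
  unfolding KI_eq by blast

lemma lab_KI: "pl lab \<Longrightarrow> lab w \<in> KI"
  using lab_K[of lab w "length w"] K_KI by blast

text \<open>An embedding over the base field. For the fields \<open>K n\<close> and
  \<open>KI\<close> it is onto (\<open>fixing_K\<close>, \<open>fixing_KI\<close>), so restricting
  it to the field gives a Galois element.\<close>

definition fixing :: "'a alg_closure set \<Rightarrow> ('a alg_closure \<Rightarrow> 'a alg_closure) \<Rightarrow> bool" where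
  "fixing L \<tau> \<longleftrightarrow> hom_on L \<tau> \<and> (\<forall>x\<in>base. \<tau> x = x)"

lemma fixing_subset: "fixing L \<tau> \<Longrightarrow> F \<subseteq> L \<Longrightarrow> fixing F \<tau>"
  unfolding fixing_def using hom_on_subset by blast

lemma fixing_lab:
  assumes "pl lab" "fixing (K n) \<tau>"
  shows "\<tau> ` (lab ` words n) = lab ` words n"
proof (rule card_subset_eq)
  have h: "hom_on (K n) \<tau>" and fx: "\<And>x. \<tau> (to_ac x) = to_ac x" using assms(2) by (auto simp: fixing_def)
  have "(quad (to_ac c) ^^ m) (\<tau> z) = \<tau> ((quad (to_ac c) ^^ m) z) \<and> (quad (to_ac c) ^^ m) z \<in> K n" if "z \<in> K n" for m z
  proof (induction m)
    case (Suc m)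
    let ?y = "(quad (to_ac c) ^^ m) z"
    have y: "?y \<in> K n" "?y ^ 2 \<in> K n" "to_ac c \<in> K n"
      using Suc sfieldD(9)[OF K_sfield] base_K[of n] by auto
    have "\<tau> (?y ^ 2 + to_ac c) = \<tau> ?y ^ 2 + to_ac c"
      using hom_onD(3)[OF h K_sfield y(2,3)] hom_onD(8)[OF h K_sfield y(1)] fx by simp
    moreover have "?y ^ 2 + to_ac c \<in> K n" by (rule sfieldD(3)[OF K_sfield y(2,3)])
    ultimately show ?case
      using Suc by (simp add: quad_def[of "to_ac c" ?y] quad_def[of "to_ac c" "\<tau> ?y"])
  qed (use that in simp)
  note comm = this
  have "\<tau> z \<in> preim c x0 n" if z: "z \<in> preim c x0 n" for z
  proof -
    have "z \<in> K n" using z lab_K[OF assms(1), of _ n] unfolding preim_eq[OF assms(1)] by auto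
    moreover have "(quad (to_ac c) ^^ n) z = to_ac x0" using z by (simp add: preim_def)
    ultimately have "(quad (to_ac c) ^^ n) (\<tau> z) = to_ac x0" using comm[of z n] fx[of x0] by metis
    then show ?thesis by (simp add: preim_def)
  qed
  then show "\<tau> ` (lab ` words n) \<subseteq> lab ` words n" unfolding preim_eq[OF assms(1)] by blast
  show "finite (lab ` words n)" by simp
  have "lab ` words n \<subseteq> K n" using lab_K[OF assms(1)] by auto
  then show "card (\<tau> ` (lab ` words n)) = card (lab ` words n)"
    by (intro card_image inj_on_subset[OF hom_on_inj[OF h K_sfield]])
qed

lemma fixing_K: "fixing (K n) \<tau> \<Longrightarrow> \<tau> ` K n = K n"
proof
  assume f: "fixing (K n) \<tau>"
  then have h: "hom_on (K n) \<tau>" and fx: "\<And>x. \<tau> (to_ac x) = to_ac x" by (auto simp: fixing_def)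
  obtain lab where lab: "pl lab" using prelabeling_ex[OF sq] by blast
  note im = fixing_lab[OF lab f]
  have gens: "base \<union> lab ` words n \<subseteq> K n" using base_K lab_K[OF lab] by auto
  have imb: "\<tau> ` (base \<union> lab ` words n) = base \<union> lab ` words n"
    unfolding image_Un im using fx by (force simp: image_image)
  show "\<tau> ` K n \<subseteq> K n"
    unfolding K_eq[OF lab] by (rule hom_on_genf_image[OF h K_sfield gens]) (use imb genf_incl in blast)
  show "K n \<subseteq> \<tau> ` K n"
  proof -
    have "genf (base \<union> lab ` words n) \<subseteq> \<tau> ` K n"
      by (rule genf_min[OF hom_on_image[OF h K_sfield]]) (use imb gens in blast)
    then show ?thesis by (metis K_eq[OF lab])
  qed
qed

lemma fixing_KI: "fixing KI \<tau> \<Longrightarrow> \<tau> ` KI = KI"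
proof -
  assume "fixing KI \<tau>"
  then have "\<tau> ` K n = K n" for n using fixing_K[OF fixing_subset[OF _ K_KI]] by blast
  then show ?thesis unfolding KI_eq image_UN by simp
qed

lemma gal_carrier:
  assumes "F = K n \<or> F = KI"
  shows "carrier (gal F) = {\<tau> \<in> extensional F. fixing F \<tau>}"
proof -
  have sf: "sfield F" and im: "\<And>\<tau>. fixing F \<tau> \<Longrightarrow> \<tau> ` F = F" and bF: "base \<subseteq> F"
    using assms K_sfield[of n] KI_sfield apply blast
    using assms fixing_K[of n] fixing_KI apply blast
    using assms base_K[of 0] base_K[of n] K_KI[of 0] by blast
  show ?thesis
  proof (intro equalityI subsetI)
    fix \<tau> assume "\<tau> \<in> carrier (gal F)"
    then have t: "\<tau> \<in> Bij F" "\<tau> \<in> ring_hom (rta\<lparr>carrier := F\<rparr>) (rta\<lparr>carrier := F\<rparr>)" "\<forall>y\<in>base. \<tau> y = y"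
      by (auto simp: gal_def ring_iso_def)
    have "\<tau> x = x" if "x \<in> base" for x using t(3) that by blast
    moreover have "\<tau> 1 = 1" using t(3) to_ac_1 by (metis rangeI)
    moreover have "\<tau> (x + y) = \<tau> x + \<tau> y" "\<tau> (x * y) = \<tau> x * \<tau> y" if "x \<in> F" "y \<in> F" for x y
      using ring_hom_add[OF t(2), of x y] ring_hom_mult[OF t(2), of x y] that by simp_all
    ultimately have "fixing F \<tau>" unfolding fixing_def hom_on_def by blast
    then show "\<tau> \<in> {\<tau> \<in> extensional F. fixing F \<tau>}" using Bij_imp_extensional[OF t(1)] by simp
  next
    fix \<tau> assume "\<tau> \<in> {\<tau> \<in> extensional F. fixing F \<tau>}"
    then have e: "\<tau> \<in> extensional F" and f: "fixing F \<tau>" by auto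
    then have h: "hom_on F \<tau>" by (simp add: fixing_def)
    have b: "bij_betw \<tau> F F" unfolding bij_betw_def using hom_on_inj[OF h sf] im[OF f] by blast
    have "\<tau> \<in> ring_iso (rta\<lparr>carrier := F\<rparr>) (rta\<lparr>carrier := F\<rparr>)"
      unfolding ring_iso_def ring_hom_def using b h bij_betw_imp_funcset[OF b] by (simp add: hom_on_def)
    moreover have "\<forall>y\<in>base. \<tau> y = y" using f by (simp add: fixing_def)
    ultimately show "\<tau> \<in> carrier (gal F)" using e b by (simp add: gal_def Bij_def)
  qed
qed

lemma tower_K: "\<exists>zs. tower base zs \<and> adjs base zs = K n"
proof (induction n)
  case 0
  have "K 0 = base" unfolding K_level_def adjoin_def
    by (rule genf_eq[OF sfield_base]) (auto simp: preim_def genf_incl[THEN subsetD])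
  then show ?case by (intro exI[of _ "[]"]) simp
next
  case (Suc n)
  then obtain zs where zs: "tower base zs" "adjs base zs = K n" by blast
  obtain lab where lab: "pl lab" using prelabeling_ex[OF sq] by blast
  have "bounded_tower (K n) (genf (K n \<union> lab ` words (Suc n))) (card (lab ` words (Suc n)))"
  proof (rule bounded_tower_gen[OF two K_sfield])
    fix z assume "z \<in> lab ` words (Suc n)"
    then obtain w l where w: "length w = n" "z = lab (w @ [l])"
      by (auto simp: words_Suc_snoc)
    have "lab w - to_ac c \<in> K n" using lab_K[OF lab, of w n] w(1) base_K by (intro sfieldD(7)[OF K_sfield]) auto
    then show "z ^ 2 \<in> K n" unfolding w(2) lab_sq[OF lab] .
  qed simp
  moreover have "genf (K n \<union> lab ` words (Suc n)) = K (Suc n)"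
  proof (rule genf_eq[OF K_sfield])
    show "K n \<union> lab ` words (Suc n) \<subseteq> K (Suc n)" using K_mono[of n "Suc n"] lab_K[OF lab] by auto
    show "K (Suc n) \<subseteq> genf (K n \<union> lab ` words (Suc n))"
      unfolding K_eq[OF lab, of "Suc n"] by (rule genf_mono) (use base_K in auto)
  qed
  ultimately obtain ys where "tower (K n) ys" "adjs (K n) ys = K (Suc n)" unfolding bounded_tower_def by auto
  then show ?case using zs by (intro exI[of _ "zs @ ys"]) (simp add: tower_append adjs_append)
qed

text \<open>\<open>K n\<close> is reached by square roots, and one tower counts both the degree and
  the embeddings over the base, which are automorphisms of \<open>K n\<close>.\<close>

lemma card_gal: "\<exists>d. ext_degree (K n) (2 ^ d) \<and> card (carrier (gal (K n))) = 2 ^ d"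
proof -
  obtain zs where zs: "tower base zs" "adjs base zs = K n" using tower_K by blast
  have "hom_on base id" by (simp add: hom_on_def)
  from card_homs[OF two sq sfield_base zs(1) this]
  have "card (homs (K n) base id) = 2 ^ steps base zs" unfolding zs(2) by blast
  moreover have "homs (K n) base id = carrier (gal (K n))"
    unfolding gal_carrier[OF disjI1[OF refl]] homs_def fixing_def by auto
  moreover have "ext_degree (K n) (2 ^ steps base zs)"
    using dimension_adjs[OF two sfield_base zs(1)] unfolding zs(2) ext_degree_def .
  ultimately show ?thesis by metis
qed

lemma ext_degree_unique: "ext_degree E m \<Longrightarrow> ext_degree E n \<Longrightarrow> m = n"
  unfolding ext_degree_def using dimension_unique[OF sfield_base] by blast

lemma ext_degree_card_gal: "ext_degree (K n) m \<longleftrightarrow> m = card (carrier (gal (K n)))"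
  using card_gal[of n] ext_degree_unique by metis

text \<open>The larger field \<open>L\<close> contains the square roots of its elements, in
  particular \<open>\<iota>\<close> and \<open>\<kappa>\<close>, so the signs of the extended
  embedding on them are defined.\<close>

lemma fixing_extend:
  assumes "sfield E" "base \<subseteq> E" "fixing E \<sigma>"
  shows "\<exists>L \<tau>. sfield L \<and> E \<subseteq> L \<and> KI \<subseteq> L \<and> fixing L \<tau> \<and> (\<forall>x\<in>E. \<tau> x = \<sigma> x) \<and> (\<forall>z. z ^ 2 \<in> L \<longrightarrow> z \<in> L)"
proof -
  have "hom_on E \<sigma>" using assms(3) by (simp add: fixing_def)
  from hom_quadratic_closure[OF two sq assms(1) this]
  obtain L \<tau> where L: "sfield L" "E \<subseteq> L" "hom_on L \<tau>" "\<And>x. x \<in> E \<Longrightarrow> \<tau> x = \<sigma> x" "\<And>z. z ^ 2 \<in> L \<Longrightarrow> z \<in> L" by blast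
  obtain lab where lab: "pl lab" using prelabeling_ex[OF sq] by blast
  have "lab w \<in> L" for w
  proof (induction w rule: rev_induct)
    case Nil
    then show ?case using lab_Nil[OF lab] assms(2) L(2) by auto
  next
    case (snoc l w)
    have "to_ac c \<in> L" using assms(2) L(2) by blast
    then have "lab w - to_ac c \<in> L" by (rule sfieldD(7)[OF L(1) snoc])
    then show ?case using L(5) lab_sq[OF lab, of w l] by metis
  qed
  then have "K n \<subseteq> L" for n
    unfolding K_eq[OF lab] by (intro genf_min[OF L(1)]) (use assms(2) L(2) in auto)
  moreover have "fixing L \<tau>" using assms(2,3) L(3,4) by (auto simp: fixing_def subset_iff)
  ultimately show ?thesis using L unfolding KI_eq by blast
qed

text \<open>A node below the root labelled 0 coincides with its sibling, so bijectivity fails.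
  Otherwise siblings have opposite nonzero labels, which differ, and injectivity passes down the
  levels.\<close>

lemma labeling_iff: "labeling c x0 lab \<longleftrightarrow> pl lab \<and> nondeg"
proof
  assume l: "labeling c x0 lab"
  have p: "pl lab" unfolding prelabeling_def
  proof (intro conjI allI)
    show "lab [] = to_ac x0" using l by (simp add: labeling_def)
    fix w
    let ?A = "lab (w @ [La])" and ?B = "lab (w @ [Lb])"
    have e: "{?A, ?B} = {z. quad (to_ac c) z = lab w}" using l by (simp add: labeling_def)
    have "quad (to_ac c) ?A = lab w" "quad (to_ac c) ?B = lab w" using e by blast+
    then show sq: "?A ^ 2 = lab w - to_ac c" by (simp add: quad_def algebra_simps)
    then have "quad (to_ac c) (- ?A) = lab w" by (simp add: quad_def)
    then have "- ?A = ?A \<or> - ?A = ?B" using e by blast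
    moreover have "?B = - ?A" if "- ?A = ?A"
    proof -
      have "2 * ?A = 0" using that by (metis add.right_inverse mult_2)
      then have "?A = 0" using two by simp
      moreover have "?B ^ 2 = ?A ^ 2" 
        unfolding sq using \<open>quad (to_ac c) ?B = lab w\<close> by (metis add_diff_cancel_right' quad_def)
      ultimately show ?thesis by simp
    qed
    ultimately show "?B = - ?A" by metis
  qed
  have "nondeg" unfolding nondeg_def
  proof (intro allI impI notI)
    fix m :: nat assume m: "1 \<le> m" "(quad (to_ac c) ^^ m) 0 = to_ac x0"
    then have "0 \<in> lab ` words m" using preim_eq[OF p, of m] by (auto simp: preim_def)
    then obtain w where w: "length w = m" "lab w = 0" by auto
    then obtain u k where u: "w = u @ [k]" using m(1) by (cases w rule: rev_cases) auto
    have "lab (u @ [La]) = 0" "lab (u @ [Lb]) = 0" using w(2) lab_Lb[OF p, of u] unfolding u by (cases k; simp)+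
    moreover have "inj_on lab (words m)" using l unfolding labeling_def bij_betw_def by blast
    ultimately have "u @ [La] = u @ [Lb]" using w(1) unfolding u by (intro inj_onD[of lab "words m"]) auto
    then show False by simp
  qed
  then show "pl lab \<and> nondeg" using p by blast
next
  assume a: "pl lab \<and> nondeg"
  then have p: "pl lab" and nz: "\<And>w. w \<noteq> [] \<Longrightarrow> lab w \<noteq> 0" using nondeg_nz by blast+
  have neq: "z \<noteq> - z" if "z \<noteq> 0" for z :: "'a alg_closure"
    using two that by (metis add.right_inverse mult_2 mult_eq_0_iff)
  have inj: "u = v" if "lab u = lab v" "length u = length v" for u v
    using that
  proof (induction u arbitrary: v rule: rev_induct)
    case (snoc l u)
    then obtain v' l' where v: "v = v' @ [l']" by (cases v rule: rev_cases) auto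
    have "lab u = lab v'" using lab_sq[OF p, of u l] lab_sq[OF p, of v' l'] snoc(2) unfolding v by simp
    then have uv: "u = v'" using snoc v by simp
    have "l = l'"
    proof (rule ccontr)
      assume "l \<noteq> l'"
      then have "l' = other l" by (cases l; cases l') auto
      then show False using snoc(2) lab_other[OF p, of u l] neq[OF nz[of "u @ [l]"]] unfolding v uv by simp
    qed
    then show ?case using uv v by simp
  qed simp
  have "{lab (w @ [La]), lab (w @ [Lb])} = {z. quad (to_ac c) z = lab w}" for w
  proof -
    have "quad (to_ac c) z = lab w \<longleftrightarrow> z ^ 2 = lab (w @ [La]) ^ 2" for z
      by (simp only: quad_def lab_sq[OF p] eq_diff_eq)
    then show ?thesis using lab_Lb[OF p, of w] by (auto simp: power2_eq_iff)
  qed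
  then show "labeling c x0 lab"
    unfolding labeling_def bij_betw_def inj_on_def using inj lab_Nil[OF p] preim_eq[OF p] by auto
qed

end

section \<open>The action of Galois elements on words\<close>

lemma mult_carrier_update: "monoid.mult (G\<lparr>carrier := A\<rparr>) = monoid.mult (G :: 'x monoid)"
  by simp

lemma tree_aut_mult:
  assumes "\<sigma> \<in> Bij W" "\<tau> \<in> Bij W"
  shows "\<sigma> \<otimes>\<^bsub>(tree_aut W)\<lparr>carrier := M\<rparr>\<^esub> \<tau> = compose W \<sigma> \<tau>"
proof -
  have "monoid.mult (BijGroup W) \<sigma> \<tau> = compose W \<sigma> \<tau>" using assms by (simp add: BijGroup_def)
  then show ?thesis unfolding tree_aut_def mult_carrier_update .
qed

lemma sfield_numeral: "sfield E \<Longrightarrow> numeral n \<in> E"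
proof -
  assume E: "sfield E"
  have "of_nat m \<in> E" for m by (induction m) (use sfieldD(1-3)[OF E] in auto)
  from this[of "numeral n"] show ?thesis by simp
qed

lemma hom_on_numeral: "hom_on E \<tau> \<Longrightarrow> sfield E \<Longrightarrow> \<tau> (numeral n) = numeral n"
proof -
  assume h: "hom_on E \<tau>" "sfield E"
  have "of_nat m \<in> E \<and> \<tau> (of_nat m) = of_nat m" for m
    by (induction m) (use hom_onD(1-3)[OF h] sfieldD(1-3)[OF h(2)] in auto)
  from this[of "numeral n"] show ?thesis by simp
qed

lemma hom_on_prod:
  assumes "hom_on E \<tau>" "sfield E" "finite A" "\<And>x. x \<in> A \<Longrightarrow> f x \<in> E"
  shows "(\<Prod>x\<in>A. f x) \<in> E \<and> \<tau> (\<Prod>x\<in>A. f x) = (\<Prod>x\<in>A. \<tau> (f x))"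
  using assms(3,4)
  by (induction A rule: finite_induct) (auto simp: hom_onD(1,4)[OF assms(1,2)] sfieldD(1,4)[OF assms(2)])

lemma hom_on_EE:
  assumes h: "hom_on E \<tau>" and E: "sfield E" and m: "c \<in> E" "x \<in> E" "y \<in> E" "z \<in> E" "w \<in> E" and c: "\<tau> c = c"
  shows "EE c x y z w \<in> E \<and> \<tau> (EE c x y z w) = EE c (\<tau> x) (\<tau> y) (\<tau> z) (\<tau> w)"
proof -
  note f = sfieldD[OF E] and n = sfield_numeral[OF E] hom_on_numeral[OF h E]
  have "\<tau> (u / v) = \<tau> u / \<tau> v" if "u \<in> E" "v \<in> E" for u v
    unfolding divide_inverse using hom_onD(4,6)[OF h E] f(6) that by simp
  then show ?thesis unfolding EE_def EE4_def
    by (simp add: m c n f(1,3,4,7,8,9) hom_onD(1,3,4,7,8)[OF h E])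
qed

context arboreal
begin

definition wa :: "(word \<Rightarrow> 'a alg_closure) \<Rightarrow> ('a alg_closure \<Rightarrow> 'a alg_closure) \<Rightarrow> word \<Rightarrow> word" where
  "wa lab \<tau> w = inv_into (words (length w)) lab (\<tau> (lab w))"

lemma word_action_eq: "word_action lab W \<tau> = restrict (wa lab \<tau>) W"
  by (auto simp: word_action_def wa_def restrict_def fun_eq_iff)

context
  fixes lab :: "word \<Rightarrow> 'a alg_closure"
  assumes labeling: "labeling c x0 lab"
begin

lemma pl: "pl lab"
  using labeling by (simp add: labeling_iff)

lemma nz: "w \<noteq> [] \<Longrightarrow> lab w \<noteq> 0"
  using labeling nondeg_nz by (simp add: labeling_iff)

lemma lab_inj: "lab u = lab v \<Longrightarrow> length u = length v \<Longrightarrow> u = v"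
  using labeling unfolding labeling_def bij_betw_def inj_on_def by simp

lemma wa_lab:
  assumes "fixing (K n) \<tau>" "length w \<le> n"
  shows "length (wa lab \<tau> w) = length w" "lab (wa lab \<tau> w) = \<tau> (lab w)"
proof -
  have "fixing (K (length w)) \<tau>" by (rule fixing_subset[OF assms(1) K_mono[OF assms(2)]])
  from fixing_lab[OF pl this] have m: "\<tau> (lab w) \<in> lab ` words (length w)" by auto
  show "length (wa lab \<tau> w) = length w" using inv_into_into[OF m] by (simp add: wa_def)
  show "lab (wa lab \<tau> w) = \<tau> (lab w)" using f_inv_into_f[OF m] by (simp add: wa_def)
qed

lemma wa_KI: "fixing KI \<tau> \<Longrightarrow> length (wa lab \<tau> w) = length w" "fixing KI \<tau> \<Longrightarrow> lab (wa lab \<tau> w) = \<tau> (lab w)"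
  by (rule wa_lab[OF fixing_subset[OF _ K_KI] order_refl]; assumption)+

lemma wa_eqI: "fixing (K n) \<tau> \<Longrightarrow> length w \<le> n \<Longrightarrow> lab v = \<tau> (lab w) \<Longrightarrow> length v = length w \<Longrightarrow> wa lab \<tau> w = v"
  by (rule lab_inj) (simp_all add: wa_lab)

lemma wa_surj: "fixing (K n) \<tau> \<Longrightarrow> length v \<le> n \<Longrightarrow> \<exists>u. length u = length v \<and> wa lab \<tau> u = v"
proof -
  assume a: "fixing (K n) \<tau>" "length v \<le> n"
  have "fixing (K (length v)) \<tau>" by (rule fixing_subset[OF a(1) K_mono[OF a(2)]])
  from fixing_lab[OF pl this] have "lab v \<in> \<tau> ` (lab ` words (length v))" by simp
  then obtain u where u: "length u = length v" "lab v = \<tau> (lab u)" by auto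
  have "wa lab \<tau> u = v" by (rule wa_eqI[OF a(1) _ u(2)]) (use u(1) a(2) in auto)
  then show ?thesis using u(1) by blast
qed

lemma wa_inj: "fixing (K n) \<tau> \<Longrightarrow> length u \<le> n \<Longrightarrow> length v \<le> n \<Longrightarrow> wa lab \<tau> u = wa lab \<tau> v \<Longrightarrow> u = v"
proof -
  assume a: "fixing (K n) \<tau>" "length u \<le> n" "length v \<le> n" "wa lab \<tau> u = wa lab \<tau> v"
  have "\<tau> (lab u) = \<tau> (lab v)" "length u = length v" using wa_lab[OF a(1,2)] wa_lab[OF a(1,3)] a(4) by auto
  moreover have "inj_on \<tau> (K n)" using a(1) hom_on_inj[OF _ K_sfield] unfolding fixing_def by blast
  ultimately show "u = v" using lab_inj lab_K[OF pl] a(2,3) unfolding inj_on_def by blast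
qed

lemma wa_aut: "fixing KI \<tau> \<Longrightarrow> wa lab \<tau> \<in> Aut_inf"
proof -
  assume f: "fixing KI \<tau>"
  have fn: "fixing (K n) \<tau>" for n by (rule fixing_subset[OF f K_KI])
  have "inj (wa lab \<tau>)"
  proof (rule injI)
    fix u v assume "wa lab \<tau> u = wa lab \<tau> v"
    then show "u = v" using wa_inj[OF fn[of "max (length u) (length v)"], of u v] by simp
  qed
  moreover have "surj (wa lab \<tau>)" unfolding surj_def using wa_surj[OF fn order_refl] by metis
  moreover have "prefix (wa lab \<tau> u) (wa lab \<tau> (u @ z))" for u z
  proof (induction z rule: rev_induct)
    case (snoc l z)
    let ?v = "u @ z"
    obtain y m where y: "wa lab \<tau> (?v @ [l]) = y @ [m]"
      using wa_KI(1)[OF f, of "?v @ [l]"] by (cases "wa lab \<tau> (?v @ [l])" rule: rev_cases) auto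
    have h: "hom_on KI \<tau>" and fc: "\<tau> (to_ac c) = to_ac c" using f by (auto simp: fixing_def)
    have "lab y - to_ac c = \<tau> (lab (?v @ [l])) ^ 2"
      using lab_sq[OF pl, of y m] wa_KI(2)[OF f, of "?v @ [l]"] unfolding y by simp
    also have "\<dots> = \<tau> (lab ?v - to_ac c)"
      using hom_onD(8)[OF h KI_sfield lab_KI[OF pl], of "?v @ [l]" 2] lab_sq[OF pl, of ?v l] by simp
    also have "\<dots> = \<tau> (lab ?v) - to_ac c"
      using hom_onD(7)[OF h KI_sfield lab_KI[OF pl, of ?v], of "to_ac c"] base_K[of 0] K_KI[of 0] fc by auto
    finally have "wa lab \<tau> ?v = y"
      using wa_KI(1)[OF f, of "?v @ [l]"] y by (intro wa_eqI[OF fn[of "length ?v"]]) auto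
    then show ?case using snoc y by (metis append.assoc prefix_append prefix_order.trans prefixI)
  qed simp
  ultimately show ?thesis unfolding aut_iff bij_def using wa_KI(1)[OF f] by (auto simp: prefix_def)
qed

lemma wa_comp:
  assumes "fixing (K n) \<tau>" "fixing (K n) \<mu>" "fixing (K n) \<nu>" "\<And>x. x \<in> K n \<Longrightarrow> \<nu> x = \<tau> (\<mu> x)" "length w \<le> n"
  shows "wa lab \<nu> w = wa lab \<tau> (wa lab \<mu> w)"
proof (rule wa_eqI[OF assms(3,5)])
  show "lab (wa lab \<tau> (wa lab \<mu> w)) = \<nu> (lab w)"
    using wa_lab[OF assms(2,5)] wa_lab[OF assms(1), of "wa lab \<mu> w"] assms(4,5) lab_K[OF pl assms(5)] by simp
  show "length (wa lab \<tau> (wa lab \<mu> w)) = length w"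
    using wa_lab[OF assms(2,5)] wa_lab[OF assms(1), of "wa lab \<mu> w"] assms(5) by simp
qed

lemma fixing_determined:
  assumes "fixing (K n) \<tau>" "fixing (K n) \<mu>" "\<And>w. length w \<le> n \<Longrightarrow> wa lab \<tau> w = wa lab \<mu> w" "x \<in> K n"
  shows "\<tau> x = \<mu> x"
proof (rule hom_on_genf_eq[of "K n" \<tau> \<mu> "base \<union> lab ` words n"])
  show "hom_on (K n) \<tau>" "hom_on (K n) \<mu>" using assms(1,2) by (auto simp: fixing_def)
  show "base \<union> lab ` words n \<subseteq> K n" using base_K lab_K[OF pl] by auto
  show "x \<in> genf (base \<union> lab ` words n)" using assms(4) unfolding K_eq[OF pl] .
  show "\<tau> y = \<mu> y" if y: "y \<in> base \<union> lab ` words n" for y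
  proof (cases "y \<in> base")
    case True
    then show ?thesis using assms(1,2) by (auto simp: fixing_def)
  next
    case False
    then obtain w where "length w = n" "y = lab w" using y by auto
    then show ?thesis using wa_lab(2)[OF assms(1), of w] wa_lab(2)[OF assms(2), of w] assms(3)[of w] by simp
  qed
qed simp

text \<open>The word action is always an injective homomorphism: labels determine words within a
  level and generate the field, so only the image is in question. The predicate \<open>ok\<close>
  selects the levels contained in \<open>W\<close> and \<open>F\<close>, which treats finite levels
  and the infinite tree at once.\<close>

lemma iso_iff:
  assumes FW: "F = K n \<and> W = tree n \<or> F = KI \<and> W = UNIV"
  shows "word_action lab W \<in> iso (gal F) ((tree_aut W)\<lparr>carrier := M\<rparr>) \<longleftrightarrow> word_action lab W ` carrier (gal F) = M"
proof -
  define ok where "ok m \<longleftrightarrow> (\<forall>w. length w \<le> m \<longrightarrow> w \<in> W) \<and> K m \<subseteq> F" for m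
  have okw: "ok (length w)" if "w \<in> W" for w
    using FW that K_KI K_mono unfolding ok_def tree_def by (metis (mono_tags, lifting) UNIV_I mem_Collect_eq order_trans)
  have okF: "\<exists>m. ok m \<and> x \<in> K m" if "x \<in> F" for x
    using FW that unfolding ok_def tree_def by (auto simp: KI_eq)
  have car: "carrier (gal F) = {\<tau> \<in> extensional F. fixing F \<tau>}" by (rule gal_carrier[of _ n]) (use FW in blast)
  have fx: "fixing (K m) \<tau>" if "\<tau> \<in> carrier (gal F)" "ok m" for \<tau> m
    using that fixing_subset unfolding car ok_def by blast
  have bij: "word_action lab W \<tau> \<in> Bij W" if t: "\<tau> \<in> carrier (gal F)" for \<tau>
  proof -
    have "inj_on (wa lab \<tau>) W"
    proof (rule inj_onI)
      fix u v assume uv: "u \<in> W" "v \<in> W" "wa lab \<tau> u = wa lab \<tau> v"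
      have "ok (max (length u) (length v))" using okw uv(1,2) by (simp add: max_def)
      then show "u = v" using wa_inj[OF fx[OF t], of "max (length u) (length v)" u v] uv(3) by simp
    qed
    moreover have "wa lab \<tau> ` W = W"
    proof (intro equalityI subsetI)
      fix v assume "v \<in> wa lab \<tau> ` W"
      then obtain u where u: "u \<in> W" "v = wa lab \<tau> u" by blast
      then have "length v = length u" using wa_lab(1)[OF fx[OF t okw[OF u(1)]]] by simp
      then show "v \<in> W" using okw[OF u(1)] unfolding ok_def by simp
    next
      fix v assume v: "v \<in> W"
      obtain u where "length u = length v" "wa lab \<tau> u = v" using wa_surj[OF fx[OF t okw[OF v]]] by blast
      then show "v \<in> wa lab \<tau> ` W" using okw[OF v] unfolding ok_def by force
    qed
    ultimately have "bij_betw (wa lab \<tau>) W W" by (simp add: bij_betw_def)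
    then have "bij_betw (restrict (wa lab \<tau>) W) W W" by (simp cong: bij_betw_cong)
    then show ?thesis unfolding word_action_eq Bij_def by simp
  qed
  have inj: "inj_on (word_action lab W) (carrier (gal F))"
  proof (rule inj_onI)
    fix \<tau> \<mu> assume a: "\<tau> \<in> carrier (gal F)" "\<mu> \<in> carrier (gal F)" "word_action lab W \<tau> = word_action lab W \<mu>"
    have eq: "wa lab \<tau> w = wa lab \<mu> w" if "w \<in> W" for w
      using fun_cong[OF a(3), of w] that by (simp add: word_action_eq)
    have "\<tau> x = \<mu> x" if x: "x \<in> F" for x
    proof -
      obtain m where m: "ok m" "x \<in> K m" using okF[OF x] by blast
      show ?thesis
        by (rule fixing_determined[OF fx[OF a(1) m(1)] fx[OF a(2) m(1)] eq m(2)]) (use m(1) ok_def in blast)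
    qed
    then show "\<tau> = \<mu>" using a(1,2) unfolding car by (auto intro: extensionalityI)
  qed
  have mult: "word_action lab W (\<tau> \<otimes>\<^bsub>gal F\<^esub> \<mu>) = word_action lab W \<tau> \<otimes>\<^bsub>(tree_aut W)\<lparr>carrier := M\<rparr>\<^esub> word_action lab W \<mu>"
    if t: "\<tau> \<in> carrier (gal F)" and r: "\<mu> \<in> carrier (gal F)" for \<tau> \<mu>
  proof -
    have B: "\<tau> \<in> Bij F" "\<mu> \<in> Bij F" using t r by (auto simp: gal_def)
    have m1: "\<tau> \<otimes>\<^bsub>gal F\<^esub> \<mu> = compose F \<tau> \<mu>" using B by (simp add: gal_def BijGroup_def)
    have m2: "word_action lab W \<tau> \<otimes>\<^bsub>(tree_aut W)\<lparr>carrier := M\<rparr>\<^esub> word_action lab W \<mu> =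
        compose W (word_action lab W \<tau>) (word_action lab W \<mu>)"
      by (rule tree_aut_mult[OF bij[OF t] bij[OF r]])
    have m3: "wa lab (compose F \<tau> \<mu>) w = wa lab \<tau> (wa lab \<mu> w)" if w: "w \<in> W" for w
    proof -
      note o = okw[OF w]
      have sub: "K (length w) \<subseteq> F" using o by (simp add: ok_def)
      have e: "compose F \<tau> \<mu> x = \<tau> (\<mu> x)" if "x \<in> K (length w)" for x using that sub by (auto simp: compose_def)
      have im: "\<mu> ` K (length w) = K (length w)" by (rule fixing_K[OF fx[OF r o]])
      have "hom_on (K (length w)) (\<tau> \<circ> \<mu>)"
        using hom_on_comp[of "K (length w)" \<mu> "K (length w)" \<tau>] fx[OF t o] fx[OF r o] im by (simp add: fixing_def)
      then have "hom_on (K (length w)) (compose F \<tau> \<mu>)" by (rule hom_on_cong[OF _ K_sfield]) (simp add: e)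
      moreover have "compose F \<tau> \<mu> x = x" if "x \<in> base" for x
      proof -
        have "\<tau> x = x" "\<mu> x = x" using fx[OF t o] fx[OF r o] that unfolding fixing_def by blast+
        then show ?thesis using e[of x] base_K[of "length w"] that by auto
      qed
      ultimately have "fixing (K (length w)) (compose F \<tau> \<mu>)" by (simp add: fixing_def)
      then show ?thesis by (rule wa_comp[OF fx[OF t o] fx[OF r o] _ e order_refl])
    qed
    have m4: "wa lab \<mu> w \<in> W" if "w \<in> W" for w
      using wa_lab(1)[OF fx[OF r okw[OF that]]] okw[OF that] unfolding ok_def by simp
    show ?thesis unfolding m1 m2
    proof
      fix w show "word_action lab W (compose F \<tau> \<mu>) w = compose W (word_action lab W \<tau>) (word_action lab W \<mu>) w"
      proof (cases "w \<in> W")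
        case True
        then show ?thesis unfolding word_action_eq compose_eq[OF True] using m3[OF True] m4[OF True] by simp
      next
        case False
        then show ?thesis by (simp add: word_action_eq compose_def)
      qed
    qed
  qed
  have carM: "carrier ((tree_aut W)\<lparr>carrier := M\<rparr>) = M" by simp
  show ?thesis
  proof
    assume "word_action lab W \<in> iso (gal F) ((tree_aut W)\<lparr>carrier := M\<rparr>)"
    then have "bij_betw (word_action lab W) (carrier (gal F)) (carrier ((tree_aut W)\<lparr>carrier := M\<rparr>))"
      unfolding iso_def by blast
    then show "word_action lab W ` carrier (gal F) = M" unfolding carM by (rule bij_betw_imp_surj_on)
  next
    assume im: "word_action lab W ` carrier (gal F) = M"
    have "word_action lab W \<in> hom (gal F) ((tree_aut W)\<lparr>carrier := M\<rparr>)"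
    proof (rule homI)
      fix \<tau> assume "\<tau> \<in> carrier (gal F)"
      then have "word_action lab W \<tau> \<in> M" unfolding im[symmetric] by (rule imageI)
      then show "word_action lab W \<tau> \<in> carrier ((tree_aut W)\<lparr>carrier := M\<rparr>)" unfolding carM .
    qed (rule mult)
    moreover have "bij_betw (word_action lab W) (carrier (gal F)) (carrier ((tree_aut W)\<lparr>carrier := M\<rparr>))"
      unfolding carM bij_betw_def using inj im by (rule conjI)
    ultimately show "word_action lab W \<in> iso (gal F) ((tree_aut W)\<lparr>carrier := M\<rparr>)"
      unfolding iso_def by blast
  qed
qed

lemma image_level: "word_action lab (tree n) ` carrier (gal (K n)) = (\<lambda>\<sigma>. restrict \<sigma> (tree n)) ` {wa lab \<tau> |\<tau>. fixing KI \<tau>}"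
proof (intro equalityI subsetI)
  fix \<alpha> assume "\<alpha> \<in> word_action lab (tree n) ` carrier (gal (K n))"
  then obtain \<sigma> where \<sigma>: "fixing (K n) \<sigma>" "\<alpha> = restrict (wa lab \<sigma>) (tree n)"
    unfolding gal_carrier[OF disjI1[OF refl]] word_action_eq by blast
  obtain L \<tau> where L: "KI \<subseteq> L" "fixing L \<tau>" "\<And>x. x \<in> K n \<Longrightarrow> \<tau> x = \<sigma> x"
    using fixing_extend[OF K_sfield base_K \<sigma>(1)] by blast
  have "fixing KI \<tau>" by (rule fixing_subset[OF L(2,1)])
  moreover have "wa lab \<tau> w = wa lab \<sigma> w" if "length w \<le> n" for w
    using L(3)[OF lab_K[OF pl that]] by (simp add: wa_def)
  then have "\<alpha> = restrict (wa lab \<tau>) (tree n)" unfolding \<sigma>(2) by (auto simp: restrict_def tree_def)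
  ultimately show "\<alpha> \<in> (\<lambda>\<sigma>. restrict \<sigma> (tree n)) ` {wa lab \<tau> |\<tau>. fixing KI \<tau>}" by blast
next
  fix \<alpha> assume "\<alpha> \<in> (\<lambda>\<sigma>. restrict \<sigma> (tree n)) ` {wa lab \<tau> |\<tau>. fixing KI \<tau>}"
  then obtain \<tau> where \<tau>: "fixing KI \<tau>" "\<alpha> = restrict (wa lab \<tau>) (tree n)" by blast
  let ?\<sigma> = "restrict \<tau> (K n)"
  have "fixing (K n) \<tau>" by (rule fixing_subset[OF \<tau>(1) K_KI])
  then have "fixing (K n) ?\<sigma>" using hom_on_cong[of "K n" \<tau> ?\<sigma>] base_K[of n] unfolding fixing_def by auto
  then have "?\<sigma> \<in> carrier (gal (K n))" unfolding gal_carrier[OF disjI1[OF refl]] by simp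
  moreover have "wa lab ?\<sigma> w = wa lab \<tau> w" if "length w \<le> n" for w
    using lab_K[OF pl that] by (simp add: wa_def)
  then have "\<alpha> = word_action lab (tree n) ?\<sigma>" unfolding \<tau>(2) word_action_eq by (auto simp: restrict_def tree_def)
  ultimately show "\<alpha> \<in> word_action lab (tree n) ` carrier (gal (K n))" by blast
qed

lemma image_inf: "word_action lab UNIV ` carrier (gal KI) = {wa lab \<tau> |\<tau>. fixing KI \<tau>}"
proof (intro equalityI subsetI)
  fix \<alpha> assume "\<alpha> \<in> {wa lab \<tau> |\<tau>. fixing KI \<tau>}"
  then obtain \<tau> where \<tau>: "fixing KI \<tau>" "\<alpha> = wa lab \<tau>" by blast
  let ?\<sigma> = "restrict \<tau> KI"
  have "base \<subseteq> KI" using base_K[of 0] K_KI[of 0] by blast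
  then have "fixing KI ?\<sigma>" using hom_on_cong[of KI \<tau> ?\<sigma>] \<tau>(1) unfolding fixing_def by auto
  then have "?\<sigma> \<in> carrier (gal KI)" unfolding gal_carrier[OF disjI2[OF refl]] by simp
  moreover have "\<alpha> = word_action lab UNIV ?\<sigma>"
    unfolding \<tau>(2) word_action_eq using lab_KI[OF pl] by (simp add: wa_def fun_eq_iff)
  ultimately show "\<alpha> \<in> word_action lab UNIV ` carrier (gal KI)" by blast
next
  fix \<alpha> assume "\<alpha> \<in> word_action lab UNIV ` carrier (gal KI)"
  then obtain \<tau> where "fixing KI \<tau>" "\<alpha> = restrict (wa lab \<tau>) UNIV"
    unfolding gal_carrier[OF disjI2[OF refl]] word_action_eq by blast
  then show "\<alpha> \<in> {wa lab \<tau> |\<tau>. fixing KI \<tau>}" by (auto simp only: restrict_UNIV)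
qed

end

end

section \<open>Characters as signs of Galois on square roots\<close>

context arboreal
begin

text \<open>The square roots on which Galois acts by the characters, listed in the order of
  \<open>chi\<close>.\<close>

definition zz :: "(word \<Rightarrow> 'a alg_closure) \<Rightarrow> 'a alg_closure \<Rightarrow> 'a alg_closure \<Rightarrow> nat \<Rightarrow> 'a alg_closure" where
  "zz lab \<iota> \<kappa> i = (if i \<le> r then PI lab (i - 1) [] else if i = Suc r \<and> s \<noteq> 1 then \<iota> else \<kappa>)"

lemma orbit_base: "(quad (to_ac c) ^^ m) 0 = to_ac ((quad c ^^ m) 0)"
  by (induction m) (simp_all add: quad_def[of "to_ac c" "to_ac u" for u] quad_def[of c u for u])

text \<open>Applying \<open>\<tau>\<close> to the normalised relations gives the same relations for
  \<open>lab \<circ> act q\<close>, with \<open>\<iota>\<close> and \<open>\<kappa>\<close> replaced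
  by their images. By the change lemmas the equations for \<open>Pc\<close> and \<open>Rc\<close>
  then hold with the signs of \<open>\<tau>\<close> on \<open>\<iota>\<close> and
  \<open>\<kappa>\<close> as constants, the same at every \<open>x\<close>.\<close>

lemma galois_action:
  assumes labeling: "labeling c x0 lab" and N: "\<And>x l. N1 \<iota> lab x l" "\<And>x. N2 \<kappa> lab x"
    and i: "iotaok \<iota>" "s = 1 \<Longrightarrow> \<iota> = 1" and \<kappa>: "\<kappa> ^ 2 = 2"
    and L: "sfield L" "KI \<subseteq> L" "fixing L \<tau>" "\<And>z. z ^ 2 \<in> L \<Longrightarrow> z \<in> L"
  shows "wa lab \<tau> \<in> Mt_inf r s \<and> (\<forall>i\<in>{1..NN}. \<tau> (zz lab \<iota> \<kappa> i) = sg (chi i (wa lab \<tau>)) * zz lab \<iota> \<kappa> i)"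
proof -
  note p = pl[OF labeling] and nz = nz[OF labeling]
  have f: "fixing KI \<tau>" by (rule fixing_subset[OF L(3,2)])
  have h: "hom_on L \<tau>" and fx: "\<And>x. \<tau> (to_ac x) = to_ac x" using L(3) by (auto simp: fixing_def)
  note hD = hom_onD[OF h L(1)]
  define q where "q = Par (wa lab \<tau>)"
  have au: "wa lab \<tau> \<in> Aut_inf" by (rule wa_aut[OF labeling f])
  have act: "act q = wa lab \<tau>" unfolding q_def by (rule act_Par[OF au])
  have lab_L: "lab w \<in> L" for w using lab_KI[OF p] L(2) by blast
  have tl: "\<tau> (lab w) = (lab \<circ> act q) w" for w unfolding act using wa_KI(2)[OF labeling f] by simp
  have bL: "to_ac x \<in> L" for x using base_K[of 0] K_KI[of 0] L(2) by blast
  have PI: "PI lab m u \<in> L \<and> \<tau> (PI lab m u) = PI (lab \<circ> act q) m u" for m u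
    using hom_on_prod[OF h L(1), of "words m" "\<lambda>w. lab (u @ w @ [La])"] lab_L tl unfolding PI_def by simp
  have i2: "\<iota> ^ 2 = 1 \<or> \<iota> ^ 2 = - 1" using i(1) unfolding iotaok_def by metis
  then have iL: "\<iota> \<in> L" using L(4)[of \<iota>] sfieldD(1,5)[OF L(1)] by metis
  have kL: "\<kappa> \<in> L" using L(4)[of \<kappa>] \<kappa> sfield_numeral[OF L(1)] by metis
  have "\<tau> \<iota> ^ 2 = \<iota> ^ 2" using hD(8)[OF iL, of 2] i2 hD(1) hD(5)[OF sfieldD(1)[OF L(1)]] by metis
  then obtain P0 where P0: "\<tau> \<iota> = sg P0 * \<iota>" using square_sg by blast
  \<comment> \<open>For \<open>s = 1\<close> the value 0 is imposed, as \<open>ok\<close> demands;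
    it is a correct sign because \<open>\<iota>\<close> is then 1.\<close>
  define P where "P = (if s = 1 then 0 else P0)"
  have P: "\<tau> \<iota> = sg P * \<iota>"
  proof (cases "s = 1")
    case True
    show ?thesis unfolding P_def if_P[OF True] i(2)[OF True] using hD(1) by simp
  next
    case False
    show ?thesis unfolding P_def if_not_P[OF False] by (rule P0)
  qed
  have "\<tau> \<kappa> ^ 2 = \<kappa> ^ 2" using hD(8)[OF kL, of 2] hom_on_numeral[OF h L(1)] unfolding \<kappa> by metis
  then obtain R where R: "\<tau> \<kappa> = sg R * \<kappa>" using square_sg by blast
  have N1': "N1 (sg P * \<iota>) (lab \<circ> act q) x l" for x l
  proof -
    have "\<tau> (PI lab (r - 1) (x @ [l])) = \<tau> (\<iota> * PI lab (s - 1) (x @ [other l]))"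
      using N(1)[of x l] unfolding N1_def by simp
    then show ?thesis unfolding N1_def hD(4)[OF iL PI[THEN conjunct1]] PI[THEN conjunct2] P .
  qed
  have Pc: "Pc r s q x l = P" for x l
    using N1_change[OF p nz N(1)[of "act q x" "turn (q x) l"] i(1), of P] N1'[of x l] by blast
  have Rc: "Rc r s q x = R" if sp: "s = 1 \<or> r = 3 \<and> s = 2" for x
  proof -
    have "N2 (sg R * \<kappa>) (lab \<circ> act q) x"
    proof (cases "s = 1")
      case True
      note n = N(2)[of x, unfolded N2_def if_P[OF True]]
      have m: "PI lab (r - 2) (x @ [La, Lb]) * PI lab (r - 2) (x @ [Lb, Lb]) \<in> L"
        using PI sfieldD(4)[OF L(1)] by blast
      have a: "\<tau> (\<kappa> * (PI lab (r - 2) (x @ [La, Lb]) * PI lab (r - 2) (x @ [Lb, Lb]))) =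
          sg R * \<kappa> * (PI (lab \<circ> act q) (r - 2) (x @ [La, Lb]) * PI (lab \<circ> act q) (r - 2) (x @ [Lb, Lb]))"
        unfolding hD(4)[OF kL m] hD(4)[OF PI[THEN conjunct1] PI[THEN conjunct1]] PI[THEN conjunct2] R ..
      have b: "\<tau> ((quad (to_ac c) ^^ (r - 1)) 0 - lab (x @ [La, Lb]) - lab (x @ [Lb, Lb])) =
          (quad (to_ac c) ^^ (r - 1)) 0 - (lab \<circ> act q) (x @ [La, Lb]) - (lab \<circ> act q) (x @ [Lb, Lb])"
        unfolding orbit_base hD(7)[OF sfieldD(7)[OF L(1) bL lab_L] lab_L] hD(7)[OF bL lab_L] fx tl ..
      show ?thesis unfolding N2_def if_P[OF True] a[symmetric] b[symmetric] n ..
    next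
      case False
      then have rs: "r = 3 \<and> s = 2" using \<open>s = 1 \<or> r = 3 \<and> s = 2\<close> by blast
      note n = N(2)[of x, unfolded N2_def if_not_P[OF False] if_P[OF rs]]
      have qq: "qq lab 0 u \<in> L \<and> \<tau> (qq lab 0 u) = qq (lab \<circ> act q) 0 u" for u
      proof
        show "qq lab 0 u \<in> L" unfolding qq_def by (rule sfieldD(4)[OF L(1) PI[THEN conjunct1] PI[THEN conjunct1]])
        show "\<tau> (qq lab 0 u) = qq (lab \<circ> act q) 0 u"
          unfolding qq_def hD(4)[OF PI[THEN conjunct1] PI[THEN conjunct1]] PI[THEN conjunct2] ..
      qed
      have 1: "\<tau> (\<Prod>w\<in>words 2. qq lab 0 (x @ w)) = (\<Prod>w\<in>words 2. qq (lab \<circ> act q) 0 (x @ w))"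
        using hom_on_prod[OF h L(1), of "words 2" "\<lambda>w. qq lab 0 (x @ w)"] qq by simp
      note E = hom_on_EE[OF h L(1) bL lab_L lab_L lab_L lab_L fx, of c "x @ [La, La, La]" "x @ [La, Lb, La]" "x @ [Lb, La, La]" "x @ [Lb, Lb, La]"]
      show ?thesis unfolding N2_def if_not_P[OF False] if_P[OF rs] 1[symmetric] n
        hD(4)[OF kL E[THEN conjunct1]] E[THEN conjunct2] R tl ..
    qed
    then show ?thesis using N2_change[OF p nz \<kappa> N(1) i N(2)[of "act q x"] sp, of R] by blast
  qed
  have Rgen: "Rc r s q x = 0" if "\<not> (s = 1 \<or> r = 3 \<and> s = 2)" for x using that unfolding Rc_def by auto
  have "\<exists>R'. ok r s P R' q"
  proof (cases "s = 1 \<or> r = 3 \<and> s = 2")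
    case True
    then show ?thesis unfolding ok_def using Pc Rc[OF True] by (intro exI[of _ R]) (simp add: P_def)
  next
    case False
    then show ?thesis unfolding ok_def using Pc Rgen[OF False] by (intro exI[of _ 0]) simp
  qed
  then have M: "wa lab \<tau> \<in> Mt_inf r s" using M_iff au unfolding q_def by blast
  have "\<tau> (zz lab \<iota> \<kappa> j) = sg (chi j (wa lab \<tau>)) * zz lab \<iota> \<kappa> j" if j: "j \<in> {1..NN}" for j
  proof (cases "j \<le> r")
    case True
    have "\<tau> (PI lab (j - 1) []) = sg (lev q (j - 1) []) * PI lab (j - 1) []"
      unfolding PI[THEN conjunct2] PI_act[OF p] by simp
    then show ?thesis unfolding zz_def if_P[OF True] chi_cases(1)[OF True] q_def .
  next
    case jr: False
    have "j = Suc r \<and> s \<noteq> 1 \<or> (s = 1 \<or> r = 3 \<and> s = 2) \<and> \<not> (j = Suc r \<and> s \<noteq> 1) \<and> (j = Suc r \<and> s = 1 \<or> j = 5 \<and> r = 3)"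
      using j jr by (cases rule: NN_cases) auto
    then show ?thesis
    proof (elim disjE conjE)
      assume a: "j = Suc r" "s \<noteq> 1"
      show ?thesis using jr a P Pc unfolding zz_def a(1) chi_cases(3)[OF a(2)] q_def by simp
    next
      assume a: "j = Suc r" "s = 1" "s = 1"
      show ?thesis using jr R Rc[OF disjI1[OF a(2)]] unfolding zz_def a(1) chi_cases(2)[OF a(2)] q_def using a(2) by simp
    next
      assume a: "\<not> (j = Suc r \<and> s \<noteq> 1)" "j = 5" "r = 3" "s = 1"
      have "NN = Suc r" using a(4) by (cases rule: NN_cases) linarith+
      then have "j \<le> Suc r" using j by (metis atLeastAtMost_iff)
      then show ?thesis using a(2,3) by linarith
    next
      assume a: "\<not> (j = Suc r \<and> s \<noteq> 1)" "j = 5" "r = 3" "r = 3" "s = 2"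
      have z: "zz lab \<iota> \<kappa> j = \<kappa>" unfolding zz_def if_not_P[OF jr] if_not_P[OF a(1)] ..
      have "chi j (wa lab \<tau>) = Rc r s q []" unfolding a(2) chi_cases(4)[OF a(3)] q_def ..
      then show ?thesis unfolding z Rc[OF disjI2[OF conjI[OF a(4,5)]]] R by simp
    next
      assume a: "j = Suc r" "s = 1" "r = 3" "s = 2"
      then show ?thesis by simp
    qed
  qed
  then show ?thesis using M by blast
qed

lemma zz_square: "pl lab \<Longrightarrow> iotaok \<iota> \<Longrightarrow> \<kappa> ^ 2 = 2 \<Longrightarrow> i \<in> {1..NN} \<Longrightarrow> zz lab \<iota> \<kappa> i ^ 2 \<in> base"
  and zz_D: "pl lab \<Longrightarrow> i \<in> {1..r} \<Longrightarrow> zz lab \<iota> \<kappa> i ^ 2 = to_ac (D_elem c x0 i)"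
proof -
  have D: "zz lab \<iota> \<kappa> i ^ 2 = to_ac (D_elem c x0 i)" if p: "pl lab" and i: "i \<in> {1..r}" for i
  proof (cases "i = 1")
    case True
    then show ?thesis using i by (simp add: zz_def D_elem_def lab_sq[OF p, of "[]" La, simplified] lab_Nil[OF p])
  next
    case False
    then obtain m where m: "i = Suc (Suc m)" using i by (metis One_nat_def atLeastAtMost_iff not0_implies_Suc not_one_le_zero)
    have "zz lab \<iota> \<kappa> i = PI lab (Suc m) []" using i by (simp add: zz_def m)
    then show ?thesis unfolding D_elem_def if_not_P[OF False] using PI_sq(2)[OF p, of m "[]"] lab_Nil[OF p]
      unfolding orbit_base m[symmetric] by simp
  qed
  show "pl lab \<Longrightarrow> i \<in> {1..r} \<Longrightarrow> zz lab \<iota> \<kappa> i ^ 2 = to_ac (D_elem c x0 i)" by (rule D)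
  assume a: "pl lab" "iotaok \<iota>" "\<kappa> ^ 2 = 2" "i \<in> {1..NN}"
  show "zz lab \<iota> \<kappa> i ^ 2 \<in> base"
  proof (cases "i \<le> r")
    case True
    then show ?thesis using D[OF a(1), of i] a(4) by simp
  next
    case False
    have "\<iota> ^ 2 \<in> base" using a(2) sfieldD(1,5)[OF sfield_base] unfolding iotaok_def by metis
    moreover have "\<kappa> ^ 2 \<in> base" unfolding a(3) by (rule sfield_numeral[OF sfield_base])
    ultimately show ?thesis using False by (auto simp: zz_def)
  qed
qed

lemma degree_iff:
  assumes "pl lab" "iotaok \<iota>" "\<kappa> ^ 2 = 2"
  shows "ext_degree (genf (base \<union> zz lab \<iota> \<kappa> ` {1..NN})) (2 ^ NN) \<longleftrightarrow> steps base (map (zz lab \<iota> \<kappa>) [1..<Suc NN]) = NN"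
    (is "ext_degree ?F _ \<longleftrightarrow> steps base ?zs = NN")
proof -
  have set: "set ?zs = zz lab \<iota> \<kappa> ` {1..NN}" by (simp add: atLeastLessThanSuc_atLeastAtMost del: upt_Suc)
  have tw: "tower base ?zs"
    by (rule tower_sq[OF two sfield_base]) (use zz_square[OF assms] set in auto)
  have "ext_degree ?F (2 ^ steps base ?zs)"
    using dimension_adjs[OF two sfield_base tw] adjs_genf[OF two sfield_base tw] unfolding set ext_degree_def by simp
  then show ?thesis using ext_degree_unique by (metis one_less_numeral_iff power_inject_exp semiring_norm(76))
qed

text \<open>The degree condition speaks of \<open>\<gamma>\<close>, the characters of
  \<open>\<iota>\<close> and \<open>\<kappa>\<close>. For \<open>(3, 2)\<close> the eighth root of
  unity provides both, as \<open>\<gamma>^2\<close> and \<open>\<gamma> + 1/\<gamma>\<close>, and is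
  recovered as \<open>\<kappa> (1 + \<gamma>^2) / 2\<close>. For \<open>s = 1\<close> the root of 2
  is \<open>\<gamma>\<close> itself, and for generic parameters \<open>\<iota>\<close> is.\<close>

lemma generators:
  assumes gamma: "is_gamma r s \<gamma>" and sqrtD: "\<And>i. i \<in> {1..r} \<Longrightarrow> sqrtD i ^ 2 = to_ac (D_elem c x0 i)"
  shows "\<exists>\<iota> \<kappa>. iotaok \<iota> \<and> (s = 1 \<longrightarrow> \<iota> = 1) \<and> \<kappa> ^ 2 = 2 \<and>
    (\<forall>lab. pl lab \<longrightarrow> adjoin (insert \<gamma> (sqrtD ` {1..r})) = genf (base \<union> zz lab \<iota> \<kappa> ` {1..NN}))"
proof -
  have main: "adjoin (insert \<gamma> (sqrtD ` {1..r})) = genf (base \<union> zz lab \<iota> \<kappa> ` {1..NN})"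
    if p: "pl lab" and g: "\<gamma> \<in> genf (base \<union> zz lab \<iota> \<kappa> ` {1..NN})"
      and z: "\<And>i F. sfield F \<Longrightarrow> \<gamma> \<in> F \<Longrightarrow> i \<in> {1..NN} \<Longrightarrow> \<not> i \<le> r \<Longrightarrow> zz lab \<iota> \<kappa> i \<in> F" for lab \<iota> \<kappa>
  proof -
    let ?F = "genf (base \<union> insert \<gamma> (sqrtD ` {1..r}))" and ?G = "genf (base \<union> zz lab \<iota> \<kappa> ` {1..NN})"
    have rN: "r \<le> NN" by (simp add: NN_def)
    have e: "\<exists>b. sqrtD i = sg b * zz lab \<iota> \<kappa> i" if "i \<in> {1..r}" for i
      by (rule square_sg) (simp only: sqrtD[OF that] zz_D[OF p that])
    have sgF: "sg b * y \<in> F" if "sfield F" "y \<in> F" for b F and y :: "'a alg_closure"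
      using sfieldD(5)[OF that] that(2) by (cases b) auto
    have "sqrtD i \<in> ?G" if "i \<in> {1..r}" for i
    proof -
      have "zz lab \<iota> \<kappa> i \<in> ?G" using that rN genf_incl[of "base \<union> zz lab \<iota> \<kappa> ` {1..NN}"] by auto
      then show ?thesis using e[OF that] sgF[OF genf_sfield] by metis
    qed
    moreover have "zz lab \<iota> \<kappa> i \<in> ?F" if i: "i \<in> {1..NN}" for i
    proof (cases "i \<le> r")
      case True
      then obtain b where b: "sqrtD i = sg b * zz lab \<iota> \<kappa> i" using e i by auto
      then have "zz lab \<iota> \<kappa> i = sg b * sqrtD i" by simp
      moreover have "sqrtD i \<in> ?F" using i True genf_incl[of "base \<union> insert \<gamma> (sqrtD ` {1..r})"] by auto
      ultimately show ?thesis using sgF[OF genf_sfield] by metis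
    next
      case False
      have "\<gamma> \<in> ?F" using genf_incl[of "base \<union> insert \<gamma> (sqrtD ` {1..r})"] by auto
      then show ?thesis by (rule z[OF genf_sfield _ i False])
    qed
    ultimately have "?F \<subseteq> ?G" "?G \<subseteq> ?F"
      using g genf_incl[of "base \<union> zz lab \<iota> \<kappa> ` {1..NN}"] genf_incl[of "base \<union> insert \<gamma> (sqrtD ` {1..r})"]
      by (intro genf_min[OF genf_sfield]; blast)+
    then show ?thesis unfolding adjoin_def by blast
  qed
  have inG: "zz lab \<iota> \<kappa> i \<in> genf (base \<union> zz lab \<iota> \<kappa> ` {1..NN})" if "i \<in> {1..NN}" for lab \<iota> \<kappa> i
    using that genf_incl[of "base \<union> zz lab \<iota> \<kappa> ` {1..NN}"] by auto
  show ?thesis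
  proof (cases rule: NN_cases)
    case one
    then have k: "\<gamma> ^ 2 = 2" using gamma unfolding is_gamma_def by simp
    have z: "zz lab 1 \<gamma> i = \<gamma>" if "\<not> i \<le> r" for lab i
      unfolding zz_def using that one(1) by simp
    have "adjoin (insert \<gamma> (sqrtD ` {1..r})) = genf (base \<union> zz lab 1 \<gamma> ` {1..NN})" if "pl lab" for lab
      using inG[of "Suc r" lab 1 \<gamma>] z[of "Suc r" lab] z one(2) by (intro main[OF that]) auto
    moreover have "iotaok 1" unfolding iotaok_def using one(1) by simp
    ultimately show ?thesis using k by blast
  next
    case gen
    then have s: "s \<noteq> 1" "\<not> (r = 3 \<and> s = 2)" by auto
    have g: "\<gamma> ^ 4 = 1" "\<gamma> ^ 2 \<noteq> 1" using gamma s unfolding is_gamma_def primitive_root_of_unity_def by auto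
    have "(\<gamma> ^ 2 - 1) * (\<gamma> ^ 2 + 1) = \<gamma> ^ 4 - 1" by (simp add: algebra_simps power2_eq_square power4_eq_xxxx)
    then have "\<gamma> ^ 2 = - 1" using g by (simp add: eq_neg_iff_add_eq_0)
    then have i: "iotaok \<gamma>" unfolding iotaok_def using s by simp
    obtain k :: "'a alg_closure" where k: "k ^ 2 = 2" using sq by blast
    have z: "zz lab \<gamma> k i = \<gamma>" if "i \<in> {1..NN}" "\<not> i \<le> r" for lab i
    proof -
      have "i = Suc r" using that gen(3) by simp
      then show ?thesis using s by (simp add: zz_def)
    qed
    have "adjoin (insert \<gamma> (sqrtD ` {1..r})) = genf (base \<union> zz lab \<gamma> k ` {1..NN})" if "pl lab" for lab
      using inG[of "Suc r" lab \<gamma> k] z[of "Suc r" lab] z gen(3) by (intro main[OF that]) auto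
    then show ?thesis using i k s by blast
  next
    case two
    have g: "\<gamma> ^ 8 = 1" "\<gamma> ^ 4 \<noteq> 1" using gamma two unfolding is_gamma_def primitive_root_of_unity_def by auto
    have "(\<gamma> ^ 4 - 1) * (\<gamma> ^ 4 + 1) = \<gamma> ^ 8 - 1" by (simp add: algebra_simps flip: power_add)
    then have g4: "\<gamma> ^ 4 = - 1" using g by (simp add: eq_neg_iff_add_eq_0)
    have g0: "\<gamma> \<noteq> 0" using g(1) by auto
    define k where "k = \<gamma> + inverse \<gamma>"
    have gk: "\<gamma> * k = \<gamma> ^ 2 + 1" using g0 by (simp add: k_def algebra_simps power2_eq_square)
    have "\<gamma> ^ 2 * k ^ 2 = (\<gamma> ^ 2 + 1) ^ 2" unfolding gk[symmetric] by (simp add: power_mult_distrib)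
    also have "\<dots> = \<gamma> ^ 4 + 2 * \<gamma> ^ 2 + 1" by (simp add: algebra_simps power2_eq_square power4_eq_xxxx)
    also have "\<dots> = \<gamma> ^ 2 * 2" using g4 by simp
    finally have k: "k ^ 2 = 2" using g0 by simp
    have "k * (1 + \<gamma> ^ 2) = \<gamma> * k ^ 2" using gk by (simp add: power2_eq_square ac_simps)
    then have "\<gamma> * 2 = k * (1 + \<gamma> ^ 2)" using k by simp
    then have gg: "\<gamma> = k * (1 + \<gamma> ^ 2) / 2" using postcritical.two[OF postcritical_axioms] by (simp add: field_simps)
    have s: "s \<noteq> 1" using two by simp
    have "(\<gamma> ^ 2) ^ 2 = - 1" using g4 by (simp flip: power_mult)
    then have i: "iotaok (\<gamma> ^ 2)" unfolding iotaok_def using s by simp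
    have z4: "zz lab (\<gamma> ^ 2) k 4 = \<gamma> ^ 2" and z5: "zz lab (\<gamma> ^ 2) k 5 = k" for lab
      unfolding zz_def using two s by simp_all
    have "adjoin (insert \<gamma> (sqrtD ` {1..r})) = genf (base \<union> zz lab (\<gamma> ^ 2) k ` {1..NN})" if p: "pl lab" for lab
    proof (rule main[OF p])
      let ?G = "genf (base \<union> zz lab (\<gamma> ^ 2) k ` {1..NN})"
      have "\<gamma> ^ 2 \<in> ?G" "k \<in> ?G" using inG[of 4 lab "\<gamma> ^ 2" k] inG[of 5 lab "\<gamma> ^ 2" k] z4 z5 two(3) by simp_all
      then have "k * (1 + \<gamma> ^ 2) / 2 \<in> ?G"
        by (intro sfieldD(8)[OF genf_sfield] sfieldD(4)[OF genf_sfield] sfieldD(3)[OF genf_sfield] sfieldD(1)[OF genf_sfield] sfield_numeral[OF genf_sfield])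
      then show "\<gamma> \<in> ?G" unfolding gg[symmetric] .
      fix i F assume a: "sfield F" "\<gamma> \<in> F" "i \<in> {1..NN}" "\<not> i \<le> r"
      then have "i = 4 \<or> i = 5" using two by auto
      then show "zz lab (\<gamma> ^ 2) k i \<in> F" using z4 z5 sfieldD(3,6,9)[OF a(1)] a(2) by (auto simp: k_def)
    qed
    then show ?thesis using i k s by blast
  qed
qed

section \<open>Base points in the critical orbit\<close>

lemma orbit:
  assumes "\<not> nondeg"
  obtains i where "i \<in> {1..r}" "(quad c ^^ i) 0 = x0"
proof -
  have sq': "((quad c ^^ r) 0) ^ 2 = ((quad c ^^ s) 0) ^ 2"
  proof -
    have "to_ac ((quad c ^^ r) 0) = - to_ac ((quad c ^^ s) 0)" using pre unfolding orbit_base .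
    then have "(to_ac ((quad c ^^ r) 0)) ^ 2 = (to_ac ((quad c ^^ s) 0)) ^ 2" by simp
    then show ?thesis by (simp flip: to_ac_power)
  qed
  have "\<exists>i\<in>{1..r}. (quad c ^^ i) 0 = (quad c ^^ Suc m) 0" for m
  proof (induction m)
    case 0
    then show ?case using r3 by (intro bexI[of _ 1]) auto
  next
    case (Suc m)
    then obtain i where i: "i \<in> {1..r}" "(quad c ^^ i) 0 = (quad c ^^ Suc m) 0" by blast
    show ?case
    proof (cases "i = r")
      case True
      \<comment> \<open>Squaring removes the sign in the relation between \<open>f^r(0)\<close> and
        \<open>f^s(0)\<close>, so after step \<open>r\<close> the orbit continues at
        \<open>s + 1\<close>.\<close>
      have "(quad c ^^ Suc s) 0 = (quad c ^^ Suc (Suc m)) 0"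
        using i(2) sq' unfolding True by (simp add: quad_def[of c "(quad c ^^ s) 0"] quad_def[of c "quad c ((quad c ^^ m) 0)"])
      then show ?thesis using sr by (intro bexI[of _ "Suc s"]) auto
    next
      case False
      then show ?thesis using i by (intro bexI[of _ "Suc i"]) auto
    qed
  qed
  moreover obtain m where "1 \<le> m" "(quad (to_ac c) ^^ m) 0 = to_ac x0" using assms unfolding nondeg_def by blast
  then have "(quad c ^^ Suc (m - 1)) 0 = x0" unfolding orbit_base by simp
  ultimately show ?thesis using that by metis
qed

text \<open>No labeling exists here, so the degree is bounded directly. The label 0 saves one square
  root on its level, and every block from level \<open>r\<close> on saves one more through
  \<open>N1\<close>, taken up to sign. The total is one below the exponent in
  \<open>card_Mt_ge\<close>.\<close>

lemma degenerate:
  assumes nd: "\<not> nondeg" and d: "ext_degree (K NN) (2 ^ d)"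
  shows "d < 2 ^ NN - 1 - (if r = 3 \<and> s = 2 then 6 else 2) + (if s = 1 then 0 else 1)"
proof -
  obtain i where i: "i \<in> {1..r}" "(quad c ^^ i) 0 = x0" using orbit[OF nd] .
  obtain lab where p: "pl lab" using prelabeling_ex[OF sq] by blast
  obtain \<iota> where \<iota>: "iotaok \<iota>" unfolding iotaok_def using sq by blast
  define \<epsilon> where "\<epsilon> = (if s = 1 then 0 else 1 :: nat)"
  define Z where "Z = (if s = 1 then {} else {\<iota>})"
  \<comment> \<open>Adjoining \<open>\<iota>\<close> makes \<open>N1\<close> available over each
    field; unless \<open>s = 1\<close> this costs one step, which matches the bit for
    \<open>P\<close> in \<open>card_Mt_ge\<close>.\<close>
  define E where "E n = genf (base \<union> Z \<union> lab ` words n)" for n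
  define g where "g w = lab (w @ [La])" for w
  have Esf: "sfield (E n)" for n by (simp add: E_def)
  have KE: "K n \<subseteq> E n" for n unfolding K_eq[OF p] E_def by (rule genf_mono) auto
  have bE: "base \<subseteq> E n" "Z \<subseteq> E n" for n using genf_incl[of "base \<union> Z \<union> lab ` words n"] by (auto simp: E_def)
  have iE: "\<iota> \<in> E n" for n
  proof (cases "s = 1")
    case True
    have "\<iota> ^ 2 = 1" using \<iota> unfolding iotaok_def if_P[OF True] .
    then have "\<iota> = 1 \<or> \<iota> = - 1" by (simp add: power2_eq_1_iff)
    then show ?thesis using sfieldD(1,5)[OF Esf] by metis
  next
    case False
    then show ?thesis using bE(2)[of n] by (simp add: Z_def)
  qed
  have lE: "lab w \<in> E n" if "length w \<le> n" for w n using lab_K[OF p that] KE by blast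
  have base0: "bounded_tower base (E 0) \<epsilon>"
  proof -
    have "\<iota> ^ 2 \<in> base" using \<iota> sfieldD(1,5)[OF sfield_base] unfolding iotaok_def by metis
    then have "bounded_tower base (genf (base \<union> Z)) (card Z)"
      by (intro bounded_tower_gen[OF two sfield_base]) (auto simp: Z_def split: if_splits)
    moreover have "base \<union> Z \<union> lab ` words 0 = base \<union> Z" using lab_Nil[OF p] by auto
    ultimately show ?thesis unfolding E_def \<epsilon>_def Z_def by (simp split: if_splits)
  qed
  have step: "bounded_tower (E n) (E (Suc n)) (2 ^ n - card D)"
    if D: "D \<subseteq> words n" "\<And>w. w \<in> D \<Longrightarrow> g w \<in> genf (E n \<union> g ` (words n - D))" for n D
  proof -
    let ?G = "genf (E n \<union> g ` (words n - D))"
    have EG: "E n \<subseteq> ?G" and gG: "g ` (words n - D) \<subseteq> ?G" using genf_incl[of "E n \<union> g ` (words n - D)"] by blast+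
    have all: "g w \<in> ?G" if "w \<in> words n" for w using that D(2) gG by (cases "w \<in> D") auto
    have t: "bounded_tower (E n) ?G (card (g ` (words n - D)))"
    proof (rule bounded_tower_gen[OF two Esf])
      fix z assume "z \<in> g ` (words n - D)"
      then obtain w where w: "length w = n" "z = lab (w @ [La])" by (auto simp: g_def)
      show "z ^ 2 \<in> E n" unfolding w(2) lab_sq[OF p]
        by (rule sfieldD(7)[OF Esf]) (use lE[of w n] w(1) bE(1)[of n] in auto)
    qed simp
    have "E (Suc n) = ?G"
    proof
      have "lab w \<in> ?G" if w: "w \<in> words (Suc n)" for w
      proof -
        obtain u l where u: "length u = n" "w = u @ [l]" using w by (auto simp: words_Suc_snoc)
        have "lab (u @ [La]) \<in> ?G" using all[of u] u(1) by (simp add: g_def)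
        then show ?thesis unfolding u(2) using lab_Lb[OF p, of u] sfieldD(5)[OF genf_sfield] by (cases l) auto
      qed
      then show "E (Suc n) \<subseteq> ?G" unfolding E_def[of "Suc n"]
        by (intro genf_min[OF genf_sfield]) (use EG bE[of n] in blast)
      have "E n \<subseteq> E (Suc n)" unfolding E_def[of n]
        by (rule genf_min[OF Esf]) (use bE[of "Suc n"] lE[of _ "Suc n"] in auto)
      moreover have "g ` (words n - D) \<subseteq> E (Suc n)" using lE[of _ "Suc n"] by (auto simp: g_def)
      ultimately show "?G \<subseteq> E (Suc n)" by (intro genf_min[OF Esf]) blast
    qed
    moreover have "card (g ` (words n - D)) \<le> 2 ^ n - card D"
      using card_image_le[of "words n - D" g] D(1) by (simp add: card_Diff_subset[OF finite_subset[OF D(1)]])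
    ultimately show ?thesis using t unfolding bounded_tower_def by (metis order_trans)
  qed
  have free: "bounded_tower (E m) (E (m + k)) (2 ^ (m + k) - 2 ^ m)" for m k
  proof (induction k)
    case 0
    show ?case unfolding bounded_tower_def by (intro exI[of _ "[]"]) simp
  next
    case (Suc k)
    have "bounded_tower (E (m + k)) (E (Suc (m + k))) (2 ^ (m + k))" using step[of "{}" "m + k"] by simp
    from bounded_tower_trans[OF Suc this]
    have "bounded_tower (E m) (E (m + Suc k)) (2 ^ (m + k) - 2 ^ m + 2 ^ (m + k))" by simp
    moreover have "2 ^ (m + k) - 2 ^ m + 2 ^ (m + k) = 2 ^ (m + Suc k) - (2::nat) ^ m"
      using power_increasing[of m "m + k" "2::nat"] by simp
    ultimately show ?case by (simp only:)
  qed
  define j where "j = i - 1"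
  have j: "i = Suc j" "Suc j \<le> r" using i(1) by (auto simp: j_def)
  have "bounded_tower (E j) (E (Suc j)) (2 ^ j - 1)"
  proof -
    have "0 \<in> lab ` words i" using i(2) unfolding preim_eq[OF p, symmetric] preim_def orbit_base by (simp add: orbit_base)
    then obtain u l where u: "length u = j" "lab (u @ [l]) = 0" unfolding j(1) words_Suc_snoc by auto
    then have "g u = 0" using lab_Lb[OF p, of u] by (cases l) (simp_all add: g_def)
    moreover have "0 \<in> genf (E j \<union> g ` (words j - {u}))" by (rule sfieldD(2)[OF genf_sfield])
    ultimately show ?thesis using step[of "{u}" j] u(1) by simp
  qed
  from bounded_tower_trans[OF bounded_tower_trans[OF bounded_tower_trans[OF base0 free[of 0 j, simplified]] this] free[of "Suc j" "r - Suc j"]]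
  have low: "bounded_tower base (E r) (\<epsilon> + (2 ^ j - 1) + (2 ^ j - 1) + (2 ^ r - 2 ^ Suc j))" using j(2) by simp
  \<comment> \<open>Levels before \<open>j\<close>, level \<open>j\<close> with one root saved, and
    the levels from \<open>j + 1\<close> up to \<open>r - 1\<close> are added up, together with the
    step for \<open>\<iota>\<close>.\<close>
  have ar: "\<epsilon> + (a - 1) + (a - 1) + (b - 2 * a) = \<epsilon> + b - 2" if "1 \<le> a" "2 * a \<le> b" for a b :: nat
    using that by arith
  have "2 * 2 ^ j \<le> (2::nat) ^ r" using power_increasing[OF j(2), of "2::nat"] by simp
  then have "\<epsilon> + (2 ^ j - 1) + (2 ^ j - 1) + (2 ^ r - 2 ^ Suc j) = \<epsilon> + 2 ^ r - (2::nat)"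
    unfolding power_Suc by (intro ar one_le_power) simp_all
  with low have low: "bounded_tower base (E r) (\<epsilon> + 2 ^ r - 2)" by simp
  have block: "bounded_tower (E n) (E (Suc n)) (2 ^ n - 2 ^ (n - r + 1))" if n: "r \<le> n" for n
  proof -
    \<comment> \<open>In each block one node is singled out, with label 0 if possible. If no label
      of the block is 0, the chosen one is the block product divided by the others.\<close>
    have "\<exists>z. length z = r - 1 \<and> (g (u @ z) = 0 \<or> (\<forall>z'. length z' = r - 1 \<longrightarrow> g (u @ z') \<noteq> 0))" for u
    proof (cases "\<exists>z. length z = r - 1 \<and> g (u @ z) = 0")
      case True
      then show ?thesis by blast
    next
      case False
      then show ?thesis by (intro exI[of _ "replicate (r - 1) La"]) auto
    qed
    then obtain zf where zf: "\<And>u. length (zf u) = r - 1"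
      "\<And>u. g (u @ zf u) = 0 \<or> (\<forall>z'. length z' = r - 1 \<longrightarrow> g (u @ z') \<noteq> 0)" by metis
    define f where "f u = u @ zf u" for u
    let ?D = "f ` words (n - r + 1)"
    have tk: "take (length u) (f u) = u" "length (f u) = length u + (r - 1)" for u
      by (simp_all add: f_def zf(1))
    have "inj_on f (words (n - r + 1))"
    proof (rule inj_onI)
      fix u v assume "u \<in> words (n - r + 1)" "v \<in> words (n - r + 1)" "f u = f v"
      then show "u = v" using tk(1)[of u] tk(1)[of v] by simp
    qed
    then have cD: "card ?D = 2 ^ (n - r + 1)" by (simp add: card_image)
    have "g w \<in> genf (E n \<union> g ` (words n - ?D))" if w: "w \<in> ?D" for w
    proof -
      let ?G = "genf (E n \<union> g ` (words n - ?D))"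
      have EG: "E n \<subseteq> ?G" and gG: "g ` (words n - ?D) \<subseteq> ?G" using genf_incl[of "E n \<union> g ` (words n - ?D)"] by blast+
      obtain u where u: "length u = n - r + 1" "w = f u" using w by auto
      define z where "z = zf u"
      have z: "length z = r - 1" "f u = u @ z" "g (f u) = 0 \<or> (\<forall>z'\<in>words (r - 1). g (u @ z') \<noteq> 0)"
        using zf[of u] by (auto simp: z_def f_def)
      obtain x l where xl: "u = x @ [l]" using u(1) by (cases u rule: rev_cases) auto
      show ?thesis
      proof (cases "g (f u) = 0")
        case True
        then show ?thesis unfolding u(2) using sfieldD(2)[OF genf_sfield] by metis
      next
        case False
        then have ne: "g (u @ z') \<noteq> 0" if "z' \<in> words (r - 1)" for z' using z(3) that by blast
        define Q where "Q = (\<Prod>z'\<in>words (r - 1) - {z}. g (u @ z'))"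
        have PQ: "PI lab (r - 1) u = g w * Q"
          unfolding PI_def Q_def u(2) z(2) using z(1) by (subst prod.remove[of _ z]) (auto simp: g_def)
        have Q0: "Q \<noteq> 0" unfolding Q_def using ne by simp
        have "g (u @ z') \<in> ?G" if "z' \<in> words (r - 1) - {z}" for z'
        proof -
          have "u @ z' \<notin> ?D"
          proof
            assume "u @ z' \<in> ?D"
            then obtain v where v: "length v = n - r + 1" "u @ z' = f v" by auto
            then have "v = u" using tk(1)[of v] u(1) by (metis append_eq_conv_conj)
            then show False using v(2) z(2) that by simp
          qed
          moreover have "u @ z' \<in> words n" using that u(1) n r3 by simp
          ultimately show ?thesis using gG by blast
        qed
        then have QG: "Q \<in> ?G" unfolding Q_def
          using hom_on_prod[of ?G id "words (r - 1) - {z}" "\<lambda>z'. g (u @ z')"] by (simp add: hom_on_def)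
        obtain e where e: "N1 (sg e * \<iota>) lab x l" using N1_ex[OF p \<iota>] by blast
        have "PI lab (s - 1) (x @ [other l]) \<in> E n"
          unfolding PI_def using hom_on_prod[of "E n" id "words (s - 1)" "\<lambda>w. lab ((x @ [other l]) @ w @ [La])"] Esf
            lE[of _ n] u(1) n sr s1 unfolding xl by (simp add: hom_on_def)
        moreover have "sg e * \<iota> \<in> E n" using iE[of n] sfieldD(5)[OF Esf] by (cases e) auto
        ultimately have PG: "PI lab (r - 1) u \<in> ?G"
          using e EG sfieldD(4)[OF Esf] unfolding N1_def xl by (metis subsetD)
        have "g w * Q / Q \<in> ?G" using sfieldD(8)[OF genf_sfield PG QG] unfolding PQ .
        then show ?thesis using Q0 by simp
      qed
    qed
    moreover have "?D \<subseteq> words n" using tk(2) n r3 by auto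
    ultimately show ?thesis using step[of ?D n] cD by simp
  qed
  have "\<exists>m. bounded_tower base (E NN) m \<and> m < 2 ^ NN - 1 - (if r = 3 \<and> s = 2 then 6 else 2) + \<epsilon>"
  proof -
    have p3: "(8::nat) \<le> 2 ^ r" using power_increasing[of 3 r "2::nat"] r3 by simp
    have one: "bounded_tower base (E (Suc r)) (\<epsilon> + 2 ^ r - 2 + (2 ^ r - 2))"
      using bounded_tower_trans[OF low block[OF order_refl]] by simp
    have top: ?thesis if "NN = Suc r" "\<not> (r = 3 \<and> s = 2)"
    proof -
      have "bounded_tower base (E NN) (\<epsilon> + 2 ^ r - 2 + (2 ^ r - 2))" using one unfolding that(1) .
      moreover have "\<epsilon> + 2 ^ r - 2 + (2 ^ r - 2) < (2::nat) ^ NN - 1 - 2 + \<epsilon>"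
        unfolding that(1) power_Suc using p3 by linarith
      ultimately show ?thesis unfolding if_not_P[OF that(2)] by blast
    qed
    show ?thesis
    proof (cases rule: NN_cases)
      case 1: one
      have "\<not> (r = 3 \<and> s = 2)" using 1(1) by linarith
      then show ?thesis by (rule top[OF 1(2)])
    next
      case 2: two
      have t: "bounded_tower base (E (Suc (Suc r))) (\<epsilon> + 2 ^ r - 2 + (2 ^ r - 2) + (2 ^ Suc r - 2 ^ (Suc r - r + 1)))"
        by (rule bounded_tower_trans[OF one block]) simp
      have N: "NN = Suc (Suc r)" using 2(1,3) by linarith
      have e: "Suc r - r + 1 = 2" by simp
      have "(2::nat) ^ r = 8" unfolding 2(1) by simp
      then have "\<epsilon> + 2 ^ r - 2 + (2 ^ r - 2) + (2 ^ Suc r - 2 ^ (Suc r - r + 1)) < (2::nat) ^ NN - 1 - 6 + \<epsilon>"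
        unfolding N e power_Suc by simp
      moreover have "r = 3 \<and> s = 2" using 2(1,2) by (rule conjI)
      ultimately show ?thesis using t unfolding N if_P[OF \<open>r = 3 \<and> s = 2\<close>] by blast
    next
      case 3: gen
      have "\<not> (r = 3 \<and> s = 2)" using 3(2) by linarith
      then show ?thesis by (rule top[OF 3(3)])
    qed
  qed
  then obtain m zs where m: "m < 2 ^ NN - 1 - (if r = 3 \<and> s = 2 then 6 else 2) + \<epsilon>"
    and zs: "tower base zs" "adjs base zs = E NN" "length zs \<le> m" unfolding bounded_tower_def by blast
  obtain ks where ks: "tower base ks" "adjs base ks = K NN" using tower_K by blast
  have "bounded_tower (K NN) (genf (K NN \<union> Z)) (card Z)"
  proof (rule bounded_tower_gen[OF two K_sfield])
    show "finite Z" by (simp add: Z_def)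
    have "\<iota> ^ 2 \<in> K NN" using \<iota> sfieldD(1,5)[OF K_sfield] unfolding iotaok_def by metis
    then show "z ^ 2 \<in> K NN" if "z \<in> Z" for z using that by (auto simp: Z_def split: if_splits)
  qed
  moreover have "genf (K NN \<union> Z) = E NN"
  proof (rule genf_eq[OF Esf])
    show "K NN \<union> Z \<subseteq> E NN" using KE bE by blast
    show "E NN \<subseteq> genf (K NN \<union> Z)" unfolding E_def by (rule genf_mono) (use base_K[of NN] lab_K[OF p, of _ NN] in auto)
  qed
  ultimately obtain ys where ys: "tower (K NN) ys" "adjs (K NN) ys = E NN" unfolding bounded_tower_def by metis
  have "2 ^ steps base zs = (2::nat) ^ steps base (ks @ ys)"
    using dimension_unique[OF sfield_base dimension_adjs[OF two sfield_base zs(1)]]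
      dimension_adjs[OF two sfield_base, of "ks @ ys"] ks ys zs(2) by (simp add: tower_append adjs_append)
  then have "steps base ks \<le> steps base zs" by (simp add: steps_append)
  moreover have "2 ^ d = (2::nat) ^ steps base ks"
    using ext_degree_unique[OF d] dimension_adjs[OF two sfield_base ks(1)] unfolding ks(2) ext_degree_def by blast
  then have "d = steps base ks" by simp
  ultimately show ?thesis using m zs(3) steps_le[of base zs] unfolding \<epsilon>_def by linarith
qed

end

section \<open>The implications between the five conditions\<close>

context arboreal
begin

text \<open>The labeling is normalised with the \<open>\<iota>\<close> and \<open>\<kappa>\<close>
  derived from \<open>\<gamma>\<close>, so the degree condition makes the characters surjective on
  the image \<open>H\<close>, and \<open>dense\<close> applies. Equality follows since
  \<open>H\<close> is closed under limits of compatible approximations.\<close>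

lemma full_image:
  assumes gamma: "is_gamma r s \<gamma>" and sqrtD: "\<And>i. i \<in> {1..r} \<Longrightarrow> sqrtD i ^ 2 = to_ac (D_elem c x0 i)"
    and deg: "ext_degree (adjoin (insert \<gamma> (sqrtD ` {1..r}))) (2 ^ NN)"
  shows "\<exists>lab. labeling c x0 lab \<and> {wa lab \<tau> |\<tau>. fixing KI \<tau>} = Mt_inf r s"
proof -
  obtain \<iota> \<kappa> where g: "iotaok \<iota>" "s = 1 \<longrightarrow> \<iota> = 1" "\<kappa> ^ 2 = 2"
    "\<And>lab. pl lab \<Longrightarrow> adjoin (insert \<gamma> (sqrtD ` {1..r})) = genf (base \<union> zz lab \<iota> \<kappa> ` {1..NN})"
    using generators[of \<gamma> sqrtD, OF gamma sqrtD] by blast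
  have full: "steps base (map (zz lab \<iota> \<kappa>) [1..<Suc NN]) = NN" if "pl lab" for lab
    using deg degree_iff[OF that g(1,3)] unfolding g(4)[OF that] by blast
  have zs: "length (map (zz lab \<iota> \<kappa>) [1..<Suc NN]) = NN" "\<And>i. i < NN \<Longrightarrow> map (zz lab \<iota> \<kappa>) [1..<Suc NN] ! i = zz lab \<iota> \<kappa> (Suc i)"
    "set (map (zz lab \<iota> \<kappa>) [1..<Suc NN]) = zz lab \<iota> \<kappa> ` {1..NN}" for lab
    by (simp_all add: nth_map_upt atLeastLessThanSuc_atLeastAtMost del: upt_Suc)
  have rN: "r \<le> NN" by (simp add: NN_def)
  have tw: "tower base (map (zz lab \<iota> \<kappa>) [1..<Suc NN])" if "pl lab" for lab
    by (rule tower_sq[OF two sfield_base]) (use zz_square[OF that g(1,3)] zs(3) in auto)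
  have z0: "zz lab \<iota> \<kappa> i \<noteq> 0" if p: "pl lab" and i: "i \<in> {1..NN}" for lab i
  proof
    assume z: "zz lab \<iota> \<kappa> i = 0"
    let ?zs = "map (zz lab \<iota> \<kappa>) [1..<Suc NN]"
    have l: "i - 1 < length ?zs" using i zs(1) by (metis Suc_diff_1 Suc_le_eq atLeastAtMost_iff less_numeral_extra(1) order_less_le_trans)
    have zi: "?zs ! (i - 1) = 0" using zs(2)[of "i - 1" lab] i z l zs(1)[of lab] by simp
    have sp: "?zs = take (i - 1) ?zs @ 0 # drop (Suc (i - 1)) ?zs" using id_take_nth_drop[OF l] unfolding zi .
    have "tower base (take (i - 1) ?zs)" using tw[OF p] sp by (metis tower_append)
    then have "0 \<in> adjs base (take (i - 1) ?zs)" by (rule sfieldD(2)[OF adjs_sfield[OF two sfield_base]])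
    moreover have "steps base ?zs = length ?zs" using full[OF p] zs(1) by simp
    ultimately show False using sp unfolding steps_full by blast
  qed
  have nd: nondeg
  proof (rule ccontr)
    assume "\<not> nondeg"
    then obtain i where i: "i \<in> {1..r}" "(quad c ^^ i) 0 = x0" by (rule orbit)
    obtain lab where p: "pl lab" using prelabeling_ex[OF sq] by blast
    have "D_elem c x0 i = 0" using i(2) by (auto simp: D_elem_def quad_def)
    then have "zz lab \<iota> \<kappa> i = 0" using zz_D[OF p i(1), of \<iota> \<kappa>] by simp
    then show False using z0[OF p, of i] i(1) rN by simp
  qed
  obtain lab where lab: "pl lab" "\<And>x l. N1 \<iota> lab x l" "\<And>x. N2 \<kappa> lab x"
    using normalised_labeling[OF nd g(3,1)] g(2) by blast
  have labeling: "labeling c x0 lab" using labeling_iff nd lab(1) by blast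
  define H where "H = {wa lab \<tau> |\<tau>. fixing KI \<tau>}"
  have bKI: "base \<subseteq> KI" using base_K[of 0] K_KI[of 0] by blast
  have act: "wa lab \<tau> \<in> Mt_inf r s \<and> (\<forall>i\<in>{1..NN}. \<tau> (zz lab \<iota> \<kappa> i) = sg (chi i (wa lab \<tau>)) * zz lab \<iota> \<kappa> i)"
    if "sfield L" "KI \<subseteq> L" "fixing L \<tau>" "\<forall>z. z ^ 2 \<in> L \<longrightarrow> z \<in> L" for L \<tau>
    using galois_action[OF labeling lab(2,3) g(1) _ g(3) that(1-3)] g(2) that(4) by blast
  have HM: "H \<subseteq> Mt_inf r s"
  proof
    fix \<alpha> assume "\<alpha> \<in> H"
    then obtain \<sigma> where \<sigma>: "fixing KI \<sigma>" "\<alpha> = wa lab \<sigma>" unfolding H_def by blast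
    obtain L \<tau> where L: "sfield L" "KI \<subseteq> L" "fixing L \<tau>" "\<And>x. x \<in> KI \<Longrightarrow> \<tau> x = \<sigma> x" "\<forall>z. z ^ 2 \<in> L \<longrightarrow> z \<in> L"
      using fixing_extend[OF KI_sfield bKI \<sigma>(1)] by blast
    have "\<alpha> = wa lab \<tau>" unfolding \<sigma>(2) using L(4) lab_KI[OF lab(1)] by (simp add: wa_def fun_eq_iff)
    then show "\<alpha> \<in> Mt_inf r s" using act[OF L(1-3,5)] by blast
  qed
  have surj: "\<exists>h\<in>H. \<forall>i\<in>{1..NN}. chi i h = e i" for e
  proof -
    let ?zs = "map (zz lab \<iota> \<kappa>) [1..<Suc NN]"
    have "hom_on base id" by (simp add: hom_on_def)
    moreover have "steps base ?zs = length ?zs" using full[OF lab(1)] zs(1) by simp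
    moreover have "\<And>z. z \<in> set ?zs \<Longrightarrow> z ^ 2 \<in> base \<and> id (z ^ 2) = z ^ 2"
      using zz_square[OF lab(1) g(1,3)] unfolding zs(3) by auto
    ultimately obtain \<sigma> where \<sigma>: "hom_on (adjs base ?zs) \<sigma>" "\<And>x. x \<in> base \<Longrightarrow> \<sigma> x = x"
      "\<And>i. i < NN \<Longrightarrow> \<sigma> (zz lab \<iota> \<kappa> (Suc i)) = sg (e (Suc i)) * zz lab \<iota> \<kappa> (Suc i)"
      using sign_extension[OF two sfield_base tw[OF lab(1)], of id "\<lambda>i. e (Suc i)"] zs(1,2) by (metis id_apply)
    have A: "adjs base ?zs = genf (base \<union> zz lab \<iota> \<kappa> ` {1..NN})"
      using adjs_genf[OF two sfield_base tw[OF lab(1)]] unfolding zs(3) .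
    have "base \<union> zz lab \<iota> \<kappa> ` {1..NN} \<subseteq> adjs base ?zs" unfolding A by (rule genf_incl)
    moreover have "sfield (adjs base ?zs)" unfolding A by simp
    moreover have "fixing (adjs base ?zs) \<sigma>" using \<sigma>(1,2) by (simp add: fixing_def)
    ultimately obtain L \<tau> where L: "sfield L" "KI \<subseteq> L" "fixing L \<tau>" "\<And>x. x \<in> adjs base ?zs \<Longrightarrow> \<tau> x = \<sigma> x"
      "\<forall>z. z ^ 2 \<in> L \<longrightarrow> z \<in> L" and sub: "base \<union> zz lab \<iota> \<kappa> ` {1..NN} \<subseteq> adjs base ?zs"
      using fixing_extend[of "adjs base ?zs" \<sigma>] by blast
    have "chi i (wa lab \<tau>) = e i" if i: "i \<in> {1..NN}" for i
    proof -
      obtain j where j: "i = Suc j" "j < NN" using i by (cases i) auto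
      have m: "zz lab \<iota> \<kappa> i \<in> adjs base ?zs" using sub i by blast
      have "\<tau> (zz lab \<iota> \<kappa> i) = sg (chi i (wa lab \<tau>)) * zz lab \<iota> \<kappa> i" using act[OF L(1-3,5)] i by blast
      moreover have "\<tau> (zz lab \<iota> \<kappa> i) = sg (e i) * zz lab \<iota> \<kappa> i"
        using L(4)[OF m] \<sigma>(3)[OF j(2)] unfolding j(1) by (rule trans)
      ultimately have "sg (chi i (wa lab \<tau>)) * zz lab \<iota> \<kappa> i = sg (e i) * zz lab \<iota> \<kappa> i" by metis
      then show ?thesis using sg_eq_iff[OF two z0[OF lab(1) i]] by blast
    qed
    moreover have "wa lab \<tau> \<in> H" unfolding H_def using fixing_subset[OF L(3,2)] by blast
    ultimately show ?thesis by blast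
  qed
  have comp: "\<exists>\<nu>. fixing KI \<nu> \<and> wa lab \<nu> = wa lab \<tau> \<circ> wa lab \<sigma>" if t: "fixing KI \<tau>" and m: "fixing KI \<sigma>" for \<tau> \<sigma>
  proof -
    have f: "fixing KI (\<tau> \<circ> \<sigma>)"
      using hom_on_comp[of KI \<sigma> KI \<tau>] t m fixing_KI[OF m] by (simp add: fixing_def)
    have "wa lab (\<tau> \<circ> \<sigma>) w = wa lab \<tau> (wa lab \<sigma> w)" for w
      by (rule wa_comp[OF labeling fixing_subset[OF t K_KI] fixing_subset[OF m K_KI] fixing_subset[OF f K_KI] _ order_refl]) simp
    then show ?thesis using f by (intro exI[of _ "\<tau> \<circ> \<sigma>"]) (simp add: fun_eq_iff)
  qed
  have idf: "fixing KI id" by (simp add: fixing_def hom_on_def)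
  have idw: "wa lab id = id"
    using wa_KI[OF labeling idf] lab_inj[OF labeling] by (intro ext) (metis id_apply)
  have inv: "inv_into UNIV (wa lab \<tau>) \<in> H" if t: "fixing KI \<tau>" for \<tau>
  proof -
    let ?\<sigma> = "inv_into KI \<tau>"
    have h: "hom_on KI \<tau>" and im: "\<tau> ` KI = KI" using t fixing_KI by (auto simp: fixing_def)
    have inj: "inj_on \<tau> KI" by (rule hom_on_inj[OF h KI_sfield])
    have r: "\<tau> (?\<sigma> x) = x" "?\<sigma> x \<in> KI" if "x \<in> KI" for x using that f_inv_into_f[of x \<tau> KI] inv_into_into[of x \<tau> KI] unfolding im by auto
    have l: "?\<sigma> (\<tau> x) = x" if "x \<in> KI" for x by (rule inv_into_f_f[OF inj that])
    have "hom_on KI ?\<sigma>" unfolding hom_on_def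
    proof (intro conjI ballI)
      show "?\<sigma> 1 = 1" using l[OF sfieldD(1)[OF KI_sfield]] hom_onD(1)[OF h KI_sfield] by simp
      fix x y assume xy: "x \<in> KI" "y \<in> KI"
      note a = r(2)[OF xy(1)] r(2)[OF xy(2)]
      show "?\<sigma> (x + y) = ?\<sigma> x + ?\<sigma> y"
        using l[OF sfieldD(3)[OF KI_sfield a]] hom_onD(3)[OF h KI_sfield a] r(1)[OF xy(1)] r(1)[OF xy(2)] by simp
      show "?\<sigma> (x * y) = ?\<sigma> x * ?\<sigma> y"
        using l[OF sfieldD(4)[OF KI_sfield a]] hom_onD(4)[OF h KI_sfield a] r(1)[OF xy(1)] r(1)[OF xy(2)] by simp
    qed
    moreover have "?\<sigma> x = x" if "x \<in> base" for x using l[of x] that bKI t by (auto simp: fixing_def)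
    ultimately have f: "fixing KI ?\<sigma>" by (simp add: fixing_def)
    have "wa lab ?\<sigma> w = inv_into UNIV (wa lab \<tau>) w" for w
    proof -
      have "wa lab id w = wa lab \<tau> (wa lab ?\<sigma> w)"
        by (rule wa_comp[OF labeling fixing_subset[OF t K_KI] fixing_subset[OF f K_KI] fixing_subset[OF idf K_KI] _ order_refl])
          (simp add: r(1)[OF subsetD[OF K_KI]])
      then have "w = wa lab \<tau> (wa lab ?\<sigma> w)" unfolding idw by simp
      moreover have "inj (wa lab \<tau>)" using aut_bij[OF wa_aut[OF labeling t]] by (simp add: bij_def)
      ultimately show ?thesis by (metis inv_f_eq)
    qed
    then have "inv_into UNIV (wa lab \<tau>) = wa lab ?\<sigma>" by (simp add: fun_eq_iff)
    then show ?thesis unfolding H_def using f by blast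
  qed
  have "Mt_inf r s \<subseteq> H"
  proof
    fix \<alpha> assume \<alpha>: "\<alpha> \<in> Mt_inf r s"
    have "\<exists>h\<in>H. \<forall>w. length w \<le> m \<longrightarrow> h w = \<alpha> w" for m
    proof (rule dense[OF HM _ _ _ surj \<alpha>])
      show "id \<in> H" unfolding H_def using idf idw by (metis (mono_tags, lifting) mem_Collect_eq)
      show "\<sigma> \<circ> \<tau> \<in> H" if "\<sigma> \<in> H" "\<tau> \<in> H" for \<sigma> \<tau>
        using that comp unfolding H_def by (smt (verit) mem_Collect_eq)
      show "inv_into UNIV \<sigma> \<in> H" if "\<sigma> \<in> H" for \<sigma> using that inv unfolding H_def by blast
    qed
    then have "\<exists>\<tau>. fixing KI \<tau> \<and> (\<forall>w. length w \<le> m \<longrightarrow> wa lab \<tau> w = \<alpha> w)" for m unfolding H_def by blast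
    \<comment> \<open>Embeddings that realise \<open>\<alpha>\<close> up to each level. They agree
      on \<open>K m\<close> from index \<open>m\<close> on, because an embedding of
      \<open>K m\<close> is determined by its action on words of length at most \<open>m\<close>,
      and so they glue.\<close>
    then obtain T where T: "\<And>m. fixing KI (T m)" "\<And>m w. length w \<le> m \<Longrightarrow> wa lab (T m) w = \<alpha> w" by metis
    have agree: "T m x = T n x" if "m \<le> n" "x \<in> K m" for m n x
      by (rule fixing_determined[OF labeling fixing_subset[OF T(1) K_KI] fixing_subset[OF T(1) K_KI] _ that(2)]) (use T(2) that(1) in simp)
    define \<tau> where "\<tau> x = T (LEAST m. x \<in> K m) x" for x
    have tT: "\<tau> x = T m x" if "x \<in> K m" for x m
      unfolding \<tau>_def by (rule agree[OF Least_le[of "\<lambda>m. x \<in> K m", OF that] LeastI[of "\<lambda>m. x \<in> K m", OF that]])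
    have "hom_on KI \<tau>" unfolding hom_on_def
    proof (intro conjI ballI)
      have hm: "hom_on (K m) (T m)" for m using fixing_subset[OF T(1) K_KI] by (simp add: fixing_def)
      show "\<tau> 1 = 1" using tT[OF sfieldD(1)[OF K_sfield[of 0]]] hom_onD(1)[OF hm K_sfield] by metis
      fix x y assume "x \<in> KI" "y \<in> KI"
      then obtain a b where ab: "x \<in> K a" "y \<in> K b" unfolding KI_eq by blast
      have xy: "x \<in> K (max a b)" "y \<in> K (max a b)" using ab K_mono[of a "max a b"] K_mono[of b "max a b"] by auto
      show "\<tau> (x + y) = \<tau> x + \<tau> y"
        unfolding tT[OF xy(1)] tT[OF xy(2)] tT[OF sfieldD(3)[OF K_sfield xy]] by (rule hom_onD(3)[OF hm K_sfield xy])
      show "\<tau> (x * y) = \<tau> x * \<tau> y"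
        unfolding tT[OF xy(1)] tT[OF xy(2)] tT[OF sfieldD(4)[OF K_sfield xy]] by (rule hom_onD(4)[OF hm K_sfield xy])
    qed
    moreover have "\<tau> x = x" if "x \<in> base" for x using tT[of x 0] base_K[of 0] that T(1)[of 0] by (auto simp: fixing_def)
    ultimately have "fixing KI \<tau>" by (simp add: fixing_def)
    moreover have "wa lab \<tau> w = \<alpha> w" for w
      using tT[OF lab_K[OF lab(1) order_refl], of w] T(2)[of w "length w"] by (simp add: wa_def)
    then have "\<alpha> = wa lab \<tau>" by (simp add: fun_eq_iff)
    ultimately show "\<alpha> \<in> H" unfolding H_def by blast
  qed
  then show ?thesis using HM labeling unfolding H_def by blast
qed

text \<open>Comparing \<open>degenerate\<close> with \<open>card_Mt_ge\<close> first shows that a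
  labeling exists. Then the image of Galois lies in the finite group and has the same order, so it
  is everything; all sign patterns of the characters occur, and the square roots are
  independent.\<close>

lemma degree_implies_signs:
  assumes gamma: "is_gamma r s \<gamma>" and sqrtD: "\<And>i. i \<in> {1..r} \<Longrightarrow> sqrtD i ^ 2 = to_ac (D_elem c x0 i)"
    and deg: "ext_degree (K NN) (card (Mt r s NN))"
  shows "ext_degree (adjoin (insert \<gamma> (sqrtD ` {1..r}))) (2 ^ NN)"
proof -
  obtain d where d: "ext_degree (K NN) (2 ^ d)" "card (carrier (gal (K NN))) = 2 ^ d" using card_gal by blast
  have cd: "card (Mt r s NN) = 2 ^ d" by (rule ext_degree_unique[OF deg d(1)])
  have nd: nondeg
  proof (rule ccontr)
    assume "\<not> nondeg"
    have 12: "(1::nat) < 2" by simp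
    from degenerate[OF \<open>\<not> nondeg\<close> d(1)] have "(2::nat) ^ d < 2 ^ (2 ^ NN - 1 - (if r = 3 \<and> s = 2 then 6 else 2) + (if s = 1 then 0 else 1))"
      by (rule power_strict_increasing) (rule 12)
    from order_less_le_trans[OF this card_Mt_ge] show False unfolding cd by simp
  qed
  obtain \<iota> \<kappa> where g: "iotaok \<iota>" "s = 1 \<longrightarrow> \<iota> = 1" "\<kappa> ^ 2 = 2"
    "\<And>lab. pl lab \<Longrightarrow> adjoin (insert \<gamma> (sqrtD ` {1..r})) = genf (base \<union> zz lab \<iota> \<kappa> ` {1..NN})"
    using generators[of \<gamma> sqrtD, OF gamma sqrtD] by blast
  obtain lab where lab: "pl lab" "\<And>x l. N1 \<iota> lab x l" "\<And>x. N2 \<kappa> lab x"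
    using normalised_labeling[OF nd g(3,1)] g(2) by blast
  have labeling: "labeling c x0 lab" using labeling_iff nd lab(1) by blast
  have bKI: "base \<subseteq> KI" using base_K[of 0] K_KI[of 0] by blast
  have ext: "\<exists>L \<tau>. sfield L \<and> KI \<subseteq> L \<and> fixing L \<tau> \<and> wa lab \<tau> = wa lab \<sigma> \<and> wa lab \<tau> \<in> Mt_inf r s \<and>
      (\<forall>i\<in>{1..NN}. \<tau> (zz lab \<iota> \<kappa> i) = sg (chi i (wa lab \<tau>)) * zz lab \<iota> \<kappa> i) \<and> (\<forall>z. z ^ 2 \<in> L \<longrightarrow> z \<in> L)"
    if \<sigma>: "fixing KI \<sigma>" for \<sigma>
  proof -
    obtain L \<tau> where L: "sfield L" "KI \<subseteq> L" "fixing L \<tau>" "\<And>x. x \<in> KI \<Longrightarrow> \<tau> x = \<sigma> x" "\<And>z. z ^ 2 \<in> L \<Longrightarrow> z \<in> L"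
      using fixing_extend[OF KI_sfield bKI \<sigma>] by blast
    have "wa lab \<tau> = wa lab \<sigma>" using L(4) lab_KI[OF lab(1)] by (simp add: wa_def fun_eq_iff)
    moreover have "wa lab \<tau> \<in> Mt_inf r s \<and> (\<forall>i\<in>{1..NN}. \<tau> (zz lab \<iota> \<kappa> i) = sg (chi i (wa lab \<tau>)) * zz lab \<iota> \<kappa> i)"
      using galois_action[OF labeling lab(2,3) g(1) _ g(3) L(1-3) L(5)] g(2) by blast
    ultimately show ?thesis using L by blast
  qed
  let ?I = "word_action lab (tree NN) ` carrier (gal (K NN))"
  have sub: "?I \<subseteq> Mt r s NN"
    unfolding image_level[OF labeling] Mt_def using ext by (auto simp del: restrict_apply) (metis image_eqI)
  have "word_action lab (tree NN) \<in> iso (gal (K NN)) ((tree_aut (tree NN))\<lparr>carrier := ?I\<rparr>)"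
    using iso_iff[OF labeling, of "K NN" NN "tree NN" ?I] by blast
  then have "bij_betw (word_action lab (tree NN)) (carrier (gal (K NN))) (carrier ((tree_aut (tree NN))\<lparr>carrier := ?I\<rparr>))"
    unfolding iso_def by blast
  then have "card ?I = 2 ^ d" using bij_betw_same_card d(2) by fastforce
  then have eq: "?I = Mt r s NN" using card_subset_eq[OF finite_Mt sub] cd by simp
  have p: "pl lab" by (rule lab(1))
  have kz: "\<iota> \<noteq> 0" "\<kappa> \<noteq> 0" using g(1,3) two by (auto simp: iotaok_def split: if_splits)
  have zs: "length (map (zz lab \<iota> \<kappa>) [1..<Suc NN]) = NN" "\<And>i. i < NN \<Longrightarrow> map (zz lab \<iota> \<kappa>) [1..<Suc NN] ! i = zz lab \<iota> \<kappa> (Suc i)"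
    "set (map (zz lab \<iota> \<kappa>) [1..<Suc NN]) = zz lab \<iota> \<kappa> ` {1..NN}"
    by (simp_all add: nth_map_upt atLeastLessThanSuc_atLeastAtMost del: upt_Suc)
  have z0: "zz lab \<iota> \<kappa> i \<noteq> 0" for i
    unfolding zz_def PI_def using nz[OF labeling] kz by auto
  have "steps base (map (zz lab \<iota> \<kappa>) [1..<Suc NN]) = length (map (zz lab \<iota> \<kappa>) [1..<Suc NN])"
  proof (rule signs_full[OF two sfield_base])
    show "z ^ 2 \<in> base \<and> z \<noteq> 0" if "z \<in> set (map (zz lab \<iota> \<kappa>) [1..<Suc NN])" for z
      using that zz_square[OF p g(1,3)] z0 unfolding zs(3) by auto
    fix e :: "nat \<Rightarrow> bit"
    obtain \<alpha> where \<alpha>: "\<alpha> \<in> Mt_inf r s" "\<And>i. i \<in> {1..NN} \<Longrightarrow> chi i \<alpha> = e (i - 1)" using chi_surj[of "\<lambda>i. e (i - 1)"] by blast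
    have "restrict \<alpha> (tree NN) \<in> ?I" unfolding eq Mt_def using \<alpha>(1) by blast
    then obtain \<sigma> where \<sigma>: "fixing KI \<sigma>" "restrict \<alpha> (tree NN) = restrict (wa lab \<sigma>) (tree NN)"
      unfolding image_level[OF labeling] by blast
    obtain L \<tau> where L: "sfield L" "KI \<subseteq> L" "fixing L \<tau>" "wa lab \<tau> = wa lab \<sigma>" "wa lab \<tau> \<in> Mt_inf r s"
      "\<And>i. i \<in> {1..NN} \<Longrightarrow> \<tau> (zz lab \<iota> \<kappa> i) = sg (chi i (wa lab \<tau>)) * zz lab \<iota> \<kappa> i" "\<And>z. z ^ 2 \<in> L \<Longrightarrow> z \<in> L"
      using ext[OF \<sigma>(1)] by blast
    have "wa lab \<tau> w = \<alpha> w" if "length w \<le> NN" for w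
      using fun_cong[OF \<sigma>(2), of w] that unfolding L(4) by (simp add: tree_def)
    then have "chi i (wa lab \<tau>) = e (i - 1)" if "i \<in> {1..NN}" for i
      using chi_level[OF L(5) \<alpha>(1) that] \<alpha>(2)[OF that] that by simp
    then have sgn: "\<tau> (zz lab \<iota> \<kappa> (Suc i)) = sg (e i) * zz lab \<iota> \<kappa> (Suc i)" if "i < NN" for i
      using L(6)[of "Suc i"] that by simp
    have bL: "base \<subseteq> L" using bKI L(2) by blast
    moreover have "set (map (zz lab \<iota> \<kappa>) [1..<Suc NN]) \<subseteq> L" unfolding zs(3)
      using zz_square[OF p g(1,3)] L(7) bL by blast
    moreover have "hom_on L \<tau>" "\<forall>x\<in>base. \<tau> x = x" using L(3) by (simp_all add: fixing_def)
    ultimately show "\<exists>L \<tau>. sfield L \<and> base \<subseteq> L \<and> set (map (zz lab \<iota> \<kappa>) [1..<Suc NN]) \<subseteq> L \<and> hom_on L \<tau> \<and> (\<forall>x\<in>base. \<tau> x = x) \<and>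
        (\<forall>i<length (map (zz lab \<iota> \<kappa>) [1..<Suc NN]). \<tau> (map (zz lab \<iota> \<kappa>) [1..<Suc NN] ! i) = sg (e i) * map (zz lab \<iota> \<kappa>) [1..<Suc NN] ! i)"
      using L(1) sgn zs(1,2) by (intro exI[of _ L] exI[of _ \<tau>]) simp
  qed
  then show ?thesis using degree_iff[OF p g(1,3)] zs(1) unfolding g(4)[OF p] by simp
qed

lemma image_implies_levels:
  assumes "labeling c x0 lab" "{wa lab \<tau> |\<tau>. fixing KI \<tau>} = Mt_inf r s"
  shows "gal_equals c x0 UNIV KI (Mt_inf r s)" "gal_equals c x0 (tree n) (K n) (Mt r s n)"
proof -
  show "gal_equals c x0 UNIV KI (Mt_inf r s)"
    unfolding gal_equals_def using iso_iff[OF assms(1), of KI 0 UNIV "Mt_inf r s"] image_inf[OF assms(1)] assms by auto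
  show "gal_equals c x0 (tree n) (K n) (Mt r s n)"
    unfolding gal_equals_def using iso_iff[OF assms(1), of "K n" n "tree n" "Mt r s n"] image_level[OF assms(1), of n] assms
    by (auto simp: Mt_def)
qed

text \<open>The implications run from \<open>A1\<close> to \<open>A4\<close> and \<open>A5\<close>,
  from \<open>A5\<close> to \<open>A4\<close>, and from \<open>A4\<close> through \<open>A3\<close>
  and \<open>A2\<close> back to \<open>A1\<close>.\<close>

lemma equivalences:
  assumes gamma: "is_gamma r s \<gamma>" and sqrtD: "\<And>i. i \<in> {1..r} \<Longrightarrow> sqrtD i ^ 2 = to_ac (D_elem c x0 i)"
  defines "A1 \<equiv> ext_degree (adjoin (insert \<gamma> (sqrtD ` {1..r}))) (2 ^ NN)"
    and "A2 \<equiv> ext_degree (K NN) (card (Mt r s NN))"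
    and "A3 \<equiv> gal_equals c x0 (tree NN) (K NN) (Mt r s NN)"
    and "A4 \<equiv> \<forall>n\<ge>1. gal_equals c x0 (tree n) (K n) (Mt r s n)"
    and "A5 \<equiv> gal_equals c x0 UNIV KI (Mt_inf r s)"
  shows "(A1 \<longleftrightarrow> A2) \<and> (A2 \<longleftrightarrow> A3) \<and> (A3 \<longleftrightarrow> A4) \<and> (A4 \<longleftrightarrow> A5)"
proof -
  have 1: A4 A5 if A1
    using full_image[of \<gamma> sqrtD, OF gamma sqrtD] that image_implies_levels unfolding A1_def A4_def A5_def by blast+
  have 5: A4 if A5
  proof -
    obtain lab where l: "labeling c x0 lab" "word_action lab UNIV \<in> iso (gal KI) ((tree_aut UNIV)\<lparr>carrier := Mt_inf r s\<rparr>)"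
      using \<open>A5\<close> unfolding A5_def gal_equals_def by blast
    have "{wa lab \<tau> |\<tau>. fixing KI \<tau>} = Mt_inf r s"
      using l(2) iso_iff[OF l(1), of KI 0 UNIV "Mt_inf r s"] image_inf[OF l(1)] by blast
    then show A4 unfolding A4_def using image_implies_levels(2)[OF l(1)] by blast
  qed
  have "1 \<le> NN" using r3 by (simp add: NN_def)
  then have 4: A3 if A4 using that unfolding A3_def A4_def by blast
  have 3: A2 if A3
  proof -
    obtain lab where "word_action lab (tree NN) \<in> iso (gal (K NN)) ((tree_aut (tree NN))\<lparr>carrier := Mt r s NN\<rparr>)"
      using \<open>A3\<close> unfolding A3_def gal_equals_def by blast
    then have "bij_betw (word_action lab (tree NN)) (carrier (gal (K NN))) (carrier ((tree_aut (tree NN))\<lparr>carrier := Mt r s NN\<rparr>))"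
      unfolding iso_def by blast
    from bij_betw_same_card[OF this] show A2 unfolding A2_def ext_degree_card_gal by simp
  qed
  have 2: A1 if A2 using degree_implies_signs[of \<gamma> sqrtD, OF gamma sqrtD] that unfolding A1_def A2_def by blast
  show ?thesis using 1 2 3 4 5 by blast
qed

end

theorem theorem7p6:
  fixes c x0 :: "'a::field" and r s :: nat
    and \<gamma> :: "'a alg_closure" and sqrtD :: "nat \<Rightarrow> 'a alg_closure"
  assumes char: "CHAR('a) \<noteq> 2"
    and preper: "strictly_preperiodic (quad c) 0"
    and rs: "1 \<le> s" "s < r" "(quad c ^^ r) 0 = - (quad c ^^ s) 0"
    and rs_minimal: "\<And>r' s'. 1 \<le> s' \<Longrightarrow> s' < r' \<Longrightarrow>
          (quad c ^^ r') 0 = - (quad c ^^ s') 0 \<Longrightarrow> r \<le> r' \<and> s \<le> s'"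
    and r3: "3 \<le> r"
    and gamma: "is_gamma r s \<gamma>"
    and sqrtD: "\<And>i. i \<in> {1..r} \<Longrightarrow> sqrtD i ^ 2 = to_ac (D_elem c x0 i)"
  shows
    "(ext_degree (adjoin (insert \<gamma> (sqrtD ` {1..r}))) (2 ^ (r + e_shift r s)) \<longleftrightarrow>
      ext_degree (K_level c x0 (r + e_shift r s)) (card (Mt r s (r + e_shift r s)))) \<and>
     (ext_degree (K_level c x0 (r + e_shift r s)) (card (Mt r s (r + e_shift r s))) \<longleftrightarrow>
      gal_equals c x0 (tree (r + e_shift r s)) (K_level c x0 (r + e_shift r s))
        (Mt r s (r + e_shift r s))) \<and>
     (gal_equals c x0 (tree (r + e_shift r s)) (K_level c x0 (r + e_shift r s))
        (Mt r s (r + e_shift r s)) \<longleftrightarrow>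
      (\<forall>n\<ge>1. gal_equals c x0 (tree n) (K_level c x0 n) (Mt r s n))) \<and>
     ((\<forall>n\<ge>1. gal_equals c x0 (tree n) (K_level c x0 n) (Mt r s n)) \<longleftrightarrow>
      gal_equals c x0 UNIV (K_inf c x0) (Mt_inf r s))"
proof -
  have two: "(2 :: 'a alg_closure) \<noteq> 0"
  proof
    assume "(2 :: 'a alg_closure) = 0"
    then have "of_nat 2 = (0 :: 'a alg_closure)" by simp
    then have "CHAR('a) dvd 2" unfolding of_nat_eq_0_iff_char_dvd by simp
    moreover have "CHAR('a) \<noteq> 1"
    proof
      assume "CHAR('a) = 1"
      then have "of_nat 1 = (0::'a)" unfolding of_nat_eq_0_iff_char_dvd by simp
      then show False by simp
    qed
    ultimately show False using char two_is_prime_nat by (metis prime_nat_iff)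
  qed
  have orb: "(quad (to_ac c) ^^ m) 0 = to_ac ((quad c ^^ m) 0)" for m
    by (induction m) (simp_all add: quad_def[of "to_ac c" "to_ac u" for u] quad_def[of c u for u])
  have cubic: "to_ac c ^ 3 + 2 * to_ac c ^ 2 + 2 * to_ac c + 2 = 0" if "r = 3" "s = 2"
  proof -
    \<comment> \<open>The relation \<open>f^3(0) = - f^2(0)\<close> is \<open>c\<close> times the
      cubic, and \<open>c = 0\<close> would make 0 a fixed point.\<close>
    have "c \<noteq> 0"
    proof
      assume "c = 0"
      then have "periodic (quad c) 0" unfolding periodic_def by (intro exI[of _ 1]) (simp add: quad_def)
      then show False using preper by (simp add: strictly_preperiodic_def)
    qed
    moreover have "((c^2 + c)^2 + c) = - (c^2 + c)" using rs(3) that by (simp add: quad_def eval_nat_numeral)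
    then have "c * (c ^ 3 + 2 * c ^ 2 + 2 * c + 2) = 0" by (simp add: algebra_simps power2_eq_square power3_eq_cube eq_neg_iff_add_eq_0)
    ultimately have "c ^ 3 + 2 * c ^ 2 + 2 * c + 2 = 0" by simp
    then have "to_ac (c ^ 3 + 2 * c ^ 2 + 2 * c + 2) = 0" by simp
    then show ?thesis by simp
  qed
  interpret arboreal r s c x0
  proof
    show "1 \<le> s" "s < r" "3 \<le> r" by fact+
    show "(2 :: 'a alg_closure) \<noteq> 0" by (rule two)
    show "\<exists>y. y ^ 2 = x" for x :: "'a alg_closure" by (rule nth_root_exists) simp
    show "(quad (to_ac c) ^^ r) 0 = - (quad (to_ac c) ^^ s) 0" unfolding orb rs(3) by simp
  qed (rule cubic)
  show ?thesis using equivalences[of \<gamma> sqrtD, OF gamma sqrtD] unfolding NN_def by simp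
qed

end
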